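(* Assume (H1), (H2) and $\ell>\frac1{(p_--1)^2}$. Let $(u_0,u_1)\in V\times H$ and let $u$ be the maximal energy solution of (P) on $[0,T_{\max})$. Suppose $\mathcal E(0)\ge0$ and $$L_0:=(u_0,u_1)-\frac{p_-}{C}\mathcal E(0)>0,$$ and put $\beta:=\frac{CL_0}{2p_-}$. Let $\tau$ be the unique positive solution of $$CL_0\tau^2+\left[L_0-\frac{2(\mathcal E(0)+\beta)}{\lambda_1}\right]\tau-\|u_0\|_2^2=0,$$ and set $$U_\tau:=\left(\|u_0\|_2+\sqrt{\tfrac{\tau(\mathcal E(0)+\beta)}{\lambda_1}}\right)^2,\qquad G_\tau:=\left(\|\nabla u_0\|_2+\sqrt{\tau(\mathcal E(0)+\beta)}\right)^2.$$ Then either $T_{\max}\le\tau$, or there is $t_\beta\in(0,\tau)$ such that $$\mathcal E(t_\beta)=-\beta,\quad (u(t_\beta),u_t(t_\beta))\ge\frac{L_0}{2},\quad \|u(t_\beta)\|_2^2\le U_\tau,\quad \|\nabla u(t_\beta)\|_2^2\le G_\tau.$$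
   Context: Setting. $n\ge1$ and $\Omega\subset\mathbb R^n$ is a bounded domain with smooth boundary; $V=H_0^1(\Omega)$ with $\|z\|_V=\|\nabla z\|_2$; $H=L^2(\Omega)$; $\|\cdot\|_2$ and $(\cdot,\cdot)$ are the $L^2(\Omega)$ norm and inner product; $\langle\cdot,\cdot\rangle$ is the pairing of $V^*$ and $V$; $\lambda_1>0$ is the first Dirichlet eigenvalue of $-\Delta$ on $\Omega$. (H1): $p:\Omega\to\mathbb R$ is measurable and $2<p_-:=\operatorname{ess\,inf}_\Omega p\le p(x)\le p_+:=\operatorname{ess\,sup}_\Omega p<2^*$ for a.e. $x$, where $2^*=2n/(n-2)$ if $n\ge3$ and $2^*=\infty$ if $n\le2$. (H2): $g\in C^1([0,\infty))$, $g\ge0$, $g'\le0$, and $\ell:=1-\int_0^\infty g(s)\,ds>0$. Problem (P): $u_{tt}-\Delta u+\int_0^t g(t-s)\Delta u(s)\,ds-\Delta u_t=|u|^{p(x)-2}u\log|u|$ in $\Omega\times(0,\infty)$, $u=0$ on $\partial\Omega\times(0,\infty)$, $u(0)=u_0$, $u_t(0)=u_1$; the source is $0$ at $u=0$. For $(u_0,u_1)\in V\times H$, an energy solution on $[0,T]$ is $u\in C([0,T];V)$ with $u_t\in C([0,T];H)\cap L^2(0,T;V)$, $u_{tt}\in L^2(0,T;V^* )$, $u(0)=u_0$, $u_t(0)=u_1$, such that for every $z\in V$ and a.e. $t\in(0,T)$: $\langle u_{tt},z\rangle+(\nabla u,\nabla z)+(\nabla u_t,\nabla z)-\int_0^tg(t-s)(\nabla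 u(s),\nabla z)\,ds=\int_\Omega|u|^{p(x)-2}u\log|u|\,z\,dx$. Energies. $F(x,r)=\frac{|r|^{p(x)}}{p(x)}\log|r|-\frac{|r|^{p(x)}}{p(x)^2}$, $F(x,0)=0$; $(g\circ\nabla u)(t)=\int_0^tg(t-s)\|\nabla u(t)-\nabla u(s)\|_2^2\,ds$; $$E(t)=\tfrac12\|u_t(t)\|_2^2+\tfrac12\Big(1-\int_0^tg(s)\,ds\Big)\|\nabla u(t)\|_2^2+\tfrac12(g\circ\nabla u)(t)-\int_\Omega F(x,u(t))\,dx.$$ For $q\ge p_-$: $c_{p_-}(q)=\frac{q-p_-}{q^2}e^{-q/(q-p_-)}$ if $q>p_-$ and $c_{p_-}(p_-)=0$. $C_*=\int_\Omega c_{p_-}(p(x))\,dx$ (finite). The shifted energy is $\mathcal E(t)=E(t)+C_*/p_-$. Local theory (taken as known under (H1), (H2)). For every $(u_0,u_1)\in V\times H$, (P) has a unique maximal energy solution on $[0,T_{\max})$, $T_{\max}\in(0,\infty]$ (an energy solution on $[0,T]$ for each $T<T_{\max}$); if $T_{\max}<\infty$ then $\limsup_{t\uparrow T_{\max}}(\|u(t)\|_V+\|u_t(t)\|_2)=\infty$; $E$ is locally absolutely continuous and, for a.e. $t<T_{\max}$, $E'(t)=-\|\nabla u_t(t)\|_2^2-\frac12g(t)\|\nabla u(t)\|_2^2+\frac12\int_0^tg'(t-s)\|\nabla u(t)-\nabla u(s)\|_2^2\,ds$. Constant. $C=\min\left\{p_-+2,\ \frac{2\lambda_1[(p_--1)^2\ell-1]}{2p_-+\lambda_1}\right\}>0$.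 *)

theory Defs
  imports "HOL-Probability.Probability"
begin

abbreviation partial :: "'a::euclidean_space \<Rightarrow> ('a \<Rightarrow> real) \<Rightarrow> 'a \<Rightarrow> real" where
  "partial b f x \<equiv> frechet_derivative f (at x) b"

fun Ck_on :: "nat \<Rightarrow> 'a::euclidean_space set \<Rightarrow> ('a \<Rightarrow> real) \<Rightarrow> bool" where
  "Ck_on 0 S f \<longleftrightarrow> continuous_on S f"
| "Ck_on (Suc k) S f \<longleftrightarrow>
     (\<forall>x\<in>S. f differentiable (at x)) \<and> (\<forall>b\<in>Basis. Ck_on k S (partial b f))"

definition smooth_on :: "'a::euclidean_space set \<Rightarrow> ('a \<Rightarrow> real) \<Rightarrow> bool" where
  "smooth_on S f \<longleftrightarrow> (\<forall>k. Ck_on k S f)"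

definition grad :: "('a::euclidean_space \<Rightarrow> real) \<Rightarrow> 'a \<Rightarrow> 'a" where
  "grad f x = (\<Sum>b\<in>Basis. partial b f x *\<^sub>R b)"

text \<open>The elements of \<open>C\<^sub>c\<^sup>\<infinity>(\<Omega>)\<close> are taken as functions on the whole space, extended by zero.\<close>

definition test_fun :: "'a::euclidean_space set \<Rightarrow> ('a \<Rightarrow> real) \<Rightarrow> bool" where
  "test_fun \<Omega> \<phi> \<longleftrightarrow> smooth_on UNIV \<phi> \<and>
     compact (closure {x. \<phi> x \<noteq> 0}) \<and> closure {x. \<phi> x \<noteq> 0} \<subseteq> \<Omega>"

text \<open>Smoothness of the boundary is expressed by local defining functions with nonvanishing
  gradient; by the implicit function theorem \<open>\<Omega>\<close> then lies locally on one side of a smooth graph.\<close>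

definition smooth_bounded_domain :: "'a::euclidean_space set \<Rightarrow> bool" where
  "smooth_bounded_domain \<Omega> \<longleftrightarrow>
     open \<Omega> \<and> connected \<Omega> \<and> \<Omega> \<noteq> {} \<and> bounded \<Omega> \<and>
     (\<forall>x\<in>frontier \<Omega>. \<exists>U \<rho>. open U \<and> x \<in> U \<and> smooth_on U \<rho> \<and>
        (\<forall>y\<in>U. grad \<rho> y \<noteq> 0) \<and> \<Omega> \<inter> U = {y \<in> U. \<rho> y < 0} \<and> frontier \<Omega> \<inter> U = {y \<in> U. \<rho> y = 0})"

text \<open>Elements of \<open>L\<^sup>2(\<Omega>)\<close> and \<open>H\<^sup>1\<^sub>0(\<Omega>)\<close> are represented by functions; all notions below are
  invariant under changes on null sets and outside \<open>\<Omega>\<close>. The value type is \<open>real\<close> for functions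
  and the ambient space itself for gradient fields.\<close>

definition L2 :: "'a::euclidean_space set \<Rightarrow> ('a \<Rightarrow> 'c::euclidean_space) set" where
  "L2 \<Omega> = {f \<in> borel_measurable (lebesgue_on \<Omega>). integrable (lebesgue_on \<Omega>) (\<lambda>x. (norm (f x))\<^sup>2)}"

definition L2_inner :: "'a::euclidean_space set \<Rightarrow> ('a \<Rightarrow> 'c::euclidean_space) \<Rightarrow> ('a \<Rightarrow> 'c) \<Rightarrow> real" where
  "L2_inner \<Omega> f h = (LINT x|lebesgue_on \<Omega>. f x \<bullet> h x)"

definition L2_norm :: "'a::euclidean_space set \<Rightarrow> ('a \<Rightarrow> 'c::euclidean_space) \<Rightarrow> real" where
  "L2_norm \<Omega> f = sqrt (LINT x|lebesgue_on \<Omega>. (norm (f x))\<^sup>2)"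

definition has_weak_grad :: "'a::euclidean_space set \<Rightarrow> ('a \<Rightarrow> real) \<Rightarrow> ('a \<Rightarrow> 'a) \<Rightarrow> bool" where
  "has_weak_grad \<Omega> z G \<longleftrightarrow> G \<in> L2 \<Omega> \<and>
     (\<forall>\<phi>. test_fun \<Omega> \<phi> \<longrightarrow> (\<forall>b\<in>Basis.
        (LINT x|lebesgue_on \<Omega>. z x * partial b \<phi> x) = - (LINT x|lebesgue_on \<Omega>. (G x \<bullet> b) * \<phi> x)))"

text \<open>The weak gradient is unique up to null sets.\<close>

definition wgrad :: "'a::euclidean_space set \<Rightarrow> ('a \<Rightarrow> real) \<Rightarrow> 'a \<Rightarrow> 'a" where
  "wgrad \<Omega> z = (SOME G. has_weak_grad \<Omega> z G)"

definition H1 :: "'a::euclidean_space set \<Rightarrow> ('a \<Rightarrow> real) set" where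
  "H1 \<Omega> = {z \<in> L2 \<Omega>. \<exists>G. has_weak_grad \<Omega> z G}"

definition H10 :: "'a::euclidean_space set \<Rightarrow> ('a \<Rightarrow> real) set" where
  "H10 \<Omega> = {z \<in> H1 \<Omega>. \<exists>\<phi>. (\<forall>k::nat. test_fun \<Omega> (\<phi> k)) \<and>
      (\<lambda>k. L2_norm \<Omega> (\<phi> k - z)) \<longlonglongrightarrow> 0 \<and>
      (\<lambda>k. L2_norm \<Omega> (grad (\<phi> k) - wgrad \<Omega> z)) \<longlonglongrightarrow> 0}"

definition H10_norm :: "'a::euclidean_space set \<Rightarrow> ('a \<Rightarrow> real) \<Rightarrow> real" where
  "H10_norm \<Omega> z = L2_norm \<Omega> (wgrad \<Omega> z)"

text \<open>Only the values of a functional on \<open>H\<^sup>1\<^sub>0(\<Omega>)\<close> matter; the bound forces it to respect equality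
  almost everywhere.\<close>

definition H10_dual :: "'a::euclidean_space set \<Rightarrow> (('a \<Rightarrow> real) \<Rightarrow> real) set" where
  "H10_dual \<Omega> = {f.
     (\<forall>y\<in>H10 \<Omega>. \<forall>z\<in>H10 \<Omega>. \<forall>a b. f (\<lambda>x. a * y x + b * z x) = a * f y + b * f z) \<and>
     (\<exists>K. \<forall>z\<in>H10 \<Omega>. \<bar>f z\<bar> \<le> K * H10_norm \<Omega> z)}"

definition H10_dual_norm :: "'a::euclidean_space set \<Rightarrow> (('a \<Rightarrow> real) \<Rightarrow> real) \<Rightarrow> real" where
  "H10_dual_norm \<Omega> f = Sup {\<bar>f z\<bar> | z. z \<in> H10 \<Omega> \<and> H10_norm \<Omega> z \<le> 1}"

definition dirichlet_eigenvalue :: "'a::euclidean_space set \<Rightarrow> real \<Rightarrow> bool" where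
  "dirichlet_eigenvalue \<Omega> \<mu> \<longleftrightarrow> (\<exists>z\<in>H10 \<Omega>. L2_norm \<Omega> z \<noteq> 0 \<and>
     (\<forall>v\<in>H10 \<Omega>. L2_inner \<Omega> (wgrad \<Omega> z) (wgrad \<Omega> v) = \<mu> * L2_inner \<Omega> z v))"

definition first_dirichlet_eigenvalue :: "'a::euclidean_space set \<Rightarrow> real" where
  "first_dirichlet_eigenvalue \<Omega> = Inf {\<mu>. dirichlet_eigenvalue \<Omega> \<mu>}"

text \<open>The target space is given by a carrier \<open>X\<close> and a seminorm \<open>N\<close>.\<close>

definition C_into :: "real set \<Rightarrow> 'b::minus set \<Rightarrow> ('b \<Rightarrow> real) \<Rightarrow> (real \<Rightarrow> 'b) set" where
  "C_into I X N = {f. \<forall>t\<in>I. f t \<in> X \<and> ((\<lambda>s. N (f s - f t)) \<longlongrightarrow> 0) (at t within I)}"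

definition strongly_measurable :: "real set \<Rightarrow> 'b::minus set \<Rightarrow> ('b \<Rightarrow> real) \<Rightarrow> (real \<Rightarrow> 'b) \<Rightarrow> bool" where
  "strongly_measurable I X N f \<longleftrightarrow> (\<exists>s :: nat \<Rightarrow> real \<Rightarrow> 'b.
     (\<forall>k. finite (s k ` I) \<and> s k ` I \<subseteq> X \<and> (\<forall>y. {t \<in> I. s k t = y} \<in> sets lebesgue)) \<and>
     (AE t in lebesgue_on I. (\<lambda>k. N (s k t - f t)) \<longlonglongrightarrow> 0))"

definition L2_into :: "real set \<Rightarrow> 'b::minus set \<Rightarrow> ('b \<Rightarrow> real) \<Rightarrow> (real \<Rightarrow> 'b) set" where
  "L2_into I X N = {f. (AE t in lebesgue_on I. f t \<in> X) \<and> strongly_measurable I X N f \<and>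
     integrable (lebesgue_on I) (\<lambda>t. (N (f t))\<^sup>2)}"

definition has_L2_derivative_on ::
  "'a::euclidean_space set \<Rightarrow> real set \<Rightarrow> (real \<Rightarrow> 'a \<Rightarrow> real) \<Rightarrow> (real \<Rightarrow> 'a \<Rightarrow> real) \<Rightarrow> bool" where
  "has_L2_derivative_on \<Omega> I u v \<longleftrightarrow> (\<forall>t\<in>I.
     ((\<lambda>s. L2_norm \<Omega> (\<lambda>x. (u s x - u t x) / (s - t) - v t x)) \<longlongrightarrow> 0) (at t within I))"

text \<open>\<open>w\<close> is the distributional time derivative of \<open>v\<close> with values in the dual of \<open>H\<^sup>1\<^sub>0(\<Omega>)\<close>, where
  \<open>L\<^sup>2(\<Omega>)\<close> is embedded through the \<open>L\<^sup>2\<close> inner product.\<close>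

definition has_dual_derivative_on ::
  "'a::euclidean_space set \<Rightarrow> real set \<Rightarrow> (real \<Rightarrow> 'a \<Rightarrow> real) \<Rightarrow> (real \<Rightarrow> ('a \<Rightarrow> real) \<Rightarrow> real) \<Rightarrow> bool" where
  "has_dual_derivative_on \<Omega> I v w \<longleftrightarrow> (\<forall>z\<in>H10 \<Omega>. \<forall>\<phi>. test_fun I \<phi> \<longrightarrow>
     (LINT t|lebesgue_on I. deriv \<phi> t * L2_inner \<Omega> (v t) z) = - (LINT t|lebesgue_on I. \<phi> t * w t z))"

definition abs_cont_on :: "real set \<Rightarrow> (real \<Rightarrow> real) \<Rightarrow> bool" where
  "abs_cont_on I f \<longleftrightarrow> (\<forall>\<epsilon>>0. \<exists>\<delta>>0. \<forall>m::nat. \<forall>a b :: nat \<Rightarrow> real.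
     (\<forall>i<m. a i \<le> b i \<and> {a i..b i} \<subseteq> I) \<and>
     (\<forall>i<m. \<forall>j<m. i \<noteq> j \<longrightarrow> {a i<..<b i} \<inter> {a j<..<b j} = {}) \<and>
     (\<Sum>i<m. b i - a i) < \<delta>
     \<longrightarrow> (\<Sum>i<m. \<bar>f (b i) - f (a i)\<bar>) < \<epsilon>)"

definition p_minus :: "'a::euclidean_space set \<Rightarrow> ('a \<Rightarrow> real) \<Rightarrow> ereal" where
  "p_minus \<Omega> p = - esssup (lebesgue_on \<Omega>) (\<lambda>x. - ereal (p x))"

definition p_plus :: "'a::euclidean_space set \<Rightarrow> ('a \<Rightarrow> real) \<Rightarrow> ereal" where
  "p_plus \<Omega> p = esssup (lebesgue_on \<Omega>) (\<lambda>x. ereal (p x))"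

abbreviation pm :: "'a::euclidean_space set \<Rightarrow> ('a \<Rightarrow> real) \<Rightarrow> real" where
  "pm \<Omega> p \<equiv> real_of_ereal (p_minus \<Omega> p)"

definition sobolev_exponent :: "nat \<Rightarrow> ereal" where
  "sobolev_exponent n = (if n \<ge> 3 then ereal (2 * real n / (real n - 2)) else \<infinity>)"

definition hyp_H1 :: "'a::euclidean_space set \<Rightarrow> ('a \<Rightarrow> real) \<Rightarrow> bool" where
  "hyp_H1 \<Omega> p \<longleftrightarrow> p \<in> borel_measurable (lebesgue_on \<Omega>) \<and>
     2 < p_minus \<Omega> p \<and> p_plus \<Omega> p < sobolev_exponent DIM('a)"

abbreviation rderiv :: "(real \<Rightarrow> real) \<Rightarrow> real \<Rightarrow> real" where
  "rderiv g t \<equiv> vector_derivative g (at t within {0..})"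

definition ell :: "(real \<Rightarrow> real) \<Rightarrow> real" where
  "ell g = 1 - integral {0..} g"

definition hyp_H2 :: "(real \<Rightarrow> real) \<Rightarrow> bool" where
  "hyp_H2 g \<longleftrightarrow> g differentiable_on {0..} \<and> continuous_on {0..} (rderiv g) \<and>
     (\<forall>t\<ge>0. g t \<ge> 0) \<and> (\<forall>t\<ge>0. rderiv g t \<le> 0) \<and>
     g integrable_on {0..} \<and> ell g > 0"

text \<open>Here and below \<open>q\<close> stands for \<open>p x\<close>. As \<open>0 powr q = 0\<close>, both expressions vanish at \<open>r = 0\<close>.\<close>

definition source :: "real \<Rightarrow> real \<Rightarrow> real" where
  "source q r = \<bar>r\<bar> powr (q - 2) * r * ln \<bar>r\<bar>"

definition F_pot :: "real \<Rightarrow> real \<Rightarrow> real" where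
  "F_pot q r = \<bar>r\<bar> powr q / q * ln \<bar>r\<bar> - \<bar>r\<bar> powr q / q\<^sup>2"

text \<open>The pair \<open>(u, v)\<close> consists of the solution and its time derivative \<open>u\<^sub>t\<close>; \<open>w\<close> is \<open>u\<^sub>t\<^sub>t\<close>.
  A Bochner integral of a nonintegrable function is \<open>0\<close> by convention, so the existence of the
  source integral, which is implicit in the identity (and follows from the Sobolev embedding), is
  spelled out.\<close>

definition energy_solution ::
  "'a::euclidean_space set \<Rightarrow> ('a \<Rightarrow> real) \<Rightarrow> (real \<Rightarrow> real) \<Rightarrow> ('a \<Rightarrow> real) \<Rightarrow> ('a \<Rightarrow> real) \<Rightarrow> real \<Rightarrow>
   (real \<Rightarrow> 'a \<Rightarrow> real) \<Rightarrow> (real \<Rightarrow> 'a \<Rightarrow> real) \<Rightarrow> bool" where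
  "energy_solution \<Omega> p g u0 u1 T u v \<longleftrightarrow>
     u \<in> C_into {0..T} (H10 \<Omega>) (H10_norm \<Omega>) \<and>
     has_L2_derivative_on \<Omega> {0..T} u v \<and>
     v \<in> C_into {0..T} (L2 \<Omega>) (L2_norm \<Omega>) \<and>
     v \<in> L2_into {0<..<T} (H10 \<Omega>) (H10_norm \<Omega>) \<and>
     (AE x in lebesgue_on \<Omega>. u 0 x = u0 x) \<and> (AE x in lebesgue_on \<Omega>. v 0 x = u1 x) \<and>
     (\<exists>w. w \<in> L2_into {0<..<T} (H10_dual \<Omega>) (H10_dual_norm \<Omega>) \<and>
        has_dual_derivative_on \<Omega> {0<..<T} v w \<and>
        (\<forall>z\<in>H10 \<Omega>. AE t in lebesgue_on {0<..<T}.
           integrable (lebesgue_on \<Omega>) (\<lambda>x. source (p x) (u t x) * z x) \<and>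
           w t z + L2_inner \<Omega> (wgrad \<Omega> (u t)) (wgrad \<Omega> z) + L2_inner \<Omega> (wgrad \<Omega> (v t)) (wgrad \<Omega> z)
             - integral {0..t} (\<lambda>s. g (t - s) * L2_inner \<Omega> (wgrad \<Omega> (u s)) (wgrad \<Omega> z))
           = (LINT x|lebesgue_on \<Omega>. source (p x) (u t x) * z x)))"

definition energy_solution_upto ::
  "'a::euclidean_space set \<Rightarrow> ('a \<Rightarrow> real) \<Rightarrow> (real \<Rightarrow> real) \<Rightarrow> ('a \<Rightarrow> real) \<Rightarrow> ('a \<Rightarrow> real) \<Rightarrow> ereal \<Rightarrow>
   (real \<Rightarrow> 'a \<Rightarrow> real) \<Rightarrow> (real \<Rightarrow> 'a \<Rightarrow> real) \<Rightarrow> bool" where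
  "energy_solution_upto \<Omega> p g u0 u1 Tm u v \<longleftrightarrow> 0 < Tm \<and>
     (\<forall>T. 0 < T \<and> ereal T < Tm \<longrightarrow> energy_solution \<Omega> p g u0 u1 T u v)"

definition agree_upto ::
  "'a::euclidean_space set \<Rightarrow> ereal \<Rightarrow> (real \<Rightarrow> 'a \<Rightarrow> real) \<Rightarrow> (real \<Rightarrow> 'a \<Rightarrow> real) \<Rightarrow> bool" where
  "agree_upto \<Omega> Tm u u' \<longleftrightarrow>
     (\<forall>t. 0 \<le> t \<and> ereal t < Tm \<longrightarrow> (AE x in lebesgue_on \<Omega>. u t x = u' t x))"

definition maximal_energy_solution ::
  "'a::euclidean_space set \<Rightarrow> ('a \<Rightarrow> real) \<Rightarrow> (real \<Rightarrow> real) \<Rightarrow> ('a \<Rightarrow> real) \<Rightarrow> ('a \<Rightarrow> real) \<Rightarrow> ereal \<Rightarrow>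
   (real \<Rightarrow> 'a \<Rightarrow> real) \<Rightarrow> (real \<Rightarrow> 'a \<Rightarrow> real) \<Rightarrow> bool" where
  "maximal_energy_solution \<Omega> p g u0 u1 Tm u v \<longleftrightarrow>
     energy_solution_upto \<Omega> p g u0 u1 Tm u v \<and>
     (\<forall>Tm' u' v'. energy_solution_upto \<Omega> p g u0 u1 Tm' u' v' \<and> Tm \<le> Tm' \<and> agree_upto \<Omega> Tm u u'
        \<longrightarrow> Tm' = Tm)"

definition energy ::
  "'a::euclidean_space set \<Rightarrow> ('a \<Rightarrow> real) \<Rightarrow> (real \<Rightarrow> real) \<Rightarrow>
   (real \<Rightarrow> 'a \<Rightarrow> real) \<Rightarrow> (real \<Rightarrow> 'a \<Rightarrow> real) \<Rightarrow> real \<Rightarrow> real" where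
  "energy \<Omega> p g u v t =
     (L2_norm \<Omega> (v t))\<^sup>2 / 2 + (1 - integral {0..t} g) * (L2_norm \<Omega> (wgrad \<Omega> (u t)))\<^sup>2 / 2
     + integral {0..t} (\<lambda>s. g (t - s) * (L2_norm \<Omega> (wgrad \<Omega> (u t) - wgrad \<Omega> (u s)))\<^sup>2) / 2
     - (LINT x|lebesgue_on \<Omega>. F_pot (p x) (u t x))"

definition c_min :: "real \<Rightarrow> real \<Rightarrow> real" where
  "c_min m q = (if q > m then (q - m) / q\<^sup>2 * exp (- q / (q - m)) else 0)"

definition C_star :: "'a::euclidean_space set \<Rightarrow> ('a \<Rightarrow> real) \<Rightarrow> real" where
  "C_star \<Omega> p = (LINT x|lebesgue_on \<Omega>. c_min (pm \<Omega> p) (p x))"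

definition shifted_energy ::
  "'a::euclidean_space set \<Rightarrow> ('a \<Rightarrow> real) \<Rightarrow> (real \<Rightarrow> real) \<Rightarrow>
   (real \<Rightarrow> 'a \<Rightarrow> real) \<Rightarrow> (real \<Rightarrow> 'a \<Rightarrow> real) \<Rightarrow> real \<Rightarrow> real" where
  "shifted_energy \<Omega> p g u v t = energy \<Omega> p g u v t + C_star \<Omega> p / pm \<Omega> p"

definition growth_const :: "'a::euclidean_space set \<Rightarrow> ('a \<Rightarrow> real) \<Rightarrow> (real \<Rightarrow> real) \<Rightarrow> real" where
  "growth_const \<Omega> p g = min (pm \<Omega> p + 2)
     (2 * first_dirichlet_eigenvalue \<Omega> * ((pm \<Omega> p - 1)\<^sup>2 * ell g - 1)
        / (2 * pm \<Omega> p + first_dirichlet_eigenvalue \<Omega>))"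

text \<open>Well-posedness for all data, blow-up alternative and energy identity are classical for this
  problem; they are collected here to be used as one hypothesis.\<close>

definition local_theory ::
  "'a::euclidean_space set \<Rightarrow> ('a \<Rightarrow> real) \<Rightarrow> (real \<Rightarrow> real) \<Rightarrow> bool" where
  "local_theory \<Omega> p g \<longleftrightarrow> (\<forall>u0\<in>H10 \<Omega>. \<forall>u1\<in>L2 \<Omega>.
     (\<exists>Tm u v. maximal_energy_solution \<Omega> p g u0 u1 Tm u v) \<and>
     (\<forall>Tm u v Tm' u' v'. maximal_energy_solution \<Omega> p g u0 u1 Tm u v \<and>
        maximal_energy_solution \<Omega> p g u0 u1 Tm' u' v' \<longrightarrow> Tm = Tm' \<and> agree_upto \<Omega> Tm u u') \<and>
     (\<forall>Tm u v. maximal_energy_solution \<Omega> p g u0 u1 Tm u v \<longrightarrow>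
        (Tm < \<infinity> \<longrightarrow>
           Limsup (at_left (real_of_ereal Tm)) (\<lambda>t. ereal (H10_norm \<Omega> (u t) + L2_norm \<Omega> (v t))) = \<infinity>) \<and>
        (\<forall>T. 0 < T \<and> ereal T < Tm \<longrightarrow> abs_cont_on {0..T} (energy \<Omega> p g u v)) \<and>
        (AE t in lebesgue. 0 < t \<and> ereal t < Tm \<longrightarrow>
           (energy \<Omega> p g u v has_real_derivative
              (- (L2_norm \<Omega> (wgrad \<Omega> (v t)))\<^sup>2 - g t * (L2_norm \<Omega> (wgrad \<Omega> (u t)))\<^sup>2 / 2
               + integral {0..t} (\<lambda>s. rderiv g (t - s)
                   * (L2_norm \<Omega> (wgrad \<Omega> (u t) - wgrad \<Omega> (u s)))\<^sup>2) / 2)) (at t))))"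

end

theory Submission
  imports Defs "HOL-Library.Diagonal_Subsequence"
begin

text \<open>
  Write \<open>m\<close> for the essential infimum of \<open>p\<close> and consider
  \<open>L(t) = (u(t), u\<^sub>t(t)) - (m/C) \<E>(t)\<close>, so that \<open>L(0) = L\<^sub>0\<close>. The proof rests on the differential
  inequality \<open>L' \<ge> C L\<close>. Differentiating \<open>(u, u\<^sub>t)\<close> along the equation produces the source term
  \<open>\<integral> |u|\<^bsup>p\<^esup> ln |u|\<close>, which is at least \<open>m\<close> times the potential energy minus \<open>C\<^sub>*\<close>; hence it is
  controlled from below by the kinetic, elastic and memory energies minus \<open>m \<E>\<close>. Young's inequality with
  weight \<open>m\<close> lets the memory energy cancel, the viscous term is absorbed by the dissipation
  \<open>(m/C) \<parallel>\<nabla>u\<^sub>t\<parallel>\<^sup>2\<close> that \<open>- (m/C) \<E>'\<close> contributes, and the definition of \<open>C\<close> is what the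
  Poincare inequality with \<open>\<lambda>\<^sub>1\<close> requires in order to close the estimate
  (\<open>pointwise_growth\<close>). So \<open>L(t) \<ge> L\<^sub>0 exp (C t)\<close> (\<open>exponential_growth\<close>).

  Suppose that \<open>\<E>\<close> stays above \<open>- \<beta>\<close> on \<open>(0, \<tau>)\<close>. As \<open>(m/C) \<beta> = L\<^sub>0/2\<close>, the moment satisfies
  \<open>2 (u, u\<^sub>t) \<ge> 2 L\<^sub>0 exp (C t) - L\<^sub>0 > L\<^sub>0 + 2 C L\<^sub>0 t\<close>, and therefore
  \<open>\<parallel>u(\<tau>)\<parallel>\<^sup>2 > \<parallel>u\<^sub>0\<parallel>\<^sup>2 + L\<^sub>0 \<tau> + C L\<^sub>0 \<tau>\<^sup>2\<close>. On the other hand the dissipated energy is at most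
  \<open>\<E>(0) + \<beta>\<close>, so that \<open>\<parallel>\<nabla>(u(\<tau>) - u\<^sub>0)\<parallel>\<^sup>2 \<le> \<tau> (\<E>(0) + \<beta>)\<close> by Cauchy-Schwarz in time
  (\<open>displacement_bound\<close>) and \<open>\<parallel>u(\<tau>)\<parallel>\<^sup>2 \<le> 2 \<parallel>u\<^sub>0\<parallel>\<^sup>2 + 2 \<tau> (\<E>(0) + \<beta>) / \<lambda>\<^sub>1\<close>. The equation for \<open>\<tau>\<close> says
  that the two bounds are equal, a contradiction (\<open>energy_reaches_level\<close>). So the level is reached at
  some \<open>t\<^sub>\<beta>\<close> before \<open>\<tau>\<close>, where the same two estimates give the remaining claims (\<open>state_at_level\<close>).

  Two points need care. The function \<open>(u, u\<^sub>t)\<close> is not differentiated: \<open>u\<^sub>t\<close> has only a distributional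
  derivative in the dual of \<open>H\<^sup>1\<^sub>0\<close>. The inequality \<open>L' \<ge> C L\<close> is proved in integrated form
  instead. On a short interval \<open>[a, b]\<close> the equation is tested with the fixed element \<open>u(b)\<close>, which leads
  to scalar functions of time, for which a du Bois-Reymond lemma (\<open>weak_derivative_increment\<close>) and
  the fundamental theorem for absolutely continuous functions (\<open>abs_cont_has_integral\<close>) suffice; the
  errors are at most \<open>\<epsilon>\<close> times the integral of \<open>1 + \<parallel>\<nabla>u\<^sub>t\<parallel>\<^sup>2\<close>, and a bisection argument adds the
  intervals up.
  Further, the first eigenvalue is an infimum over eigenvalues, so it must be shown that it is
  attained and equals the minimum of the Rayleigh quotient (\<open>first_eigenvalue\<close>), and the source pairing
  must be continuous on \<open>H\<^sup>1\<^sub>0\<close> (\<open>source_pairing_small\<close>). Both follow from one elementary estimate: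
  a function differs from its averages over dyadic cubes of side \<open>2\<^sup>-\<^sup>j\<close> by \<open>O(2\<^sup>-\<^sup>j) \<parallel>\<nabla>\<phi>\<parallel>\<^sub>2\<close>
  (\<open>average_estimate\<close>). It yields compactness in \<open>L\<^sup>2\<close> (\<open>Rellich_test\<close>) and, by
  comparing consecutive levels, the subcritical Sobolev inequality (\<open>Sobolev_H10\<close>).
\<close>

section \<open>Square-integrable functions\<close>

lemma L2_D:
  assumes "f \<in> L2 \<Omega>"
  shows "f \<in> borel_measurable (lebesgue_on \<Omega>)" "integrable (lebesgue_on \<Omega>) (\<lambda>x. (norm (f x))\<^sup>2)"
  using assms by (auto simp: L2_def)

lemma L2_inner_integrable:
  assumes f: "f \<in> L2 \<Omega>" and h: "h \<in> L2 \<Omega>"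
  shows "integrable (lebesgue_on \<Omega>) (\<lambda>x. f x \<bullet> h x)"
proof (rule Bochner_Integration.integrable_bound)
  show "integrable (lebesgue_on \<Omega>) (\<lambda>x. (norm (f x))\<^sup>2 + (norm (h x))\<^sup>2)"
    using L2_D[OF f] L2_D[OF h] by auto
  show "(\<lambda>x. f x \<bullet> h x) \<in> borel_measurable (lebesgue_on \<Omega>)"
    using L2_D[OF f] L2_D[OF h] by measurable
  have "\<bar>f x \<bullet> h x\<bar> \<le> (norm (f x))\<^sup>2 + (norm (h x))\<^sup>2" for x
  proof -
    have "\<bar>f x \<bullet> h x\<bar> \<le> norm (f x) * norm (h x)" by (rule Cauchy_Schwarz_ineq2)
    also have "\<dots> \<le> (norm (f x))\<^sup>2 + (norm (h x))\<^sup>2"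
      using sum_squares_bound[of "norm (f x)" "norm (h x)"] mult_nonneg_nonneg[of "norm (f x)" "norm (h x)", OF norm_ge_zero norm_ge_zero] by linarith
    finally show ?thesis .
  qed
  then show "AE x in lebesgue_on \<Omega>. norm (f x \<bullet> h x) \<le> norm ((norm (f x))\<^sup>2 + (norm (h x))\<^sup>2)"
    by (intro always_eventually) (auto simp: abs_le_iff)
qed

lemma L2_add:
  assumes f: "f \<in> L2 \<Omega>" and h: "h \<in> L2 \<Omega>"
  shows "(\<lambda>x. f x + h x) \<in> L2 \<Omega>"
  unfolding L2_def
proof (intro CollectI conjI)
  show "(\<lambda>x. f x + h x) \<in> borel_measurable (lebesgue_on \<Omega>)"
    using L2_D[OF f] L2_D[OF h] by measurable
  have "integrable (lebesgue_on \<Omega>) (\<lambda>x. (norm (f x))\<^sup>2 + 2 * (f x \<bullet> h x) + (norm (h x))\<^sup>2)"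
    using L2_D[OF f] L2_D[OF h] L2_inner_integrable[OF f h] by auto
  then show "integrable (lebesgue_on \<Omega>) (\<lambda>x. (norm (f x + h x))\<^sup>2)"
    by (simp add: power2_norm_eq_inner algebra_simps inner_commute)
qed

lemma L2_scaleR:
  assumes f: "f \<in> L2 \<Omega>"
  shows "(\<lambda>x. c *\<^sub>R f x) \<in> L2 \<Omega>"
  using L2_D[OF f] by (auto simp: L2_def power_mult_distrib)

lemma L2_cmult:
  fixes f :: "'a::euclidean_space \<Rightarrow> real"
  assumes f: "f \<in> L2 \<Omega>"
  shows "(\<lambda>x. c * f x) \<in> L2 \<Omega>"
  using L2_scaleR[OF f, of c] by simp

lemma L2_diff:
  assumes f: "f \<in> L2 \<Omega>" and h: "h \<in> L2 \<Omega>"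
  shows "(\<lambda>x. f x - h x) \<in> L2 \<Omega>"
  using L2_add[OF f L2_scaleR[OF h, of "-1"]] by simp

lemma L2_zero: "(\<lambda>x. 0) \<in> L2 \<Omega>"
  by (simp add: L2_def)

lemma L2_inner_component:
  assumes f: "f \<in> L2 \<Omega>" shows "(\<lambda>x. f x \<bullet> b) \<in> L2 \<Omega>"
  unfolding L2_def
proof (intro CollectI conjI)
  show "(\<lambda>x. f x \<bullet> b) \<in> borel_measurable (lebesgue_on \<Omega>)"
    using L2_D[OF f] by measurable
  show "integrable (lebesgue_on \<Omega>) (\<lambda>x. (norm (f x \<bullet> b))\<^sup>2)"
  proof (rule Bochner_Integration.integrable_bound)
    show "integrable (lebesgue_on \<Omega>) (\<lambda>x. (norm b)\<^sup>2 * (norm (f x))\<^sup>2)"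
      using L2_D[OF f] by auto
    show "(\<lambda>x. (norm (f x \<bullet> b))\<^sup>2) \<in> borel_measurable (lebesgue_on \<Omega>)"
      using L2_D[OF f] by measurable
    have "norm ((norm (f x \<bullet> b))\<^sup>2) \<le> norm ((norm b)\<^sup>2 * (norm (f x))\<^sup>2)" for x
      using power_mono[OF Cauchy_Schwarz_ineq2[of "f x" b], of 2]
      by (simp add: power_mult_distrib mult.commute)
    then show "AE x in lebesgue_on \<Omega>. norm ((norm (f x \<bullet> b))\<^sup>2) \<le> norm ((norm b)\<^sup>2 * (norm (f x))\<^sup>2)"
      by simp
  qed
qed

lemma L2_inner_cong_AE:
  assumes "AE x in lebesgue_on \<Omega>. f x = f' x" "AE x in lebesgue_on \<Omega>. h x = h' x"
    "f \<in> L2 \<Omega>" "f' \<in> L2 \<Omega>" "h \<in> L2 \<Omega>" "h' \<in> L2 \<Omega>"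
  shows "L2_inner \<Omega> f h = L2_inner \<Omega> f' h'"
  unfolding L2_inner_def
  by (rule integral_cong_AE)
    (use assms L2_inner_integrable[of f \<Omega> h] L2_inner_integrable[of f' \<Omega> h'] in auto)

lemma L2_norm_cong_AE:
  assumes "AE x in lebesgue_on \<Omega>. f x = f' x" "f \<in> L2 \<Omega>" "f' \<in> L2 \<Omega>"
  shows "L2_norm \<Omega> f = L2_norm \<Omega> f'"
  unfolding L2_norm_def
  by (rule arg_cong[of _ _ sqrt], rule integral_cong_AE)
    (use assms(1) L2_D(2)[OF assms(2)] L2_D(2)[OF assms(3)] in auto)

lemma L2_norm_nonneg [simp]: "0 \<le> L2_norm \<Omega> f"
  by (auto simp: L2_norm_def intro!: Bochner_Integration.integral_nonneg)

lemma L2_norm_sq: "(L2_norm \<Omega> f)\<^sup>2 = L2_inner \<Omega> f f"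
  unfolding L2_norm_def L2_inner_def
  by (subst real_sqrt_pow2) (auto simp: power2_norm_eq_inner intro!: Bochner_Integration.integral_nonneg)

lemma L2_norm_sq_int: "(L2_norm \<Omega> f)\<^sup>2 = (LINT x|lebesgue_on \<Omega>. (norm (f x))\<^sup>2)"
  unfolding L2_norm_def
  by (subst real_sqrt_pow2) (auto intro!: Bochner_Integration.integral_nonneg)

lemma L2_inner_commute: "L2_inner \<Omega> f h = L2_inner \<Omega> h f"
  by (simp add: L2_inner_def inner_commute)

lemma L2_inner_add_left:
  assumes "f \<in> L2 \<Omega>" "h \<in> L2 \<Omega>" "k \<in> L2 \<Omega>"
  shows "L2_inner \<Omega> (\<lambda>x. f x + h x) k = L2_inner \<Omega> f k + L2_inner \<Omega> h k"
  unfolding L2_inner_def by (simp add: inner_add_left L2_inner_integrable assms)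

lemma L2_inner_scaleR_left: "L2_inner \<Omega> (\<lambda>x. c *\<^sub>R f x) k = c * L2_inner \<Omega> f k"
  unfolding L2_inner_def by simp

lemma L2_inner_cmult_left:
  "L2_inner \<Omega> (\<lambda>x. c * f x) k = c * L2_inner \<Omega> f (k :: 'a::euclidean_space \<Rightarrow> real)"
  using L2_inner_scaleR_left[of \<Omega> c f k] by simp

lemma L2_inner_cmult_right:
  "L2_inner \<Omega> k (\<lambda>x. c * f x) = c * L2_inner \<Omega> k (f :: 'a::euclidean_space \<Rightarrow> real)"
  using L2_inner_cmult_left[of \<Omega> c f k] by (simp add: L2_inner_commute)

lemma L2_inner_diff_left:
  assumes "f \<in> L2 \<Omega>" "h \<in> L2 \<Omega>" "k \<in> L2 \<Omega>"
  shows "L2_inner \<Omega> (\<lambda>x. f x - h x) k = L2_inner \<Omega> f k - L2_inner \<Omega> h k"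
  unfolding L2_inner_def by (simp add: inner_diff_left L2_inner_integrable assms)

lemma L2_inner_add_right:
  assumes "f \<in> L2 \<Omega>" "h \<in> L2 \<Omega>" "k \<in> L2 \<Omega>"
  shows "L2_inner \<Omega> k (\<lambda>x. f x + h x) = L2_inner \<Omega> k f + L2_inner \<Omega> k h"
  using L2_inner_add_left[OF assms] by (simp add: L2_inner_commute)

lemma L2_inner_diff_right:
  assumes "f \<in> L2 \<Omega>" "h \<in> L2 \<Omega>" "k \<in> L2 \<Omega>"
  shows "L2_inner \<Omega> k (\<lambda>x. f x - h x) = L2_inner \<Omega> k f - L2_inner \<Omega> k h"
  using L2_inner_diff_left[OF assms] by (simp add: L2_inner_commute)

lemma L2_norm_add_sq:
  assumes f: "f \<in> L2 \<Omega>" and h: "h \<in> L2 \<Omega>"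
  shows "(L2_norm \<Omega> (\<lambda>x. f x + h x))\<^sup>2 = (L2_norm \<Omega> f)\<^sup>2 + 2 * L2_inner \<Omega> f h + (L2_norm \<Omega> h)\<^sup>2"
  unfolding L2_norm_sq using f h
  by (simp add: L2_inner_add_left L2_inner_add_right L2_add L2_inner_commute[of \<Omega> h f])

lemma L2_norm_diff_sq:
  assumes f: "f \<in> L2 \<Omega>" and h: "h \<in> L2 \<Omega>"
  shows "(L2_norm \<Omega> (\<lambda>x. f x - h x))\<^sup>2 = (L2_norm \<Omega> f)\<^sup>2 - 2 * L2_inner \<Omega> f h + (L2_norm \<Omega> h)\<^sup>2"
  unfolding L2_norm_sq using f h
  by (simp add: L2_inner_diff_left L2_inner_diff_right L2_diff L2_inner_commute[of \<Omega> h f])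

lemma L2_norm_scaleR: "L2_norm \<Omega> (\<lambda>x. c *\<^sub>R f x) = \<bar>c\<bar> * L2_norm \<Omega> f"
  by (simp add: L2_norm_def power_mult_distrib real_sqrt_mult)

lemma L2_norm_cmult:
  "L2_norm \<Omega> (\<lambda>x. c * f x) = \<bar>c\<bar> * L2_norm \<Omega> (f :: 'a::euclidean_space \<Rightarrow> real)"
  using L2_norm_scaleR[of \<Omega> c f] by simp

text \<open>Yields both the Cauchy-Schwarz inequality and, with \<open>a = 0\<close>, the vanishing of a first variation.\<close>

lemma nonneg_quadratic_imp_discriminant:
  fixes a b c :: real
  assumes "\<And>t. 0 \<le> a + 2 * t * b + t\<^sup>2 * c"
  shows "b\<^sup>2 \<le> a * c"
proof (cases "c = 0")
  case True
  have "b = 0"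
  proof (rule ccontr)
    assume "b \<noteq> 0"
    then show False using assms[of "-(a+1)/(2*b)"] True by (simp add: field_simps)
  qed
  then show ?thesis using True by simp
next
  case False
  \<comment> \<open>For \<open>c < 0\<close> the quadratic is negative at \<open>t = 1 + (\<bar>a\<bar> + 2 \<bar>b\<bar>) / \<bar>c\<bar>\<close>.\<close>
  have "0 \<le> c"
  proof (rule ccontr)
    assume "\<not> 0 \<le> c"
    then have c: "c < 0" by simp
    define t where "t = 1 + (\<bar>a\<bar> + 2 * \<bar>b\<bar>) / (- c)"
    have t: "t \<ge> 1" using c unfolding t_def by (simp add: divide_nonneg_neg divide_nonpos_neg divide_le_0_iff)
    have "t * c = c - (\<bar>a\<bar> + 2 * \<bar>b\<bar>)" using c unfolding t_def by (simp add: field_simps)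
    then have "t * (t * c + 2 * b) + a = t * (c - \<bar>a\<bar> - 2 * \<bar>b\<bar> + 2 * b) + a" by simp
    also have "\<dots> \<le> t * (c - \<bar>a\<bar>) + a" using t by (intro add_right_mono mult_left_mono) auto
    also have "\<dots> \<le> 1 * (c - \<bar>a\<bar>) + a" using t c by (intro add_right_mono mult_right_mono_neg) auto
    also have "\<dots> < 0" using c abs_ge_self[of a] by simp
    finally show False using assms[of t] by (simp add: power2_eq_square algebra_simps)
  qed
  with False have c: "c > 0" by simp
  have "0 \<le> a + 2 * (-b/c) * b + (-b/c)\<^sup>2 * c" by (rule assms)
  also have "\<dots> = a - b\<^sup>2 / c" using c by (simp add: field_simps power2_eq_square)
  finally show ?thesis using c by (simp add: field_simps)
qed

lemma L2_Cauchy_Schwarz: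
  assumes f: "f \<in> L2 \<Omega>" and h: "h \<in> L2 \<Omega>"
  shows "\<bar>L2_inner \<Omega> f h\<bar> \<le> L2_norm \<Omega> f * L2_norm \<Omega> h"
proof -
  have "0 \<le> (L2_norm \<Omega> f)\<^sup>2 + 2 * t * L2_inner \<Omega> f h + t\<^sup>2 * (L2_norm \<Omega> h)\<^sup>2" for t
  proof -
    have "0 \<le> (L2_norm \<Omega> (\<lambda>x. f x + t *\<^sub>R h x))\<^sup>2" by simp
    also have "\<dots> = (L2_norm \<Omega> f)\<^sup>2 + 2 * L2_inner \<Omega> f (\<lambda>x. t *\<^sub>R h x) + (L2_norm \<Omega> (\<lambda>x. t *\<^sub>R h x))\<^sup>2"
      by (rule L2_norm_add_sq) (use f h L2_scaleR in auto)
    finally show ?thesis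
      by (simp add: L2_inner_commute[of \<Omega> f] L2_inner_scaleR_left L2_norm_scaleR power_mult_distrib)
  qed
  from nonneg_quadratic_imp_discriminant[OF this]
  have "(L2_inner \<Omega> f h)\<^sup>2 \<le> (L2_norm \<Omega> f * L2_norm \<Omega> h)\<^sup>2" by (simp add: power_mult_distrib)
  then show ?thesis
    by (simp add: abs_le_square_iff[symmetric] abs_mult)
qed

lemma L2_norm_triangle:
  assumes f: "f \<in> L2 \<Omega>" and h: "h \<in> L2 \<Omega>"
  shows "L2_norm \<Omega> (\<lambda>x. f x + h x) \<le> L2_norm \<Omega> f + L2_norm \<Omega> h"
proof (rule power2_le_imp_le)
  show "(L2_norm \<Omega> (\<lambda>x. f x + h x))\<^sup>2 \<le> (L2_norm \<Omega> f + L2_norm \<Omega> h)\<^sup>2"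
    using L2_Cauchy_Schwarz[OF f h] unfolding L2_norm_add_sq[OF f h] by (simp add: power2_sum)
qed simp

lemma L2_norm_diff_commute: "L2_norm \<Omega> (\<lambda>x. f x - h x) = L2_norm \<Omega> (\<lambda>x. h x - f x)"
  by (simp add: L2_norm_def norm_minus_commute)

lemma L2_norm_triangle_diff:
  assumes f: "f \<in> L2 \<Omega>" and h: "h \<in> L2 \<Omega>" and k: "k \<in> L2 \<Omega>"
  shows "L2_norm \<Omega> (\<lambda>x. f x - k x) \<le> L2_norm \<Omega> (\<lambda>x. f x - h x) + L2_norm \<Omega> (\<lambda>x. h x - k x)"
  using L2_norm_triangle[OF L2_diff[OF f h] L2_diff[OF h k]] by simp

lemma L2_norm_diff_abs:
  assumes f: "f \<in> L2 \<Omega>" and h: "h \<in> L2 \<Omega>"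
  shows "\<bar>L2_norm \<Omega> f - L2_norm \<Omega> h\<bar> \<le> L2_norm \<Omega> (\<lambda>x. f x - h x)"
  using L2_norm_triangle[OF h L2_diff[OF f h]] L2_norm_triangle[OF f L2_diff[OF h f]]
  by (simp add: L2_norm_diff_commute[of \<Omega> h f])

lemma L2_norm_tendsto:
  assumes f: "\<And>k. f k \<in> L2 \<Omega>" and g: "g \<in> L2 \<Omega>"
    and lim: "((\<lambda>k. L2_norm \<Omega> (\<lambda>x. f k x - g x)) \<longlongrightarrow> 0) F"
  shows "((\<lambda>k. L2_norm \<Omega> (f k)) \<longlongrightarrow> L2_norm \<Omega> g) F"
proof -
  have "((\<lambda>k. L2_norm \<Omega> (f k) - L2_norm \<Omega> g) \<longlongrightarrow> 0) F"
    by (rule Lim_null_comparison[OF _ lim]) (simp add: L2_norm_diff_abs f g)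
  then show ?thesis by (simp add: LIM_zero_iff)
qed

lemma L2_inner_tendsto:
  assumes f: "\<And>k. f k \<in> L2 \<Omega>" and g: "g \<in> L2 \<Omega>"
    and lim: "((\<lambda>k. L2_norm \<Omega> (\<lambda>x. f k x - g x)) \<longlongrightarrow> 0) F"
    and f': "\<And>k. f' k \<in> L2 \<Omega>" and g': "g' \<in> L2 \<Omega>"
    and lim': "((\<lambda>k. L2_norm \<Omega> (\<lambda>x. f' k x - g' x)) \<longlongrightarrow> 0) F"
  shows "((\<lambda>k. L2_inner \<Omega> (f k) (f' k)) \<longlongrightarrow> L2_inner \<Omega> g g') F"
proof -
  have "((\<lambda>k. L2_inner \<Omega> (f k) (f' k) - L2_inner \<Omega> g g') \<longlongrightarrow> 0) F"
  proof (rule Lim_null_comparison)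
    show "\<forall>\<^sub>F k in F. norm (L2_inner \<Omega> (f k) (f' k) - L2_inner \<Omega> g g')
       \<le> L2_norm \<Omega> (\<lambda>x. f k x - g x) * L2_norm \<Omega> (f' k)
          + L2_norm \<Omega> g * L2_norm \<Omega> (\<lambda>x. f' k x - g' x)"
    proof (intro always_eventually allI)
      fix k
      have "L2_inner \<Omega> (f k) (f' k) - L2_inner \<Omega> g g'
          = L2_inner \<Omega> (\<lambda>x. f k x - g x) (f' k) + L2_inner \<Omega> g (\<lambda>x. f' k x - g' x)"
        by (simp add: L2_inner_diff_left L2_inner_diff_right f g f' g')
      then show "norm (L2_inner \<Omega> (f k) (f' k) - L2_inner \<Omega> g g')
       \<le> L2_norm \<Omega> (\<lambda>x. f k x - g x) * L2_norm \<Omega> (f' k)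
          + L2_norm \<Omega> g * L2_norm \<Omega> (\<lambda>x. f' k x - g' x)"
        using L2_Cauchy_Schwarz[OF L2_diff[OF f g] f', of k k]
          L2_Cauchy_Schwarz[OF g L2_diff[OF f' g'], of k] by simp
    qed
    have "((\<lambda>k. L2_norm \<Omega> (\<lambda>x. f k x - g x) * L2_norm \<Omega> (f' k)
          + L2_norm \<Omega> g * L2_norm \<Omega> (\<lambda>x. f' k x - g' x)) \<longlongrightarrow> 0 * L2_norm \<Omega> g' + L2_norm \<Omega> g * 0) F"
      by (intro tendsto_intros lim lim' L2_norm_tendsto f' g')
    then show "((\<lambda>k. L2_norm \<Omega> (\<lambda>x. f k x - g x) * L2_norm \<Omega> (f' k)
          + L2_norm \<Omega> g * L2_norm \<Omega> (\<lambda>x. f' k x - g' x)) \<longlongrightarrow> 0) F" by simp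
  qed
  then show ?thesis by (simp add: LIM_zero_iff)
qed

lemma L2_norm_sq_nn_integral:
  assumes "f \<in> L2 \<Omega>"
  shows "(\<integral>\<^sup>+x. ennreal ((norm (f x))\<^sup>2) \<partial>lebesgue_on \<Omega>) = ennreal ((L2_norm \<Omega> f)\<^sup>2)"
  unfolding L2_norm_sq_int by (rule nn_integral_eq_integral) (use L2_D[OF assms] in auto)

lemma L2_of_nn_integral:
  assumes "f \<in> borel_measurable (lebesgue_on \<Omega>)"
    and "(\<integral>\<^sup>+x. ennreal ((norm (f x))\<^sup>2) \<partial>lebesgue_on \<Omega>) \<le> ennreal (c\<^sup>2)" and "0 \<le> c"
  shows "f \<in> L2 \<Omega>" "L2_norm \<Omega> f \<le> c"
proof -
  have "integrable (lebesgue_on \<Omega>) (\<lambda>x. (norm (f x))\<^sup>2)"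
    by (rule integrableI_bounded) (use assms in \<open>auto simp: le_less_trans[OF _ ennreal_less_top]\<close>)
  then show f: "f \<in> L2 \<Omega>" using assms by (simp add: L2_def)
  from assms(2) have "(L2_norm \<Omega> f)\<^sup>2 \<le> c\<^sup>2" unfolding L2_norm_sq_nn_integral[OF f]
    by (simp add: ennreal_le_iff)
  then show "L2_norm \<Omega> f \<le> c" using assms(3) by (rule power2_le_imp_le)
qed

text \<open>A subsequence whose consecutive distances are at most \<open>2\<^sup>-\<^sup>k\<close> makes
  \<open>\<Sum>k. 2\<^sup>k \<bar>d\<^sub>k\<bar>\<^sup>2\<close> integrable for the differences \<open>d\<^sub>k\<close>, so that they decay geometrically almost
  everywhere; the pointwise limit is the limit in \<open>L\<^sup>2\<close> by Fatou's lemma.\<close>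

lemma L2_complete:
  fixes f :: "nat \<Rightarrow> 'a::euclidean_space \<Rightarrow> 'c::euclidean_space"
  assumes f: "\<And>k. f k \<in> L2 \<Omega>"
    and cauchy: "\<And>e. e > 0 \<Longrightarrow> \<exists>N. \<forall>m\<ge>N. \<forall>n\<ge>N. L2_norm \<Omega> (\<lambda>x. f m x - f n x) < e"
  obtains g r where "g \<in> L2 \<Omega>" "strict_mono r" "AE x in lebesgue_on \<Omega>. (\<lambda>k. f (r k) x) \<longlonglongrightarrow> g x"
    "(\<lambda>k. L2_norm \<Omega> (\<lambda>x. f k x - g x)) \<longlonglongrightarrow> 0"
proof -
  let ?M = "lebesgue_on \<Omega>"
  have "\<forall>k::nat. \<exists>N. \<forall>m\<ge>N. \<forall>n\<ge>N. L2_norm \<Omega> (\<lambda>x. f m x - f n x) < (1/2)^k"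
    using cauchy by simp
  then obtain N where N: "\<And>k m n. m \<ge> N k \<Longrightarrow> n \<ge> N k \<Longrightarrow> L2_norm \<Omega> (\<lambda>x. f m x - f n x) < (1/2)^k"
    by metis
  define r where "r = (\<lambda>k. k + (\<Sum>i\<le>k. N i))"
  have r: "strict_mono r" unfolding r_def by (rule strict_mono_Suc_iff[THEN iffD2]) auto
  have rN: "r k \<ge> N k" for k unfolding r_def
    by (metis atMost_iff finite_atMost le_add2 le_trans member_le_sum order_refl zero_le)
  define d where "d = (\<lambda>k x. f (r (Suc k)) x - f (r k) x)"
  have dL2: "d k \<in> L2 \<Omega>" for k unfolding d_def by (intro L2_diff f)
  have dn: "L2_norm \<Omega> (d k) < (1/2)^k" for k
    unfolding d_def using rN[of k] strict_monoD[OF r, of k "Suc k"] by (intro N) auto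
  have [measurable]: "f k \<in> borel_measurable ?M" for k using L2_D[OF f] by auto
  have [measurable]: "d k \<in> borel_measurable ?M" for k using L2_D[OF dL2] by auto
  have "(\<integral>\<^sup>+x. (\<Sum>k. ennreal (2^k * (norm (d k x))\<^sup>2)) \<partial>?M)
      = (\<Sum>k. \<integral>\<^sup>+x. ennreal (2^k * (norm (d k x))\<^sup>2) \<partial>?M)"
    by (rule nn_integral_suminf) measurable
  also have "\<dots> = (\<Sum>k. ennreal (2^k * (L2_norm \<Omega> (d k))\<^sup>2))"
  proof (rule suminf_cong)
    fix k
    have "(\<integral>\<^sup>+x. ennreal (2^k * (norm (d k x))\<^sup>2) \<partial>?M) = (\<integral>\<^sup>+x. ennreal (2^k) * ennreal ((norm (d k x))\<^sup>2) \<partial>?M)"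
      by (simp add: ennreal_mult)
    also have "\<dots> = ennreal (2^k) * ennreal ((L2_norm \<Omega> (d k))\<^sup>2)"
      by (subst nn_integral_cmult) (auto simp: L2_norm_sq_nn_integral[OF dL2])
    finally show "(\<integral>\<^sup>+x. ennreal (2^k * (norm (d k x))\<^sup>2) \<partial>?M) = ennreal (2^k * (L2_norm \<Omega> (d k))\<^sup>2)"
      by (simp add: ennreal_mult)
  qed
  also have "\<dots> \<le> (\<Sum>k. ennreal ((1/2)^k))"
  proof (rule suminf_le)
    fix k
    have "(L2_norm \<Omega> (d k))\<^sup>2 \<le> ((1/2)^k)\<^sup>2" using dn[of k] by (intro power_mono) auto
    then have "2^k * (L2_norm \<Omega> (d k))\<^sup>2 \<le> 2^k * ((1/2)^k)\<^sup>2" by (intro mult_left_mono) auto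
    also have "\<dots> = (1/2)^k" by (simp add: power_divide power2_eq_square)
    finally show "ennreal (2^k * (L2_norm \<Omega> (d k))\<^sup>2) \<le> ennreal ((1/2)^k)" by (rule ennreal_leI)
  qed auto
  also have "(\<Sum>k. ennreal ((1/2)^k)) = ennreal (\<Sum>k. (1/2)^k)"
    by (rule suminf_ennreal2) (auto intro: summable_geometric)
  also have "\<dots> < \<infinity>" by (rule ennreal_less_top[folded infinity_ennreal_def])
  finally have "AE x in ?M. (\<Sum>k. ennreal (2^k * (norm (d k x))\<^sup>2)) \<noteq> \<infinity>"
    by (intro nn_integral_PInf_AE) (auto simp: less_top)
  then have conv: "AE x in ?M. convergent (\<lambda>k. f (r k) x)"
  proof eventually_elim
    fix x assume fin: "(\<Sum>k. ennreal (2^k * (norm (d k x))\<^sup>2)) \<noteq> \<infinity>"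
    have sm: "summable (\<lambda>k. 2^k * (norm (d k x))\<^sup>2)"
      by (rule summable_suminf_not_top) (use fin in auto)
    have "summable (\<lambda>k. norm (d k x))"
    proof (rule summable_comparison_test')
      show "summable (\<lambda>k. 2^k * (norm (d k x))\<^sup>2 + (1/2)^k)"
        by (intro summable_add sm summable_geometric) auto
      fix k :: nat assume "k \<ge> 0"
      let ?a = "norm (d k x)"
      have "2^k * ?a * 1 \<le> (2^k * ?a)\<^sup>2 + 1\<^sup>2"
        using sum_squares_bound[of "2^k * ?a" 1] by (smt (verit) zero_le_mult_iff norm_ge_zero zero_le_power)
      then have "(1/2)^k * (2^k * ?a) \<le> (1/2)^k * ((2^k * ?a)\<^sup>2 + 1)"
        by (intro mult_left_mono) auto
      then show "norm (norm (d k x)) \<le> 2^k * (norm (d k x))\<^sup>2 + (1/2)^k"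
        by (simp add: power_divide power2_eq_square field_simps)
    qed
    then have "summable (\<lambda>k. d k x)" by (rule summable_norm_cancel)
    then have "convergent (\<lambda>n. \<Sum>k<n. d k x)" by (simp add: summable_iff_convergent)
    moreover have "(\<Sum>k<n. d k x) = f (r n) x - f (r 0) x" for n
      unfolding d_def by (rule sum_lessThan_telescope)
    ultimately have "convergent (\<lambda>n. f (r n) x - f (r 0) x)" by simp
    then have "convergent (\<lambda>n. (f (r n) x - f (r 0) x) + f (r 0) x)"
      by (intro convergent_add convergent_const)
    then show "convergent (\<lambda>k. f (r k) x)" by simp
  qed
  define g where "g = (\<lambda>x. lim (\<lambda>k. f (r k) x))"
  have [measurable]: "g \<in> borel_measurable ?M" unfolding g_def by measurable
  have lim: "AE x in ?M. (\<lambda>k. f (r k) x) \<longlonglongrightarrow> g x"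
    using conv by eventually_elim (simp add: g_def convergent_LIMSEQ_iff)
  have key: "f n - g \<in> L2 \<Omega> \<and> L2_norm \<Omega> (\<lambda>x. f n x - g x) \<le> e"
    if e: "e > 0" and n: "\<forall>m\<ge>K. \<forall>n\<ge>K. L2_norm \<Omega> (\<lambda>x. f m x - f n x) < e" "n \<ge> K" for e K n
  proof -
    have "(\<integral>\<^sup>+x. ennreal ((norm (f n x - g x))\<^sup>2) \<partial>?M)
        = (\<integral>\<^sup>+x. liminf (\<lambda>k. ennreal ((norm (f n x - f (r k) x))\<^sup>2)) \<partial>?M)"
    proof (rule nn_integral_cong_AE)
      show "AE x in ?M. ennreal ((norm (f n x - g x))\<^sup>2) = liminf (\<lambda>k. ennreal ((norm (f n x - f (r k) x))\<^sup>2))"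
        using lim
      proof eventually_elim
        fix x assume "(\<lambda>k. f (r k) x) \<longlonglongrightarrow> g x"
        then have "(\<lambda>k. ennreal ((norm (f n x - f (r k) x))\<^sup>2)) \<longlonglongrightarrow> ennreal ((norm (f n x - g x))\<^sup>2)"
          by (intro tendsto_ennrealI tendsto_intros)
        then show "ennreal ((norm (f n x - g x))\<^sup>2) = liminf (\<lambda>k. ennreal ((norm (f n x - f (r k) x))\<^sup>2))"
          by (rule lim_imp_Liminf[OF sequentially_bot, symmetric])
      qed
    qed
    also have "\<dots> \<le> liminf (\<lambda>k. \<integral>\<^sup>+x. ennreal ((norm (f n x - f (r k) x))\<^sup>2) \<partial>?M)"
      by (rule nn_integral_liminf) measurable
    also have "\<dots> \<le> ennreal (e\<^sup>2)"
    proof (rule Liminf_le)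
      show "\<forall>\<^sub>F k in sequentially. (\<integral>\<^sup>+x. ennreal ((norm (f n x - f (r k) x))\<^sup>2) \<partial>?M) \<le> ennreal (e\<^sup>2)"
        using eventually_ge_at_top[of K]
      proof eventually_elim
        fix k assume "k \<ge> K"
        then have "r k \<ge> K" using seq_suble[OF r, of k] by linarith
        then have "L2_norm \<Omega> (\<lambda>x. f n x - f (r k) x) < e" using n by auto
        then show "(\<integral>\<^sup>+x. ennreal ((norm (f n x - f (r k) x))\<^sup>2) \<partial>?M) \<le> ennreal (e\<^sup>2)"
          by (subst L2_norm_sq_nn_integral) (auto intro!: L2_diff f ennreal_leI power_mono)
      qed
    qed simp
    finally show ?thesis using L2_of_nn_integral[of "\<lambda>x. f n x - g x" \<Omega> e] e
      by (auto simp: fun_diff_def)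
  qed
  obtain K where "\<forall>m\<ge>K. \<forall>n\<ge>K. L2_norm \<Omega> (\<lambda>x. f m x - f n x) < 1" using cauchy[of 1] by auto
  then have "f K - g \<in> L2 \<Omega>" using key[of 1 K K] by auto
  from L2_diff[OF f[of K] this] have gL2: "g \<in> L2 \<Omega>" by (simp add: fun_diff_def)
  have "(\<lambda>k. L2_norm \<Omega> (\<lambda>x. f k x - g x)) \<longlonglongrightarrow> 0"
  proof (rule LIMSEQ_I)
    fix e :: real assume "e > 0"
    then obtain K where "\<forall>m\<ge>K. \<forall>n\<ge>K. L2_norm \<Omega> (\<lambda>x. f m x - f n x) < e/2" using cauchy[of "e/2"] by auto
    then show "\<exists>no. \<forall>n\<ge>no. norm (L2_norm \<Omega> (\<lambda>x. f n x - g x) - 0) < e"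
      using key[of "e/2" K] \<open>e > 0\<close> by (intro exI[of _ K]) (fastforce intro: le_less_trans)
  qed
  with gL2 r lim that show thesis by blast
qed

section \<open>Smooth functions with compact support\<close>

lemma partial_eq:
  assumes "(f has_derivative f') (at x)" shows "partial b f x = f' b"
  using frechet_derivative_at[OF assms] by simp

lemma frechet_has_derivative:
  "f differentiable (at x) \<Longrightarrow> (f has_derivative frechet_derivative f (at x)) (at x)"
  by (simp add: frechet_derivative_works)

lemma Ck_on_Suc_imp: "Ck_on (Suc k) UNIV f \<Longrightarrow> Ck_on k UNIV f"
proof (induction k arbitrary: f)
  case 0
  then show ?case
    by (auto intro!: continuous_at_imp_continuous_on differentiable_imp_continuous_within)
next
  case (Suc k)
  then have "f differentiable at x" for x by simp
  moreover have "Ck_on k UNIV (partial b f)" if "b \<in> Basis" for b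
    by (rule Suc.IH) (use Suc.prems that in simp)
  ultimately show ?case by simp
qed

lemma Ck_on_const: "Ck_on k UNIV (\<lambda>x. c)"
proof (induction k arbitrary: c)
  case (Suc k)
  have "partial b (\<lambda>x. c) = (\<lambda>x. 0)" for b :: 'a
    using partial_eq[OF has_derivative_const] by blast
  then show ?case using Suc by simp
qed simp

lemma Ck_on_add: "Ck_on k UNIV f \<Longrightarrow> Ck_on k UNIV h \<Longrightarrow> Ck_on k UNIV (\<lambda>x. f x + h x)"
proof (induction k arbitrary: f h)
  case 0 then show ?case by (simp add: continuous_on_add)
next
  case (Suc k)
  then have d: "f differentiable at x" "h differentiable at x" for x by auto
  have "partial b (\<lambda>x. f x + h x) = (\<lambda>x. partial b f x + partial b h x)" for b
    by (rule ext, rule partial_eq) (rule has_derivative_add[OF frechet_has_derivative[OF d(1)] frechet_has_derivative[OF d(2)]])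
  then show ?case using Suc d by (auto intro!: differentiable_add)
qed

lemma Ck_on_mult: "Ck_on k UNIV f \<Longrightarrow> Ck_on k UNIV h \<Longrightarrow> Ck_on k UNIV (\<lambda>x. f x * h x)"
proof (induction k arbitrary: f h)
  case 0 then show ?case by (simp add: continuous_on_mult)
next
  case (Suc k)
  then have d: "f differentiable at x" "h differentiable at x" for x by auto
  have "partial b (\<lambda>x. f x * h x) = (\<lambda>x. f x * partial b h x + partial b f x * h x)" for b
    by (rule ext, rule partial_eq) (rule has_derivative_mult[OF frechet_has_derivative[OF d(1)] frechet_has_derivative[OF d(2)]])
  moreover have "Ck_on k UNIV (\<lambda>x. f x * partial b h x + partial b f x * h x)" if "b \<in> Basis" for b
    by (intro Ck_on_add Suc.IH Ck_on_Suc_imp[OF Suc.prems(1)] Ck_on_Suc_imp[OF Suc.prems(2)])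
      (use Suc.prems that in auto)
  ultimately show ?case using d by (auto intro!: differentiable_mult)
qed

lemma Ck_on_cmult: "Ck_on k UNIV f \<Longrightarrow> Ck_on k UNIV (\<lambda>x. c * f x)"
  by (intro Ck_on_mult Ck_on_const)

lemma Ck_on_prod:
  "finite I \<Longrightarrow> (\<And>i. i \<in> I \<Longrightarrow> Ck_on k UNIV (f i)) \<Longrightarrow> Ck_on k UNIV (\<lambda>x. \<Prod>i\<in>I. f i x)"
  by (induction I rule: finite_induct) (auto intro!: Ck_on_mult Ck_on_const)

lemma Ck_on_compose_affine:
  fixes h :: "real \<Rightarrow> real" and a :: "'a::euclidean_space"
  shows "Ck_on k UNIV h \<Longrightarrow> Ck_on k UNIV (\<lambda>x::'a. h (x \<bullet> a + d))"
proof (induction k arbitrary: h)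
  case 0
  then show ?case
    by (auto intro!: continuous_on_compose2[of UNIV h UNIV] continuous_intros)
next
  case (Suc k)
  then have d: "h differentiable at x" for x by auto
  have hd: "((\<lambda>x::'a. h (x \<bullet> a + d)) has_derivative (\<lambda>y. frechet_derivative h (at (x \<bullet> a + d)) (y \<bullet> a))) (at x)" for x
    by (rule has_derivative_compose[OF _ frechet_has_derivative[OF d], of "\<lambda>x. x \<bullet> a + d" "\<lambda>y. y \<bullet> a", simplified])
       (auto intro!: derivative_eq_intros)
  have lin: "frechet_derivative h (at y) c = c * partial 1 h y" for y c
  proof -
    interpret bounded_linear "frechet_derivative h (at y)"
      by (rule has_derivative_bounded_linear[OF frechet_has_derivative[OF d]])
    show ?thesis using scaleR[of c 1] by simp
  qed
  have "partial b (\<lambda>x::'a. h (x \<bullet> a + d)) = (\<lambda>x. (b \<bullet> a) * partial 1 h (x \<bullet> a + d))" for b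
    by (rule ext, subst partial_eq[OF hd], rule lin)
  moreover have "Ck_on k UNIV (\<lambda>x::'a. partial 1 h (x \<bullet> a + d))"
    by (rule Suc.IH) (use Suc.prems in simp)
  ultimately show ?case using hd by (auto simp: differentiable_def intro!: Ck_on_cmult)
qed

lemma Ck_on_real_Suc:
  fixes f :: "real \<Rightarrow> real"
  assumes "\<And>t. (f has_real_derivative f' t) (at t)" and "Ck_on k UNIV f'"
  shows "Ck_on (Suc k) UNIV f"
proof -
  have "partial 1 f = f'"
    using partial_eq[OF assms(1)[unfolded has_field_derivative_def]] by auto
  moreover have "f differentiable at t" for t
    using assms(1) by (auto simp: differentiable_def has_field_derivative_def)
  ultimately show ?thesis using assms(2) by simp
qed

text \<open>The family \<open>exp (- 1/t) t\<^sup>-\<^sup>k\<close>, extended by zero, is closed under differentiation up to linear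
  combinations, which makes smoothness a plain induction.\<close>

definition flat_exp :: "nat \<Rightarrow> real \<Rightarrow> real" where
  "flat_exp k t = (if t > 0 then exp (- 1 / t) / t ^ k else 0)"

lemma flat_exp_DERIV:
  "(flat_exp k has_real_derivative flat_exp (k + 2) t - real k * flat_exp (k + 1) t) (at t)"
proof -
  consider "t > 0" | "t < 0" | "t = 0" by linarith
  then show ?thesis
  proof cases
    case 1
    have deriv: "((\<lambda>t. exp (- 1 / t) / t ^ k) has_real_derivative
        (exp (- 1 / t) * (1 / t\<^sup>2)) / t ^ k - exp (- 1 / t) * (real k * t ^ (k - 1)) / (t ^ k * t ^ k)) (at t)"
      using 1 by (auto intro!: derivative_eq_intros simp: power2_eq_square field_simps)
    have "real k * t ^ (k - 1) / (t ^ k * t ^ k) = real k / t ^ (k + 1)"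
      using 1 by (cases k) (auto simp: field_simps)
    from this[THEN arg_cong[of _ _ "\<lambda>z. exp (- 1 / t) * z"]]
    have "exp (- 1 / t) * (real k * t ^ (k - 1)) / (t ^ k * t ^ k) = real k * (exp (- 1 / t) / t ^ (k + 1))"
      by (simp only: times_divide_eq_right mult.commute)
    moreover have "exp (- 1 / t) * (1 / t\<^sup>2) / t ^ k = exp (- 1 / t) / t ^ (k + 2)"
      by (simp add: power_add mult.commute power2_eq_square)
    moreover note deriv
    ultimately have "((\<lambda>t. exp (- 1 / t) / t ^ k) has_real_derivative
        flat_exp (k + 2) t - real k * flat_exp (k + 1) t) (at t)"
      using 1 unfolding flat_exp_def by (simp del: power_add_numeral power_add_numeral2 add_2_eq_Suc' power_Suc)
    then show ?thesis
      by (rule has_field_derivative_transform_within_open[of _ _ _ "{0<..}"]) (use 1 in \<open>auto simp: flat_exp_def\<close>)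
  next
    case 2
    have "((\<lambda>t. 0) has_real_derivative flat_exp (k + 2) t - real k * flat_exp (k + 1) t) (at t)"
      using 2 unfolding flat_exp_def by simp
    then show ?thesis
      by (rule has_field_derivative_transform_within_open[of _ _ _ "{..<0}"]) (use 2 in \<open>auto simp: flat_exp_def\<close>)
  next
    case 3
    have "((\<lambda>h. flat_exp k h / h) \<longlongrightarrow> 0) (at_right 0)"
    proof (rule Lim_transform_eventually)
      show "((\<lambda>h. (inverse h) ^ (k+1) / exp (inverse h)) \<longlongrightarrow> (0::real)) (at_right 0)"
        by (rule filterlim_compose[OF tendsto_power_div_exp_0 filterlim_inverse_at_top_right])
      show "\<forall>\<^sub>F h::real in at_right 0. (inverse h) ^ (k+1) / exp (inverse h) = flat_exp k h / h"
        using eventually_at_right_less[of 0]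
        by eventually_elim (auto simp: flat_exp_def exp_minus field_simps)
    qed
    moreover have "((\<lambda>h. flat_exp k h / h) \<longlongrightarrow> 0) (at_left 0)"
    proof (rule Lim_transform_eventually)
      show "((\<lambda>h. 0) \<longlongrightarrow> (0::real)) (at_left 0)" by simp
      show "\<forall>\<^sub>F h::real in at_left 0. 0 = flat_exp k h / h"
        using eventually_at_left_real[of "-1" 0, simplified]
        by eventually_elim (auto simp: flat_exp_def)
    qed
    ultimately have "((\<lambda>h. flat_exp k h / h) \<longlongrightarrow> 0) (at 0)"
      by (simp add: filterlim_split_at)
    then have "(flat_exp k has_real_derivative 0) (at 0)"
      by (simp add: DERIV_def flat_exp_def)
    then show ?thesis using 3 by (simp add: flat_exp_def)
  qed
qed

lemma Ck_on_flat_exp: "Ck_on m UNIV (flat_exp k)"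
proof (induction m arbitrary: k)
  case 0
  show ?case
    using flat_exp_DERIV by (auto intro!: continuous_at_imp_continuous_on DERIV_isCont)
next
  case (Suc m)
  have "Ck_on m UNIV (\<lambda>t. flat_exp (k + 2) t + (- real k) * flat_exp (k + 1) t)"
    by (intro Ck_on_add Ck_on_cmult Suc)
  then show ?case
    by (intro Ck_on_real_Suc[OF flat_exp_DERIV]) simp
qed

definition bump :: "real \<Rightarrow> real" where
  "bump t = flat_exp 0 t * flat_exp 0 (1 - t)"

lemma Ck_on_bump: "Ck_on k UNIV bump"
proof -
  have "Ck_on k UNIV (\<lambda>t::real. flat_exp 0 (t \<bullet> (-1) + 1))"
    by (rule Ck_on_compose_affine[OF Ck_on_flat_exp])
  then have "Ck_on k UNIV (\<lambda>t. flat_exp 0 t * flat_exp 0 (1 - t))"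
    by (intro Ck_on_mult Ck_on_flat_exp) (simp add: add.commute)
  then show ?thesis by (simp add: bump_def[abs_def])
qed

lemma bump_cont: "continuous_on UNIV bump"
  using Ck_on_bump[of 0] by simp

lemma bump_nonneg: "bump t \<ge> 0" and bump_pos: "0 < t \<Longrightarrow> t < 1 \<Longrightarrow> bump t > 0"
  and bump_zero: "t \<le> 0 \<or> t \<ge> 1 \<Longrightarrow> bump t = 0"
  by (auto simp: bump_def flat_exp_def)

definition ramp :: "real \<Rightarrow> real" where
  "ramp t = integral {0..t} bump"

lemma ramp_DERIV: "(ramp has_real_derivative bump t) (at t)"
proof (cases "t < 0")
  case True
  have "((\<lambda>t. 0) has_real_derivative bump t) (at t)" using True by (simp add: bump_zero)
  then show ?thesis
    by (rule has_field_derivative_transform_within_open[of _ _ _ "{..<0}"]) (use True in \<open>auto simp: ramp_def\<close>)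
next
  case False
  have bc: "continuous_on S bump" for S using bump_cont continuous_on_subset by blast
  have eq: "integral {-1..s} bump = ramp s" if "s > -1" for s
  proof (cases "s \<ge> 0")
    case True
    have "integral {-1..0} bump + integral {0..s} bump = integral {-1..s} bump"
      by (rule Henstock_Kurzweil_Integration.integral_combine) (use True that in \<open>auto intro!: integrable_continuous_real bc\<close>)
    moreover have "integral {-1..0} bump = 0"
      using Henstock_Kurzweil_Integration.integral_cong[of "{-1..0}" bump "\<lambda>x. 0"] by (simp add: bump_zero)
    ultimately show ?thesis by (simp add: ramp_def)
  next
    case False
    have "integral {-1..s} bump = integral {-1..s} (\<lambda>x. 0)"
      by (rule Henstock_Kurzweil_Integration.integral_cong) (use False in \<open>auto simp: bump_zero\<close>)
    then show ?thesis using False by (simp add: ramp_def)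
  qed
  have "((\<lambda>s. integral {-1..s} bump) has_real_derivative bump t) (at t within {-1..t+1})"
    by (rule integral_has_real_derivative) (use False in \<open>auto intro!: bc\<close>)
  then have "((\<lambda>s. integral {-1..s} bump) has_real_derivative bump t) (at t)"
    using False by (subst (asm) at_within_interior) auto
  then show ?thesis
    by (rule has_field_derivative_transform_within_open[of _ _ _ "{-1<..}"]) (use False eq in auto)
qed

lemma ramp_1_pos: "ramp 1 > 0"
proof -
  have "ramp 0 < ramp 1"
    by (rule DERIV_pos_imp_increasing_open)
       (auto intro!: exI[of _ "bump _"] ramp_DERIV bump_pos continuous_at_imp_continuous_on DERIV_isCont[OF ramp_DERIV])
  then show ?thesis by (simp add: ramp_def)
qed

text \<open>A smooth transition from \<open>0\<close> on \<open>t \<le> 0\<close> to \<open>1\<close> on \<open>t \<ge> 1\<close>; its derivative \<open>smooth_kernel\<close> serves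
  as the one-dimensional mollifier.\<close>

definition smooth_step :: "real \<Rightarrow> real" where
  "smooth_step t = ramp t / ramp 1"

definition smooth_kernel :: "real \<Rightarrow> real" where
  "smooth_kernel t = bump t / ramp 1"

lemma smooth_step_DERIV: "(smooth_step has_real_derivative smooth_kernel t) (at t)"
  unfolding smooth_step_def[abs_def] smooth_kernel_def
  by (rule DERIV_cdivide[OF ramp_DERIV])

lemma Ck_on_smooth_kernel: "Ck_on k UNIV smooth_kernel"
  using Ck_on_cmult[OF Ck_on_bump, of k "1 / ramp 1"] by (simp add: smooth_kernel_def[abs_def])

lemma Ck_on_smooth_step: "Ck_on k UNIV smooth_step"
  by (rule Ck_on_Suc_imp) (rule Ck_on_real_Suc[OF smooth_step_DERIV Ck_on_smooth_kernel])

lemma smooth_kernel_nonneg: "smooth_kernel t \<ge> 0"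
  and smooth_kernel_zero: "t \<le> 0 \<or> t \<ge> 1 \<Longrightarrow> smooth_kernel t = 0"
  using ramp_1_pos by (auto simp: smooth_kernel_def bump_nonneg bump_zero)

lemma smooth_kernel_cont: "continuous_on S smooth_kernel"
  using Ck_on_smooth_kernel[of 0] continuous_on_subset by auto

lemma smooth_step_mono: "s \<le> t \<Longrightarrow> smooth_step s \<le> smooth_step t"
  by (rule DERIV_nonneg_imp_nondecreasing) (auto intro!: exI smooth_step_DERIV smooth_kernel_nonneg)

lemma smooth_step_0: "t \<le> 0 \<Longrightarrow> smooth_step t = 0"
  by (cases "t = 0") (auto simp: smooth_step_def ramp_def)

lemma smooth_step_1:
  assumes "t \<ge> 1" shows "smooth_step t = 1"
proof (cases "t = 1")
  case True then show ?thesis using ramp_1_pos by (simp add: smooth_step_def)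
next
  case False
  have "smooth_step 1 = smooth_step t"
    by (rule DERIV_isconst2[of 1 t, symmetric])
       (use assms False smooth_step_DERIV[of "_"] in \<open>auto intro!: continuous_at_imp_continuous_on DERIV_isCont[OF smooth_step_DERIV]
        intro: DERIV_cong[OF smooth_step_DERIV] simp: smooth_kernel_zero\<close>)
  then show ?thesis using ramp_1_pos by (simp add: smooth_step_def)
qed

lemma smooth_step_range: "0 \<le> smooth_step t" "smooth_step t \<le> 1"
  using smooth_step_mono[of "min 0 t" t] smooth_step_0[of "min 0 t"]
    smooth_step_mono[of t "max 1 t"] smooth_step_1[of "max 1 t"] by auto

lemma smooth_step_scaled_tendsto:
  "(\<lambda>m. smooth_step (real m * t)) \<longlonglongrightarrow> (if t > 0 then 1 else 0)"
proof (cases "t > 0")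
  case True
  have "\<forall>\<^sub>F m in sequentially. smooth_step (real m * t) = 1"
    using eventually_ge_at_top[of "nat \<lceil>1/t\<rceil>"]
  proof eventually_elim
    fix m assume "m \<ge> nat \<lceil>1/t\<rceil>"
    then have "real m \<ge> 1/t" by linarith
    then show "smooth_step (real m * t) = 1" using True by (intro smooth_step_1) (simp add: field_simps)
  qed
  then show ?thesis using True by (simp add: tendsto_eventually)
next
  case False
  then have "smooth_step (real m * t) = 0" for m by (intro smooth_step_0) (simp add: mult_nonneg_nonpos)
  then show ?thesis using False by simp
qed

lemma test_fun_Ck: "test_fun \<Omega> \<phi> \<Longrightarrow> Ck_on k UNIV \<phi>"
  by (simp add: test_fun_def smooth_on_def)

lemma test_funI:
  assumes "\<And>k. Ck_on k UNIV \<phi>" and "{x. \<phi> x \<noteq> 0} \<subseteq> K" "compact K" "K \<subseteq> \<Omega>"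
  shows "test_fun \<Omega> \<phi>"
proof -
  have "closure {x. \<phi> x \<noteq> 0} \<subseteq> K" using assms(2,3) by (simp add: closure_minimal compact_imp_closed)
  moreover from this have "compact (closure {x. \<phi> x \<noteq> 0})"
    using assms(3) by (metis closed_Int_compact closed_closure inf.absorb1)
  ultimately show ?thesis using assms by (auto simp: test_fun_def smooth_on_def)
qed

lemma test_fun_support:
  assumes "test_fun \<Omega> \<phi>"
  obtains K where "compact K" "K \<subseteq> \<Omega>" "{x. \<phi> x \<noteq> 0} \<subseteq> K"
  by (rule that[of "closure {x. \<phi> x \<noteq> 0}"]) (use assms closure_subset[of "{x. \<phi> x \<noteq> 0}"] in \<open>simp_all add: test_fun_def\<close>)

definition box_cutoff :: "nat \<Rightarrow> 'a::euclidean_space \<Rightarrow> 'a \<Rightarrow> 'a \<Rightarrow> real" where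
  "box_cutoff m a c x = (\<Prod>b\<in>Basis. smooth_step (real m * (x \<bullet> b - a \<bullet> b)) * smooth_step (real m * (c \<bullet> b - x \<bullet> b)))"

lemma box_cutoff_zero: "x \<notin> box a c \<Longrightarrow> box_cutoff m a c x = 0"
proof -
  assume "x \<notin> box a c"
  then have "\<not> (\<forall>b\<in>Basis. a \<bullet> b < x \<bullet> b \<and> x \<bullet> b < c \<bullet> b)" by (simp add: mem_box(1))
  then obtain b where b: "b \<in> Basis" "\<not> (a \<bullet> b < x \<bullet> b \<and> x \<bullet> b < c \<bullet> b)" by blast
  then have b2: "x \<bullet> b \<le> a \<bullet> b \<or> c \<bullet> b \<le> x \<bullet> b" by linarith
  from b2 have "smooth_step (real m * (x \<bullet> b - a \<bullet> b)) * smooth_step (real m * (c \<bullet> b - x \<bullet> b)) = 0"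
  proof (elim disjE)
    assume "x \<bullet> b \<le> a \<bullet> b"
    then have "smooth_step (real m * (x \<bullet> b - a \<bullet> b)) = 0"
      by (intro smooth_step_0 mult_nonneg_nonpos) auto
    then show ?thesis by simp
  next
    assume "c \<bullet> b \<le> x \<bullet> b"
    then have "smooth_step (real m * (c \<bullet> b - x \<bullet> b)) = 0"
      by (intro smooth_step_0 mult_nonneg_nonpos) auto
    then show ?thesis by simp
  qed
  then show ?thesis unfolding box_cutoff_def using b(1) by (intro prod_zero) auto
qed

lemma box_cutoff_range: "0 \<le> box_cutoff m a c x" "box_cutoff m a c x \<le> 1"
  unfolding box_cutoff_def
  by (rule prod_nonneg, simp add: smooth_step_range)
     (rule prod_le_1, simp add: smooth_step_range mult_le_one)

lemma box_cutoff_tendsto: "(\<lambda>m. box_cutoff m a c x) \<longlonglongrightarrow> indicator (box a c) x"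
proof (cases "x \<in> box a c")
  case True
  have "(\<lambda>m. box_cutoff m a c x) \<longlonglongrightarrow> (\<Prod>b\<in>(Basis::'a set). 1 * 1)"
    unfolding box_cutoff_def
  proof (intro tendsto_prod tendsto_mult)
    fix b :: 'a assume "b \<in> Basis"
    then have "x \<bullet> b - a \<bullet> b > 0" "c \<bullet> b - x \<bullet> b > 0" using True by (auto simp: mem_box)
    then show "(\<lambda>m. smooth_step (real m * (x \<bullet> b - a \<bullet> b))) \<longlonglongrightarrow> 1"
      "(\<lambda>m. smooth_step (real m * (c \<bullet> b - x \<bullet> b))) \<longlonglongrightarrow> 1"
      using smooth_step_scaled_tendsto[of "x \<bullet> b - a \<bullet> b"] smooth_step_scaled_tendsto[of "c \<bullet> b - x \<bullet> b"] by auto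
  qed
  then show ?thesis using True by simp
qed (simp add: box_cutoff_zero)

lemma Ck_on_box_cutoff: "Ck_on k UNIV (box_cutoff m a c)"
proof -
  have "Ck_on k UNIV (\<lambda>x::'a. smooth_step (x \<bullet> (real m *\<^sub>R b) + (- real m * (a \<bullet> b))))"
    "Ck_on k UNIV (\<lambda>x::'a. smooth_step (x \<bullet> ((- real m) *\<^sub>R b) + real m * (c \<bullet> b)))" for b
    by (rule Ck_on_compose_affine[OF Ck_on_smooth_step])+
  then have "Ck_on k UNIV (\<lambda>x. \<Prod>b\<in>Basis. smooth_step (real m * (x \<bullet> b - a \<bullet> b)) * smooth_step (real m * (c \<bullet> b - x \<bullet> b)))"
    by (intro Ck_on_prod Ck_on_mult) (auto simp: algebra_simps)
  then show ?thesis by (simp add: box_cutoff_def[abs_def])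
qed

lemma test_fun_box_cutoff:
  assumes "cbox a c \<subseteq> \<Omega>" shows "test_fun \<Omega> (box_cutoff m a c)"
  by (rule test_funI[of _ "cbox a c"]) (use assms box_cutoff_zero box_subset_cbox in \<open>blast intro: Ck_on_box_cutoff compact_cbox\<close>)+

lemma smooth_measurable_lebesgue_on [measurable]:
  "continuous_on UNIV f \<Longrightarrow> f \<in> borel_measurable (lebesgue_on S)" for f :: "'a::euclidean_space \<Rightarrow> real"
  by (simp add: borel_measurable_continuous_onI measurable_lborel1 measurable_completion measurable_restrict_space1)

lemma sigma_finite_lebesgue: "sigma_finite_measure (lebesgue :: 'a::euclidean_space measure)"
proof
  have "emeasure lebesgue (ball (0::'a) (real n)) \<noteq> \<infinity>" for n
    using emeasure_lborel_ball_finite[of "0::'a" "real n"] by simp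
  moreover have "(\<Union>n. ball (0::'a) (real n)) = UNIV"
    by (auto simp: reals_Archimedean2)
  ultimately show "\<exists>A::'a set set. countable A \<and> A \<subseteq> sets lebesgue \<and> \<Union> A = space lebesgue \<and> (\<forall>a\<in>A. emeasure lebesgue a \<noteq> \<infinity>)"
    by (intro exI[of _ "range (\<lambda>n. ball (0::'a) (real n))"]) auto
qed

text \<open>Cutoffs of boxes converge boundedly to indicators, so \<open>f\<close> has integral zero over every box whose
  closure lies in \<open>\<Omega>\<close>. Inside a fixed such box the sets over which \<open>f\<close> has integral zero form a
  Dynkin system containing the boxes, hence all Borel sets.\<close>

lemma fundamental_lemma:
  fixes f :: "'a::euclidean_space \<Rightarrow> real"
  assumes \<Omega>: "open \<Omega>" and f: "integrable (lebesgue_on \<Omega>) f"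
    and zero: "\<And>\<phi>. test_fun \<Omega> \<phi> \<Longrightarrow> (LINT x|lebesgue_on \<Omega>. f x * \<phi> x) = 0"
  shows "AE x in lebesgue_on \<Omega>. f x = 0"
proof -
  let ?M = "lebesgue_on \<Omega>"
  have [measurable]: "f \<in> borel_measurable ?M" using f by simp
  have \<Omega>s: "\<Omega> \<in> sets lebesgue" using \<Omega> by auto
  have ind [measurable]: "(indicator A :: 'a \<Rightarrow> real) \<in> borel_measurable ?M" if "A \<in> sets lebesgue" for A
    using that by (intro measurable_restrict_space1 borel_measurable_indicator)
  have int: "integrable ?M (\<lambda>x. f x * indicator A x)" if "A \<in> sets lebesgue" for A
    by (rule Bochner_Integration.integrable_bound[OF f borel_measurable_times[OF _ ind[OF that]]])
      (auto simp: indicator_def)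
  have box0: "(LINT x|?M. f x * indicator (box a c) x) = 0" if "cbox a c \<subseteq> \<Omega>" for a c
  proof -
    have "(\<lambda>m. LINT x|?M. f x * box_cutoff m a c x) \<longlonglongrightarrow> (LINT x|?M. f x * indicator (box a c) x)"
    proof (rule integral_dominated_convergence[where w = "\<lambda>x. \<bar>f x\<bar>"])
      show "(\<lambda>x. f x * indicator (box a c) x) \<in> borel_measurable ?M"
        using int[of "box a c"] by simp
      show "(\<lambda>x. f x * box_cutoff m a c x) \<in> borel_measurable ?M" for m
        using smooth_measurable_lebesgue_on[of "box_cutoff m a c" \<Omega>] Ck_on_box_cutoff[of 0 m a c] by auto
      show "integrable ?M (\<lambda>x. \<bar>f x\<bar>)" using f by simp
      show "AE x in ?M. (\<lambda>m. f x * box_cutoff m a c x) \<longlonglongrightarrow> f x * indicator (box a c) x"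
        by (intro always_eventually allI tendsto_mult tendsto_const box_cutoff_tendsto)
      show "AE x in ?M. norm (f x * box_cutoff m a c x) \<le> \<bar>f x\<bar>" for m
        by (intro always_eventually allI) (auto simp: abs_mult box_cutoff_range intro!: mult_left_le)
    qed
    moreover have "(LINT x|?M. f x * box_cutoff m a c x) = 0" for m
      by (rule zero[OF test_fun_box_cutoff[OF that]])
    ultimately show ?thesis by (simp add: LIMSEQ_const_iff)
  qed
  have local: "AE x in ?M. x \<in> cbox a c \<longrightarrow> f x = 0" if ac: "cbox a c \<subseteq> \<Omega>" for a c
  proof -
    have borel0: "(LINT x|?M. f x * indicator (A \<inter> box a c) x) = 0" if "A \<in> sets borel" for A
    proof -
      have st: "Int_stable (range (\<lambda>(a, b). box a b :: 'a set))" by (auto simp: Int_stable_def box_Int_box)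
      have sub: "(range (\<lambda>(a, b). box a b :: 'a set)) \<subseteq> Pow UNIV" by auto
      have A: "A \<in> sigma_sets UNIV (range (\<lambda>(a, b). box a b))" using that unfolding borel_eq_box by simp
      have leb: "A \<in> sets lebesgue" if "A \<in> sigma_sets UNIV (range (\<lambda>(a, b). box a b :: 'a set))" for A
      proof -
        have "A \<in> sets borel" using that unfolding borel_eq_box by simp
        then show ?thesis by simp
      qed
      from st sub A show ?thesis
      proof (induction rule: sigma_sets_induct_disjoint)
        case (basic A)
        then obtain a' c' where A: "A = box a' c'" by auto
        let ?a = "\<Sum>i\<in>Basis. max (a'\<bullet>i) (a\<bullet>i) *\<^sub>R i" and ?c = "\<Sum>i\<in>Basis. min (c'\<bullet>i) (c\<bullet>i) *\<^sub>R i"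
        have "cbox ?a ?c \<subseteq> cbox a c" by (auto simp: mem_box)
        then have "(LINT x|?M. f x * indicator (box ?a ?c) x) = 0" using ac by (intro box0) auto
        then show ?case by (simp add: A box_Int_box)
      next
        case empty show ?case by simp
      next
        case (compl A)
        have "(LINT x|?M. f x * indicator ((UNIV - A) \<inter> box a c) x)
          = (LINT x|?M. f x * indicator (box a c) x - f x * indicator (A \<inter> box a c) x)"
          by (intro Bochner_Integration.integral_cong) (auto simp: indicator_def)
        also have "\<dots> = 0"
          using compl leb[OF compl(1)] by (subst Bochner_Integration.integral_diff) (auto intro!: int simp: box0[OF ac])
        finally show ?case .
      next
        case (union A)
        have Al: "A i \<in> sets lebesgue" for i using leb[of "A i"] union by auto
        have sums: "(\<lambda>i. f x * indicator (A i \<inter> box a c) x) sums (f x * indicator (\<Union>(range A) \<inter> box a c) x)" for x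
        proof -
          have "(\<lambda>i. indicator (A i) x :: real) sums indicator (\<Union>(range A)) x"
            by (rule indicator_sums) (use union(1) in \<open>auto simp: disjoint_family_on_def\<close>)
          from sums_mult[OF this, of "f x * indicator (box a c) x"]
          show ?thesis by (simp add: indicator_inter_arith mult.assoc mult.commute mult.left_commute)
        qed
        have "(\<lambda>n. LINT x|?M. (\<Sum>i<n. f x * indicator (A i \<inter> box a c) x)) \<longlonglongrightarrow>
           (LINT x|?M. f x * indicator (\<Union>(range A) \<inter> box a c) x)"
        proof (rule integral_dominated_convergence[where w = "\<lambda>x. \<bar>f x\<bar>"])
          show "(\<lambda>x. f x * indicator (\<Union>(range A) \<inter> box a c) x) \<in> borel_measurable ?M"
            by (rule borel_measurable_integrable[OF int]) (use Al in auto)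
          show "(\<lambda>x. \<Sum>i<n. f x * indicator (A i \<inter> box a c) x) \<in> borel_measurable ?M" for n
            by (intro borel_measurable_sum borel_measurable_integrable[OF int]) (use Al in auto)
          show "integrable ?M (\<lambda>x. \<bar>f x\<bar>)" using f by simp
          show "AE x in ?M. (\<lambda>n. \<Sum>i<n. f x * indicator (A i \<inter> box a c) x) \<longlonglongrightarrow> f x * indicator (\<Union>(range A) \<inter> box a c) x"
            using sums by (auto simp: sums_def)
          have "norm (\<Sum>i<n. f x * indicator (A i \<inter> box a c) x) \<le> \<bar>f x\<bar>" for n x
          proof -
            have "(\<Sum>i<n. f x * indicator (A i \<inter> box a c) x) = f x * indicator (\<Union>i<n. A i \<inter> box a c) x"
              using union(1) unfolding sum_distrib_left[symmetric]
              by (subst indicator_UN_disjoint) (auto simp: disjoint_family_on_def)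
            then show ?thesis by (auto simp: indicator_def abs_mult)
          qed
          then show "AE x in ?M. norm (\<Sum>i<n. f x * indicator (A i \<inter> box a c) x) \<le> \<bar>f x\<bar>" for n by auto
        qed
        moreover have "(LINT x|?M. (\<Sum>i<n. f x * indicator (A i \<inter> box a c) x)) = 0" for n
          using union Al by (subst Bochner_Integration.integral_sum) (auto intro!: int)
        ultimately show ?case by (simp add: LIMSEQ_const_iff)
      qed
    qed
    have "AE x in ?M. f x * indicator (box a c) x = 0"
    proof (rule sigma_finite_measure.density_zero)
      show "sigma_finite_measure ?M"
        by (rule sigma_finite_measure_restrict_space[OF sigma_finite_lebesgue]) (use \<Omega>s in simp)
      show "integrable ?M (\<lambda>x. f x * indicator (box a c) x)" by (intro int) auto
      fix A assume "A \<in> sets ?M"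
      then have A: "A \<in> sets lebesgue" "A \<subseteq> \<Omega>" using \<Omega>s by (auto simp: sets_restrict_space_iff)
      obtain C N where C: "fsigma C" "N \<in> null_sets lebesgue" "C \<union> N = A"
        using lebesgue_set_almost_fsigma[OF A(1)] by metis
      have Cb: "C \<in> sets borel" using C(1) by cases (auto intro: borel_closed)
      have "AE x in lebesgue. x \<notin> N" using C(2) by (rule AE_not_in)
      then have N: "AE x in ?M. x \<notin> N" by (subst AE_restrict_space_iff) (use \<Omega>s in auto)
      have "set_lebesgue_integral ?M A (\<lambda>x. f x * indicator (box a c) x)
        = (LINT x|?M. f x * indicator (C \<inter> box a c) x)"
        unfolding set_lebesgue_integral_def
      proof (rule integral_cong_AE)
        show "(\<lambda>x. indicat_real A x *\<^sub>R (f x * indicat_real (box a c) x)) \<in> borel_measurable ?M"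
          using borel_measurable_integrable[OF int[of "A \<inter> box a c"]] A
          by (simp add: indicator_inter_arith mult_ac sets.Int)
        show "(\<lambda>x. f x * indicator (C \<inter> box a c) x) \<in> borel_measurable ?M"
          by (rule borel_measurable_integrable[OF int]) (use Cb in auto)
        show "AE x in ?M. indicat_real A x *\<^sub>R (f x * indicat_real (box a c) x) = f x * indicator (C \<inter> box a c) x"
          using N by eventually_elim (use C in \<open>auto simp: indicator_def\<close>)
      qed
      then show "set_lebesgue_integral ?M A (\<lambda>x. f x * indicator (box a c) x) = 0"
        using borel0[OF Cb] by simp
    qed
    moreover have "AE x in ?M. x \<notin> cbox a c - box a c"
    proof -
      have "cbox a c - box a c \<in> null_sets lebesgue"
        using negligible_frontier_interval negligible_iff_null_sets by blast
      then have "AE x in lebesgue. x \<notin> cbox a c - box a c" by (rule AE_not_in)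
      then show ?thesis by (subst AE_restrict_space_iff) (use \<Omega>s in auto)
    qed
    ultimately show ?thesis by eventually_elim (auto simp: indicator_def split: if_splits)
  qed
  obtain D where D: "countable D" "D \<subseteq> Pow \<Omega>" "\<And>X. X \<in> D \<Longrightarrow> \<exists>a b. X = cbox a b" "\<Union>D = \<Omega>"
    using open_countable_Union_open_cbox[OF \<Omega>] by metis
  have "AE x in ?M. \<forall>X\<in>D. x \<in> X \<longrightarrow> f x = 0"
    unfolding AE_ball_countable[OF D(1)]
    using D(2,3) local by (metis PowD subsetD)
  moreover have "AE x in ?M. x \<in> \<Omega>" by (metis AE_space space_lebesgue_on)
  ultimately show ?thesis by eventually_elim (use D(4) in auto)
qed

section \<open>Test functions and weak gradients\<close>

lemma test_fun_differentiable: "test_fun \<Omega> \<phi> \<Longrightarrow> \<phi> differentiable (at x)"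
  using test_fun_Ck[of \<Omega> \<phi> 1] by simp

lemma test_fun_cont: "test_fun \<Omega> \<phi> \<Longrightarrow> continuous_on S \<phi>"
  using test_fun_Ck[of \<Omega> \<phi> 0] continuous_on_subset by auto

lemma test_fun_zero_outside: "test_fun \<Omega> \<phi> \<Longrightarrow> x \<notin> \<Omega> \<Longrightarrow> \<phi> x = 0"
  by (erule test_fun_support) auto

lemma partial_eq_inner_grad:
  assumes "b \<in> Basis" shows "grad \<phi> x \<bullet> b = partial b \<phi> x"
  using assms by (simp add: grad_def inner_sum_left inner_Basis if_distrib sum.delta cong: if_cong)

lemma has_derivative_grad:
  assumes "\<phi> differentiable (at x)"
  shows "(\<phi> has_derivative (\<lambda>z. grad \<phi> x \<bullet> z)) (at x)"
proof -
  let ?D = "frechet_derivative \<phi> (at x)"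
  have D: "(\<phi> has_derivative ?D) (at x)" using assms by (rule frechet_has_derivative)
  then have "linear ?D" by (rule has_derivative_linear)
  then have "?D z = grad \<phi> x \<bullet> z" for z
  proof -
    have "?D z = ?D (\<Sum>b\<in>Basis. (z \<bullet> b) *\<^sub>R b)" by (simp add: euclidean_representation)
    also have "\<dots> = (\<Sum>b\<in>Basis. (z \<bullet> b) * ?D b)"
      using \<open>linear ?D\<close> by (simp add: linear_sum linear_cmul)
    also have "\<dots> = grad \<phi> x \<bullet> z"
      by (simp add: grad_def inner_sum_left inner_commute[of z] mult.commute)
    finally show ?thesis .
  qed
  then have "?D = (\<lambda>z. grad \<phi> x \<bullet> z)" by blast
  then show ?thesis using D by metis
qed

lemma grad_add:
  assumes "\<phi> differentiable (at x)" "\<psi> differentiable (at x)"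
  shows "grad (\<lambda>x. \<phi> x + \<psi> x) x = grad \<phi> x + grad \<psi> x"
  using partial_eq[OF has_derivative_add[OF frechet_has_derivative[OF assms(1)] frechet_has_derivative[OF assms(2)]]]
  by (simp add: grad_def scaleR_add_left sum.distrib)

lemma grad_cmult:
  assumes "\<phi> differentiable (at x)"
  shows "grad (\<lambda>x. c * \<phi> x) x = c *\<^sub>R grad \<phi> x"
  using partial_eq[OF has_derivative_mult_right[OF frechet_has_derivative[OF assms]]]
  by (simp add: grad_def scaleR_sum_right)

lemma test_fun_add:
  assumes "test_fun \<Omega> \<phi>" "test_fun \<Omega> \<psi>" shows "test_fun \<Omega> (\<lambda>x. \<phi> x + \<psi> x)"
proof -
  obtain K L where K: "compact K" "K \<subseteq> \<Omega>" "{x. \<phi> x \<noteq> 0} \<subseteq> K" and L: "compact L" "L \<subseteq> \<Omega>" "{x. \<psi> x \<noteq> 0} \<subseteq> L"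
    using test_fun_support[OF assms(1)] test_fun_support[OF assms(2)] by metis
  show ?thesis
  proof (rule test_funI[of _ "K \<union> L"])
    show "Ck_on k UNIV (\<lambda>x. \<phi> x + \<psi> x)" for k
      using assms by (intro Ck_on_add test_fun_Ck)
    show "{x. \<phi> x + \<psi> x \<noteq> 0} \<subseteq> K \<union> L" using K L by (auto simp: subset_iff) (metis add_0)
  qed (use K L in auto)
qed

lemma test_fun_mult:
  assumes "test_fun \<Omega> \<phi>" "\<And>k. Ck_on k UNIV \<psi>" shows "test_fun \<Omega> (\<lambda>x. \<phi> x * \<psi> x)"
proof -
  obtain K where K: "compact K" "K \<subseteq> \<Omega>" "{x. \<phi> x \<noteq> 0} \<subseteq> K"
    using test_fun_support[OF assms(1)] by metis
  show ?thesis
  proof (rule test_funI[of _ K])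
    show "Ck_on k UNIV (\<lambda>x. \<phi> x * \<psi> x)" for k
      by (intro Ck_on_mult test_fun_Ck[OF assms(1)] assms(2))
  qed (use K in auto)
qed

lemma test_fun_cmult:
  assumes "test_fun \<Omega> \<phi>" shows "test_fun \<Omega> (\<lambda>x. c * \<phi> x)"
  using test_fun_mult[OF assms Ck_on_const[of _ c]] by (simp add: mult.commute)

lemma test_fun_diff:
  assumes "test_fun \<Omega> \<phi>" "test_fun \<Omega> \<psi>" shows "test_fun \<Omega> (\<lambda>x. \<phi> x - \<psi> x)"
  using test_fun_add[OF assms(1) test_fun_cmult[OF assms(2), of "-1"]] by simp

lemma test_fun_partial:
  assumes \<phi>: "test_fun \<Omega> \<phi>" and b: "b \<in> Basis" shows "test_fun \<Omega> (partial b \<phi>)"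
proof -
  obtain K where K: "compact K" "K \<subseteq> \<Omega>" "{x. \<phi> x \<noteq> 0} \<subseteq> K"
    using test_fun_support[OF \<phi>] by metis
  show ?thesis
  proof (rule test_funI[of _ K])
    show "Ck_on k UNIV (partial b \<phi>)" for k
      using test_fun_Ck[OF \<phi>, of "Suc k"] b by simp
    show "{x. partial b \<phi> x \<noteq> 0} \<subseteq> K"
    proof (rule ccontr)
      assume "\<not> {x. partial b \<phi> x \<noteq> 0} \<subseteq> K"
      then obtain x where x: "partial b \<phi> x \<noteq> 0" "x \<notin> K" by auto
      have "((\<lambda>x. 0) has_derivative (\<lambda>x. 0)) (at x)" by (rule has_derivative_const)
      then have "(\<phi> has_derivative (\<lambda>x. 0)) (at x)"
        by (rule has_derivative_transform_within_open[of _ _ _ _ "- K"]) (use K x in \<open>auto simp: compact_imp_closed\<close>)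
      then show False using x partial_eq by metis
    qed
  qed (use K in auto)
qed

lemma continuous_grad:
  assumes \<phi>: "test_fun \<Omega> \<phi>" shows "continuous_on S (grad \<phi>)"
proof -
  have "continuous_on S (\<lambda>x. \<Sum>b\<in>Basis. partial b \<phi> x *\<^sub>R b)"
    by (intro continuous_intros test_fun_cont[OF test_fun_partial[OF \<phi>]])
  then show ?thesis by (simp add: grad_def[abs_def])
qed

lemma grad_support:
  assumes "compact K" "{x. \<phi> x \<noteq> 0} \<subseteq> K" "x \<notin> K"
  shows "grad \<phi> x = 0"
proof -
  have "((\<lambda>x. 0) has_derivative (\<lambda>x. 0)) (at x)" by (rule has_derivative_const)
  then have "(\<phi> has_derivative (\<lambda>x. 0)) (at x)"
    by (rule has_derivative_transform_within_open[of _ _ _ _ "- K"]) (use assms in \<open>auto simp: compact_imp_closed\<close>)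
  then show ?thesis using partial_eq unfolding grad_def by (metis (no_types, lifting) scaleR_zero_left sum.neutral)
qed

lemma test_fun_bounds:
  assumes \<phi>: "test_fun \<Omega> \<phi>"
  obtains R K where "R > 0" "K > 0" "\<And>x. norm x > R \<Longrightarrow> \<phi> x = 0" "\<And>x. norm x > R \<Longrightarrow> grad \<phi> x = 0"
    "\<And>x. \<bar>\<phi> x\<bar> \<le> K" "\<And>x. norm (grad \<phi> x) \<le> K" "\<And>x z. \<bar>\<phi> (x + z) - \<phi> x\<bar> \<le> K * norm z"
proof -
  obtain L where L: "compact L" "L \<subseteq> \<Omega>" "{x. \<phi> x \<noteq> 0} \<subseteq> L"
    using test_fun_support[OF \<phi>] by metis
  obtain R where R: "R > 0" "\<And>x. x \<in> L \<Longrightarrow> norm x \<le> R"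
    using compact_imp_bounded[OF L(1)] by (metis bounded_pos)
  obtain K1 where K1: "\<And>x. x \<in> L \<Longrightarrow> norm (\<phi> x) \<le> K1"
    using compact_imp_bounded[OF compact_continuous_image[OF test_fun_cont[OF \<phi>] L(1)]] unfolding bounded_iff by auto
  obtain K2 where K2: "\<And>x. x \<in> L \<Longrightarrow> norm (grad \<phi> x) \<le> K2"
    using compact_imp_bounded[OF compact_continuous_image[OF continuous_grad[OF \<phi>] L(1)]] unfolding bounded_iff by auto
  define K where "K = max 1 (max K1 K2)"
  have g0: "grad \<phi> x = 0" if "x \<notin> L" for x by (rule grad_support[OF L(1,3) that])
  have gK: "norm (grad \<phi> x) \<le> K" for x
    using K2[of x] g0[of x] by (cases "x \<in> L") (auto simp: K_def)
  have \<phi>K: "\<bar>\<phi> x\<bar> \<le> K" for x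
  proof (cases "x \<in> L")
    case True then show ?thesis using K1[of x] by (auto simp: K_def)
  next
    case False
    then have "\<phi> x = 0" using L(3) by auto
    then show ?thesis by (simp add: K_def)
  qed
  have "\<bar>\<phi> (x + z) - \<phi> x\<bar> \<le> K * norm z" for x z
  proof -
    have "norm (\<phi> (x + z) - \<phi> x) \<le> K * norm (x + z - x)"
    proof (rule differentiable_bound[of UNIV])
      show "(\<phi> has_derivative (\<lambda>z. grad \<phi> y \<bullet> z)) (at y within UNIV)" for y
        using has_derivative_grad[OF test_fun_differentiable[OF \<phi>]] by simp
      show "onorm (\<lambda>z. grad \<phi> y \<bullet> z) \<le> K" for y
      proof (rule onorm_bound)
        show "0 \<le> K" by (simp add: K_def)
        fix z
        have "norm (grad \<phi> y \<bullet> z) \<le> norm (grad \<phi> y) * norm z" using Cauchy_Schwarz_ineq2 by simp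
        also have "\<dots> \<le> K * norm z" using gK by (intro mult_right_mono) auto
        finally show "norm (grad \<phi> y \<bullet> z) \<le> K * norm z" .
      qed
    qed auto
    then show ?thesis by simp
  qed
  moreover have "\<phi> x = 0" "grad \<phi> x = 0" if "norm x > R" for x
  proof -
    have "x \<notin> L" using R(2)[of x] that by auto
    then show "\<phi> x = 0" "grad \<phi> x = 0" using L(3) g0 by auto
  qed
  moreover have "K > 0" by (simp add: K_def)
  ultimately show thesis using R gK \<phi>K that by blast
qed

lemma integrable_lborel_bounded_support:
  fixes f :: "'a::euclidean_space \<Rightarrow> real"
  assumes "f \<in> borel_measurable borel" "\<And>x. norm x > R \<Longrightarrow> f x = 0" "\<And>x. \<bar>f x\<bar> \<le> K"
  shows "integrable lborel f"
proof (rule Bochner_Integration.integrable_bound)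
  show "integrable lborel (\<lambda>x::'a. K * indicator (cball 0 R) x :: real)"
    using emeasure_lborel_cball_finite[of "0::'a" R]
    by (intro integrable_mult_right integrable_real_indicator) auto
  have "norm (f x) \<le> norm (K * indicator (cball 0 R) x)" for x
    using assms(2)[of x] assms(3)[of x] by (cases "norm x > R") auto
  then show "AE x in lborel. norm (f x) \<le> norm (K * indicator (cball 0 R) x)" by simp
qed (use assms in auto)

text \<open>Integrals over \<open>\<Omega>\<close> of Borel functions vanishing outside \<open>\<Omega>\<close> are integrals over the whole
  space, where translation invariance is available.\<close>

lemma
  fixes f :: "'a::euclidean_space \<Rightarrow> real"
  assumes "open \<Omega>" "f \<in> borel_measurable borel" "\<And>x. x \<notin> \<Omega> \<Longrightarrow> f x = 0"
  shows integral_lebesgue_on_eq_lborel: "(LINT x|lebesgue_on \<Omega>. f x) = (LINT x|lborel. f x)"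
    and integrable_lebesgue_on_iff_lborel: "integrable (lebesgue_on \<Omega>) f \<longleftrightarrow> integrable lborel f"
proof -
  have \<Omega>: "\<Omega> \<inter> space lebesgue \<in> sets lebesgue" using assms(1) by auto
  have eq: "(\<lambda>x. indicator \<Omega> x *\<^sub>R f x) = f" using assms(3) by (auto simp: indicator_def fun_eq_iff)
  have "(LINT x|lebesgue_on \<Omega>. f x) = (LINT x|lebesgue. indicator \<Omega> x *\<^sub>R f x)"
    by (rule integral_restrict_space[OF \<Omega>])
  also have "\<dots> = (LINT x|lborel. f x)" unfolding eq using assms(2) by (subst integral_completion) auto
  finally show "(LINT x|lebesgue_on \<Omega>. f x) = (LINT x|lborel. f x)" .
  have "integrable (lebesgue_on \<Omega>) f \<longleftrightarrow> integrable lebesgue (\<lambda>x. indicator \<Omega> x *\<^sub>R f x)"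
    by (rule integrable_restrict_space[OF \<Omega>])
  also have "\<dots> \<longleftrightarrow> integrable lborel f" unfolding eq using assms(2) by (subst integrable_completion) auto
  finally show "integrable (lebesgue_on \<Omega>) f \<longleftrightarrow> integrable lborel f" .
qed

lemma integral_lborel_translate:
  fixes f :: "'a::euclidean_space \<Rightarrow> real"
  assumes [measurable]: "f \<in> borel_measurable borel"
  shows "(LINT x|lborel. f (x + z)) = (LINT x|lborel. f x)"
proof -
  have "(LINT x|lborel. f x) = (LINT x|distr lborel borel ((+) z). f x)" by (simp add: lborel_distr_plus)
  also have "\<dots> = (LINT x|lborel. f (z + x))" by (rule integral_distr) auto
  finally show ?thesis by (simp add: add.commute)
qed

lemma directional_derivative_limit:
  assumes \<phi>: "test_fun \<Omega> \<phi>"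
  shows "(\<lambda>m. real (Suc m) * (\<phi> (x + (1 / real (Suc m)) *\<^sub>R z) - \<phi> x)) \<longlonglongrightarrow> grad \<phi> x \<bullet> z"
proof -
  have d: "(\<phi> has_derivative (\<lambda>z. grad \<phi> x \<bullet> z)) (at (x + 0 *\<^sub>R z))"
    using has_derivative_grad[OF test_fun_differentiable[OF \<phi>], of x] by simp
  have "((\<lambda>h. \<phi> (x + h *\<^sub>R z)) has_derivative (\<lambda>h. grad \<phi> x \<bullet> (h *\<^sub>R z))) (at 0)"
    by (rule has_derivative_compose[where f = "\<lambda>h. x + h *\<^sub>R z" and f' = "\<lambda>h. h *\<^sub>R z", OF _ d])
      (auto intro!: derivative_eq_intros)
  then have "((\<lambda>h. \<phi> (x + h *\<^sub>R z)) has_real_derivative (grad \<phi> x \<bullet> z)) (at 0)"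
    unfolding has_field_derivative_def by (rule has_derivative_eq_rhs) (simp add: fun_eq_iff)
  then have "((\<lambda>h. (\<phi> (x + h *\<^sub>R z) - \<phi> x) / h) \<longlongrightarrow> grad \<phi> x \<bullet> z) (at 0)"
    by (simp add: DERIV_def)
  moreover have "filterlim (\<lambda>m. 1 / real (Suc m)) (at 0) sequentially"
    unfolding filterlim_at using LIMSEQ_inverse_real_of_nat by (auto simp: inverse_eq_divide)
  ultimately have "(\<lambda>m. (\<phi> (x + (1 / real (Suc m)) *\<^sub>R z) - \<phi> x) / (1 / real (Suc m))) \<longlonglongrightarrow> grad \<phi> x \<bullet> z"
    by (rule filterlim_compose)
  then show ?thesis by (simp add: mult.commute)
qed

lemma test_fun_borel [measurable_dest]: "test_fun \<Omega> \<phi> \<Longrightarrow> \<phi> \<in> borel_measurable borel"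
  by (rule borel_measurable_continuous_onI[OF test_fun_cont])

lemma grad_borel: "test_fun \<Omega> \<phi> \<Longrightarrow> grad \<phi> \<in> borel_measurable borel"
  by (rule borel_measurable_continuous_onI[OF continuous_grad])

text \<open>The difference quotients have integral zero by translation invariance and converge boundedly.\<close>

lemma integral_partial_zero:
  assumes \<phi>: "test_fun \<Omega> \<phi>" and b: "b \<in> Basis"
  shows "(LINT x|lborel. partial b \<phi> x) = 0"
proof -
  have [measurable]: "\<phi> \<in> borel_measurable borel" by (rule test_fun_borel[OF \<phi>])
  have [measurable]: "partial b \<phi> \<in> borel_measurable borel" by (rule test_fun_borel[OF test_fun_partial[OF \<phi> b]])
  obtain R K where K: "R > 0" "K > 0" "\<And>x. norm x > R \<Longrightarrow> \<phi> x = 0"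
     "\<And>x. \<bar>\<phi> x\<bar> \<le> K" "\<And>x z. \<bar>\<phi> (x + z) - \<phi> x\<bar> \<le> K * norm z"
    using test_fun_bounds[OF \<phi>] by metis
  let ?q = "\<lambda>m x. real (Suc m) * (\<phi> (x + (1 / real (Suc m)) *\<^sub>R b) - \<phi> x)"
  have int: "integrable lborel \<phi>" using K by (intro integrable_lborel_bounded_support) auto
  have "(\<lambda>m. LINT x|lborel. ?q m x) \<longlonglongrightarrow> (LINT x|lborel. partial b \<phi> x)"
  proof (rule integral_dominated_convergence[where w = "\<lambda>x. K * indicator (cball 0 (R + 1)) x"])
    show "integrable lborel (\<lambda>x::'a. K * indicator (cball 0 (R + 1)) x :: real)"
      using emeasure_lborel_cball_finite[of "0::'a" "R+1"]
      by (intro integrable_mult_right integrable_real_indicator) auto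
    show "AE x in lborel. (\<lambda>m. ?q m x) \<longlonglongrightarrow> partial b \<phi> x"
      using directional_derivative_limit[OF \<phi>, of _ b] partial_eq_inner_grad[OF b, of \<phi>] by simp
    have "norm (?q m x) \<le> K * indicator (cball 0 (R + 1)) x" for m x
    proof (cases "norm x > R + 1")
      case True
      have nb: "norm ((1 / real (Suc m)) *\<^sub>R b) \<le> 1" using b by simp
      have "norm x \<le> norm (x + (1 / real (Suc m)) *\<^sub>R b) + norm ((1 / real (Suc m)) *\<^sub>R b)"
        by (metis add_diff_cancel_right' norm_triangle_ineq4)
      then have "norm (x + (1 / real (Suc m)) *\<^sub>R b) > R" using True nb by linarith
      then show ?thesis using K(3) True by simp
    next
      case False
      have "norm (?q m x) = real (Suc m) * \<bar>\<phi> (x + (1 / real (Suc m)) *\<^sub>R b) - \<phi> x\<bar>" by (simp add: abs_mult)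
      also have "\<dots> \<le> real (Suc m) * (K * norm ((1 / real (Suc m)) *\<^sub>R b))" by (intro mult_left_mono K) auto
      also have "\<dots> = K" using b by simp
      finally show ?thesis using False by simp
    qed
    then show "AE x in lborel. norm (?q m x) \<le> K * indicator (cball 0 (R + 1)) x" for m by simp
  qed measurable
  moreover have "(LINT x|lborel. ?q m x) = 0" for m
  proof -
    have i2: "integrable lborel (\<lambda>x. \<phi> (x + (1 / real (Suc m)) *\<^sub>R b))"
      using K by (intro integrable_lborel_bounded_support[of _ "R + norm ((1 / real (Suc m)) *\<^sub>R b)" K])
        (auto intro!: K(3) simp: less_diff_eq[symmetric] intro: less_le_trans[OF _ norm_diff_ineq])
    show ?thesis using integral_lborel_translate[of \<phi> "(1 / real (Suc m)) *\<^sub>R b"] int i2 by simp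
  qed
  ultimately show ?thesis by (simp add: LIMSEQ_const_iff)
qed

lemma test_fun_L2:
  assumes \<Omega>: "open \<Omega>" and \<phi>: "test_fun \<Omega> \<phi>"
  shows "\<phi> \<in> L2 \<Omega>" "grad \<phi> \<in> L2 \<Omega>"
proof -
  have [measurable]: "\<phi> \<in> borel_measurable borel" "grad \<phi> \<in> borel_measurable borel"
    by (rule test_fun_borel[OF \<phi>], rule grad_borel[OF \<phi>])
  obtain L where L: "compact L" "L \<subseteq> \<Omega>" "{x. \<phi> x \<noteq> 0} \<subseteq> L"
    using test_fun_support[OF \<phi>] by metis
  have g0: "grad \<phi> x = 0" if "x \<notin> \<Omega>" for x using grad_support[OF L(1,3), of x] L that by auto
  obtain R K where K: "R > 0" "K > 0" "\<And>x. norm x > R \<Longrightarrow> \<phi> x = 0" "\<And>x. norm x > R \<Longrightarrow> grad \<phi> x = 0"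
    "\<And>x. \<bar>\<phi> x\<bar> \<le> K" "\<And>x. norm (grad \<phi> x) \<le> K"
    using test_fun_bounds[OF \<phi>] by metis
  have m: "f \<in> borel_measurable (lebesgue_on \<Omega>)" if "f \<in> borel_measurable borel" for f :: "'a \<Rightarrow> 'b::euclidean_space"
    using that by (intro measurable_restrict_space1) (simp add: measurable_completion)
  have "integrable lborel (\<lambda>x. (norm (\<phi> x))\<^sup>2)" "integrable lborel (\<lambda>x. (norm (grad \<phi> x))\<^sup>2)"
    using K power_mono[OF K(5), where n = 2] power_mono[OF K(6), where n = 2]
    by (auto intro!: integrable_lborel_bounded_support[of _ R "K\<^sup>2"])
  then show "\<phi> \<in> L2 \<Omega>" "grad \<phi> \<in> L2 \<Omega>"
    unfolding L2_def using m[of \<phi>] m[of "grad \<phi>"] \<Omega> g0 test_fun_zero_outside[OF \<phi>]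
    by (auto simp: integrable_lebesgue_on_iff_lborel)
qed

text \<open>Integration by parts: the derivative of the product of two test functions has integral zero.\<close>

lemma test_fun_has_weak_grad:
  assumes \<Omega>: "open \<Omega>" and \<phi>: "test_fun \<Omega> \<phi>"
  shows "has_weak_grad \<Omega> \<phi> (grad \<phi>)"
  unfolding has_weak_grad_def
proof (intro conjI allI impI ballI)
  show "grad \<phi> \<in> L2 \<Omega>" by (rule test_fun_L2[OF \<Omega> \<phi>])
  fix \<psi> and b :: 'a assume \<psi>: "test_fun \<Omega> \<psi>" and b: "b \<in> Basis"
  have p: "partial b (\<lambda>x. \<phi> x * \<psi> x) = (\<lambda>x. \<phi> x * partial b \<psi> x + partial b \<phi> x * \<psi> x)"
    by (rule ext, rule partial_eq)
      (rule has_derivative_mult[OF frechet_has_derivative[OF test_fun_differentiable[OF \<phi>]]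
         frechet_has_derivative[OF test_fun_differentiable[OF \<psi>]]])
  have t: "test_fun \<Omega> (\<lambda>x. \<phi> x * \<psi> x)" by (rule test_fun_mult[OF \<phi> test_fun_Ck[OF \<psi>]])
  have "0 = (LINT x|lborel. partial b (\<lambda>x. \<phi> x * \<psi> x) x)"
    using integral_partial_zero[OF t b] by simp
  also have "\<dots> = (LINT x|lebesgue_on \<Omega>. partial b (\<lambda>x. \<phi> x * \<psi> x) x)"
    by (rule integral_lebesgue_on_eq_lborel[symmetric])
      (use \<Omega> test_fun_borel[OF test_fun_partial[OF t b]] test_fun_zero_outside[OF test_fun_partial[OF t b]] in auto)
  also have "\<dots> = (LINT x|lebesgue_on \<Omega>. \<phi> x * partial b \<psi> x) + (LINT x|lebesgue_on \<Omega>. partial b \<phi> x * \<psi> x)"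
    unfolding p
    using L2_inner_integrable[OF test_fun_L2(1)[OF \<Omega> \<phi>] test_fun_L2(1)[OF \<Omega> test_fun_partial[OF \<psi> b]]]
      L2_inner_integrable[OF test_fun_L2(1)[OF \<Omega> test_fun_partial[OF \<phi> b]] test_fun_L2(1)[OF \<Omega> \<psi>]]
    by simp
  finally show "(LINT x|lebesgue_on \<Omega>. \<phi> x * partial b \<psi> x) = - (LINT x|lebesgue_on \<Omega>. (grad \<phi> x \<bullet> b) * \<psi> x)"
    by (simp add: partial_eq_inner_grad[OF b])
qed

lemma has_weak_gradD:
  assumes "has_weak_grad \<Omega> z G"
  shows "G \<in> L2 \<Omega>" "\<And>\<phi> b. test_fun \<Omega> \<phi> \<Longrightarrow> b \<in> Basis \<Longrightarrow> L2_inner \<Omega> z (partial b \<phi>) = - L2_inner \<Omega> (\<lambda>x. G x \<bullet> b) \<phi>"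
  using assms by (auto simp: has_weak_grad_def L2_inner_def)

lemma has_weak_gradI:
  assumes "G \<in> L2 \<Omega>" "\<And>\<phi> b. test_fun \<Omega> \<phi> \<Longrightarrow> b \<in> Basis \<Longrightarrow> L2_inner \<Omega> z (partial b \<phi>) = - L2_inner \<Omega> (\<lambda>x. G x \<bullet> b) \<phi>"
  shows "has_weak_grad \<Omega> z G"
  using assms by (auto simp: has_weak_grad_def L2_inner_def)

locale bounded_open_domain =
  fixes \<Omega> :: "'a::euclidean_space set"
  assumes open_domain: "open \<Omega>" and bounded_domain: "bounded \<Omega>"
begin

lemma lmeasurable_domain: "\<Omega> \<in> lmeasurable"
  by (rule bounded_set_imp_lmeasurable[OF bounded_domain]) (use open_domain in auto)

lemma domain_sets: "\<Omega> \<in> sets lebesgue"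
  using open_domain by auto

lemma finite_measure_domain: "finite_measure (lebesgue_on \<Omega>)"
  by (rule finite_measure_lebesgue_on[OF lmeasurable_domain])

lemma const_L2: "(\<lambda>x. c) \<in> L2 \<Omega>"
  unfolding L2_def using finite_measure.integrable_const[OF finite_measure_domain] by auto

lemma L2_integrable: "f \<in> L2 \<Omega> \<Longrightarrow> integrable (lebesgue_on \<Omega>) f" for f :: "'a \<Rightarrow> real"
  using L2_inner_integrable[OF _ const_L2, of f 1] by simp

lemmas test_L2 = test_fun_L2[OF open_domain]
lemmas test_has_weak_grad = test_fun_has_weak_grad[OF open_domain]

lemma has_weak_grad_unique:
  assumes "has_weak_grad \<Omega> z G" "has_weak_grad \<Omega> z G'"
  shows "AE x in lebesgue_on \<Omega>. G x = G' x"
proof -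
  note G = has_weak_gradD[OF assms(1)] and G' = has_weak_gradD[OF assms(2)]
  have "AE x in lebesgue_on \<Omega>. G x \<bullet> b - G' x \<bullet> b = 0" if b: "b \<in> Basis" for b
  proof (rule fundamental_lemma[OF open_domain])
    have L: "(\<lambda>x. G x \<bullet> b) \<in> L2 \<Omega>" "(\<lambda>x. G' x \<bullet> b) \<in> L2 \<Omega>" using G G' by (auto intro: L2_inner_component)
    show "integrable (lebesgue_on \<Omega>) (\<lambda>x. G x \<bullet> b - G' x \<bullet> b)"
      by (intro L2_integrable L2_diff L)
    fix \<phi> assume \<phi>: "test_fun \<Omega> \<phi>"
    have "L2_inner \<Omega> (\<lambda>x. G x \<bullet> b - G' x \<bullet> b) \<phi> = 0"
      using G(2)[OF \<phi> b] G'(2)[OF \<phi> b] L test_L2[OF \<phi>] by (simp add: L2_inner_diff_left)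
    then show "(LINT x|lebesgue_on \<Omega>. (G x \<bullet> b - G' x \<bullet> b) * \<phi> x) = 0" by (simp add: L2_inner_def)
  qed
  then have "AE x in lebesgue_on \<Omega>. \<forall>b\<in>Basis. G x \<bullet> b - G' x \<bullet> b = 0"
    by (subst AE_ball_countable) (auto intro: countable_finite)
  then show ?thesis by eventually_elim (auto intro: euclidean_eqI)
qed

lemma has_weak_grad_wgrad: "z \<in> H1 \<Omega> \<Longrightarrow> has_weak_grad \<Omega> z (wgrad \<Omega> z)"
  unfolding wgrad_def H1_def by (auto intro: someI[of "has_weak_grad \<Omega> z"])

lemma H10_H1: "z \<in> H10 \<Omega> \<Longrightarrow> z \<in> H1 \<Omega>"
  by (simp add: H10_def)

lemma H10_L2: "z \<in> H10 \<Omega> \<Longrightarrow> z \<in> L2 \<Omega>"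
  by (simp add: H10_def H1_def)

lemma wgrad_L2: "z \<in> H10 \<Omega> \<Longrightarrow> wgrad \<Omega> z \<in> L2 \<Omega>"
  using has_weak_grad_wgrad[OF H10_H1] has_weak_gradD by blast

lemma wgrad_AE_eq:
  assumes "has_weak_grad \<Omega> z G"
  shows "AE x in lebesgue_on \<Omega>. wgrad \<Omega> z x = G x"
proof -
  have "has_weak_grad \<Omega> z (wgrad \<Omega> z)" unfolding wgrad_def using assms by (rule someI[of "has_weak_grad \<Omega> z"])
  then show ?thesis using assms by (rule has_weak_grad_unique)
qed

text \<open>Passing to the limit in the definition of the weak gradient shows that a sequence of test
  functions which converges together with its gradients has its limit in \<open>H\<^sup>1\<^sub>0\<close>.\<close>

lemma H10_limitI:
  assumes \<phi>: "\<And>k::nat. test_fun \<Omega> (\<phi> k)" and z: "z \<in> L2 \<Omega>" and G: "G \<in> L2 \<Omega>"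
    and limz: "(\<lambda>k. L2_norm \<Omega> (\<lambda>x. \<phi> k x - z x)) \<longlonglongrightarrow> 0"
    and limG: "(\<lambda>k. L2_norm \<Omega> (\<lambda>x. grad (\<phi> k) x - G x)) \<longlonglongrightarrow> 0"
  shows "z \<in> H10 \<Omega>" "AE x in lebesgue_on \<Omega>. wgrad \<Omega> z x = G x"
proof -
  have wg: "has_weak_grad \<Omega> z G"
  proof (rule has_weak_gradI[OF G])
    fix \<psi> and b :: 'a assume \<psi>: "test_fun \<Omega> \<psi>" and b: "b \<in> Basis"
    have const: "(\<lambda>k. L2_norm \<Omega> (\<lambda>x. h x - h x)) \<longlonglongrightarrow> 0" for h :: "'a \<Rightarrow> real" by (simp add: L2_norm_def)
    have constG: "(\<lambda>k. L2_norm \<Omega> (\<lambda>x. h x - h x)) \<longlonglongrightarrow> 0" for h :: "'a \<Rightarrow> 'a" by (simp add: L2_norm_def)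
    have sw: "L2_inner \<Omega> (\<lambda>x. F x \<bullet> b) \<psi> = L2_inner \<Omega> F (\<lambda>x. \<psi> x *\<^sub>R b)" for F
      by (simp add: L2_inner_def mult.commute)
    have "(\<lambda>x. \<psi> x *\<^sub>R b) \<in> L2 \<Omega>"
      using test_L2(1)[OF \<psi>] b unfolding L2_def by auto
    then have "(\<lambda>k. - L2_inner \<Omega> (\<lambda>x. grad (\<phi> k) x \<bullet> b) \<psi>) \<longlonglongrightarrow> - L2_inner \<Omega> (\<lambda>x. G x \<bullet> b) \<psi>"
      unfolding sw by (intro tendsto_minus L2_inner_tendsto test_L2[OF \<phi>] G limG constG)
    moreover have "(\<lambda>k. L2_inner \<Omega> (\<phi> k) (partial b \<psi>)) \<longlonglongrightarrow> L2_inner \<Omega> z (partial b \<psi>)"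
      by (intro L2_inner_tendsto test_L2 \<phi> z limz const test_fun_partial \<psi> b)
    ultimately show "L2_inner \<Omega> z (partial b \<psi>) = - L2_inner \<Omega> (\<lambda>x. G x \<bullet> b) \<psi>"
      using has_weak_gradD(2)[OF test_has_weak_grad[OF \<phi>] \<psi> b] by (simp add: LIMSEQ_unique)
  qed
  then show ae: "AE x in lebesgue_on \<Omega>. wgrad \<Omega> z x = G x" by (rule wgrad_AE_eq)
  have "z \<in> H1 \<Omega>" using wg z by (auto simp: H1_def)
  moreover from this have "wgrad \<Omega> z \<in> L2 \<Omega>" using has_weak_grad_wgrad has_weak_gradD by blast
  then have "L2_norm \<Omega> (\<lambda>x. grad (\<phi> k) x - wgrad \<Omega> z x) = L2_norm \<Omega> (\<lambda>x. grad (\<phi> k) x - G x)" for k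
    using ae by (intro L2_norm_cong_AE L2_diff test_L2 \<phi> G) auto
  ultimately show "z \<in> H10 \<Omega>"
    unfolding H10_def using \<phi> limz limG by (auto simp: fun_diff_def intro!: exI[of _ \<phi>])
qed

lemma H10_approx:
  assumes "z \<in> H10 \<Omega>"
  obtains \<phi> where "\<And>k::nat. test_fun \<Omega> (\<phi> k)" "(\<lambda>k. L2_norm \<Omega> (\<lambda>x. \<phi> k x - z x)) \<longlonglongrightarrow> 0"
    "(\<lambda>k. L2_norm \<Omega> (\<lambda>x. grad (\<phi> k) x - wgrad \<Omega> z x)) \<longlonglongrightarrow> 0"
proof -
  from assms obtain \<phi> where "\<forall>k::nat. test_fun \<Omega> (\<phi> k)" "(\<lambda>k. L2_norm \<Omega> (\<phi> k - z)) \<longlonglongrightarrow> 0"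
    "(\<lambda>k. L2_norm \<Omega> (grad (\<phi> k) - wgrad \<Omega> z)) \<longlonglongrightarrow> 0"
    unfolding H10_def by blast
  then show thesis by (intro that[of \<phi>]) (simp_all add: fun_diff_def)
qed

lemma H10_lin:
  assumes z: "z \<in> H10 \<Omega>" and y: "y \<in> H10 \<Omega>"
  shows "(\<lambda>x. z x + c * y x) \<in> H10 \<Omega>"
    and wgrad_lin: "AE x in lebesgue_on \<Omega>. wgrad \<Omega> (\<lambda>x. z x + c * y x) x = wgrad \<Omega> z x + c *\<^sub>R wgrad \<Omega> y x"
proof -
  obtain \<phi> where \<phi>: "\<And>k::nat. test_fun \<Omega> (\<phi> k)" "(\<lambda>k. L2_norm \<Omega> (\<lambda>x. \<phi> k x - z x)) \<longlonglongrightarrow> 0"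
    "(\<lambda>k. L2_norm \<Omega> (\<lambda>x. grad (\<phi> k) x - wgrad \<Omega> z x)) \<longlonglongrightarrow> 0"
    by (rule H10_approx[OF z]) (rule that; assumption)
  obtain \<psi> where \<psi>: "\<And>k::nat. test_fun \<Omega> (\<psi> k)" "(\<lambda>k. L2_norm \<Omega> (\<lambda>x. \<psi> k x - y x)) \<longlonglongrightarrow> 0"
    "(\<lambda>k. L2_norm \<Omega> (\<lambda>x. grad (\<psi> k) x - wgrad \<Omega> y x)) \<longlonglongrightarrow> 0"
    by (rule H10_approx[OF y]) (rule that; assumption)
  note L = H10_L2[OF z] H10_L2[OF y] wgrad_L2[OF z] wgrad_L2[OF y]
  have t: "test_fun \<Omega> (\<lambda>x. \<phi> k x + c * \<psi> k x)" for k by (intro test_fun_add test_fun_cmult \<phi> \<psi>)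
  have 1: "(\<lambda>x. z x + c * y x) \<in> L2 \<Omega>" "(\<lambda>x. wgrad \<Omega> z x + c *\<^sub>R wgrad \<Omega> y x) \<in> L2 \<Omega>"
    by (intro L2_add L2_cmult L2_scaleR L)+
  have 2: "(\<lambda>k. L2_norm \<Omega> (\<lambda>x. (\<phi> k x + c * \<psi> k x) - (z x + c * y x))) \<longlonglongrightarrow> 0"
  proof (rule Lim_null_comparison)
    show "\<forall>\<^sub>F k in sequentially. norm (L2_norm \<Omega> (\<lambda>x. (\<phi> k x + c * \<psi> k x) - (z x + c * y x)))
       \<le> L2_norm \<Omega> (\<lambda>x. \<phi> k x - z x) + \<bar>c\<bar> * L2_norm \<Omega> (\<lambda>x. \<psi> k x - y x)"
    proof (intro always_eventually allI)
      fix k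
      have "L2_norm \<Omega> (\<lambda>x. (\<phi> k x - z x) + c * (\<psi> k x - y x))
        \<le> L2_norm \<Omega> (\<lambda>x. \<phi> k x - z x) + L2_norm \<Omega> (\<lambda>x. c * (\<psi> k x - y x))"
        by (intro L2_norm_triangle L2_diff L2_cmult L test_L2 \<phi> \<psi>)
      moreover have "(\<lambda>x. (\<phi> k x - z x) + c * (\<psi> k x - y x)) = (\<lambda>x. (\<phi> k x + c * \<psi> k x) - (z x + c * y x))"
        by (auto simp: algebra_simps)
      ultimately show "norm (L2_norm \<Omega> (\<lambda>x. (\<phi> k x + c * \<psi> k x) - (z x + c * y x)))
       \<le> L2_norm \<Omega> (\<lambda>x. \<phi> k x - z x) + \<bar>c\<bar> * L2_norm \<Omega> (\<lambda>x. \<psi> k x - y x)"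
        by (simp add: L2_norm_cmult)
    qed
    show "(\<lambda>k. L2_norm \<Omega> (\<lambda>x. \<phi> k x - z x) + \<bar>c\<bar> * L2_norm \<Omega> (\<lambda>x. \<psi> k x - y x)) \<longlonglongrightarrow> 0"
      using tendsto_add[OF \<phi>(2) tendsto_mult_left[OF \<psi>(2), of "\<bar>c\<bar>"]] by simp
  qed
  have 3: "(\<lambda>k. L2_norm \<Omega> (\<lambda>x. grad (\<lambda>x. \<phi> k x + c * \<psi> k x) x - (wgrad \<Omega> z x + c *\<^sub>R wgrad \<Omega> y x))) \<longlonglongrightarrow> 0"
  proof (rule Lim_null_comparison)
    show "\<forall>\<^sub>F k in sequentially. norm (L2_norm \<Omega> (\<lambda>x. grad (\<lambda>x. \<phi> k x + c * \<psi> k x) x - (wgrad \<Omega> z x + c *\<^sub>R wgrad \<Omega> y x)))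
       \<le> L2_norm \<Omega> (\<lambda>x. grad (\<phi> k) x - wgrad \<Omega> z x) + \<bar>c\<bar> * L2_norm \<Omega> (\<lambda>x. grad (\<psi> k) x - wgrad \<Omega> y x)"
    proof (intro always_eventually allI)
      fix k
      have "L2_norm \<Omega> (\<lambda>x. (grad (\<phi> k) x - wgrad \<Omega> z x) + c *\<^sub>R (grad (\<psi> k) x - wgrad \<Omega> y x))
        \<le> L2_norm \<Omega> (\<lambda>x. grad (\<phi> k) x - wgrad \<Omega> z x) + L2_norm \<Omega> (\<lambda>x. c *\<^sub>R (grad (\<psi> k) x - wgrad \<Omega> y x))"
        by (intro L2_norm_triangle L2_diff L2_scaleR L test_L2 \<phi> \<psi>)
      moreover have "(\<lambda>x. (grad (\<phi> k) x - wgrad \<Omega> z x) + c *\<^sub>R (grad (\<psi> k) x - wgrad \<Omega> y x))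
          = (\<lambda>x. grad (\<lambda>x. \<phi> k x + c * \<psi> k x) x - (wgrad \<Omega> z x + c *\<^sub>R wgrad \<Omega> y x))"
      proof
        fix x
        have "grad (\<lambda>x. \<phi> k x + c * \<psi> k x) x = grad (\<phi> k) x + c *\<^sub>R grad (\<psi> k) x"
          unfolding grad_add[OF test_fun_differentiable[OF \<phi>(1)] test_fun_differentiable[OF test_fun_cmult[OF \<psi>(1)]]]
            grad_cmult[OF test_fun_differentiable[OF \<psi>(1)]] ..
        then show "(grad (\<phi> k) x - wgrad \<Omega> z x) + c *\<^sub>R (grad (\<psi> k) x - wgrad \<Omega> y x)
          = grad (\<lambda>x. \<phi> k x + c * \<psi> k x) x - (wgrad \<Omega> z x + c *\<^sub>R wgrad \<Omega> y x)"
          by (simp add: algebra_simps)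
      qed
      ultimately show "norm (L2_norm \<Omega> (\<lambda>x. grad (\<lambda>x. \<phi> k x + c * \<psi> k x) x - (wgrad \<Omega> z x + c *\<^sub>R wgrad \<Omega> y x)))
       \<le> L2_norm \<Omega> (\<lambda>x. grad (\<phi> k) x - wgrad \<Omega> z x) + \<bar>c\<bar> * L2_norm \<Omega> (\<lambda>x. grad (\<psi> k) x - wgrad \<Omega> y x)"
        by (simp add: L2_norm_scaleR)
    qed
    show "(\<lambda>k. L2_norm \<Omega> (\<lambda>x. grad (\<phi> k) x - wgrad \<Omega> z x) + \<bar>c\<bar> * L2_norm \<Omega> (\<lambda>x. grad (\<psi> k) x - wgrad \<Omega> y x)) \<longlonglongrightarrow> 0"
      using tendsto_add[OF \<phi>(3) tendsto_mult_left[OF \<psi>(3), of "\<bar>c\<bar>"]] by simp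
  qed
  show "(\<lambda>x. z x + c * y x) \<in> H10 \<Omega>"
    "AE x in lebesgue_on \<Omega>. wgrad \<Omega> (\<lambda>x. z x + c * y x) x = wgrad \<Omega> z x + c *\<^sub>R wgrad \<Omega> y x"
    by (rule H10_limitI[OF t 1 2 3])+
qed

lemma H10_diff:
  assumes z: "z \<in> H10 \<Omega>" and y: "y \<in> H10 \<Omega>"
  shows "(\<lambda>x. z x - y x) \<in> H10 \<Omega>"
    and wgrad_diff: "AE x in lebesgue_on \<Omega>. wgrad \<Omega> (\<lambda>x. z x - y x) x = wgrad \<Omega> z x - wgrad \<Omega> y x"
  using H10_lin[OF z y, of "-1"] wgrad_lin[OF z y, of "-1"] by simp_all

lemma test_fun_H10:
  assumes \<phi>: "test_fun \<Omega> \<phi>"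
  shows "\<phi> \<in> H10 \<Omega>" "AE x in lebesgue_on \<Omega>. wgrad \<Omega> \<phi> x = grad \<phi> x"
  using H10_limitI[of "\<lambda>_. \<phi>" \<phi> "grad \<phi>"] \<phi> test_L2[OF \<phi>] by (simp_all add: L2_norm_def)

lemma H10_norm_test: "test_fun \<Omega> \<phi> \<Longrightarrow> H10_norm \<Omega> \<phi> = L2_norm \<Omega> (grad \<phi>)"
  unfolding H10_norm_def
  by (intro L2_norm_cong_AE test_fun_H10 wgrad_L2 test_L2)

lemma H10_norm_diff:
  assumes "z \<in> H10 \<Omega>" "y \<in> H10 \<Omega>"
  shows "H10_norm \<Omega> (\<lambda>x. z x - y x) = L2_norm \<Omega> (\<lambda>x. wgrad \<Omega> z x - wgrad \<Omega> y x)"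
  unfolding H10_norm_def
  by (intro L2_norm_cong_AE wgrad_diff wgrad_L2 L2_diff H10_diff assms)

lemma H10_norm_lin:
  assumes "z \<in> H10 \<Omega>" "y \<in> H10 \<Omega>"
  shows "H10_norm \<Omega> (\<lambda>x. z x + c * y x) = L2_norm \<Omega> (\<lambda>x. wgrad \<Omega> z x + c *\<^sub>R wgrad \<Omega> y x)"
  unfolding H10_norm_def
  by (intro L2_norm_cong_AE wgrad_lin wgrad_L2 L2_add L2_scaleR H10_lin assms)

text \<open>The weak gradient is determined by the pairings with test functions, so the choice made in its
  definition depends on the class of the function only.\<close>

lemma wgrad_cong_AE:
  assumes "AE x in lebesgue_on \<Omega>. z x = y x" "z \<in> L2 \<Omega>" "y \<in> L2 \<Omega>"
  shows "wgrad \<Omega> z = wgrad \<Omega> y"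
proof -
  have "L2_inner \<Omega> z (partial b \<phi>) = L2_inner \<Omega> y (partial b \<phi>)" if "test_fun \<Omega> \<phi>" "b \<in> Basis" for \<phi> b
    using that assms test_L2(1)[OF test_fun_partial[OF that]] by (intro L2_inner_cong_AE) auto
  then have "has_weak_grad \<Omega> z = has_weak_grad \<Omega> y"
    by (auto simp: fun_eq_iff has_weak_grad_def L2_inner_def)
  then show ?thesis by (simp add: wgrad_def)
qed

end

section \<open>Translations and dyadic cube averages\<close>

lemma L2_UNIV_I:
  fixes f :: "'a::euclidean_space \<Rightarrow> real"
  assumes "f \<in> borel_measurable borel" "integrable lborel (\<lambda>x. (f x)\<^sup>2)"
  shows "f \<in> L2 UNIV"
  using assms by (auto simp: L2_def lebesgue_on_UNIV_eq integrable_completion measurable_completion)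

lemma L2_norm_UNIV:
  fixes f :: "'a::euclidean_space \<Rightarrow> 'b::euclidean_space"
  assumes "f \<in> borel_measurable borel"
  shows "(L2_norm UNIV f)\<^sup>2 = (LINT x|lborel. (norm (f x))\<^sup>2)"
  unfolding L2_norm_sq_int using assms by (simp add: lebesgue_on_UNIV_eq integral_completion)

lemma L2_inner_UNIV:
  fixes f h :: "'a::euclidean_space \<Rightarrow> real"
  assumes "f \<in> borel_measurable borel" "h \<in> borel_measurable borel"
  shows "L2_inner UNIV f h = (LINT x|lborel. f x * h x)"
  unfolding L2_inner_def using assms by (simp add: lebesgue_on_UNIV_eq integral_completion)

lemma L2_norm_sq_nn_integral_UNIV:
  fixes f :: "'a::euclidean_space \<Rightarrow> real"
  assumes "f \<in> L2 UNIV" "f \<in> borel_measurable borel"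
  shows "(\<integral>\<^sup>+x. ennreal ((f x)\<^sup>2) \<partial>lborel) = ennreal ((L2_norm UNIV f)\<^sup>2)"
  using L2_norm_sq_nn_integral[OF assms(1)] assms(2)
  by (simp add: lebesgue_on_UNIV_eq nn_integral_completion)

lemma L2_bounded_support:
  fixes f :: "'a::euclidean_space \<Rightarrow> real"
  assumes "f \<in> borel_measurable borel" "\<And>x. norm x > R \<Longrightarrow> f x = 0" "\<And>x. \<bar>f x\<bar> \<le> K"
  shows "f \<in> L2 UNIV"
proof (rule L2_UNIV_I)
  show "integrable lborel (\<lambda>x. (f x)\<^sup>2)"
  proof (rule integrable_lborel_bounded_support[of _ R "K\<^sup>2"])
    show "\<bar>(f x)\<^sup>2\<bar> \<le> K\<^sup>2" for x
      using power_mono[OF assms(3)[of x], where n = 2] by simp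
  qed (use assms in auto)
qed fact

lemma test_fun_UNIV: "test_fun \<Omega> \<phi> \<Longrightarrow> test_fun UNIV \<phi>"
  by (auto simp: test_fun_def)

lemma L2_norm_test_UNIV:
  assumes "open \<Omega>" "test_fun \<Omega> \<phi>"
  shows "L2_norm UNIV \<phi> = L2_norm \<Omega> \<phi>" "L2_norm UNIV (grad \<phi>) = L2_norm \<Omega> (grad \<phi>)"
proof -
  obtain L where L: "compact L" "L \<subseteq> \<Omega>" "{x. \<phi> x \<noteq> 0} \<subseteq> L"
    using test_fun_support[OF assms(2)] by metis
  have g0: "grad \<phi> x = 0" if "x \<notin> \<Omega>" for x using grad_support[OF L(1,3), of x] L that by auto
  have [measurable]: "\<phi> \<in> borel_measurable borel" "grad \<phi> \<in> borel_measurable borel"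
    by (rule test_fun_borel[OF assms(2)], rule grad_borel[OF assms(2)])
  have "(L2_norm UNIV \<phi>)\<^sup>2 = (L2_norm \<Omega> \<phi>)\<^sup>2"
    unfolding L2_norm_sq_int[of \<Omega>]
    by (subst integral_lebesgue_on_eq_lborel) (use assms test_fun_zero_outside[OF assms(2)] in \<open>auto simp: L2_norm_UNIV\<close>)
  moreover have "(L2_norm UNIV (grad \<phi>))\<^sup>2 = (L2_norm \<Omega> (grad \<phi>))\<^sup>2"
    unfolding L2_norm_sq_int[of \<Omega>]
    by (subst integral_lebesgue_on_eq_lborel) (use assms g0 in \<open>auto simp: L2_norm_UNIV\<close>)
  ultimately show "L2_norm UNIV \<phi> = L2_norm \<Omega> \<phi>" "L2_norm UNIV (grad \<phi>) = L2_norm \<Omega> (grad \<phi>)"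
    by (simp_all add: power2_eq_iff_nonneg)
qed

lemma test_fun_translate_L2:
  assumes \<phi>: "test_fun UNIV \<phi>"
  shows "(\<lambda>x. \<phi> (x + z)) \<in> L2 UNIV"
proof -
  have [measurable]: "\<phi> \<in> borel_measurable borel" by (rule test_fun_borel[OF \<phi>])
  obtain R K where K: "\<And>x. norm x > R \<Longrightarrow> \<phi> x = 0" "\<And>x. \<bar>\<phi> x\<bar> \<le> K"
    using test_fun_bounds[OF \<phi>] by metis
  have "norm (x + z) > R" if "norm x > R + norm z" for x
    using norm_diff_ineq[of x z] that by linarith
  then show ?thesis using K by (intro L2_bounded_support[of _ "R + norm z" K]) auto
qed

lemma L2_norm_translate:
  fixes f :: "'a::euclidean_space \<Rightarrow> real"
  assumes [measurable]: "f \<in> borel_measurable borel"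
  shows "L2_norm UNIV (\<lambda>x. f (x + z)) = L2_norm UNIV f"
proof -
  have "(L2_norm UNIV (\<lambda>x. f (x + z)))\<^sup>2 = (L2_norm UNIV f)\<^sup>2"
    using integral_lborel_translate[of "\<lambda>x. (f x)\<^sup>2" z] by (simp add: L2_norm_UNIV)
  then show ?thesis by (simp add: power2_eq_iff_nonneg)
qed

text \<open>The distance between \<open>\<phi>\<close> and its translate by \<open>z\<close> is subadditive in \<open>z\<close>, so it is at most
  \<open>m\<close> times the distance for \<open>z / m\<close>; as \<open>m\<close> tends to infinity the difference quotients converge.\<close>

lemma translation_estimate:
  assumes \<phi>: "test_fun UNIV \<phi>"
  shows "L2_norm UNIV (\<lambda>x. \<phi> (x + z) - \<phi> x) \<le> norm z * L2_norm UNIV (grad \<phi>)"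
proof -
  have [measurable]: "\<phi> \<in> borel_measurable borel" by (rule test_fun_borel[OF \<phi>])
  have [measurable]: "grad \<phi> \<in> borel_measurable borel" by (rule grad_borel[OF \<phi>])
  note tL2 = test_fun_translate_L2[OF \<phi>]
  have \<phi>L2: "\<phi> \<in> L2 UNIV" using tL2[of 0] by simp
  have multi: "L2_norm UNIV (\<lambda>x. \<phi> (x + real i *\<^sub>R w) - \<phi> x) \<le> real i * L2_norm UNIV (\<lambda>x. \<phi> (x + w) - \<phi> x)" for i w
  proof (induction i)
    case 0 then show ?case by (simp add: L2_norm_def)
  next
    case (Suc i)
    have "L2_norm UNIV (\<lambda>x. \<phi> (x + real (Suc i) *\<^sub>R w) - \<phi> x)
      \<le> L2_norm UNIV (\<lambda>x. \<phi> (x + real (Suc i) *\<^sub>R w) - \<phi> (x + real i *\<^sub>R w)) + L2_norm UNIV (\<lambda>x. \<phi> (x + real i *\<^sub>R w) - \<phi> x)"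
      by (rule L2_norm_triangle_diff[OF tL2 tL2 \<phi>L2])
    also have "L2_norm UNIV (\<lambda>x. \<phi> (x + real (Suc i) *\<^sub>R w) - \<phi> (x + real i *\<^sub>R w)) = L2_norm UNIV (\<lambda>x. \<phi> (x + w) - \<phi> x)"
      using L2_norm_translate[of "\<lambda>x. \<phi> (x + w) - \<phi> x" "real i *\<^sub>R w"] by (simp add: algebra_simps)
    finally show ?case using Suc by (simp add: algebra_simps)
  qed
  let ?q = "\<lambda>m x. real (Suc m) * (\<phi> (x + (1 / real (Suc m)) *\<^sub>R z) - \<phi> x)"
  obtain R K where K: "R > 0" "K > 0" "\<And>x. norm x > R \<Longrightarrow> \<phi> x = 0"
     "\<And>x. norm (grad \<phi> x) \<le> K" "\<And>x z. \<bar>\<phi> (x + z) - \<phi> x\<bar> \<le> K * norm z" "\<And>x. norm x > R \<Longrightarrow> grad \<phi> x = 0"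
    using test_fun_bounds[OF \<phi>] by metis
  have "(\<lambda>m. LINT x|lborel. (?q m x)\<^sup>2) \<longlonglongrightarrow> (LINT x|lborel. (grad \<phi> x \<bullet> z)\<^sup>2)"
  proof (rule integral_dominated_convergence[where w = "\<lambda>x. (K * norm z)\<^sup>2 * indicator (cball 0 (R + norm z)) x"])
    show "integrable lborel (\<lambda>x::'a. (K * norm z)\<^sup>2 * indicator (cball 0 (R + norm z)) x :: real)"
      using emeasure_lborel_cball_finite[of "0::'a" "R+norm z"]
      by (intro integrable_mult_right integrable_real_indicator) auto
    show "AE x in lborel. (\<lambda>m. (?q m x)\<^sup>2) \<longlonglongrightarrow> (grad \<phi> x \<bullet> z)\<^sup>2"
      by (intro always_eventually allI tendsto_power directional_derivative_limit[OF \<phi>])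
    have "norm ((?q m x)\<^sup>2) \<le> (K * norm z)\<^sup>2 * indicator (cball 0 (R + norm z)) x" for m x
    proof (cases "norm x > R + norm z")
      case True
      have nb: "norm ((1 / real (Suc m)) *\<^sub>R z) \<le> norm z" by (simp add: field_simps mult_left_le)
      have "norm (x + (1 / real (Suc m)) *\<^sub>R z) > R" using norm_diff_ineq[of x "(1 / real (Suc m)) *\<^sub>R z"] nb True by linarith
      moreover have "norm x > R" using True norm_ge_zero[of z] by linarith
      ultimately show ?thesis using K(3) True by simp
    next
      case False
      have "\<bar>?q m x\<bar> = real (Suc m) * \<bar>\<phi> (x + (1 / real (Suc m)) *\<^sub>R z) - \<phi> x\<bar>" by (simp add: abs_mult)
      also have "\<dots> \<le> real (Suc m) * (K * norm ((1 / real (Suc m)) *\<^sub>R z))" by (intro mult_left_mono K) auto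
      also have "\<dots> = K * norm z" by simp
      finally have "\<bar>?q m x\<bar>\<^sup>2 \<le> (K * norm z)\<^sup>2" by (intro power_mono) auto
      then show ?thesis using False by simp
    qed
    then show "AE x in lborel. norm ((?q m x)\<^sup>2) \<le> (K * norm z)\<^sup>2 * indicator (cball 0 (R + norm z)) x" for m by simp
  qed measurable
  moreover have "(L2_norm UNIV (\<lambda>x. \<phi> (x + z) - \<phi> x))\<^sup>2 \<le> (LINT x|lborel. (?q m x)\<^sup>2)" for m
  proof -
    have "L2_norm UNIV (\<lambda>x. \<phi> (x + z) - \<phi> x) \<le> real (Suc m) * L2_norm UNIV (\<lambda>x. \<phi> (x + (1 / real (Suc m)) *\<^sub>R z) - \<phi> x)"
      using multi[of "Suc m" "(1 / real (Suc m)) *\<^sub>R z"] by simp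
    also have "\<dots> = L2_norm UNIV (?q m)" by (simp add: L2_norm_cmult)
    finally have "(L2_norm UNIV (\<lambda>x. \<phi> (x + z) - \<phi> x))\<^sup>2 \<le> (L2_norm UNIV (?q m))\<^sup>2" by (intro power_mono) auto
    also have "\<dots> = (LINT x|lborel. (?q m x)\<^sup>2)" by (subst L2_norm_UNIV) auto
    finally show ?thesis .
  qed
  ultimately have "(L2_norm UNIV (\<lambda>x. \<phi> (x + z) - \<phi> x))\<^sup>2 \<le> (LINT x|lborel. (grad \<phi> x \<bullet> z)\<^sup>2)"
    by (intro LIMSEQ_le_const) auto
  also have "\<dots> \<le> (LINT x|lborel. (norm z)\<^sup>2 * (norm (grad \<phi> x))\<^sup>2)"
  proof (rule integral_mono)
    show "(grad \<phi> x \<bullet> z)\<^sup>2 \<le> (norm z)\<^sup>2 * (norm (grad \<phi> x))\<^sup>2" for x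
      using power_mono[OF Cauchy_Schwarz_ineq2[of "grad \<phi> x" z], of 2] by (simp add: power_mult_distrib mult.commute)
    show i: "integrable lborel (\<lambda>x. (norm z)\<^sup>2 * (norm (grad \<phi> x))\<^sup>2)"
      using K power_mono[OF K(4), where n = 2]
      by (intro integrable_mult_right integrable_lborel_bounded_support[of _ R "K\<^sup>2"]) auto
    show "integrable lborel (\<lambda>x. (grad \<phi> x \<bullet> z)\<^sup>2)"
      by (rule Bochner_Integration.integrable_bound[OF i])
        (use power_mono[OF Cauchy_Schwarz_ineq2[of "grad \<phi> _" z], where n = 2] in \<open>auto simp: power_mult_distrib mult.commute\<close>)
  qed
  also have "\<dots> = (norm z * L2_norm UNIV (grad \<phi>))\<^sup>2"
    by (simp add: power_mult_distrib L2_norm_UNIV)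
  finally show ?thesis by (rule power2_le_imp_le) simp
qed

text \<open>Translating by twice the radius of \<open>\<Omega>\<close> separates \<open>\<phi>\<close> from its translate, so \<open>\<parallel>\<phi>\<parallel>\<^sub>2\<close> is at
  most their distance.\<close>

lemma Poincare_test:
  fixes \<Omega> :: "'a::euclidean_space set"
  assumes \<Omega>: "open \<Omega>" and R: "\<And>x. x \<in> \<Omega> \<Longrightarrow> norm x < R" "R > 0" and \<phi>: "test_fun \<Omega> \<phi>"
  shows "L2_norm \<Omega> \<phi> \<le> 2 * R * L2_norm \<Omega> (grad \<phi>)"
proof -
  have \<phi>U: "test_fun UNIV \<phi>" by (rule test_fun_UNIV[OF \<phi>])
  have [measurable]: "\<phi> \<in> borel_measurable borel" by (rule test_fun_borel[OF \<phi>])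
  obtain b :: 'a where b: "b \<in> Basis" by (meson nonempty_Basis ex_in_conv)
  define z where "z = (2 * R) *\<^sub>R b"
  have nz: "norm z = 2 * R" using b R by (simp add: z_def)
  note t0 = test_fun_translate_L2[OF \<phi>U, of 0, simplified] and tz = test_fun_translate_L2[OF \<phi>U, of z]
  have "\<phi> (x + z) * \<phi> x = 0" for x
  proof (rule ccontr)
    assume "\<phi> (x + z) * \<phi> x \<noteq> 0"
    then have "x + z \<in> \<Omega>" "x \<in> \<Omega>" using test_fun_zero_outside[OF \<phi>] by auto
    then have "norm (x + z) < R" "norm x < R" using R by auto
    moreover have "norm z \<le> norm (x + z) + norm x" by (metis add_diff_cancel_left' norm_triangle_ineq4)
    ultimately show False using nz by linarith
  qed
  then have "L2_inner UNIV (\<lambda>x. \<phi> (x + z)) \<phi> = 0"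
    unfolding L2_inner_def inner_real_def by (simp only: Bochner_Integration.integral_zero)
  then have "(L2_norm UNIV (\<lambda>x. \<phi> (x + z) - \<phi> x))\<^sup>2 = 2 * (L2_norm UNIV \<phi>)\<^sup>2"
    using L2_norm_diff_sq[OF tz t0] L2_norm_translate[of \<phi> z] by simp
  then have "(L2_norm UNIV \<phi>)\<^sup>2 \<le> (L2_norm UNIV (\<lambda>x. \<phi> (x + z) - \<phi> x))\<^sup>2" by simp
  then have "L2_norm UNIV \<phi> \<le> L2_norm UNIV (\<lambda>x. \<phi> (x + z) - \<phi> x)" by (rule power2_le_imp_le) simp
  also have "\<dots> \<le> 2 * R * L2_norm UNIV (grad \<phi>)" using translation_estimate[OF \<phi>U, of z] nz by simp
  finally show ?thesis using L2_norm_test_UNIV[OF \<Omega> \<phi>] by simp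
qed

text \<open>\<open>cell j x\<close> is the integer point labelling the dyadic cube of side \<open>2\<^sup>-\<^sup>j\<close> that contains \<open>x\<close>.\<close>

definition cell :: "nat \<Rightarrow> 'a::euclidean_space \<Rightarrow> 'a" where
  "cell j x = (\<Sum>b\<in>Basis. real_of_int \<lfloor>2 ^ j * (x \<bullet> b)\<rfloor> *\<^sub>R b)"

definition cube :: "nat \<Rightarrow> 'a::euclidean_space \<Rightarrow> 'a set" where
  "cube j k = {y. cell j y = k}"

abbreviation cube_volume :: "nat \<Rightarrow> nat \<Rightarrow> real" where
  "cube_volume n j \<equiv> (1 / 2 ^ j) ^ n"

definition average :: "nat \<Rightarrow> ('a::euclidean_space \<Rightarrow> real) \<Rightarrow> 'a \<Rightarrow> real" where
  "average j f x = (LINT y|lborel. f y * indicator (cube j (cell j x)) y) / cube_volume DIM('a) j"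

lemma cell_inner: "b \<in> Basis \<Longrightarrow> cell j x \<bullet> b = real_of_int \<lfloor>2 ^ j * (x \<bullet> b)\<rfloor>"
  by (simp add: cell_def inner_sum_left inner_Basis if_distrib sum.delta cong: if_cong)

lemma cell_eq_iff: "cell j x = cell j y \<longleftrightarrow> (\<forall>b\<in>Basis. \<lfloor>2 ^ j * (x \<bullet> b)\<rfloor> = \<lfloor>2 ^ j * (y \<bullet> b)\<rfloor>)"
  by (subst euclidean_eq_iff) (auto simp: cell_inner)

lemma cell_borel [measurable]: "cell j \<in> borel_measurable borel"
  unfolding cell_def
  by (intro borel_measurable_sum borel_measurable_scaleR measurable_compose[OF _ borel_measurable_real_floor]) auto

lemma cube_borel [measurable]: "cube j k \<in> sets borel"
proof -
  have "cube j k = cell j -` {k} \<inter> space borel" by (auto simp: cube_def)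
  also have "\<dots> \<in> sets borel" by (rule measurable_sets[OF cell_borel]) auto
  finally show ?thesis .
qed

lemma cube_bounds:
  "box ((1 / 2 ^ j) *\<^sub>R cell j x) ((1 / 2 ^ j) *\<^sub>R (cell j x + One)) \<subseteq> cube j (cell j x)"
  "cube j (cell j x) \<subseteq> cbox ((1 / 2 ^ j) *\<^sub>R cell j x) ((1 / 2 ^ j) *\<^sub>R (cell j x + One))"
proof -
  have *: "(c / 2^j \<le> t \<longleftrightarrow> c \<le> 2^j * t) \<and> (c / 2^j < t \<longleftrightarrow> c < 2^j * t) \<and> (t \<le> c / 2^j \<longleftrightarrow> 2^j * t \<le> c) \<and> (t < c / 2^j \<longleftrightarrow> 2^j * t < c)" for c t :: real
    by (simp add: field_simps)
  show "box ((1 / 2 ^ j) *\<^sub>R cell j x) ((1 / 2 ^ j) *\<^sub>R (cell j x + One)) \<subseteq> cube j (cell j x)"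
  proof
    fix y assume y: "y \<in> box ((1 / 2 ^ j) *\<^sub>R cell j x) ((1 / 2 ^ j) *\<^sub>R (cell j x + One))"
    have "\<lfloor>2 ^ j * (y \<bullet> b)\<rfloor> = \<lfloor>2 ^ j * (x \<bullet> b)\<rfloor>" if b: "b \<in> Basis" for b
    proof -
      have "(cell j x \<bullet> b) / 2^j < y \<bullet> b" "y \<bullet> b < (cell j x \<bullet> b + 1) / 2^j"
        using y b by (auto simp: mem_box inner_add_left)
      then have "real_of_int \<lfloor>2 ^ j * (x \<bullet> b)\<rfloor> < 2 ^ j * (y \<bullet> b)" "2 ^ j * (y \<bullet> b) < real_of_int \<lfloor>2 ^ j * (x \<bullet> b)\<rfloor> + 1"
        using * cell_inner[OF b] by auto
      then show ?thesis by linarith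
    qed
    then show "y \<in> cube j (cell j x)" by (simp add: cube_def cell_eq_iff)
  qed
  show "cube j (cell j x) \<subseteq> cbox ((1 / 2 ^ j) *\<^sub>R cell j x) ((1 / 2 ^ j) *\<^sub>R (cell j x + One))"
  proof
    fix y assume "y \<in> cube j (cell j x)"
    then have eq: "cell j y = cell j x" by (simp add: cube_def)
    have "(cell j x \<bullet> b) / 2^j \<le> y \<bullet> b \<and> y \<bullet> b \<le> (cell j x \<bullet> b + 1) / 2^j" if b: "b \<in> Basis" for b
    proof -
      have "cell j x \<bullet> b \<le> 2^j * (y \<bullet> b)" "2^j * (y \<bullet> b) \<le> cell j x \<bullet> b + 1"
        unfolding eq[symmetric] cell_inner[OF b] by linarith+
      then show ?thesis using * by auto
    qed
    then show "y \<in> cbox ((1 / 2 ^ j) *\<^sub>R cell j x) ((1 / 2 ^ j) *\<^sub>R (cell j x + One))"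
      by (auto simp: mem_box inner_add_left)
  qed
qed

lemma emeasure_cube:
  "emeasure lborel (cube j (cell j x)) = ennreal (cube_volume DIM('a) j)" for x :: "'a::euclidean_space"
proof (rule antisym)
  let ?l = "(1 / 2 ^ j) *\<^sub>R cell j x" and ?u = "(1 / 2 ^ j) *\<^sub>R (cell j x + One)"
  have le: "?l \<bullet> b \<le> ?u \<bullet> b" if "b \<in> Basis" for b using that by (simp add: inner_add_left field_simps)
  have p: "(\<Prod>b\<in>Basis. (?u - ?l) \<bullet> b) = cube_volume DIM('a) j"
    by (simp add: inner_diff_left inner_add_left scaleR_add_right)
  have "emeasure lborel (cube j (cell j x)) \<le> emeasure lborel (cbox ?l ?u)"
    by (rule emeasure_mono[OF cube_bounds(2)]) auto
  then show "emeasure lborel (cube j (cell j x)) \<le> ennreal (cube_volume DIM('a) j)"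
    using le by (simp add: emeasure_lborel_cbox p)
  have "emeasure lborel (box ?l ?u) \<le> emeasure lborel (cube j (cell j x))"
    by (rule emeasure_mono[OF cube_bounds(1)]) auto
  then show "ennreal (cube_volume DIM('a) j) \<le> emeasure lborel (cube j (cell j x))"
    using le by (simp add: emeasure_lborel_box p)
qed

lemma cell_Suc_imp: "cell (Suc j) x = cell (Suc j) y \<Longrightarrow> cell j x = cell j y"
proof -
  assume "cell (Suc j) x = cell (Suc j) y"
  moreover have "\<lfloor>2 ^ j * t\<rfloor> = \<lfloor>2 ^ Suc j * t\<rfloor> div 2" for t :: real
    using floor_divide_real_eq_div[of 2 "2 ^ Suc j * t"] by simp
  ultimately show ?thesis by (simp add: cell_eq_iff)
qed

lemma cube_displacement:
  assumes "cell j y = cell j (x::'a::euclidean_space)"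
  shows "y - x \<in> cbox (- (1 / 2 ^ j) *\<^sub>R One) ((1 / 2 ^ j) *\<^sub>R One)"
proof -
  have "\<bar>(y - x) \<bullet> b\<bar> \<le> 1 / 2 ^ j" if b: "b \<in> Basis" for b
  proof -
    have "\<lfloor>2 ^ j * (y \<bullet> b)\<rfloor> = \<lfloor>2 ^ j * (x \<bullet> b)\<rfloor>" using assms b by (simp add: cell_eq_iff)
    then have "\<bar>2 ^ j * (y \<bullet> b) - 2 ^ j * (x \<bullet> b)\<bar> \<le> 1" by linarith
    then have "2 ^ j * \<bar>(y - x) \<bullet> b\<bar> \<le> 1" by (simp add: inner_diff_left abs_mult flip: right_diff_distrib)
    then show ?thesis by (simp add: field_simps)
  qed
  then show ?thesis by (auto simp: mem_box abs_le_iff) (metis minus_le_iff inner_diff_left)+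
qed

lemma norm_cbox_le:
  fixes h :: real
  assumes "w \<in> cbox (- h *\<^sub>R One) (h *\<^sub>R One :: 'a::euclidean_space)"
  shows "norm w \<le> DIM('a) * h"
proof -
  have "norm w \<le> (\<Sum>b\<in>Basis. \<bar>w \<bullet> b\<bar>)" by (rule norm_le_l1)
  also have "\<dots> \<le> (\<Sum>b\<in>(Basis::'a set). h)" using assms by (intro sum_mono) (auto simp: mem_box abs_le_iff minus_le_iff)
  finally show ?thesis by simp
qed

lemma indicator_power2: "(indicator S x :: real)\<^sup>2 = indicator S x"
  by (simp add: indicator_def)

lemma indicator_cube_L2: "(indicator (cube j (cell j x)) :: 'a::euclidean_space \<Rightarrow> real) \<in> L2 UNIV"
  by (rule L2_UNIV_I) (auto simp: indicator_power2 emeasure_cube intro!: integrable_real_indicator)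

lemma L2_norm_indicator_cube:
  "(L2_norm UNIV (indicator (cube j (cell j x)) :: 'a \<Rightarrow> real))\<^sup>2 = cube_volume DIM('a) j" for x :: "'a::euclidean_space"
proof -
  have "(L2_norm UNIV (indicator (cube j (cell j x)) :: 'a \<Rightarrow> real))\<^sup>2 = (LINT y|lborel. indicator (cube j (cell j x)) y)"
    by (subst L2_norm_UNIV) (auto simp: indicator_power2)
  also have "\<dots> = measure lborel (cube j (cell j x))" by simp
  also have "\<dots> = cube_volume DIM('a) j" by (simp add: measure_def emeasure_cube)
  finally show ?thesis .
qed

lemma L2_mult_indicator:
  fixes f :: "'a::euclidean_space \<Rightarrow> real"
  assumes "f \<in> L2 UNIV" "f \<in> borel_measurable borel" "S \<in> sets borel"
  shows "(\<lambda>x. f x * indicator S x) \<in> L2 UNIV"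
proof (rule L2_UNIV_I)
  have "integrable lborel (\<lambda>x. (f x)\<^sup>2)" using L2_D(2)[OF assms(1)] assms(2)
    by (simp add: lebesgue_on_UNIV_eq integrable_completion)
  then show "integrable lborel (\<lambda>x. (f x * indicator S x)\<^sup>2)"
    by (rule Bochner_Integration.integrable_bound) (use assms in \<open>auto simp: indicator_def\<close>)
qed (use assms in measurable)

lemma cube_integral_sq_le:
  fixes f :: "'a::euclidean_space \<Rightarrow> real"
  assumes f: "f \<in> L2 UNIV" "f \<in> borel_measurable borel"
  shows "(LINT y|lborel. f y * indicator (cube j (cell j x)) y)\<^sup>2
     \<le> cube_volume DIM('a) j * (L2_norm UNIV (\<lambda>y. f y * indicator (cube j (cell j x)) y))\<^sup>2"
proof -
  let ?I = "indicator (cube j (cell j x)) :: 'a \<Rightarrow> real"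
  have fI: "(\<lambda>y. f y * ?I y) \<in> L2 UNIV" by (intro L2_mult_indicator f) auto
  have "(LINT y|lborel. f y * ?I y) = L2_inner UNIV (\<lambda>y. f y * ?I y) ?I"
    by (subst L2_inner_UNIV) (use f in \<open>auto simp: indicator_def intro!: Bochner_Integration.integral_cong\<close>)
  then have "(LINT y|lborel. f y * ?I y)\<^sup>2 \<le> (L2_norm UNIV (\<lambda>y. f y * ?I y) * L2_norm UNIV ?I)\<^sup>2"
    using L2_Cauchy_Schwarz[OF fI indicator_cube_L2] by (simp add: abs_le_square_iff[symmetric] abs_mult)
  then show ?thesis by (simp add: power_mult_distrib L2_norm_indicator_cube mult.commute)
qed

lemma average_abs_le:
  fixes f :: "'a::euclidean_space \<Rightarrow> real"
  assumes f: "f \<in> L2 UNIV" "f \<in> borel_measurable borel"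
  shows "\<bar>average j f x\<bar> \<le> sqrt ((2 ^ j) ^ DIM('a)) * L2_norm UNIV f"
proof (rule power2_le_imp_le)
  let ?V = "cube_volume DIM('a) j"
  let ?I = "indicator (cube j (cell j x)) :: 'a \<Rightarrow> real"
  have V: "?V > 0" by simp
  have "(average j f x)\<^sup>2 = (LINT y|lborel. f y * ?I y)\<^sup>2 / ?V\<^sup>2"
    unfolding average_def by (rule power_divide)
  also have "\<dots> \<le> (?V * (L2_norm UNIV (\<lambda>y. f y * ?I y))\<^sup>2) / ?V\<^sup>2"
    using cube_integral_sq_le[OF f] by (intro divide_right_mono) auto
  also have "\<dots> = (L2_norm UNIV (\<lambda>y. f y * ?I y))\<^sup>2 / ?V" by (simp add: power2_eq_square)
  also have "\<dots> \<le> (L2_norm UNIV f)\<^sup>2 / ?V"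
  proof (rule divide_right_mono)
    have "integrable lborel (\<lambda>x. (f x)\<^sup>2)" using L2_D(2)[OF f(1)] f(2)
      by (simp add: lebesgue_on_UNIV_eq integrable_completion)
    then show "(L2_norm UNIV (\<lambda>y. f y * ?I y))\<^sup>2 \<le> (L2_norm UNIV f)\<^sup>2"
      using f(2) by (simp add: L2_norm_UNIV) (rule integral_mono', auto simp: indicator_def)
  qed simp
  also have "\<dots> = (sqrt ((2 ^ j) ^ DIM('a)) * L2_norm UNIV f)\<^sup>2"
    by (simp add: power_mult_distrib power_divide field_simps)
  finally show "\<bar>average j f x\<bar>\<^sup>2 \<le> (sqrt ((2 ^ j) ^ DIM('a)) * L2_norm UNIV f)\<^sup>2" by simp
qed simp

lemma average_borel [measurable]:
  fixes f :: "'a::euclidean_space \<Rightarrow> real"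
  assumes [measurable]: "f \<in> borel_measurable borel"
  shows "average j f \<in> borel_measurable borel"
proof -
  have "(\<lambda>x. LINT y|lborel. f y * (if cell j y = cell j x then 1 else 0)) \<in> borel_measurable borel"
    by measurable
  moreover have "average j f = (\<lambda>x. (LINT y|lborel. f y * (if cell j y = cell j x then 1 else 0)) / cube_volume DIM('a) j)"
    by (auto simp: average_def cube_def indicator_def fun_eq_iff intro!: Bochner_Integration.integral_cong)
  ultimately show ?thesis by simp
qed

text \<open>By Cauchy-Schwarz the squared deviation from the average is at most the mean of
  \<open>(\<phi>(y) - \<phi>(x))\<^sup>2\<close> over the cube of \<open>x\<close>, whose points are \<open>y = x + w\<close> with \<open>w\<close> in the box
  \<open>[-h, h]\<^sup>n\<close>, \<open>h = 2\<^sup>-\<^sup>j\<close>. Integrating in \<open>x\<close> first leaves translation distances.\<close>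

lemma average_estimate:
  fixes \<phi> :: "'a::euclidean_space \<Rightarrow> real"
  assumes \<phi>: "test_fun UNIV \<phi>"
  shows "(\<lambda>x. \<phi> x - average j \<phi> x) \<in> L2 UNIV"
    and "L2_norm UNIV (\<lambda>x. \<phi> x - average j \<phi> x) \<le> sqrt (2 ^ DIM('a)) * DIM('a) / 2 ^ j * L2_norm UNIV (grad \<phi>)"
proof -
  let ?V = "cube_volume DIM('a) j"
  define h :: real where "h = 1 / 2 ^ j"
  have h: "h > 0" "?V = h ^ DIM('a)" by (simp_all add: h_def)
  let ?W = "cbox (- h *\<^sub>R One) (h *\<^sub>R One) :: 'a set"
  have [measurable]: "\<phi> \<in> borel_measurable borel" by (rule test_fun_borel[OF \<phi>])
  obtain R K where K: "\<And>x. norm x > R \<Longrightarrow> \<phi> x = 0" "\<And>x. \<bar>\<phi> x\<bar> \<le> K"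
    using test_fun_bounds[OF \<phi>] by metis
  have \<phi>L2: "\<phi> \<in> L2 UNIV" using test_fun_translate_L2[OF \<phi>, of 0] by simp
  have eW: "emeasure lborel ?W = ennreal (2 ^ DIM('a) * ?V)"
  proof -
    have "emeasure lborel ?W = ennreal (\<Prod>b\<in>Basis. (h *\<^sub>R One - (- h *\<^sub>R One)) \<bullet> (b::'a))"
      using h(1) by (subst emeasure_lborel_cbox) auto
    also have "(\<Prod>b\<in>Basis. (h *\<^sub>R One - (- h *\<^sub>R One)) \<bullet> (b::'a)) = (2 * h) ^ DIM('a)"
      by (simp add: inner_diff_left inner_add_left)
    finally show ?thesis by (simp add: power_mult_distrib h(2))
  qed
  have V0: "0 \<le> 1 / ?V" and W0: "0 \<le> 2 ^ DIM('a) * ?V" by simp_all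
  have pt: "ennreal ((\<phi> x - average j \<phi> x)\<^sup>2) \<le> (\<integral>\<^sup>+w. ennreal (1/?V) * (ennreal ((\<phi> (x + w) - \<phi> x)\<^sup>2) * indicator ?W w) \<partial>lborel)" for x
  proof -
    let ?I = "indicator (cube j (cell j x)) :: 'a \<Rightarrow> real"
    define k where "k = (\<lambda>y. (\<phi> y - \<phi> x) * ?I y)"
    have [measurable]: "k \<in> borel_measurable borel" unfolding k_def by measurable
    have kL2: "k \<in> L2 UNIV"
    proof -
      have "(\<lambda>y. \<phi> y * ?I y - \<phi> x * ?I y) \<in> L2 UNIV"
        by (intro L2_diff L2_mult_indicator \<phi>L2 L2_cmult indicator_cube_L2) auto
      then show ?thesis by (simp add: k_def algebra_simps)
    qed
    have kI: "k y * ?I y = k y" for y by (simp add: k_def indicator_def)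
    have int\<phi>: "integrable lborel (\<lambda>y. \<phi> y * ?I y)" "integrable lborel (\<lambda>y. \<phi> x * ?I y)"
    proof -
      have "integrable lborel \<phi>" by (rule integrable_lborel_bounded_support[OF _ K]) auto
      then show "integrable lborel (\<lambda>y. \<phi> y * ?I y)"
        by (rule Bochner_Integration.integrable_bound) (auto simp: indicator_def)
      show "integrable lborel (\<lambda>y. \<phi> x * ?I y)"
        by (intro integrable_mult_right integrable_real_indicator) (auto simp: emeasure_cube)
    qed
    have "(LINT y|lborel. k y * ?I y) = (LINT y|lborel. \<phi> y * ?I y - \<phi> x * ?I y)"
      unfolding kI by (simp add: k_def algebra_simps)
    also have "\<dots> = (LINT y|lborel. \<phi> y * ?I y) - \<phi> x * ?V"
      using int\<phi> by (simp add: measure_def emeasure_cube)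
    finally have "(LINT y|lborel. k y * ?I y) / ?V = average j \<phi> x - \<phi> x"
      by (simp add: average_def diff_divide_distrib)
    then have "(\<phi> x - average j \<phi> x)\<^sup>2 = (LINT y|lborel. k y * ?I y)\<^sup>2 / ?V\<^sup>2"
      by (metis power2_commute power_divide)
    also have "\<dots> \<le> (?V * (L2_norm UNIV (\<lambda>y. k y * ?I y))\<^sup>2) / ?V\<^sup>2"
      using cube_integral_sq_le[OF kL2, of j x] by (intro divide_right_mono) auto
    also have "\<dots> = (1 / ?V) * (L2_norm UNIV k)\<^sup>2" unfolding kI by (simp add: power2_eq_square)
    finally have "ennreal ((\<phi> x - average j \<phi> x)\<^sup>2) \<le> ennreal ((1 / ?V) * (L2_norm UNIV k)\<^sup>2)"
      by (rule ennreal_leI)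
    also have "\<dots> = ennreal (1 / ?V) * (\<integral>\<^sup>+y. ennreal ((k y)\<^sup>2) \<partial>lborel)"
      by (subst ennreal_mult[OF V0 zero_le_power2]) (simp add: L2_norm_sq_nn_integral_UNIV[OF kL2])
    also have "(\<integral>\<^sup>+y. ennreal ((k y)\<^sup>2) \<partial>lborel) = (\<integral>\<^sup>+y. ennreal ((k y)\<^sup>2) \<partial>distr lborel borel ((+) x))"
      by (simp add: lborel_distr_plus)
    also have "\<dots> = (\<integral>\<^sup>+w. ennreal ((k (x + w))\<^sup>2) \<partial>lborel)"
      by (rule nn_integral_distr) auto
    also have "\<dots> \<le> (\<integral>\<^sup>+w. ennreal ((\<phi> (x + w) - \<phi> x)\<^sup>2) * indicator ?W w \<partial>lborel)"
    proof (rule nn_integral_mono)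
      fix w :: 'a
      have "w \<in> ?W" if "x + w \<in> cube j (cell j x)"
        using cube_displacement[of j "x + w" x] that unfolding h_def cube_def by simp
      then show "ennreal ((k (x + w))\<^sup>2) \<le> ennreal ((\<phi> (x + w) - \<phi> x)\<^sup>2) * indicator ?W w"
        by (auto simp: k_def indicator_def)
    qed
    finally show ?thesis by (simp add: nn_integral_cmult mult_left_mono)
  qed
  have "(\<integral>\<^sup>+x. ennreal ((\<phi> x - average j \<phi> x)\<^sup>2) \<partial>lborel)
     \<le> (\<integral>\<^sup>+x. \<integral>\<^sup>+w. ennreal (1/?V) * (ennreal ((\<phi> (x + w) - \<phi> x)\<^sup>2) * indicator ?W w) \<partial>lborel \<partial>lborel)"
    by (intro nn_integral_mono pt)
  also have "\<dots> = (\<integral>\<^sup>+w. \<integral>\<^sup>+x. ennreal (1/?V) * (ennreal ((\<phi> (x + w) - \<phi> x)\<^sup>2) * indicator ?W w) \<partial>lborel \<partial>lborel)"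
    by (rule lborel_pair.Fubini') measurable
  also have "\<dots> = (\<integral>\<^sup>+w. (ennreal (1/?V) * ennreal ((L2_norm UNIV (\<lambda>x. \<phi> (x + w) - \<phi> x))\<^sup>2)) * indicator ?W w \<partial>lborel)"
  proof (rule nn_integral_cong)
    fix w :: 'a
    have "(\<integral>\<^sup>+x. ennreal ((\<phi> (x + w) - \<phi> x)\<^sup>2) \<partial>lborel) = ennreal ((L2_norm UNIV (\<lambda>x. \<phi> (x + w) - \<phi> x))\<^sup>2)"
      by (rule L2_norm_sq_nn_integral_UNIV) (auto intro!: L2_diff test_fun_translate_L2[OF \<phi>] \<phi>L2)
    then show "(\<integral>\<^sup>+x. ennreal (1/?V) * (ennreal ((\<phi> (x + w) - \<phi> x)\<^sup>2) * indicator ?W w) \<partial>lborel)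
      = (ennreal (1/?V) * ennreal ((L2_norm UNIV (\<lambda>x. \<phi> (x + w) - \<phi> x))\<^sup>2)) * indicator ?W w"
      by (cases "w \<in> ?W") (simp_all add: nn_integral_cmult)
  qed
  also have "\<dots> \<le> (\<integral>\<^sup>+w. (ennreal (1/?V) * ennreal ((DIM('a) * h * L2_norm UNIV (grad \<phi>))\<^sup>2)) * indicator ?W w \<partial>lborel)"
  proof (rule nn_integral_mono)
    fix w :: 'a
    have "(L2_norm UNIV (\<lambda>x. \<phi> (x + w) - \<phi> x))\<^sup>2 \<le> (DIM('a) * h * L2_norm UNIV (grad \<phi>))\<^sup>2" if "w \<in> ?W"
    proof (rule power_mono)
      have "L2_norm UNIV (\<lambda>x. \<phi> (x + w) - \<phi> x) \<le> norm w * L2_norm UNIV (grad \<phi>)" by (rule translation_estimate[OF \<phi>])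
      also have "\<dots> \<le> DIM('a) * h * L2_norm UNIV (grad \<phi>)"
        using norm_cbox_le[OF that] by (intro mult_right_mono) auto
      finally show "L2_norm UNIV (\<lambda>x. \<phi> (x + w) - \<phi> x) \<le> DIM('a) * h * L2_norm UNIV (grad \<phi>)" .
    qed simp
    then show "(ennreal (1/?V) * ennreal ((L2_norm UNIV (\<lambda>x. \<phi> (x + w) - \<phi> x))\<^sup>2)) * indicator ?W w
       \<le> (ennreal (1/?V) * ennreal ((DIM('a) * h * L2_norm UNIV (grad \<phi>))\<^sup>2)) * indicator ?W w"
      by (auto simp: indicator_def intro!: mult_left_mono ennreal_leI)
  qed
  also have "\<dots> = (ennreal (1/?V) * ennreal ((DIM('a) * h * L2_norm UNIV (grad \<phi>))\<^sup>2)) * emeasure lborel ?W"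
    by (subst nn_integral_cmult_indicator) auto
  also have "\<dots> = ennreal ((1/?V) * (DIM('a) * h * L2_norm UNIV (grad \<phi>))\<^sup>2 * (2 ^ DIM('a) * ?V))"
    unfolding eW
    by (simp only: ennreal_mult[OF V0 zero_le_power2] ennreal_mult[OF mult_nonneg_nonneg[OF V0 zero_le_power2] W0])
  also have "(1/?V) * (DIM('a) * h * L2_norm UNIV (grad \<phi>))\<^sup>2 * (2 ^ DIM('a) * ?V)
     = (sqrt (2 ^ DIM('a)) * DIM('a) / 2 ^ j * L2_norm UNIV (grad \<phi>))\<^sup>2"
    by (simp add: power_mult_distrib h_def power_divide)
  finally have main: "(\<integral>\<^sup>+x. ennreal ((\<phi> x - average j \<phi> x)\<^sup>2) \<partial>lborel)
      \<le> ennreal ((sqrt (2 ^ DIM('a)) * DIM('a) / 2 ^ j * L2_norm UNIV (grad \<phi>))\<^sup>2)" .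
  have m: "(\<lambda>x. \<phi> x - average j \<phi> x) \<in> borel_measurable borel" by measurable
  show "(\<lambda>x. \<phi> x - average j \<phi> x) \<in> L2 UNIV"
    and "L2_norm UNIV (\<lambda>x. \<phi> x - average j \<phi> x) \<le> sqrt (2 ^ DIM('a)) * DIM('a) / 2 ^ j * L2_norm UNIV (grad \<phi>)"
    using L2_of_nn_integral[of "\<lambda>x. \<phi> x - average j \<phi> x" UNIV] main m
    by (simp_all add: lebesgue_on_UNIV_eq nn_integral_completion measurable_completion)
qed

section \<open>Compactness and the first Dirichlet eigenvalue\<close>

lemma finite_cells:
  fixes \<Omega> :: "'a::euclidean_space set"
  assumes "bounded \<Omega>" shows "finite (cell j ` \<Omega>)"
proof -
  obtain R where R: "\<And>x. x \<in> \<Omega> \<Longrightarrow> norm x \<le> R" using assms by (auto simp: bounded_iff)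
  define N where "N = \<lceil>2 ^ j * \<bar>R\<bar>\<rceil> + 1"
  have "cell j ` \<Omega> \<subseteq> (\<lambda>c. \<Sum>b\<in>Basis. real_of_int (c b) *\<^sub>R b) ` (Basis \<rightarrow>\<^sub>E {-N..N})"
  proof
    fix k assume "k \<in> cell j ` \<Omega>"
    then obtain x where x: "x \<in> \<Omega>" "k = cell j x" by auto
    let ?c = "restrict (\<lambda>b. \<lfloor>2 ^ j * (x \<bullet> b)\<rfloor>) Basis"
    have "k = (\<Sum>b\<in>Basis. real_of_int (?c b) *\<^sub>R b)" using x by (simp add: cell_def)
    moreover have "?c \<in> Basis \<rightarrow>\<^sub>E {-N..N}"
    proof (rule PiE_I)
      fix b :: 'a assume b: "b \<in> Basis"
      have "\<bar>x \<bullet> b\<bar> \<le> \<bar>R\<bar>" using Basis_le_norm[OF b, of x] R[OF x(1)] by linarith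
      then have "\<bar>2 ^ j * (x \<bullet> b)\<bar> \<le> 2 ^ j * \<bar>R\<bar>" by (simp add: abs_mult)
      then have "- real_of_int \<lceil>2 ^ j * \<bar>R\<bar>\<rceil> \<le> 2 ^ j * (x \<bullet> b)" "2 ^ j * (x \<bullet> b) \<le> real_of_int \<lceil>2 ^ j * \<bar>R\<bar>\<rceil>"
        by linarith+
      then have "- \<lceil>2 ^ j * \<bar>R\<bar>\<rceil> \<le> \<lfloor>2 ^ j * (x \<bullet> b)\<rfloor>" "\<lfloor>2 ^ j * (x \<bullet> b)\<rfloor> \<le> \<lceil>2 ^ j * \<bar>R\<bar>\<rceil>"
        by linarith+
      then have "\<lfloor>2 ^ j * (x \<bullet> b)\<rfloor> \<in> {-N..N}" unfolding N_def by simp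
      then show "?c b \<in> {-N..N}" using b by simp
    qed auto
    ultimately show "k \<in> (\<lambda>c. \<Sum>b\<in>Basis. real_of_int (c b) *\<^sub>R b) ` (Basis \<rightarrow>\<^sub>E {-N..N})" by blast
  qed
  moreover have "finite ((\<lambda>c. \<Sum>b\<in>Basis. real_of_int (c b) *\<^sub>R b :: 'a) ` (Basis \<rightarrow>\<^sub>E {-N..N}))"
    by (intro finite_imageI finite_PiE) auto
  ultimately show ?thesis by (rule finite_subset)
qed

lemma test_fun_integrable:
  assumes \<phi>: "test_fun \<Omega> \<phi>" shows "integrable lborel \<phi>"
proof -
  obtain R K where K: "\<And>x. norm x > R \<Longrightarrow> \<phi> x = 0" "\<And>x. \<bar>\<phi> x\<bar> \<le> K"
    using test_fun_bounds[OF \<phi>] by metis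
  show ?thesis by (rule integrable_lborel_bounded_support[OF test_fun_borel[OF \<phi>] K])
qed

text \<open>Bolzano-Weierstrass for each sequence of the family and a diagonal choice.\<close>

lemma diagonal_convergent:
  fixes a :: "nat \<Rightarrow> nat \<Rightarrow> real"
  assumes "\<And>m. bounded (range (\<lambda>k. a k m))"
  obtains r :: "nat \<Rightarrow> nat" where "strict_mono r" "\<And>m. convergent (\<lambda>k. a (r k) m)"
proof -
  interpret subseqs "\<lambda>m s. convergent (\<lambda>k. a (s k) m)"
  proof
    fix m and s :: "nat \<Rightarrow> nat" assume "strict_mono s"
    have "bounded (range (\<lambda>k. a (s k) m))" by (rule bounded_subset[OF assms[of m]]) auto
    then obtain l r where "strict_mono r" "((\<lambda>k. a (s k) m) \<circ> r) \<longlonglongrightarrow> l"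
      using bounded_imp_convergent_subsequence by blast
    then show "\<exists>r. strict_mono r \<and> convergent (\<lambda>k. a ((s \<circ> r) k) m)"
      by (auto simp: convergent_def o_def)
  qed
  have "convergent (\<lambda>k. a (diagseq k) m)" for m
  proof -
    have "convergent (\<lambda>k. a ((diagseq \<circ> (+) (Suc m)) k) m)"
    proof (rule diagseq_holds)
      fix n r and s :: "nat \<Rightarrow> nat"
      assume r: "strict_mono (r :: nat \<Rightarrow> nat)" and c: "convergent (\<lambda>k. a (s k) n)"
      then show "convergent (\<lambda>k. a ((s \<circ> r) k) n)"
        using convergent_subseq_convergent[OF c r] by (simp add: o_def)
    qed
    then have "convergent (\<lambda>k. a (diagseq (k + Suc m)) m)" by (simp add: o_def add.commute)
    then show ?thesis using convergent_ignore_initial_segment[of "\<lambda>k. a (diagseq k) m" "Suc m"] by simp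
  qed
  then show thesis using that subseq_diagseq by blast
qed

context bounded_open_domain
begin

lemma domain_radius:
  obtains R where "R > 0" "\<And>x. x \<in> \<Omega> \<Longrightarrow> norm x < R"
proof -
  obtain R where R: "R > 0" "\<forall>x\<in>\<Omega>. norm x \<le> R" using bounded_domain by (metis bounded_pos)
  show thesis
  proof (rule that[of "R + 1"])
    show "norm x < R + 1" if "x \<in> \<Omega>" for x using R(2) that by fastforce
  qed (use R(1) in simp)
qed

text \<open>The integrals over all dyadic cubes meeting \<open>\<Omega>\<close> converge along a subsequence. At level \<open>j\<close> only
  finitely many cubes matter, and the error of replacing a function by its averages is \<open>O(2\<^sup>-\<^sup>j)\<close>
  uniformly along the sequence.\<close>

theorem Rellich_test:
  assumes \<phi>: "\<And>k::nat. test_fun \<Omega> (\<phi> k)" and B: "\<And>k. L2_norm \<Omega> (grad (\<phi> k)) \<le> B"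
  obtains r :: "nat \<Rightarrow> nat" where "strict_mono r"
    "\<And>e. e > 0 \<Longrightarrow> \<exists>N. \<forall>m\<ge>N. \<forall>n\<ge>N. L2_norm \<Omega> (\<lambda>x. \<phi> (r m) x - \<phi> (r n) x) < e"
proof -
  obtain R where R: "R > 0" "\<And>x. x \<in> \<Omega> \<Longrightarrow> norm x < R" by (rule domain_radius) (rule that; assumption)
  define I where "I = (\<Union>j. {j} \<times> cell j ` \<Omega>)"
  define a where "a = (\<lambda>k (jc :: nat \<times> 'a). LINT y|lborel. \<phi> k y * indicator (cube (fst jc) (snd jc)) y)"
  define J where "J = (\<lambda>m. if I = {} then (0, 0) else from_nat_into I m)"
  have cI: "countable I" unfolding I_def 
    by (intro countable_UN countable_SIGMA) (auto intro: countable_finite finite_cells bounded_domain)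
  have b\<phi>: "\<phi> k \<in> borel_measurable borel" for k by (rule test_fun_borel[OF \<phi>])
  have \<phi>U: "\<phi> k \<in> L2 UNIV" for k using test_fun_translate_L2[OF test_fun_UNIV[OF \<phi>], of _ 0] by simp
  have bounds: "bounded (range (\<lambda>k. a k (J m)))" if I: "I \<noteq> {}" for m
  proof -
    have "J m \<in> I" using from_nat_into[OF I, of m] I by (simp add: J_def)
    then obtain j x where J: "J m = (j, cell j x)" "x \<in> \<Omega>" unfolding I_def by auto
    have "\<bar>a k (J m)\<bar> \<le> sqrt ((2 ^ j) ^ DIM('a)) * (2 * R * B) * cube_volume DIM('a) j" for k
    proof -
      have "\<bar>a k (J m)\<bar> = \<bar>average j (\<phi> k) x\<bar> * cube_volume DIM('a) j"
        by (simp add: a_def J average_def abs_mult)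
      also have "\<dots> \<le> (sqrt ((2 ^ j) ^ DIM('a)) * L2_norm UNIV (\<phi> k)) * cube_volume DIM('a) j"
        by (intro mult_right_mono average_abs_le \<phi>U b\<phi>) auto
      also have "\<dots> \<le> (sqrt ((2 ^ j) ^ DIM('a)) * (2 * R * B)) * cube_volume DIM('a) j"
      proof (intro mult_right_mono mult_left_mono)
        have "L2_norm UNIV (\<phi> k) \<le> 2 * R * L2_norm \<Omega> (grad (\<phi> k))"
          using Poincare_test[OF open_domain R(2,1) \<phi>] L2_norm_test_UNIV[OF open_domain \<phi>] by simp
        also have "\<dots> \<le> 2 * R * B" using B R by (intro mult_left_mono) auto
        finally show "L2_norm UNIV (\<phi> k) \<le> 2 * R * B" .
      qed auto
      finally show ?thesis .
    qed
    then show ?thesis unfolding bounded_iff by auto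
  qed
  obtain r :: "nat \<Rightarrow> nat" where r: "strict_mono r" "\<And>m. I \<noteq> {} \<Longrightarrow> convergent (\<lambda>k. a (r k) (J m))"
  proof (cases "I = {}")
    case True
    then show thesis using that[of id] by (auto simp: strict_mono_def)
  next
    case False
    then show thesis using diagonal_convergent[of "\<lambda>k m. a k (J m)"] bounds that by metis
  qed
  have conv: "convergent (\<lambda>k. a (r k) (j, cell j x))" if "x \<in> \<Omega>" for j x
  proof -
    have I: "(j, cell j x) \<in> I" using that by (auto simp: I_def)
    then obtain m where "from_nat_into I m = (j, cell j x)"
      using from_nat_into_surj[OF cI I] by blast
    then have "J m = (j, cell j x)" using I by (auto simp: J_def)
    then show ?thesis using r(2)[of m] I by auto
  qed
  have "\<exists>N. \<forall>m\<ge>N. \<forall>n\<ge>N. L2_norm \<Omega> (\<lambda>x. \<phi> (r m) x - \<phi> (r n) x) < e" if e: "e > 0" for e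
  proof -
    define c where "c = sqrt (2 ^ DIM('a)) * DIM('a) * (2 * B)"
    have "(\<lambda>j. c * (1/2) ^ j) \<longlonglongrightarrow> c * 0" by (intro tendsto_mult_left LIMSEQ_realpow_zero) auto
    then have "\<forall>\<^sub>F j in sequentially. c * (1/2)^j < e / 2" using e by (intro order_tendstoD(2)) auto
    then obtain j where j: "c * (1/2)^j < e / 2" by (auto simp: eventually_sequentially)
    define s where "s = L2_norm \<Omega> (\<lambda>x. 1 :: real) + 1"
    have s: "s > 0" unfolding s_def by (smt (verit) L2_norm_nonneg)
    define d where "d = e / 2 / s * cube_volume DIM('a) j"
    have d: "d > 0" using e s by (simp add: d_def)
    have "\<exists>N. \<forall>m\<ge>N. \<forall>n\<ge>N. \<bar>a (r m) (j, k) - a (r n) (j, k)\<bar> < d" if "k \<in> cell j ` \<Omega>" for k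
    proof -
      have "Cauchy (\<lambda>i. a (r i) (j, k))" using conv that by (auto intro: convergent_Cauchy)
      then show ?thesis using d by (auto simp: Cauchy_def dist_real_def)
    qed
    then obtain N where N: "\<And>k m n. k \<in> cell j ` \<Omega> \<Longrightarrow> m \<ge> N k \<Longrightarrow> n \<ge> N k \<Longrightarrow> \<bar>a (r m) (j, k) - a (r n) (j, k)\<bar> < d"
      by metis
    define M where "M = (\<Sum>k\<in>cell j ` \<Omega>. N k)"
    have NM: "N k \<le> M" if "k \<in> cell j ` \<Omega>" for k
      unfolding M_def by (rule member_le_sum[OF that]) (auto intro: finite_cells bounded_domain)
    show ?thesis
    proof (intro exI[of _ M] allI impI)
      fix m n assume mn: "M \<le> m" "M \<le> n"
      define \<psi> where "\<psi> = (\<lambda>x. \<phi> (r m) x - \<phi> (r n) x)"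
      have \<psi>: "test_fun \<Omega> \<psi>" unfolding \<psi>_def by (intro test_fun_diff \<phi>)
      have b\<psi>: "\<psi> \<in> borel_measurable borel" by (rule test_fun_borel[OF \<psi>])
      have g\<psi>: "L2_norm UNIV (grad \<psi>) \<le> 2 * B"
      proof -
        have "L2_norm \<Omega> (grad \<psi>) = H10_norm \<Omega> \<psi>" by (rule H10_norm_test[OF \<psi>, symmetric])
        also have "\<dots> = L2_norm \<Omega> (\<lambda>x. wgrad \<Omega> (\<phi> (r m)) x - wgrad \<Omega> (\<phi> (r n)) x)"
          unfolding \<psi>_def by (intro H10_norm_diff test_fun_H10 \<phi>)
        also have "\<dots> \<le> H10_norm \<Omega> (\<phi> (r m)) + H10_norm \<Omega> (\<phi> (r n))"
          using L2_norm_triangle[OF wgrad_L2[OF test_fun_H10(1)[OF \<phi>]] L2_scaleR[OF wgrad_L2[OF test_fun_H10(1)[OF \<phi>]], of "-1"], of "r m" "r n"]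
            L2_norm_scaleR[of \<Omega> "-1" "wgrad \<Omega> (\<phi> (r n))"]
          by (simp add: H10_norm_def)
        also have "\<dots> \<le> 2 * B" using B[of "r m"] B[of "r n"] by (simp add: H10_norm_test[OF \<phi>])
        finally show ?thesis using L2_norm_test_UNIV[OF open_domain \<psi>] by simp
      qed
      have avb: "average j \<psi> \<in> borel_measurable (lebesgue_on \<Omega>)"
        using average_borel[OF b\<psi>] by (intro measurable_restrict_space1) (simp add: measurable_completion)
      have av: "\<bar>average j \<psi> x\<bar> \<le> e / 2 / s" if x: "x \<in> \<Omega>" for x
      proof -
        have ind: "integrable lborel (\<lambda>y. \<phi> i y * indicator (cube j (cell j x)) y)" for i
        proof -
          have "integrable lborel (\<phi> i)" by (rule test_fun_integrable[OF \<phi>])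
          then show ?thesis
            by (rule Bochner_Integration.integrable_bound) (use b\<phi> in \<open>auto simp: indicator_def\<close>)
        qed
        have "(LINT y|lborel. \<psi> y * indicator (cube j (cell j x)) y) = a (r m) (j, cell j x) - a (r n) (j, cell j x)"
          using ind by (simp add: a_def \<psi>_def left_diff_distrib)
        then have "average j \<psi> x * cube_volume DIM('a) j = a (r m) (j, cell j x) - a (r n) (j, cell j x)"
          by (simp add: average_def)
        then have "\<bar>average j \<psi> x * cube_volume DIM('a) j\<bar> = \<bar>a (r m) (j, cell j x) - a (r n) (j, cell j x)\<bar>"
          by (rule arg_cong)
        then have "\<bar>average j \<psi> x\<bar> * cube_volume DIM('a) j = \<bar>a (r m) (j, cell j x) - a (r n) (j, cell j x)\<bar>"
          by (simp add: abs_mult)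
        also have "\<dots> \<le> d" using N[of "cell j x" m n] NM[of "cell j x"] mn x by fastforce
        finally have "\<bar>average j \<psi> x\<bar> * cube_volume DIM('a) j \<le> e / 2 / s * cube_volume DIM('a) j" by (simp add: d_def)
        then show ?thesis by (rule mult_right_le_imp_le) simp
      qed
      have cL2: "(\<lambda>x. (e / 2 / s) * 1) \<in> L2 \<Omega>" by (rule const_L2)
      have avI: "(\<lambda>x. (average j \<psi> x)\<^sup>2) \<in> borel_measurable (lebesgue_on \<Omega>)" using avb by measurable
      have avae: "AE x in lebesgue_on \<Omega>. (average j \<psi> x)\<^sup>2 \<le> (e / 2 / s)\<^sup>2"
      proof (rule AE_I2)
        fix x assume "x \<in> space (lebesgue_on \<Omega>)"
        then have "\<bar>average j \<psi> x\<bar>\<^sup>2 \<le> (e / 2 / s)\<^sup>2" using av by (intro power_mono) auto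
        then show "(average j \<psi> x)\<^sup>2 \<le> (e / 2 / s)\<^sup>2" by simp
      qed
      have avint: "integrable (lebesgue_on \<Omega>) (\<lambda>x. (average j \<psi> x)\<^sup>2)"
        by (rule Bochner_Integration.integrable_bound[OF L2_D(2)[OF const_L2[of "e / 2 / s"]] avI])
          (use avae e s in simp)
      have avL2: "average j \<psi> \<in> L2 \<Omega>" using avb avint by (simp add: L2_def)
      have avn: "L2_norm \<Omega> (average j \<psi>) \<le> e / 2"
      proof -
        have "(L2_norm \<Omega> (average j \<psi>))\<^sup>2 \<le> (L2_norm \<Omega> (\<lambda>x. (e / 2 / s) * 1))\<^sup>2"
          unfolding L2_norm_sq_int
          by (rule integral_mono_AE) (use avae avint L2_D(2)[OF cL2] e s in simp_all)
        then have "L2_norm \<Omega> (average j \<psi>) \<le> L2_norm \<Omega> (\<lambda>x. (e / 2 / s) * 1)"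
          by (rule power2_le_imp_le) simp
        also have "\<dots> = e / 2 / s * L2_norm \<Omega> (\<lambda>x. 1 :: real)"
          using e s by (subst L2_norm_cmult) auto
        also have "\<dots> \<le> e / 2 / s * s" using e s by (intro mult_left_mono) (auto simp: s_def)
        also have "\<dots> = e / 2" using s by simp
        finally show ?thesis .
      qed
      have dL2: "(\<lambda>x. \<psi> x - average j \<psi> x) \<in> L2 \<Omega>" by (intro L2_diff test_L2[OF \<psi>] avL2)
      have "L2_norm \<Omega> (\<lambda>x. \<psi> x - average j \<psi> x) \<le> L2_norm UNIV (\<lambda>x. \<psi> x - average j \<psi> x)"
      proof (rule power2_le_imp_le)
        note aL2 = average_estimate(1)[OF test_fun_UNIV[OF \<psi>], of j]
        have "(L2_norm \<Omega> (\<lambda>x. \<psi> x - average j \<psi> x))\<^sup>2 = (LINT x|lebesgue. indicator \<Omega> x *\<^sub>R (norm (\<psi> x - average j \<psi> x))\<^sup>2)"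
          unfolding L2_norm_sq_int by (rule integral_restrict_space) (use domain_sets in auto)
        also have "\<dots> \<le> (LINT x|lebesgue. (norm (\<psi> x - average j \<psi> x))\<^sup>2)"
          using L2_D(2)[OF aL2] by (intro integral_mono') (auto simp: lebesgue_on_UNIV_eq indicator_def)
        finally show "(L2_norm \<Omega> (\<lambda>x. \<psi> x - average j \<psi> x))\<^sup>2 \<le> (L2_norm UNIV (\<lambda>x. \<psi> x - average j \<psi> x))\<^sup>2"
          unfolding L2_norm_sq_int[of UNIV] by (simp add: lebesgue_on_UNIV_eq)
      qed simp
      also have "\<dots> \<le> sqrt (2 ^ DIM('a)) * DIM('a) / 2 ^ j * L2_norm UNIV (grad \<psi>)"
        by (rule average_estimate(2)[OF test_fun_UNIV[OF \<psi>]])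
      also have "\<dots> \<le> sqrt (2 ^ DIM('a)) * DIM('a) / 2 ^ j * (2 * B)" by (intro mult_left_mono g\<psi>) auto
      also have "\<dots> = c * (1/2)^j" by (simp add: c_def power_divide)
      finally have "L2_norm \<Omega> (\<lambda>x. \<psi> x - average j \<psi> x) < e / 2" using j by linarith
      moreover have "L2_norm \<Omega> \<psi> \<le> L2_norm \<Omega> (\<lambda>x. \<psi> x - average j \<psi> x) + L2_norm \<Omega> (average j \<psi>)"
        using L2_norm_triangle[OF dL2 avL2] by simp
      ultimately have "L2_norm \<Omega> \<psi> < e" using avn by linarith
      then show "L2_norm \<Omega> (\<lambda>x. \<phi> (r m) x - \<phi> (r n) x) < e" by (simp add: \<psi>_def)
    qed
  qed
  then show thesis using that r(1) by blast
qed

lemma not_AE_False: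
  assumes "\<Omega> \<noteq> {}" shows "\<not> (AE x in lebesgue_on \<Omega>. False)"
proof
  assume "AE x in lebesgue_on \<Omega>. False"
  then have "AE x in lebesgue. x \<in> \<Omega> \<longrightarrow> False"
    by (subst (asm) AE_restrict_space_iff) (use domain_sets in auto)
  then have "AE x in lebesgue. x \<notin> \<Omega>" by simp
  then have "negligible \<Omega>" using domain_sets
    by (subst negligible_iff_null_sets, subst null_sets_def) (auto simp: AE_iff_measurable[of \<Omega>] dest: AE_iff_measurable[THEN iffD1, rotated -1])
  then show False using open_not_negligible[OF open_domain assms] by simp
qed

text \<open>Otherwise the fundamental lemma would make the constant \<open>1\<close> vanish almost everywhere.\<close>

lemma nonzero_test_fun:
  assumes "\<Omega> \<noteq> {}"
  shows "\<exists>\<phi>. test_fun \<Omega> \<phi> \<and> L2_norm \<Omega> \<phi> \<noteq> 0"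
proof (rule ccontr)
  assume "\<not> (\<exists>\<phi>. test_fun \<Omega> \<phi> \<and> L2_norm \<Omega> \<phi> \<noteq> 0)"
  then have "L2_inner \<Omega> (\<lambda>x. 1) \<phi> = 0" if "test_fun \<Omega> \<phi>" for \<phi>
    using L2_Cauchy_Schwarz[OF const_L2[of 1] test_L2(1)[OF that]] that by auto
  then have "AE x in lebesgue_on \<Omega>. (1::real) = 0"
    by (intro fundamental_lemma[OF open_domain] L2_integrable const_L2) (simp add: L2_inner_def)
  then have "AE x in lebesgue_on \<Omega>. False" by simp
  then show False using not_AE_False[OF assms] by blast
qed

lemma H10_Rayleigh_from_test:
  assumes \<mu>: "\<And>\<phi>. test_fun \<Omega> \<phi> \<Longrightarrow> \<mu> * (L2_norm \<Omega> \<phi>)\<^sup>2 \<le> (L2_norm \<Omega> (grad \<phi>))\<^sup>2" and z: "z \<in> H10 \<Omega>"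
  shows "\<mu> * (L2_norm \<Omega> z)\<^sup>2 \<le> (L2_norm \<Omega> (wgrad \<Omega> z))\<^sup>2"
proof -
  obtain \<phi> where \<phi>: "\<And>k::nat. test_fun \<Omega> (\<phi> k)" "(\<lambda>k. L2_norm \<Omega> (\<lambda>x. \<phi> k x - z x)) \<longlonglongrightarrow> 0"
    "(\<lambda>k. L2_norm \<Omega> (\<lambda>x. grad (\<phi> k) x - wgrad \<Omega> z x)) \<longlonglongrightarrow> 0"
    by (rule H10_approx[OF z]) (rule that; assumption)
  have "(\<lambda>k. \<mu> * (L2_norm \<Omega> (\<phi> k))\<^sup>2) \<longlonglongrightarrow> \<mu> * (L2_norm \<Omega> z)\<^sup>2"
    by (intro tendsto_intros L2_norm_tendsto test_L2 \<phi> H10_L2 z)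
  moreover have "(\<lambda>k. (L2_norm \<Omega> (grad (\<phi> k)))\<^sup>2) \<longlonglongrightarrow> (L2_norm \<Omega> (wgrad \<Omega> z))\<^sup>2"
    by (intro tendsto_intros L2_norm_tendsto test_L2 \<phi> wgrad_L2 z)
  ultimately show ?thesis by (rule LIMSEQ_le) (use \<mu> \<phi> in auto)
qed

text \<open>A minimising sequence of the Rayleigh quotient has a subsequence converging in \<open>L\<^sup>2\<close>. By the
  parallelogram law its gradients then converge as well, so the minimum is attained; its first
  variation is the eigenvalue equation.\<close>

theorem first_eigenvalue:
  assumes ne: "\<Omega> \<noteq> {}"
  shows "first_dirichlet_eigenvalue \<Omega> > 0"
    and "\<And>z. z \<in> H10 \<Omega> \<Longrightarrow> first_dirichlet_eigenvalue \<Omega> * (L2_norm \<Omega> z)\<^sup>2 \<le> (L2_norm \<Omega> (wgrad \<Omega> z))\<^sup>2"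
proof -
  obtain R where R: "R > 0" "\<And>x. x \<in> \<Omega> \<Longrightarrow> norm x < R" by (rule domain_radius) (rule that; assumption)
  define Q where "Q = {(L2_norm \<Omega> (grad \<phi>))\<^sup>2 | \<phi>. test_fun \<Omega> \<phi> \<and> L2_norm \<Omega> \<phi> = 1}"
  define \<mu> where "\<mu> = Inf Q"
  have normal: "test_fun \<Omega> (\<lambda>x. (1 / L2_norm \<Omega> \<phi>) * \<phi> x) \<and> L2_norm \<Omega> (\<lambda>x. (1 / L2_norm \<Omega> \<phi>) * \<phi> x) = 1
      \<and> (L2_norm \<Omega> (grad (\<lambda>x. (1 / L2_norm \<Omega> \<phi>) * \<phi> x)))\<^sup>2 = (L2_norm \<Omega> (grad \<phi>))\<^sup>2 / (L2_norm \<Omega> \<phi>)\<^sup>2"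
    if \<phi>: "test_fun \<Omega> \<phi>" and n: "L2_norm \<Omega> \<phi> \<noteq> 0" for \<phi>
  proof (intro conjI)
    show "test_fun \<Omega> (\<lambda>x. (1 / L2_norm \<Omega> \<phi>) * \<phi> x)" by (rule test_fun_cmult[OF \<phi>])
    show "L2_norm \<Omega> (\<lambda>x. (1 / L2_norm \<Omega> \<phi>) * \<phi> x) = 1" using n unfolding L2_norm_cmult by simp
    have "grad (\<lambda>x. (1 / L2_norm \<Omega> \<phi>) * \<phi> x) = (\<lambda>x. (1 / L2_norm \<Omega> \<phi>) *\<^sub>R grad \<phi> x)"
      by (rule ext, rule grad_cmult[OF test_fun_differentiable[OF \<phi>]])
    then show "(L2_norm \<Omega> (grad (\<lambda>x. (1 / L2_norm \<Omega> \<phi>) * \<phi> x)))\<^sup>2 = (L2_norm \<Omega> (grad \<phi>))\<^sup>2 / (L2_norm \<Omega> \<phi>)\<^sup>2"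
      by (simp only: L2_norm_scaleR) (simp add: power_mult_distrib power_divide)
  qed
  have Qne: "Q \<noteq> {}"
  proof -
    obtain \<phi> where "test_fun \<Omega> \<phi>" "L2_norm \<Omega> \<phi> \<noteq> 0" using nonzero_test_fun[OF ne] by blast
    then show ?thesis unfolding Q_def using normal by blast
  qed
  have Qlb: "1 / (2 * R)\<^sup>2 \<le> q" if qQ: "q \<in> Q" for q
  proof -
    obtain \<phi> where \<phi>: "test_fun \<Omega> \<phi>" "L2_norm \<Omega> \<phi> = 1" "q = (L2_norm \<Omega> (grad \<phi>))\<^sup>2" using qQ unfolding Q_def by blast
    have "1 \<le> (2 * R) * L2_norm \<Omega> (grad \<phi>)" using Poincare_test[OF open_domain R(2,1) \<phi>(1)] \<phi>(2) by simp
    then have "1\<^sup>2 \<le> ((2 * R) * L2_norm \<Omega> (grad \<phi>))\<^sup>2" by (intro power_mono) auto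
    then have "1 \<le> (2*R)\<^sup>2 * q" unfolding \<phi>(3) power_mult_distrib[of "2 * R"] by simp
    then show ?thesis using R(1) by (simp add: field_simps)
  qed
  have bdd: "bdd_below Q" using Qlb by (auto simp: bdd_below_def)
  have "1 / (2 * R)\<^sup>2 \<le> \<mu>" unfolding \<mu>_def by (rule cInf_greatest[OF Qne Qlb])
  moreover have "1 / (2 * R)\<^sup>2 > 0" using R by simp
  ultimately have \<mu>pos: "\<mu> > 0" by linarith
  have test_R: "\<mu> * (L2_norm \<Omega> \<phi>)\<^sup>2 \<le> (L2_norm \<Omega> (grad \<phi>))\<^sup>2" if \<phi>: "test_fun \<Omega> \<phi>" for \<phi>
  proof (cases "L2_norm \<Omega> \<phi> = 0")
    case False
    have "(L2_norm \<Omega> (grad \<phi>))\<^sup>2 / (L2_norm \<Omega> \<phi>)\<^sup>2 \<in> Q"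
      unfolding Q_def using normal[OF \<phi> False] by (metis (mono_tags, lifting) mem_Collect_eq)
    then have "\<mu> \<le> (L2_norm \<Omega> (grad \<phi>))\<^sup>2 / (L2_norm \<Omega> \<phi>)\<^sup>2" unfolding \<mu>_def by (rule cInf_lower[OF _ bdd])
    then show ?thesis using False by (simp add: field_simps)
  qed simp
  have H10_R: "\<mu> * (L2_norm \<Omega> z)\<^sup>2 \<le> (L2_norm \<Omega> (wgrad \<Omega> z))\<^sup>2" if "z \<in> H10 \<Omega>" for z
    by (rule H10_Rayleigh_from_test[OF test_R that])
  have "\<exists>\<phi>. test_fun \<Omega> \<phi> \<and> L2_norm \<Omega> \<phi> = 1 \<and> (L2_norm \<Omega> (grad \<phi>))\<^sup>2 < \<mu> + 1 / real (Suc k)" for k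
  proof -
    have "Inf Q < \<mu> + 1 / real (Suc k)" unfolding \<mu>_def by simp
    then obtain q where "q \<in> Q" "q < \<mu> + 1 / real (Suc k)" using cInf_less_iff[OF Qne bdd] by blast
    then show ?thesis unfolding Q_def by blast
  qed
  then obtain \<phi> :: "nat \<Rightarrow> 'a \<Rightarrow> real" where \<phi>: "\<And>k. test_fun \<Omega> (\<phi> k)" "\<And>k. L2_norm \<Omega> (\<phi> k) = 1"
      "\<And>k. (L2_norm \<Omega> (grad (\<phi> k)))\<^sup>2 < \<mu> + 1 / real (Suc k)"
    by metis
  have B: "L2_norm \<Omega> (grad (\<phi> k)) \<le> sqrt (\<mu> + 1)" for k
  proof (rule real_le_rsqrt)
    have "1 / real (Suc k) \<le> 1" by simp
    then show "(L2_norm \<Omega> (grad (\<phi> k)))\<^sup>2 \<le> \<mu> + 1" using \<phi>(3)[of k] by linarith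
  qed
  obtain r :: "nat \<Rightarrow> nat" where r: "strict_mono r"
    "\<And>e. e > 0 \<Longrightarrow> \<exists>N. \<forall>m\<ge>N. \<forall>n\<ge>N. L2_norm \<Omega> (\<lambda>x. \<phi> (r m) x - \<phi> (r n) x) < e"
    by (rule Rellich_test[OF \<phi>(1) B]) (rule that; assumption)
  define f where "f = (\<lambda>k. \<phi> (r k))"
  have f: "test_fun \<Omega> (f k)" "L2_norm \<Omega> (f k) = 1" for k by (simp_all add: f_def \<phi>)
  have f3: "(L2_norm \<Omega> (grad (f k)))\<^sup>2 < \<mu> + 1 / real (Suc k)" for k
  proof -
    have "k \<le> r k" by (rule seq_suble[OF r(1)])
    then have "1 / real (Suc (r k)) \<le> 1 / real (Suc k)" by (simp add: frac_le)
    then show ?thesis using \<phi>(3)[of "r k"] by (simp add: f_def)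
  qed
  have gradC: "(L2_norm \<Omega> (\<lambda>x. grad (f m) x - grad (f n) x))\<^sup>2
      \<le> 2 / real (Suc m) + 2 / real (Suc n) + \<mu> * (L2_norm \<Omega> (\<lambda>x. f m x - f n x))\<^sup>2" for m n
  proof -
    note L = test_L2[OF f(1)]
    have par: "(L2_norm \<Omega> (\<lambda>x. a x - b x))\<^sup>2 = 2 * (L2_norm \<Omega> a)\<^sup>2 + 2 * (L2_norm \<Omega> b)\<^sup>2 - (L2_norm \<Omega> (\<lambda>x. a x + b x))\<^sup>2"
      if "a \<in> L2 \<Omega>" "b \<in> L2 \<Omega>" for a b :: "'a \<Rightarrow> 'b::euclidean_space"
      using L2_norm_add_sq[OF that] L2_norm_diff_sq[OF that] by simp
    have "grad (\<lambda>x. f m x + f n x) = (\<lambda>x. grad (f m) x + grad (f n) x)"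
      by (rule ext, rule grad_add) (rule test_fun_differentiable[OF f(1)])+
    then have "\<mu> * (L2_norm \<Omega> (\<lambda>x. f m x + f n x))\<^sup>2 \<le> (L2_norm \<Omega> (\<lambda>x. grad (f m) x + grad (f n) x))\<^sup>2"
      using test_R[OF test_fun_add[OF f(1)[of m] f(1)[of n]]] by simp
    moreover have "(L2_norm \<Omega> (\<lambda>x. f m x + f n x))\<^sup>2 = 4 - (L2_norm \<Omega> (\<lambda>x. f m x - f n x))\<^sup>2"
      using par[OF L(1)[of m] L(1)[of n]] f by simp
    ultimately have "(L2_norm \<Omega> (\<lambda>x. grad (f m) x + grad (f n) x))\<^sup>2 \<ge> 4 * \<mu> - \<mu> * (L2_norm \<Omega> (\<lambda>x. f m x - f n x))\<^sup>2"
      by (simp add: algebra_simps)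
    moreover have "2 * (L2_norm \<Omega> (grad (f i)))\<^sup>2 \<le> 2 * \<mu> + 2 / real (Suc i)" for i
      using f3[of i] by (simp add: field_simps)
    ultimately show ?thesis using par[OF L(2)[of m] L(2)[of n]] by (smt (verit))
  qed
  have cauchyG: "\<exists>N. \<forall>m\<ge>N. \<forall>n\<ge>N. L2_norm \<Omega> (\<lambda>x. grad (f m) x - grad (f n) x) < e" if e: "e > 0" for e
  proof -
    define d where "d = e / sqrt (4 * \<mu>)"
    have d: "d > 0" using e \<mu>pos by (simp add: d_def)
    have d2: "\<mu> * d\<^sup>2 = e\<^sup>2 / 4" using \<mu>pos by (simp add: d_def power_divide)
    obtain N where N: "\<forall>m\<ge>N. \<forall>n\<ge>N. L2_norm \<Omega> (\<lambda>x. f m x - f n x) < d" using r(2)[OF d] unfolding f_def by blast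
    obtain N' where N': "N' > 0" "8 / e\<^sup>2 < real N'"
    proof -
      obtain n where "8 / e\<^sup>2 < real n" using reals_Archimedean2 by blast
      moreover have "0 < 8 / e\<^sup>2" using e by simp
      ultimately show thesis using that[of n] by (metis less_trans of_nat_0_less_iff)
    qed
    have small: "2 / real (Suc i) < e\<^sup>2 / 4" if "i \<ge> N'" for i
    proof -
      have "8 / e\<^sup>2 < real (Suc i)" using N' that by linarith
      then show ?thesis using e by (simp add: field_simps)
    qed
    show ?thesis
    proof (intro exI[of _ "max N N'"] allI impI)
      fix m n assume mn: "max N N' \<le> m" "max N N' \<le> n"
      have "(L2_norm \<Omega> (\<lambda>x. f m x - f n x))\<^sup>2 \<le> d\<^sup>2" using N mn by (intro power_mono) (auto intro: less_imp_le)
      then have "\<mu> * (L2_norm \<Omega> (\<lambda>x. f m x - f n x))\<^sup>2 \<le> e\<^sup>2 / 4"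
        using mult_left_mono[of _ "d\<^sup>2" \<mu>] \<mu>pos d2 by simp
      then have "(L2_norm \<Omega> (\<lambda>x. grad (f m) x - grad (f n) x))\<^sup>2 < e\<^sup>2"
      proof -
        have "2 / real (Suc m) < e\<^sup>2 / 4" "2 / real (Suc n) < e\<^sup>2 / 4" by (rule small, use mn in simp)+
        moreover have "e\<^sup>2 > 0" using e by simp
        ultimately show ?thesis using gradC[of m n] \<open>\<mu> * _ \<le> e\<^sup>2 / 4\<close> by linarith
      qed
      then show "L2_norm \<Omega> (\<lambda>x. grad (f m) x - grad (f n) x) < e"
        by (rule power2_less_imp_less) (use e in simp)
    qed
  qed
  obtain z where z: "z \<in> L2 \<Omega>" "(\<lambda>k. L2_norm \<Omega> (\<lambda>x. f k x - z x)) \<longlonglongrightarrow> 0"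
    by (rule L2_complete[of f \<Omega>]) (use test_L2(1)[OF f(1)] r(2) in \<open>auto simp: f_def\<close>)
  obtain G where G: "G \<in> L2 \<Omega>" "(\<lambda>k. L2_norm \<Omega> (\<lambda>x. grad (f k) x - G x)) \<longlonglongrightarrow> 0"
    by (rule L2_complete[of "\<lambda>k. grad (f k)" \<Omega>]) (use test_L2(2)[OF f(1)] cauchyG in auto)
  have zH: "z \<in> H10 \<Omega>" and wz: "AE x in lebesgue_on \<Omega>. wgrad \<Omega> z x = G x"
    by (rule H10_limitI[OF f(1) z(1) G(1) z(2) G(2)])+
  have nz: "L2_norm \<Omega> z = 1"
  proof -
    have "(\<lambda>k. L2_norm \<Omega> (f k)) \<longlonglongrightarrow> L2_norm \<Omega> z" by (intro L2_norm_tendsto test_L2 f z)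
    then show ?thesis using f(2) by (simp add: LIMSEQ_const_iff)
  qed
  have nG: "(L2_norm \<Omega> (wgrad \<Omega> z))\<^sup>2 = \<mu>"
  proof (rule antisym)
    have "L2_norm \<Omega> (wgrad \<Omega> z) = L2_norm \<Omega> G" by (rule L2_norm_cong_AE[OF wz wgrad_L2[OF zH] G(1)])
    moreover have "(\<lambda>k. (L2_norm \<Omega> (grad (f k)))\<^sup>2) \<longlonglongrightarrow> (L2_norm \<Omega> G)\<^sup>2"
      by (intro tendsto_intros L2_norm_tendsto test_L2 f G)
    moreover have "(\<lambda>k. \<mu> + 1 / real (Suc k)) \<longlonglongrightarrow> \<mu> + 0"
      using LIMSEQ_inverse_real_of_nat by (intro tendsto_add tendsto_const) (simp add: inverse_eq_divide)
    ultimately show "(L2_norm \<Omega> (wgrad \<Omega> z))\<^sup>2 \<le> \<mu>"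
      using LIMSEQ_le[of "\<lambda>k. (L2_norm \<Omega> (grad (f k)))\<^sup>2" "(L2_norm \<Omega> G)\<^sup>2" "\<lambda>k. \<mu> + 1 / real (Suc k)" \<mu>] f3
      by (auto intro: less_imp_le)
    show "\<mu> \<le> (L2_norm \<Omega> (wgrad \<Omega> z))\<^sup>2" using H10_R[OF zH] nz by simp
  qed
  have "dirichlet_eigenvalue \<Omega> \<mu>"
    unfolding dirichlet_eigenvalue_def
  proof (intro bexI[of _ z] conjI ballI)
    fix v assume v: "v \<in> H10 \<Omega>"
    let ?b = "L2_inner \<Omega> (wgrad \<Omega> z) (wgrad \<Omega> v) - \<mu> * L2_inner \<Omega> z v"
    have "0 \<le> 0 + 2 * t * ?b + t\<^sup>2 * ((L2_norm \<Omega> (wgrad \<Omega> v))\<^sup>2 - \<mu> * (L2_norm \<Omega> v)\<^sup>2)" for t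
    proof -
      note L = H10_L2[OF zH] H10_L2[OF v] wgrad_L2[OF zH] wgrad_L2[OF v]
      have "\<mu> * (L2_norm \<Omega> (\<lambda>x. z x + t * v x))\<^sup>2 \<le> (L2_norm \<Omega> (\<lambda>x. wgrad \<Omega> z x + t *\<^sub>R wgrad \<Omega> v x))\<^sup>2"
        using H10_R[OF H10_lin(1)[OF zH v, of t]] H10_norm_lin[OF zH v, of t] by (simp add: H10_norm_def)
      also have "\<dots> = \<mu> + 2 * t * L2_inner \<Omega> (wgrad \<Omega> z) (wgrad \<Omega> v) + t\<^sup>2 * (L2_norm \<Omega> (wgrad \<Omega> v))\<^sup>2"
        using L2_norm_add_sq[OF L(3) L2_scaleR[OF L(4)], of t] nG L2_inner_scaleR_left[of \<Omega> t "wgrad \<Omega> v" "wgrad \<Omega> z"]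
        by (simp add: L2_inner_commute[of \<Omega> "wgrad \<Omega> z"] L2_norm_scaleR power_mult_distrib)
      also have "(L2_norm \<Omega> (\<lambda>x. z x + t * v x))\<^sup>2 = 1 + 2 * t * L2_inner \<Omega> z v + t\<^sup>2 * (L2_norm \<Omega> v)\<^sup>2"
        using L2_norm_add_sq[OF L(1) L2_cmult[OF L(2)], of t] nz
        by (simp add: L2_inner_cmult_right L2_norm_cmult power_mult_distrib)
      finally show ?thesis by (simp add: algebra_simps)
    qed
    from nonneg_quadratic_imp_discriminant[OF this] show "L2_inner \<Omega> (wgrad \<Omega> z) (wgrad \<Omega> v) = \<mu> * L2_inner \<Omega> z v"
      by simp
  qed (use zH nz in auto)
  moreover have "\<mu> \<le> \<nu>" if ev: "dirichlet_eigenvalue \<Omega> \<nu>" for \<nu>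
  proof -
    obtain v where v: "v \<in> H10 \<Omega>" "L2_norm \<Omega> v \<noteq> 0" "L2_inner \<Omega> (wgrad \<Omega> v) (wgrad \<Omega> v) = \<nu> * L2_inner \<Omega> v v"
      using ev unfolding dirichlet_eigenvalue_def by blast
    then have "\<mu> * (L2_norm \<Omega> v)\<^sup>2 \<le> \<nu> * (L2_norm \<Omega> v)\<^sup>2" using H10_R[OF v(1)] by (simp add: L2_norm_sq)
    then show ?thesis using v(2) by (simp add: mult_right_le_imp_le)
  qed
  ultimately have "first_dirichlet_eigenvalue \<Omega> = \<mu>"
    unfolding first_dirichlet_eigenvalue_def by (intro cInf_eq_minimum) auto
  then show "first_dirichlet_eigenvalue \<Omega> > 0"
    and "\<And>z. z \<in> H10 \<Omega> \<Longrightarrow> first_dirichlet_eigenvalue \<Omega> * (L2_norm \<Omega> z)\<^sup>2 \<le> (L2_norm \<Omega> (wgrad \<Omega> z))\<^sup>2"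
    using \<mu>pos H10_R by auto
qed

end

section \<open>The subcritical Sobolev inequality\<close>

lemma average_step:
  fixes \<phi> :: "'a::euclidean_space \<Rightarrow> real"
  assumes \<phi>: "test_fun UNIV \<phi>"
  shows "\<bar>average (Suc j) \<phi> x - average j \<phi> x\<bar>
     \<le> sqrt ((2 ^ Suc j) ^ DIM('a)) * (sqrt (2 ^ DIM('a)) * DIM('a) / 2 ^ j * L2_norm UNIV (grad \<phi>))"
proof -
  let ?I = "indicator (cube (Suc j) (cell (Suc j) x)) :: 'a \<Rightarrow> real"
  have [measurable]: "\<phi> \<in> borel_measurable borel" by (rule test_fun_borel[OF \<phi>])
  note aL2 = average_estimate[OF \<phi>, of j]
  have avg: "average j \<phi> y = average j \<phi> x" if "y \<in> cube (Suc j) (cell (Suc j) x)" for y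
  proof -
    have "cell j y = cell j x" using that cell_Suc_imp[of j y x] by (simp add: cube_def)
    then show ?thesis by (simp add: average_def)
  qed
  have int: "integrable lborel (\<lambda>y. \<phi> y * ?I y)" "integrable lborel (\<lambda>y. average j \<phi> x * ?I y)"
  proof -
    show "integrable lborel (\<lambda>y. \<phi> y * ?I y)"
      by (rule Bochner_Integration.integrable_bound[OF test_fun_integrable[OF \<phi>]]) (auto simp: indicator_def)
    show "integrable lborel (\<lambda>y. average j \<phi> x * ?I y)"
      by (intro integrable_mult_right integrable_real_indicator) (auto simp: emeasure_cube)
  qed
  have "(LINT y|lborel. (\<phi> y - average j \<phi> y) * ?I y) = (LINT y|lborel. \<phi> y * ?I y - average j \<phi> x * ?I y)"
    by (intro Bochner_Integration.integral_cong) (auto simp: indicator_def avg)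
  also have "\<dots> = (LINT y|lborel. \<phi> y * ?I y) - average j \<phi> x * cube_volume DIM('a) (Suc j)"
    using int by (simp add: measure_def emeasure_cube)
  finally have "average (Suc j) (\<lambda>y. \<phi> y - average j \<phi> y) x = average (Suc j) \<phi> x - average j \<phi> x"
    unfolding average_def[of "Suc j"] by (simp only: diff_divide_distrib) simp
  then have "\<bar>average (Suc j) \<phi> x - average j \<phi> x\<bar> \<le> sqrt ((2 ^ Suc j) ^ DIM('a)) * L2_norm UNIV (\<lambda>y. \<phi> y - average j \<phi> y)"
    using average_abs_le[OF aL2(1), of "Suc j" x] by simp
  also have "\<dots> \<le> sqrt ((2 ^ Suc j) ^ DIM('a)) * (sqrt (2 ^ DIM('a)) * DIM('a) / 2 ^ j * L2_norm UNIV (grad \<phi>))"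
    by (intro mult_left_mono aL2(2)) auto
  finally show ?thesis .
qed

context bounded_open_domain
begin

text \<open>Consecutive averages differ by \<open>O(2\<^bsup>(n/2-1)j\<^esup>)\<close>, and these differences are summed over the levels.
  For \<open>n \<le> 2\<close> the exponent is not positive, hence the freedom to enlarge it to some \<open>\<alpha> > 0\<close>.\<close>

lemma average_sup_bound:
  assumes \<alpha>: "\<alpha> > 0" "\<alpha> \<ge> real DIM('a) / 2 - 1"
  obtains c where "c > 0" "\<And>\<phi> j x. test_fun \<Omega> \<phi> \<Longrightarrow> \<bar>average j \<phi> x\<bar> \<le> c * (2 powr \<alpha>) ^ j * L2_norm \<Omega> (grad \<phi>)"
proof -
  obtain R where R: "R > 0" "\<And>x. x \<in> \<Omega> \<Longrightarrow> norm x < R" by (rule domain_radius) (rule that; assumption)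
  let ?n = "DIM('a)"
  define q where "q = 2 powr \<alpha>"
  have q: "q > 1" using \<alpha>(1) by (simp add: q_def)
  define A where "A = sqrt (2 ^ ?n) * (sqrt (2 ^ ?n) * ?n)"
  define c where "c = 2 * R + A / (q - 1)"
  have A: "A > 0" by (simp add: A_def)
  have c: "c > 0" using A q R by (simp add: c_def add_pos_pos)
  have "c * (q - 1) = 2 * R * (q - 1) + A" using q by (simp add: c_def distrib_right)
  moreover have "0 \<le> 2 * R * (q - 1)" using R q by simp
  ultimately have cq: "A \<le> c * (q - 1)" by linarith
  have rate: "sqrt ((2 ^ Suc j) ^ ?n) / 2 ^ j \<le> sqrt (2 ^ ?n) * q ^ j" for j
  proof -
    have "sqrt ((2 ^ Suc j) ^ ?n) = sqrt (2 ^ ?n) * sqrt ((2 ^ j) ^ ?n)"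
      by (simp add: power_mult_distrib real_sqrt_mult)
    moreover have bound: "sqrt ((2 ^ j) ^ ?n) / 2 ^ j \<le> q ^ j"
    proof -
      have "sqrt ((2 ^ j) ^ ?n) = (2 ^ (j * ?n)) powr (1 / 2)"
        by (simp add: powr_half_sqrt power_mult)
      also have "\<dots> = 2 powr (real j * real ?n / 2)"
        by (simp add: powr_realpow[symmetric] powr_powr)
      finally have "sqrt ((2 ^ j) ^ ?n) / 2 ^ j = 2 powr (real j * real ?n / 2) / 2 powr real j"
        by (simp add: powr_realpow)
      also have "\<dots> = 2 powr (real j * (real ?n / 2 - 1))" by (simp add: powr_diff[symmetric] algebra_simps)
      also have "\<dots> \<le> 2 powr (real j * \<alpha>)" using \<alpha>(2) by (intro powr_mono mult_left_mono) auto
      also have "\<dots> = q ^ j" by (simp add: q_def powr_powr[symmetric] powr_realpow mult.commute)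
      finally show ?thesis .
    qed
    ultimately show ?thesis using mult_left_mono[OF bound, of "sqrt (2 ^ ?n)"] by simp
  qed
  have "\<bar>average j \<phi> x\<bar> \<le> c * q ^ j * L2_norm \<Omega> (grad \<phi>)" if \<phi>: "test_fun \<Omega> \<phi>" for j \<phi> x
  proof (induction j)
    case 0
    have "\<phi> \<in> L2 UNIV" using test_fun_translate_L2[OF test_fun_UNIV[OF \<phi>], of 0] by simp
    then have "\<bar>average 0 \<phi> x\<bar> \<le> L2_norm UNIV \<phi>" using average_abs_le[of \<phi> 0 x] test_fun_borel[OF \<phi>] by simp
    also have "\<dots> \<le> 2 * R * L2_norm \<Omega> (grad \<phi>)"
      using Poincare_test[OF open_domain R(2,1) \<phi>] L2_norm_test_UNIV[OF open_domain \<phi>] by simp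
    also have "\<dots> \<le> c * L2_norm \<Omega> (grad \<phi>)" using A q by (intro mult_right_mono) (auto simp: c_def)
    finally show ?case by simp
  next
    case (Suc j)
    let ?g = "L2_norm \<Omega> (grad \<phi>)"
    have "\<bar>average (Suc j) \<phi> x - average j \<phi> x\<bar>
        \<le> sqrt ((2 ^ Suc j) ^ ?n) * (sqrt (2 ^ ?n) * ?n / 2 ^ j * ?g)"
      using average_step[OF test_fun_UNIV[OF \<phi>]] L2_norm_test_UNIV[OF open_domain \<phi>] by simp
    also have "\<dots> = (sqrt ((2 ^ Suc j) ^ ?n) / 2 ^ j) * (sqrt (2 ^ ?n) * ?n * ?g)" by simp
    also have "\<dots> \<le> (sqrt (2 ^ ?n) * q ^ j) * (sqrt (2 ^ ?n) * ?n * ?g)"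
      by (intro mult_right_mono rate) auto
    also have "\<dots> = A * q ^ j * ?g" by (simp add: A_def)
    also have "\<dots> \<le> c * (q - 1) * q ^ j * ?g" using cq q by (intro mult_right_mono) auto
    finally have "\<bar>average (Suc j) \<phi> x\<bar> \<le> c * q ^ j * ?g + c * (q - 1) * q ^ j * ?g" using Suc by linarith
    also have "\<dots> = c * q ^ Suc j * ?g" by (simp add: algebra_simps)
    finally show ?case .
  qed
  then show thesis using that[OF c] by (simp add: q_def)
qed

text \<open>Let \<open>\<Lambda>\<^sub>j\<close> be the bound for the averages of level \<open>j\<close>. Where \<open>2 \<Lambda>\<^sub>j < \<bar>\<phi>\<bar> \<le> 2 \<Lambda>\<^sub>j\<^sub>+\<^sub>1\<close>, at least
  half of \<open>\<bar>\<phi>\<bar>\<close> comes from the difference to the average, whose \<open>L\<^sup>2\<close> norm is \<open>O(2\<^sup>-\<^sup>j)\<close>. The sum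
  of \<open>\<Lambda>\<^sub>j\<^sub>+\<^sub>1\<^bsup>Q-2\<^esup> 4\<^sup>-\<^sup>j\<close> over \<open>j\<close> is geometric with ratio \<open>2\<^bsup>\<alpha>(Q-2)\<^esup> / 4 < 1\<close>; for \<open>\<alpha> = n/2 - 1\<close>
  this condition reads \<open>Q < 2n/(n-2)\<close>.\<close>

lemma Sobolev_test:
  assumes \<alpha>: "\<alpha> > 0" "\<alpha> \<ge> real DIM('a) / 2 - 1" and Q: "Q > 2" "\<alpha> * (Q - 2) < 2"
  obtains K where "K > 0" "\<And>\<phi> G. test_fun \<Omega> \<phi> \<Longrightarrow> G > 0 \<Longrightarrow> L2_norm \<Omega> (grad \<phi>) \<le> G \<Longrightarrow>
     (\<integral>\<^sup>+x. ennreal (\<bar>\<phi> x\<bar> powr Q) \<partial>lborel) \<le> ennreal (K * G powr Q)"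
proof -
  let ?n = "DIM('a)"
  obtain R where R: "R > 0" "\<And>x. x \<in> \<Omega> \<Longrightarrow> norm x < R" by (rule domain_radius) (rule that; assumption)
  obtain c where c: "c > 0" "\<And>\<phi> j x. test_fun \<Omega> \<phi> \<Longrightarrow> \<bar>average j \<phi> x\<bar> \<le> c * (2 powr \<alpha>) ^ j * L2_norm \<Omega> (grad \<phi>)"
    by (rule average_sup_bound[OF \<alpha>]) (rule that; assumption)
  define q where "q = 2 powr \<alpha>"
  have q: "q > 1" using \<alpha>(1) by (simp add: q_def)
  define s where "s = sqrt (2 ^ ?n) * ?n"
  define \<rho> where "\<rho> = q powr (Q - 2) / 4"
  have \<rho>: "0 < \<rho>" "\<rho> < 1"
  proof -
    show "0 < \<rho>" using q by (simp add: \<rho>_def)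
    have "q powr (Q - 2) < 2 powr 2" unfolding q_def powr_powr using Q by (intro powr_less_mono) auto
    then show "\<rho> < 1" by (simp add: \<rho>_def)
  qed
  define a where "a = (2 * c) powr (Q - 2)"
  define b where "b = a * q powr (Q - 2) * 4 * s\<^sup>2"
  have ab: "a > 0" "b \<ge> 0" using c(1) q by (simp_all add: a_def b_def)
  define K where "K = a * (2 * R)\<^sup>2 + b * (\<Sum>j. \<rho> ^ j)"
  have K: "K > 0"
    unfolding K_def using ab R \<rho> by (intro add_pos_nonneg mult_nonneg_nonneg suminf_nonneg summable_geometric) auto
  have "(\<integral>\<^sup>+x. ennreal (\<bar>\<phi> x\<bar> powr Q) \<partial>lborel) \<le> ennreal (K * G powr Q)"
    if \<phi>: "test_fun \<Omega> \<phi>" and G: "G > 0" "L2_norm \<Omega> (grad \<phi>) \<le> G" for \<phi> G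
  proof -
    have [measurable]: "\<phi> \<in> borel_measurable borel" by (rule test_fun_borel[OF \<phi>])
    note \<phi>U = test_fun_UNIV[OF \<phi>]
    have \<phi>L2: "\<phi> \<in> L2 UNIV" using test_fun_translate_L2[OF \<phi>U, of 0] by simp
    define \<Lambda> where "\<Lambda> = (\<lambda>j. c * q ^ j * G)"
    have av: "\<bar>average j \<phi> x\<bar> \<le> \<Lambda> j" for j x
    proof -
      have "\<bar>average j \<phi> x\<bar> \<le> c * q ^ j * L2_norm \<Omega> (grad \<phi>)" unfolding q_def by (rule c(2)[OF \<phi>])
      also have "\<dots> \<le> \<Lambda> j" unfolding \<Lambda>_def using c q G by (intro mult_left_mono) auto
      finally show ?thesis .
    qed
    have \<Lambda>Q: "(2 * \<Lambda> j) powr (Q - 2) = a * (q powr (Q - 2)) ^ j * G powr (Q - 2)" for j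
    proof -
      have "(q ^ j) powr (Q - 2) = (q powr (Q - 2)) ^ j"
        using q by (simp add: powr_realpow[symmetric] powr_powr mult.commute)
      moreover have "2 * \<Lambda> j = (2 * c) * (q ^ j * G)" by (simp add: \<Lambda>_def)
      ultimately show ?thesis using c q G by (simp add: powr_mult a_def)
    qed
    let ?T = "\<lambda>j x. ennreal ((2 * \<Lambda> (Suc j)) powr (Q - 2) * 4) * ennreal ((\<phi> x - average j \<phi> x)\<^sup>2)"
    have pt: "ennreal (\<bar>\<phi> x\<bar> powr Q) \<le> ennreal ((2 * \<Lambda> 0) powr (Q - 2)) * ennreal ((\<phi> x)\<^sup>2) + (\<Sum>j. ?T j x)" for x
    proof -
      have split: "\<bar>\<phi> x\<bar> powr Q = \<bar>\<phi> x\<bar> powr (Q - 2) * (\<phi> x)\<^sup>2"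
        using powr_add[of "\<bar>\<phi> x\<bar>" "Q - 2" 2] by (cases "\<phi> x = 0") auto
      show ?thesis
      proof (cases "\<bar>\<phi> x\<bar> \<le> 2 * \<Lambda> 0")
        case True
        have "\<bar>\<phi> x\<bar> powr Q \<le> (2 * \<Lambda> 0) powr (Q - 2) * (\<phi> x)\<^sup>2"
          unfolding split using True Q by (intro mult_right_mono powr_mono2) auto
        then have "ennreal (\<bar>\<phi> x\<bar> powr Q) \<le> ennreal ((2 * \<Lambda> 0) powr (Q - 2)) * ennreal ((\<phi> x)\<^sup>2)"
          by (subst ennreal_mult[symmetric]) (auto intro: ennreal_leI)
        then show ?thesis by (rule order_trans) simp
      next
        case False
        have "\<exists>j. \<bar>\<phi> x\<bar> \<le> 2 * \<Lambda> j"
        proof -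
          obtain j where "\<bar>\<phi> x\<bar> / (2 * c * G) < q ^ j" using real_arch_pow[OF q] by blast
          then have "\<bar>\<phi> x\<bar> \<le> 2 * \<Lambda> j" using c G by (simp add: \<Lambda>_def field_simps)
          then show ?thesis by blast
        qed
        then obtain i where i: "\<bar>\<phi> x\<bar> \<le> 2 * \<Lambda> i" "\<And>k. k < i \<Longrightarrow> \<not> \<bar>\<phi> x\<bar> \<le> 2 * \<Lambda> k"
          using exists_least_iff[of "\<lambda>j. \<bar>\<phi> x\<bar> \<le> 2 * \<Lambda> j"] by blast
        then obtain j where j: "i = Suc j" using False by (cases i) auto
        have lo: "2 * \<Lambda> j < \<bar>\<phi> x\<bar>" and hi: "\<bar>\<phi> x\<bar> \<le> 2 * \<Lambda> (Suc j)" using i(1) i(2)[of j] j by auto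
        have "\<bar>\<phi> x\<bar> \<le> 2 * \<bar>\<phi> x - average j \<phi> x\<bar>" 
          using av[of j x] lo abs_triangle_ineq[of "\<phi> x - average j \<phi> x" "average j \<phi> x"] by simp
        then have "\<bar>\<phi> x\<bar>\<^sup>2 \<le> (2 * \<bar>\<phi> x - average j \<phi> x\<bar>)\<^sup>2" by (intro power_mono) auto
        then have "(\<phi> x)\<^sup>2 \<le> 4 * (\<phi> x - average j \<phi> x)\<^sup>2" by (simp add: power_mult_distrib)
        then have "\<bar>\<phi> x\<bar> powr Q \<le> (2 * \<Lambda> (Suc j)) powr (Q - 2) * (4 * (\<phi> x - average j \<phi> x)\<^sup>2)"
          unfolding split using hi Q by (intro mult_mono powr_mono2) auto
        then have "ennreal (\<bar>\<phi> x\<bar> powr Q) \<le> ?T j x"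
          by (subst ennreal_mult[symmetric]) (auto intro: ennreal_leI simp: mult.assoc)
        also have "\<dots> \<le> (\<Sum>j. ?T j x)"
          using sum_le_suminf[of "\<lambda>j. ?T j x" "{j}"] by simp
        finally show ?thesis by (rule order_trans) simp
      qed
    qed
    have "(\<integral>\<^sup>+x. ennreal (\<bar>\<phi> x\<bar> powr Q) \<partial>lborel)
       \<le> (\<integral>\<^sup>+x. ennreal ((2 * \<Lambda> 0) powr (Q - 2)) * ennreal ((\<phi> x)\<^sup>2) + (\<Sum>j. ?T j x) \<partial>lborel)"
      by (intro nn_integral_mono pt)
    also have "\<dots> = (\<integral>\<^sup>+x. ennreal ((2 * \<Lambda> 0) powr (Q - 2)) * ennreal ((\<phi> x)\<^sup>2) \<partial>lborel) + (\<integral>\<^sup>+x. (\<Sum>j. ?T j x) \<partial>lborel)"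
      by (rule nn_integral_add) measurable
    also have "(\<integral>\<^sup>+x. (\<Sum>j. ?T j x) \<partial>lborel) = (\<Sum>j. \<integral>\<^sup>+x. ?T j x \<partial>lborel)"
      by (rule nn_integral_suminf) measurable
    also have "(\<integral>\<^sup>+x. ennreal ((2 * \<Lambda> 0) powr (Q - 2)) * ennreal ((\<phi> x)\<^sup>2) \<partial>lborel)
        \<le> ennreal (a * (2 * R)\<^sup>2 * G powr Q)"
    proof -
      have "L2_norm UNIV \<phi> \<le> 2 * R * L2_norm \<Omega> (grad \<phi>)"
        using Poincare_test[OF open_domain R(2,1) \<phi>] L2_norm_test_UNIV[OF open_domain \<phi>] by simp
      also have "\<dots> \<le> 2 * R * G" using G R by (intro mult_left_mono) auto
      finally have "(L2_norm UNIV \<phi>)\<^sup>2 \<le> (2 * R * G)\<^sup>2" by (intro power_mono) auto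
      then have le: "(2 * \<Lambda> 0) powr (Q - 2) * (L2_norm UNIV \<phi>)\<^sup>2 \<le> (2 * \<Lambda> 0) powr (Q - 2) * (2 * R * G)\<^sup>2"
        by (intro mult_left_mono) auto
      have "G powr Q = G powr (Q - 2) * G\<^sup>2" using G powr_add[of G "Q - 2" 2] by simp
      then have "(2 * \<Lambda> 0) powr (Q - 2) * (2 * R * G)\<^sup>2 = a * (2 * R)\<^sup>2 * G powr Q"
        unfolding \<Lambda>Q by (simp add: power_mult_distrib)
      with le have "ennreal ((2 * \<Lambda> 0) powr (Q - 2) * (L2_norm UNIV \<phi>)\<^sup>2) \<le> ennreal (a * (2 * R)\<^sup>2 * G powr Q)"
        by (intro ennreal_leI) simp
      then show ?thesis
        by (subst nn_integral_cmult) (simp_all add: L2_norm_sq_nn_integral_UNIV[OF \<phi>L2] ennreal_mult)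
    qed
    also have "(\<Sum>j. \<integral>\<^sup>+x. ?T j x \<partial>lborel) \<le> (\<Sum>j. ennreal (b * G powr Q * \<rho> ^ j))"
    proof (rule suminf_le)
      fix j
      note aL2 = average_estimate[OF \<phi>U, of j]
      have "L2_norm UNIV (\<lambda>x. \<phi> x - average j \<phi> x) \<le> s / 2 ^ j * L2_norm UNIV (grad \<phi>)"
        using aL2(2) by (simp add: s_def)
      also have "\<dots> \<le> s / 2 ^ j * G"
        using G L2_norm_test_UNIV[OF open_domain \<phi>] by (intro mult_left_mono) (auto simp: s_def)
      finally have "(L2_norm UNIV (\<lambda>x. \<phi> x - average j \<phi> x))\<^sup>2 \<le> (s / 2 ^ j * G)\<^sup>2" by (intro power_mono) auto
      then have le: "(2 * \<Lambda> (Suc j)) powr (Q - 2) * 4 * (L2_norm UNIV (\<lambda>x. \<phi> x - average j \<phi> x))\<^sup>2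
         \<le> (2 * \<Lambda> (Suc j)) powr (Q - 2) * 4 * (s / 2 ^ j * G)\<^sup>2"
        by (intro mult_left_mono) auto
      have GQ: "G powr Q = G powr (Q - 2) * G\<^sup>2" using G powr_add[of G "Q - 2" 2] by simp
      have p4: "(2 ^ j)\<^sup>2 = (4::real) ^ j" 
        using power_mult[of "2::real" 2 j] power_mult[of "2::real" j 2] by (simp add: mult.commute)
      have eq: "(2 * \<Lambda> (Suc j)) powr (Q - 2) * 4 * (s / 2 ^ j * G)\<^sup>2 = b * G powr Q * \<rho> ^ j"
        unfolding \<Lambda>Q GQ b_def \<rho>_def by (simp add: power_mult_distrib power_divide p4)
      from order_trans[OF le eq_refl[OF eq]] have "ennreal ((2 * \<Lambda> (Suc j)) powr (Q - 2) * 4 * (L2_norm UNIV (\<lambda>x. \<phi> x - average j \<phi> x))\<^sup>2)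
          \<le> ennreal (b * G powr Q * \<rho> ^ j)"
        by (rule ennreal_leI)
      then show "(\<integral>\<^sup>+x. ?T j x \<partial>lborel) \<le> ennreal (b * G powr Q * \<rho> ^ j)"
        by (subst nn_integral_cmult) (simp_all add: L2_norm_sq_nn_integral_UNIV[OF aL2(1)] ennreal_mult)
    qed auto
    also have "(\<Sum>j. ennreal (b * G powr Q * \<rho> ^ j)) = ennreal (\<Sum>j. b * G powr Q * \<rho> ^ j)"
      by (rule suminf_ennreal2) (use ab \<rho> in \<open>auto intro!: summable_mult summable_geometric\<close>)
    also have "(\<Sum>j. b * G powr Q * \<rho> ^ j) = b * G powr Q * (\<Sum>j. \<rho> ^ j)"
      by (rule suminf_mult) (use \<rho> in \<open>auto intro!: summable_geometric\<close>)
    finally have "(\<integral>\<^sup>+x. ennreal (\<bar>\<phi> x\<bar> powr Q) \<partial>lborel)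
      \<le> ennreal (a * (2 * R)\<^sup>2 * G powr Q) + ennreal (b * G powr Q * (\<Sum>j. \<rho> ^ j))"
      by (simp add: add_mono)
    also have "\<dots> = ennreal (K * G powr Q)"
    proof -
      have "(\<Sum>j. \<rho> ^ j) \<ge> 0" using \<rho> by (intro suminf_nonneg summable_geometric) auto
      then show ?thesis unfolding K_def using ab by (subst ennreal_plus[symmetric]) (auto simp: algebra_simps)
    qed
    finally show ?thesis .
  qed
  then show thesis using that[OF K] by blast
qed

lemma L2_norm_zero_AE:
  assumes "f \<in> L2 \<Omega>" "L2_norm \<Omega> f = 0"
  shows "AE x in lebesgue_on \<Omega>. f x = 0"
proof -
  have "(LINT x|lebesgue_on \<Omega>. (norm (f x))\<^sup>2) = 0" using assms(2) L2_norm_sq_int[of \<Omega> f] by simp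
  then have "AE x in lebesgue_on \<Omega>. (norm (f x))\<^sup>2 = 0"
    using L2_D(2)[OF assms(1)] by (subst (asm) integral_nonneg_eq_0_iff_AE) auto
  then show ?thesis by simp
qed

lemma L2_convergent_AE_subseq:
  fixes f :: "nat \<Rightarrow> 'a \<Rightarrow> 'b::euclidean_space"
  assumes f: "\<And>k. f k \<in> L2 \<Omega>" and z: "z \<in> L2 \<Omega>" and lim: "(\<lambda>k. L2_norm \<Omega> (\<lambda>x. f k x - z x)) \<longlonglongrightarrow> 0"
  obtains r :: "nat \<Rightarrow> nat" where "strict_mono r" "AE x in lebesgue_on \<Omega>. (\<lambda>k. f (r k) x) \<longlonglongrightarrow> z x"
proof -
  have cauchy: "\<exists>N. \<forall>m\<ge>N. \<forall>n\<ge>N. L2_norm \<Omega> (\<lambda>x. f m x - f n x) < e" if e: "e > 0" for e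
  proof -
    obtain N where N: "\<And>k. k \<ge> N \<Longrightarrow> L2_norm \<Omega> (\<lambda>x. f k x - z x) < e / 2"
      using order_tendstoD(2)[OF lim, of "e/2"] e by (auto simp: eventually_sequentially)
    have "L2_norm \<Omega> (\<lambda>x. f m x - f n x) < e" if "m \<ge> N" "n \<ge> N" for m n
      using L2_norm_triangle_diff[OF f z f, of m n] N[OF that(1)] N[OF that(2)]
      by (simp add: L2_norm_diff_commute[of \<Omega> z])
    then show ?thesis by blast
  qed
  obtain g r where g: "g \<in> L2 \<Omega>" "strict_mono (r :: nat \<Rightarrow> nat)" "AE x in lebesgue_on \<Omega>. (\<lambda>k. f (r k) x) \<longlonglongrightarrow> g x"
    "(\<lambda>k. L2_norm \<Omega> (\<lambda>x. f k x - g x)) \<longlonglongrightarrow> 0"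
    by (rule L2_complete[OF f cauchy]) (assumption, (rule that; assumption))
  have "L2_norm \<Omega> (\<lambda>x. g x - z x) \<le> 0"
  proof (rule LIMSEQ_le_const)
    show "(\<lambda>k. L2_norm \<Omega> (\<lambda>x. f k x - g x) + L2_norm \<Omega> (\<lambda>x. f k x - z x)) \<longlonglongrightarrow> 0"
      using tendsto_add[OF g(4) lim] by simp
    show "\<exists>N. \<forall>n\<ge>N. L2_norm \<Omega> (\<lambda>x. g x - z x) \<le> L2_norm \<Omega> (\<lambda>x. f n x - g x) + L2_norm \<Omega> (\<lambda>x. f n x - z x)"
      using L2_norm_triangle_diff[OF g(1) f z] by (simp add: L2_norm_diff_commute[of \<Omega> g])
  qed
  then have "AE x in lebesgue_on \<Omega>. g x - z x = 0"
    using L2_norm_nonneg[of \<Omega> "\<lambda>x. g x - z x"] by (intro L2_norm_zero_AE L2_diff g z) linarith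
  with g(3) have "AE x in lebesgue_on \<Omega>. (\<lambda>k. f (r k) x) \<longlonglongrightarrow> z x" by eventually_elim simp
  with g(2) show thesis by (rule that)
qed

text \<open>Fatou's lemma carries the inequality over from approximating test functions. The strict inequality
  for the norm lets the bound apply to their gradients, which only converge.\<close>

theorem Sobolev_H10:
  assumes Q: "2 < Q" "ereal Q < sobolev_exponent DIM('a)"
  obtains K where "K > 0" "\<And>z G. z \<in> H10 \<Omega> \<Longrightarrow> H10_norm \<Omega> z < G \<Longrightarrow>
     (\<integral>\<^sup>+x. ennreal (\<bar>z x\<bar> powr Q) \<partial>lebesgue_on \<Omega>) \<le> ennreal (K * G powr Q)"
proof -
  let ?n = "DIM('a)"
  obtain \<alpha> where \<alpha>: "\<alpha> > 0" "\<alpha> \<ge> real ?n / 2 - 1" "\<alpha> * (Q - 2) < 2"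
  proof (cases "?n \<ge> 3")
    case True
    then have "Q < 2 * real ?n / (real ?n - 2)" using Q by (simp add: sobolev_exponent_def)
    then have "(real ?n / 2 - 1) * (Q - 2) < 2" using True by (simp add: field_simps)
    then show ?thesis using True by (intro that[of "real ?n / 2 - 1"]) auto
  next
    case False
    then have "real ?n / 2 - 1 \<le> 0" by simp
    moreover have "0 < 1 / (Q - 2)" using Q by simp
    ultimately have "real ?n / 2 - 1 \<le> 1 / (Q - 2)" by linarith
    then show ?thesis using Q by (intro that[of "1 / (Q - 2)"]) simp_all
  qed
  obtain K where K: "K > 0" "\<And>\<phi> G. test_fun \<Omega> \<phi> \<Longrightarrow> G > 0 \<Longrightarrow> L2_norm \<Omega> (grad \<phi>) \<le> G \<Longrightarrow>
     (\<integral>\<^sup>+x. ennreal (\<bar>\<phi> x\<bar> powr Q) \<partial>lborel) \<le> ennreal (K * G powr Q)"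
    by (rule Sobolev_test[OF \<alpha>(1,2) Q(1) \<alpha>(3)]) (rule that; assumption)
  have "(\<integral>\<^sup>+x. ennreal (\<bar>z x\<bar> powr Q) \<partial>lebesgue_on \<Omega>) \<le> ennreal (K * G powr Q)"
    if z: "z \<in> H10 \<Omega>" and G: "H10_norm \<Omega> z < G" for z G
  proof -
    have Gpos: "G > 0" using G L2_norm_nonneg[of \<Omega> "wgrad \<Omega> z"] unfolding H10_norm_def by linarith
    obtain \<phi> where \<phi>: "\<And>k::nat. test_fun \<Omega> (\<phi> k)" "(\<lambda>k. L2_norm \<Omega> (\<lambda>x. \<phi> k x - z x)) \<longlonglongrightarrow> 0"
      "(\<lambda>k. L2_norm \<Omega> (\<lambda>x. grad (\<phi> k) x - wgrad \<Omega> z x)) \<longlonglongrightarrow> 0"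
      by (rule H10_approx[OF z]) (rule that; assumption)
    obtain r :: "nat \<Rightarrow> nat" where r: "strict_mono r" "AE x in lebesgue_on \<Omega>. (\<lambda>k. \<phi> (r k) x) \<longlonglongrightarrow> z x"
      by (rule L2_convergent_AE_subseq[OF test_L2(1)[OF \<phi>(1)] H10_L2[OF z] \<phi>(2)]) (rule that; assumption)
    have "(\<lambda>k. L2_norm \<Omega> (grad (\<phi> k))) \<longlonglongrightarrow> H10_norm \<Omega> z"
      unfolding H10_norm_def by (intro L2_norm_tendsto test_L2 \<phi> wgrad_L2 z)
    then have "\<forall>\<^sub>F k in sequentially. L2_norm \<Omega> (grad (\<phi> k)) < G" using G by (rule order_tendstoD)
    then have ev: "\<forall>\<^sub>F k in sequentially. L2_norm \<Omega> (grad (\<phi> (r k))) < G"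
      using r(1) by (rule eventually_subseq[rotated])
    have m: "\<phi> k \<in> borel_measurable (lebesgue_on \<Omega>)" for k using L2_D(1)[OF test_L2(1)[OF \<phi>(1)]] .
    have "(\<integral>\<^sup>+x. ennreal (\<bar>z x\<bar> powr Q) \<partial>lebesgue_on \<Omega>)
       = (\<integral>\<^sup>+x. liminf (\<lambda>k. ennreal (\<bar>\<phi> (r k) x\<bar> powr Q)) \<partial>lebesgue_on \<Omega>)"
    proof (rule nn_integral_cong_AE)
      show "AE x in lebesgue_on \<Omega>. ennreal (\<bar>z x\<bar> powr Q) = liminf (\<lambda>k. ennreal (\<bar>\<phi> (r k) x\<bar> powr Q))"
        using r(2)
      proof eventually_elim
        fix x assume "(\<lambda>k. \<phi> (r k) x) \<longlonglongrightarrow> z x"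
        then have "(\<lambda>k. ennreal (\<bar>\<phi> (r k) x\<bar> powr Q)) \<longlonglongrightarrow> ennreal (\<bar>z x\<bar> powr Q)"
          using Q by (intro tendsto_ennrealI tendsto_powr' tendsto_rabs tendsto_const) auto
        then show "ennreal (\<bar>z x\<bar> powr Q) = liminf (\<lambda>k. ennreal (\<bar>\<phi> (r k) x\<bar> powr Q))"
          by (rule lim_imp_Liminf[OF sequentially_bot, symmetric])
      qed
    qed
    also have "\<dots> \<le> liminf (\<lambda>k. \<integral>\<^sup>+x. ennreal (\<bar>\<phi> (r k) x\<bar> powr Q) \<partial>lebesgue_on \<Omega>)"
      by (rule nn_integral_liminf) (use m in measurable)
    also have "\<dots> \<le> ennreal (K * G powr Q)"
    proof (rule Liminf_le)
      show "\<forall>\<^sub>F k in sequentially. (\<integral>\<^sup>+x. ennreal (\<bar>\<phi> (r k) x\<bar> powr Q) \<partial>lebesgue_on \<Omega>) \<le> ennreal (K * G powr Q)"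
        using ev
      proof eventually_elim
        fix k assume k: "L2_norm \<Omega> (grad (\<phi> (r k))) < G"
        have [measurable]: "\<phi> (r k) \<in> borel_measurable borel" by (rule test_fun_borel[OF \<phi>(1)])
        have "(\<integral>\<^sup>+x. ennreal (\<bar>\<phi> (r k) x\<bar> powr Q) \<partial>lebesgue_on \<Omega>)
          = (\<integral>\<^sup>+x. ennreal (\<bar>\<phi> (r k) x\<bar> powr Q) * indicator \<Omega> x \<partial>lebesgue)"
          using domain_sets by (simp add: nn_integral_restrict_space)
        also have "\<dots> \<le> (\<integral>\<^sup>+x. ennreal (\<bar>\<phi> (r k) x\<bar> powr Q) \<partial>lebesgue)"
          by (intro nn_integral_mono) (auto simp: indicator_def)
        also have "\<dots> = (\<integral>\<^sup>+x. ennreal (\<bar>\<phi> (r k) x\<bar> powr Q) \<partial>lborel)"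
          by (rule nn_integral_completion)
        also have "\<dots> \<le> ennreal (K * G powr Q)" by (rule K(2)[OF \<phi>(1) Gpos]) (use k in simp)
        finally show "(\<integral>\<^sup>+x. ennreal (\<bar>\<phi> (r k) x\<bar> powr Q) \<partial>lebesgue_on \<Omega>) \<le> ennreal (K * G powr Q)" .
      qed
    qed simp
    finally show ?thesis .
  qed
  then show thesis using that[OF K(1)] by blast
qed

end

section \<open>The logarithmic source\<close>

lemma source_mult: "source q r * r = \<bar>r\<bar> powr q * ln \<bar>r\<bar>"
proof (cases "r = 0")
  case False
  have "\<bar>r\<bar> powr q = \<bar>r\<bar> powr (q - 2) * (r * r)"
    using powr_add[of "\<bar>r\<bar>" "q - 2" 2] False by (simp add: power2_eq_square)
  then show ?thesis by (simp add: source_def mult_ac)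
qed (simp add: source_def)

lemma abs_source: "\<bar>source q r\<bar> = \<bar>r\<bar> powr (q - 1) * \<bar>ln \<bar>r\<bar>\<bar>"
proof (cases "r = 0")
  case False
  have "\<bar>r\<bar> powr (q - 1) = \<bar>r\<bar> powr (q - 2) * \<bar>r\<bar>"
    using powr_add[of "\<bar>r\<bar>" "q - 2" 1] False by simp
  then show ?thesis by (simp add: source_def abs_mult)
qed (simp add: source_def)

text \<open>For small \<open>\<bar>r\<bar>\<close> a factor \<open>\<bar>r\<bar>\<close> beats the logarithm, for large \<open>\<bar>r\<bar>\<close> the extra power
  \<open>\<bar>r\<bar>\<^bsup>\<kappa>\<^esup> / \<kappa>\<close> does.\<close>

lemma source_bound:
  assumes "2 \<le> q" "\<kappa> > 0" "q + \<kappa> \<le> Q"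
  shows "\<bar>source q r\<bar> \<le> (1 + 1 / \<kappa>) * (1 + \<bar>r\<bar> powr (Q - 1))"
proof (cases "\<bar>r\<bar> \<le> 1")
  case True
  have "\<bar>source q r\<bar> \<le> 1"
  proof (cases "r = 0")
    case False
    have "ln (1 / \<bar>r\<bar>) \<le> 1 / \<bar>r\<bar> - 1" by (rule ln_le_minus_one) (use False in simp)
    moreover have "\<bar>ln \<bar>r\<bar>\<bar> = ln (1 / \<bar>r\<bar>)" using True False by (simp add: ln_div)
    ultimately have "\<bar>r\<bar> * \<bar>ln \<bar>r\<bar>\<bar> \<le> \<bar>r\<bar> * (1 / \<bar>r\<bar> - 1)" by (intro mult_left_mono) auto
    also have "\<dots> \<le> 1" using False by (simp add: right_diff_distrib)
    finally have "\<bar>r\<bar> * \<bar>ln \<bar>r\<bar>\<bar> \<le> 1" .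
    moreover have "\<bar>r\<bar> powr (q - 1) \<le> \<bar>r\<bar> powr 1" using assms True by (intro powr_mono') auto
    then have "\<bar>r\<bar> powr (q - 1) * \<bar>ln \<bar>r\<bar>\<bar> \<le> \<bar>r\<bar> * \<bar>ln \<bar>r\<bar>\<bar>" using False by (intro mult_right_mono) auto
    ultimately show ?thesis by (simp add: abs_source)
  qed (simp add: source_def)
  also have "1 \<le> (1 + 1 / \<kappa>) * (1 + \<bar>r\<bar> powr (Q - 1))"
    using mult_mono[of 1 "1 + 1 / \<kappa>" 1 "1 + \<bar>r\<bar> powr (Q - 1)"] assms by simp
  finally show ?thesis .
next
  case False
  have "\<bar>source q r\<bar> = \<bar>r\<bar> powr (q - 1) * ln \<bar>r\<bar>" using False by (simp add: abs_source)
  also have "\<dots> \<le> \<bar>r\<bar> powr (q - 1) * (\<bar>r\<bar> powr \<kappa> / \<kappa>)"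
    using False assms by (intro mult_left_mono ln_powr_bound) auto
  also have "\<dots> = \<bar>r\<bar> powr (q - 1 + \<kappa>) / \<kappa>" by (simp add: powr_add)
  also have "\<dots> \<le> \<bar>r\<bar> powr (Q - 1) / \<kappa>" using False assms by (intro divide_right_mono powr_mono) auto
  also have "\<dots> \<le> (1 + 1 / \<kappa>) * (1 + \<bar>r\<bar> powr (Q - 1))" using assms by (simp add: field_simps)
  finally show ?thesis .
qed

text \<open>A substitute for Hoelder's inequality: the weight \<open>\<delta>\<close> makes the first term small before the second
  is made small through \<open>b\<close>. It follows by comparing \<open>\<bar>b\<bar>\<close> with \<open>\<delta> \<bar>a\<bar>\<close>.\<close>

lemma powr_weight_split:
  assumes "Q > 1" "0 < \<delta>"
  shows "\<bar>a::real\<bar> powr (Q - 1) * \<bar>b\<bar> \<le> \<delta> * \<bar>a\<bar> powr Q + \<delta> powr (1 - Q) * \<bar>b\<bar> powr Q"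
proof (cases "a = 0 \<or> b = 0")
  case True
  then show ?thesis using assms by auto
next
  case False
  have split: "\<bar>c\<bar> powr Q = \<bar>c\<bar> powr (Q - 1) * \<bar>c\<bar>" if "c \<noteq> 0" for c :: real
    using powr_add[of "\<bar>c\<bar>" "Q - 1" 1] that by simp
  show ?thesis
  proof (cases "\<bar>b\<bar> \<le> \<delta> * \<bar>a\<bar>")
    case True
    then have "\<bar>a\<bar> powr (Q - 1) * \<bar>b\<bar> \<le> \<bar>a\<bar> powr (Q - 1) * (\<delta> * \<bar>a\<bar>)" by (intro mult_left_mono) auto
    also have "\<dots> = \<delta> * \<bar>a\<bar> powr Q" using split False by simp
    finally show ?thesis by (simp add: add_increasing2)
  next
    case lt: False
    then have "\<bar>a\<bar> \<le> \<bar>b\<bar> / \<delta>" using assms by (simp add: field_simps)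
    then have "\<bar>a\<bar> powr (Q - 1) \<le> (\<bar>b\<bar> / \<delta>) powr (Q - 1)" using assms by (intro powr_mono2) auto
    also have "\<dots> = \<delta> powr (1 - Q) * \<bar>b\<bar> powr (Q - 1)"
      using assms powr_divide[of "\<bar>b\<bar>" \<delta> "Q - 1"] powr_minus[of \<delta> "Q - 1"]
      by (simp add: divide_inverse mult.commute)
    finally have "\<bar>a\<bar> powr (Q - 1) * \<bar>b\<bar> \<le> \<delta> powr (1 - Q) * \<bar>b\<bar> powr (Q - 1) * \<bar>b\<bar>" by (intro mult_right_mono) auto
    also have "\<dots> = \<delta> powr (1 - Q) * \<bar>b\<bar> powr Q" using split False by simp
    finally show ?thesis using assms by (simp add: add_increasing)
  qed
qed

text \<open>With \<open>s = \<bar>r\<bar>\<^sup>q\<close> the difference of both sides is \<open>(q-m)/q\<^sup>2\<close> times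
  \<open>s ln (s/a) - s + a\<close>, where \<open>a = e\<^bsup>-q/(q-m)\<^esup>\<close>; this is nonnegative as \<open>ln x \<le> x - 1\<close>.\<close>

lemma source_lower_bound:
  assumes m: "0 < m" "m \<le> q"
  shows "source q r * r \<ge> m * F_pot q r - c_min m q"
proof (cases "r = 0")
  case True
  have "c_min m q \<ge> 0" using m by (auto simp: c_min_def)
  then show ?thesis using True m by (simp add: source_def F_pot_def)
next
  case False
  define s where "s = \<bar>r\<bar> powr q"
  have s: "s > 0" using False by (simp add: s_def)
  have ls: "ln s = q * ln \<bar>r\<bar>" using False by (simp add: s_def ln_powr)
  show ?thesis
  proof (cases "q > m")
    case True
    define d where "d = q - m"
    define a where "a = exp (- q / d)"
    have d: "d > 0" using True by (simp add: d_def)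
    have a: "a > 0" "ln a = - q / d" by (simp_all add: a_def)
    have "ln (a / s) \<le> a / s - 1" by (rule ln_le_minus_one) (use a s in simp)
    then have "s * (ln a - ln s) \<le> s * (a / s - 1)" using a s by (intro mult_left_mono) (auto simp: ln_div)
    also have "\<dots> = a - s" using s by (simp add: right_diff_distrib)
    finally have "0 \<le> s * ln s - s * ln a - s + a" by (simp add: algebra_simps)
    then have "0 \<le> d / q\<^sup>2 * (s * ln s - s * ln a - s + a)" using d by simp
    also have "\<dots> = source q r * r - (m * F_pot q r - c_min m q)"
    proof -
      have "d * (s * ln s - s * ln a - s + a) = d * s * (q * ln \<bar>r\<bar>) + q * s - d * s + d * a"
        using d unfolding a(2) ls by (simp add: field_simps)
      also have "\<dots> = (q\<^sup>2) * (s * ln \<bar>r\<bar>) - m * (q * s * ln \<bar>r\<bar> - s) + d * a"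
        by (simp add: d_def algebra_simps power2_eq_square)
      finally have "d / q\<^sup>2 * (s * ln s - s * ln a - s + a)
        = ((q\<^sup>2) * (s * ln \<bar>r\<bar>) - m * (q * s * ln \<bar>r\<bar> - s) + d * a) / q\<^sup>2" by simp
      also have "\<dots> = s * ln \<bar>r\<bar> - m * (s / q * ln \<bar>r\<bar> - s / q\<^sup>2) + d / q\<^sup>2 * a"
        using m by (simp add: field_simps power2_eq_square)
      finally show ?thesis
        using True by (simp add: source_mult F_pot_def c_min_def d_def a_def s_def)
    qed
    finally show ?thesis by simp
  next
    case False
    then have "q = m" using m by simp
    then show ?thesis using m s by (simp add: source_mult F_pot_def c_min_def s_def right_diff_distrib power2_eq_square)
  qed
qed

lemma c_min_bounds:
  assumes "2 \<le> m" "m \<le> q" shows "0 \<le> c_min m q" "c_min m q \<le> 1"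
proof -
  show "0 \<le> c_min m q" using assms by (auto simp: c_min_def)
  show "c_min m q \<le> 1"
  proof (cases "q > m")
    case True
    have "(q - m) / q\<^sup>2 \<le> 1"
    proof -
      have "1 * q \<le> q * q" using assms by (intro mult_right_mono) auto
      then have "q - m \<le> q\<^sup>2" using assms unfolding power2_eq_square by linarith
      then show ?thesis using assms by simp
    qed
    moreover have "exp (- q / (q - m)) \<le> 1" using True assms by (simp add: divide_nonpos_pos)
    ultimately have "(q - m) / q\<^sup>2 * exp (- q / (q - m)) \<le> 1 * 1" using True by (intro mult_mono) auto
    then show ?thesis using True by (simp add: c_min_def)
  qed (simp add: c_min_def)
qed

locale log_source_domain = bounded_open_domain \<Omega> for \<Omega> :: "'a::euclidean_space set" +
  fixes p :: "'a \<Rightarrow> real"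
  assumes nonempty: "\<Omega> \<noteq> {}" and exponent: "hyp_H1 \<Omega> p"
begin

lemma p_measurable [measurable]: "p \<in> borel_measurable (lebesgue_on \<Omega>)"
  using exponent by (simp add: hyp_H1_def)

text \<open>Almost every value of \<open>p\<close> lies between the essential bounds; as \<open>\<Omega>\<close> is not null there is such a
  value, so both bounds are finite. \<open>Q\<close> is inserted between the upper one and the critical exponent.\<close>

lemma exponent_bounds:
  obtains P Q where "2 < pm \<Omega> p" "P < Q" "2 < Q" "ereal Q < sobolev_exponent DIM('a)"
    "AE x in lebesgue_on \<Omega>. pm \<Omega> p \<le> p x \<and> p x \<le> P"
proof -
  have "AE x in lebesgue_on \<Omega>. - ereal (p x) \<le> esssup (lebesgue_on \<Omega>) (\<lambda>x. - ereal (p x))" by (rule esssup_AE)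
  then have lo: "AE x in lebesgue_on \<Omega>. p_minus \<Omega> p \<le> ereal (p x)"
    unfolding p_minus_def by eventually_elim (metis ereal_minus_le_minus ereal_uminus_uminus)
  have hi: "AE x in lebesgue_on \<Omega>. ereal (p x) \<le> p_plus \<Omega> p"
    unfolding p_plus_def by (rule esssup_AE)
  have "\<exists>x. p_minus \<Omega> p \<le> ereal (p x) \<and> ereal (p x) \<le> p_plus \<Omega> p"
  proof (rule ccontr)
    assume "\<nexists>x. p_minus \<Omega> p \<le> ereal (p x) \<and> ereal (p x) \<le> p_plus \<Omega> p"
    then have "AE x in lebesgue_on \<Omega>. False" using lo hi by auto
    then show False using not_AE_False[OF nonempty] by blast
  qed
  then obtain x0 where x0: "p_minus \<Omega> p \<le> ereal (p x0)" "ereal (p x0) \<le> p_plus \<Omega> p" by blast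
  have pm2: "2 < p_minus \<Omega> p" and pp: "p_plus \<Omega> p < sobolev_exponent DIM('a)"
    using exponent by (auto simp: hyp_H1_def)
  have pmle: "pm \<Omega> p \<le> r" if "p_minus \<Omega> p \<le> ereal r" for r
    using pm2 that by (cases "p_minus \<Omega> p") auto
  obtain P where P: "p_plus \<Omega> p = ereal P"
    using pp x0(2) by (cases "p_plus \<Omega> p") auto
  obtain Q where Q: "p_plus \<Omega> p < ereal Q" "ereal Q < sobolev_exponent DIM('a)"
    using ereal_dense2[OF pp] by blast
  show thesis
  proof (rule that)
    show pm: "2 < pm \<Omega> p" using pm2 x0(1) by (cases "p_minus \<Omega> p") auto
    show PQ: "P < Q" using Q(1) P by simp
    have "2 < P" using pm pmle[OF x0(1)] x0(2) P by simp
    then show "2 < Q" using PQ by simp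
    show "ereal Q < sobolev_exponent DIM('a)" by (rule Q)
    show "AE x in lebesgue_on \<Omega>. pm \<Omega> p \<le> p x \<and> p x \<le> P"
      using lo hi unfolding P by eventually_elim (simp add: pmle)
  qed
qed

lemma pm_gt_2: "2 < pm \<Omega> p"
  by (rule exponent_bounds)

lemma source_measurable:
  assumes [measurable]: "y \<in> borel_measurable (lebesgue_on \<Omega>)"
  shows "(\<lambda>x. source (p x) (y x)) \<in> borel_measurable (lebesgue_on \<Omega>)"
    and "(\<lambda>x. F_pot (p x) (y x)) \<in> borel_measurable (lebesgue_on \<Omega>)"
  unfolding source_def F_pot_def by measurable

lemma c_min_integrable: "integrable (lebesgue_on \<Omega>) (\<lambda>x. c_min (pm \<Omega> p) (p x))"
proof (rule Bochner_Integration.integrable_bound[OF L2_integrable[OF const_L2[of 1]]])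
  show "(\<lambda>x. c_min (pm \<Omega> p) (p x)) \<in> borel_measurable (lebesgue_on \<Omega>)"
    unfolding c_min_def by measurable
  obtain P Q where "AE x in lebesgue_on \<Omega>. pm \<Omega> p \<le> p x \<and> p x \<le> P" by (rule exponent_bounds)
  then show "AE x in lebesgue_on \<Omega>. norm (c_min (pm \<Omega> p) (p x)) \<le> norm (1::real)"
    by eventually_elim (use c_min_bounds[of "pm \<Omega> p"] pm_gt_2 in auto)
qed

text \<open>The Sobolev inequality controls \<open>\<integral> \<bar>y\<bar>\<^bsup>Q\<^esup>\<close> for some \<open>Q\<close> strictly above the essential supremum
  of \<open>p\<close>; the gap absorbs the logarithm.\<close>

lemma source_growth:
  obtains Q S K where "2 < Q" "S > 0" "K > 0"
    "AE x in lebesgue_on \<Omega>. \<forall>r. \<bar>source (p x) r\<bar> \<le> S * (1 + \<bar>r\<bar> powr (Q - 1))"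
    "AE x in lebesgue_on \<Omega>. \<forall>r. \<bar>r\<bar> powr p x \<le> 1 + \<bar>r\<bar> powr Q"
    "\<And>z G. z \<in> H10 \<Omega> \<Longrightarrow> H10_norm \<Omega> z < G \<Longrightarrow> integrable (lebesgue_on \<Omega>) (\<lambda>x. \<bar>z x\<bar> powr Q)"
    "\<And>z G. z \<in> H10 \<Omega> \<Longrightarrow> H10_norm \<Omega> z < G \<Longrightarrow> (LINT x|lebesgue_on \<Omega>. \<bar>z x\<bar> powr Q) \<le> K * G powr Q"
proof -
  obtain P Q where PQ: "2 < pm \<Omega> p" "P < Q" "2 < Q" "ereal Q < sobolev_exponent DIM('a)"
    "AE x in lebesgue_on \<Omega>. pm \<Omega> p \<le> p x \<and> p x \<le> P" by (rule exponent_bounds)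
  obtain K where K: "K > 0" "\<And>z G. z \<in> H10 \<Omega> \<Longrightarrow> H10_norm \<Omega> z < G \<Longrightarrow>
     (\<integral>\<^sup>+x. ennreal (\<bar>z x\<bar> powr Q) \<partial>lebesgue_on \<Omega>) \<le> ennreal (K * G powr Q)"
    by (rule Sobolev_H10[OF PQ(3,4)]) (rule that; assumption)
  have int: "integrable (lebesgue_on \<Omega>) (\<lambda>x. \<bar>z x\<bar> powr Q) \<and> (LINT x|lebesgue_on \<Omega>. \<bar>z x\<bar> powr Q) \<le> K * G powr Q"
    if z: "z \<in> H10 \<Omega>" and G: "H10_norm \<Omega> z < G" for z G
  proof
    have [measurable]: "z \<in> borel_measurable (lebesgue_on \<Omega>)" using L2_D[OF H10_L2[OF z]] by simp
    show i: "integrable (lebesgue_on \<Omega>) (\<lambda>x. \<bar>z x\<bar> powr Q)"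
      by (rule integrableI_bounded) (use K(2)[OF z G] in \<open>auto simp: le_less_trans[OF _ ennreal_less_top]\<close>)
    have "ennreal (LINT x|lebesgue_on \<Omega>. \<bar>z x\<bar> powr Q) \<le> ennreal (K * G powr Q)"
      using K(2)[OF z G] nn_integral_eq_integral[OF i] by simp
    then show "(LINT x|lebesgue_on \<Omega>. \<bar>z x\<bar> powr Q) \<le> K * G powr Q"
      using K(1) by (subst (asm) ennreal_le_iff) auto
  qed
  show thesis
  proof (rule that[of Q "1 + 1 / (Q - P)" K])
    show "AE x in lebesgue_on \<Omega>. \<forall>r. \<bar>source (p x) r\<bar> \<le> (1 + 1 / (Q - P)) * (1 + \<bar>r\<bar> powr (Q - 1))"
      using PQ(5)
    proof eventually_elim
      fix x assume "pm \<Omega> p \<le> p x \<and> p x \<le> P"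
      then show "\<forall>r. \<bar>source (p x) r\<bar> \<le> (1 + 1 / (Q - P)) * (1 + \<bar>r\<bar> powr (Q - 1))"
        using PQ by (intro allI source_bound) auto
    qed
    show "AE x in lebesgue_on \<Omega>. \<forall>r. \<bar>r\<bar> powr p x \<le> 1 + \<bar>r\<bar> powr Q"
      using PQ(5)
    proof eventually_elim
      fix x assume x: "pm \<Omega> p \<le> p x \<and> p x \<le> P"
      show "\<forall>r. \<bar>r\<bar> powr p x \<le> 1 + \<bar>r\<bar> powr Q"
      proof
        fix r :: real
        show "\<bar>r\<bar> powr p x \<le> 1 + \<bar>r\<bar> powr Q"
        proof (cases "\<bar>r\<bar> \<le> 1")
          case True
          then have "\<bar>r\<bar> powr p x \<le> 1 powr p x" using x PQ by (intro powr_mono2) auto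
          then show ?thesis by (simp add: add_increasing2)
        next
          case False
          then have "\<bar>r\<bar> powr p x \<le> \<bar>r\<bar> powr Q" using x PQ by (intro powr_mono) auto
          then show ?thesis by simp
        qed
      qed
    qed
    show "1 + 1 / (Q - P) > 0" using PQ by (simp add: add_pos_pos)
  qed (use PQ K int in auto)
qed

lemma source_pairing_integrable:
  assumes y: "y \<in> H10 \<Omega>" and d: "d \<in> H10 \<Omega>"
  shows "integrable (lebesgue_on \<Omega>) (\<lambda>x. source (p x) (y x) * d x)"
proof -
  obtain Q S K where c: "2 < Q" "S > 0" "AE x in lebesgue_on \<Omega>. \<forall>r. \<bar>source (p x) r\<bar> \<le> S * (1 + \<bar>r\<bar> powr (Q - 1))"
    "\<And>z G. z \<in> H10 \<Omega> \<Longrightarrow> H10_norm \<Omega> z < G \<Longrightarrow> integrable (lebesgue_on \<Omega>) (\<lambda>x. \<bar>z x\<bar> powr Q)"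
    by (rule source_growth) (rule that; assumption)
  note ym = L2_D(1)[OF H10_L2[OF y]] and dm = L2_D(1)[OF H10_L2[OF d]]
  have i: "integrable (lebesgue_on \<Omega>) (\<lambda>x. \<bar>z x\<bar> powr Q)" if "z \<in> H10 \<Omega>" for z
    by (rule c(4)[OF that, of "H10_norm \<Omega> z + 1"]) simp
  show ?thesis
  proof (rule Bochner_Integration.integrable_bound)
    show "integrable (lebesgue_on \<Omega>) (\<lambda>x. S * (\<bar>d x\<bar> + (1 * \<bar>y x\<bar> powr Q + 1 powr (1 - Q) * \<bar>d x\<bar> powr Q)))"
      using L2_integrable[OF H10_L2[OF d]] i[OF y] i[OF d] by simp
    show "(\<lambda>x. source (p x) (y x) * d x) \<in> borel_measurable (lebesgue_on \<Omega>)"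
      using source_measurable(1)[OF ym] dm by measurable
    show "AE x in lebesgue_on \<Omega>. norm (source (p x) (y x) * d x)
        \<le> norm (S * (\<bar>d x\<bar> + (1 * \<bar>y x\<bar> powr Q + 1 powr (1 - Q) * \<bar>d x\<bar> powr Q)))"
      using c(3)
    proof eventually_elim
      fix x assume "\<forall>r. \<bar>source (p x) r\<bar> \<le> S * (1 + \<bar>r\<bar> powr (Q - 1))"
      then have "\<bar>source (p x) (y x)\<bar> * \<bar>d x\<bar> \<le> S * (1 + \<bar>y x\<bar> powr (Q - 1)) * \<bar>d x\<bar>" by (intro mult_right_mono) auto
      also have "\<dots> = S * (\<bar>d x\<bar> + \<bar>y x\<bar> powr (Q - 1) * \<bar>d x\<bar>)" by (simp add: algebra_simps)
      also have "\<dots> \<le> S * (\<bar>d x\<bar> + (1 * \<bar>y x\<bar> powr Q + 1 powr (1 - Q) * \<bar>d x\<bar> powr Q))"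
        using c by (intro mult_left_mono add_left_mono powr_weight_split) auto
      finally show "norm (source (p x) (y x) * d x)
        \<le> norm (S * (\<bar>d x\<bar> + (1 * \<bar>y x\<bar> powr Q + 1 powr (1 - Q) * \<bar>d x\<bar> powr Q)))"
        using c(2) by (simp add: abs_mult)
    qed
  qed
qed

text \<open>On bounded sets of \<open>y\<close> the growth bound splits the integrand into a part of order \<open>\<delta>\<close> and a part
  that tends to zero with \<open>\<parallel>\<nabla>d\<parallel>\<close> for fixed \<open>\<delta>\<close>.\<close>

lemma source_pairing_small:
  assumes \<epsilon>: "\<epsilon> > 0" and B: "B \<ge> 0"
  obtains \<eta> where "\<eta> > 0" "\<And>y d. y \<in> H10 \<Omega> \<Longrightarrow> d \<in> H10 \<Omega> \<Longrightarrow> H10_norm \<Omega> y \<le> B \<Longrightarrow> H10_norm \<Omega> d < \<eta> \<Longrightarrow>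
     \<bar>LINT x|lebesgue_on \<Omega>. source (p x) (y x) * d x\<bar> \<le> \<epsilon>"
proof -
  obtain Q S K where c: "2 < Q" "S > 0" "K > 0"
    "AE x in lebesgue_on \<Omega>. \<forall>r. \<bar>source (p x) r\<bar> \<le> S * (1 + \<bar>r\<bar> powr (Q - 1))"
    "\<And>z G. z \<in> H10 \<Omega> \<Longrightarrow> H10_norm \<Omega> z < G \<Longrightarrow> integrable (lebesgue_on \<Omega>) (\<lambda>x. \<bar>z x\<bar> powr Q)"
    "\<And>z G. z \<in> H10 \<Omega> \<Longrightarrow> H10_norm \<Omega> z < G \<Longrightarrow> (LINT x|lebesgue_on \<Omega>. \<bar>z x\<bar> powr Q) \<le> K * G powr Q"
    by (rule source_growth) (rule that; assumption)
  define \<mu> where "\<mu> = first_dirichlet_eigenvalue \<Omega>"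
  have mu: "\<mu> > 0" "\<And>z. z \<in> H10 \<Omega> \<Longrightarrow> \<mu> * (L2_norm \<Omega> z)\<^sup>2 \<le> (H10_norm \<Omega> z)\<^sup>2"
    using first_eigenvalue[OF nonempty] by (auto simp: \<mu>_def H10_norm_def)
  define V where "V = (LINT x|lebesgue_on \<Omega>. (1::real))"
  have V: "V \<ge> 0" unfolding V_def by (intro Bochner_Integration.integral_nonneg) auto
  define A where "A = S * (V + K * (B + 1) powr Q)"
  have A: "A \<ge> 0" using c V by (simp add: A_def)
  define \<delta> where "\<delta> = \<epsilon> / (2 * (A + 1))"
  have \<delta>: "\<delta> > 0" using \<epsilon> A by (simp add: \<delta>_def)
  have \<delta>A: "\<delta> * A \<le> \<epsilon> / 2"
  proof -
    have "\<delta> * A \<le> \<delta> * (A + 1)" using \<delta> by (intro mult_left_mono) auto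
    also have "\<dots> = \<epsilon> / 2"
    proof -
      have "\<epsilon> / (2 * r) * r = \<epsilon> / 2" if "r \<noteq> 0" for r using that by simp
      from this[of "A + 1"] show ?thesis unfolding \<delta>_def using A by linarith
    qed
    finally show ?thesis .
  qed
  have nn: "\<forall>\<^sub>F h in at_right (0::real). 0 \<le> h"
    by (rule eventually_mono[OF eventually_at_right_less]) simp
  have "((\<lambda>h. S * (h\<^sup>2 / \<mu> / \<delta> + \<delta> powr (1 - Q) * (K * h powr Q))) \<longlongrightarrow> S * (0\<^sup>2 / \<mu> / \<delta> + \<delta> powr (1 - Q) * (K * 0 powr Q))) (at_right 0)"
    using mu \<delta> c nn by (intro tendsto_intros tendsto_powr') auto
  then have "\<forall>\<^sub>F h in at_right 0. S * (h\<^sup>2 / \<mu> / \<delta> + \<delta> powr (1 - Q) * (K * h powr Q)) < \<epsilon> / 2"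
    using \<epsilon> by (intro order_tendstoD(2)) auto
  then obtain b where b: "b > 0" "\<And>h. 0 < h \<Longrightarrow> h < b \<Longrightarrow> S * (h\<^sup>2 / \<mu> / \<delta> + \<delta> powr (1 - Q) * (K * h powr Q)) < \<epsilon> / 2"
    by (auto simp: eventually_at_right_field)
  define \<eta> where "\<eta> = b / 2"
  have \<eta>: "\<eta> > 0" "S * (\<eta>\<^sup>2 / \<mu> / \<delta> + \<delta> powr (1 - Q) * (K * \<eta> powr Q)) < \<epsilon> / 2"
    using b by (auto simp: \<eta>_def)
  have "\<bar>LINT x|lebesgue_on \<Omega>. source (p x) (y x) * d x\<bar> \<le> \<epsilon>"
    if y: "y \<in> H10 \<Omega>" and d: "d \<in> H10 \<Omega>" and yB: "H10_norm \<Omega> y \<le> B" and d\<eta>: "H10_norm \<Omega> d < \<eta>" for y d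
  proof -
    note id = c(5)[OF d d\<eta>]
    have iy: "integrable (lebesgue_on \<Omega>) (\<lambda>x. \<bar>y x\<bar> powr Q)" by (rule c(5)[OF y, of "B + 1"]) (use yB in simp)
    have Iy: "(LINT x|lebesgue_on \<Omega>. \<bar>y x\<bar> powr Q) \<le> K * (B + 1) powr Q" by (rule c(6)[OF y]) (use yB in simp)
    have Id: "(LINT x|lebesgue_on \<Omega>. \<bar>d x\<bar> powr Q) \<le> K * \<eta> powr Q" by (rule c(6)[OF d d\<eta>])
    have i2: "integrable (lebesgue_on \<Omega>) (\<lambda>x. (d x)\<^sup>2)" using L2_D(2)[OF H10_L2[OF d]] by simp
    have I2: "(LINT x|lebesgue_on \<Omega>. (d x)\<^sup>2) \<le> \<eta>\<^sup>2 / \<mu>"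
    proof -
      have "(LINT x|lebesgue_on \<Omega>. (d x)\<^sup>2) = (L2_norm \<Omega> d)\<^sup>2" by (simp add: L2_norm_sq_int)
      also have "\<dots> \<le> (H10_norm \<Omega> d)\<^sup>2 / \<mu>" using mu(2)[OF d] mu(1) by (simp add: field_simps)
      also have "\<dots> \<le> \<eta>\<^sup>2 / \<mu>" using d\<eta> mu(1) by (intro divide_right_mono power_mono) (auto simp: H10_norm_def)
      finally show ?thesis .
    qed
    let ?w = "\<lambda>x. S * ((\<delta> * 1 + (d x)\<^sup>2 / \<delta>) + (\<delta> * \<bar>y x\<bar> powr Q + \<delta> powr (1 - Q) * \<bar>d x\<bar> powr Q))"
    have iw: "integrable (lebesgue_on \<Omega>) ?w"
      using iy id i2 L2_integrable[OF const_L2[of \<delta>]] by simp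
    have "\<bar>LINT x|lebesgue_on \<Omega>. source (p x) (y x) * d x\<bar> \<le> (LINT x|lebesgue_on \<Omega>. \<bar>source (p x) (y x) * d x\<bar>)"
      by (rule integral_abs_bound)
    also have "\<dots> \<le> (LINT x|lebesgue_on \<Omega>. ?w x)"
    proof (rule integral_mono_AE)
      show "integrable (lebesgue_on \<Omega>) (\<lambda>x. \<bar>source (p x) (y x) * d x\<bar>)"
        using source_pairing_integrable[OF y d] by simp
      show "AE x in lebesgue_on \<Omega>. \<bar>source (p x) (y x) * d x\<bar> \<le> ?w x"
        using c(4)
      proof eventually_elim
        fix x assume "\<forall>r. \<bar>source (p x) r\<bar> \<le> S * (1 + \<bar>r\<bar> powr (Q - 1))"
        then have "\<bar>source (p x) (y x)\<bar> * \<bar>d x\<bar> \<le> S * (1 + \<bar>y x\<bar> powr (Q - 1)) * \<bar>d x\<bar>" by (intro mult_right_mono) auto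
        also have "\<dots> = S * (\<bar>d x\<bar> + \<bar>y x\<bar> powr (Q - 1) * \<bar>d x\<bar>)" by (simp add: algebra_simps)
        also have "\<dots> \<le> ?w x"
        proof (intro mult_left_mono add_mono powr_weight_split)
          have "2 * \<delta> * \<bar>d x\<bar> \<le> \<delta>\<^sup>2 + (d x)\<^sup>2" using sum_squares_bound[of \<delta> "\<bar>d x\<bar>"] by simp
          moreover have "\<delta> * \<bar>d x\<bar> \<le> 2 * \<delta> * \<bar>d x\<bar>" using \<delta> by simp
          ultimately have "\<delta> * \<bar>d x\<bar> \<le> \<delta> * \<delta> + (d x)\<^sup>2" by (simp add: power2_eq_square)
          then show "\<bar>d x\<bar> \<le> \<delta> * 1 + (d x)\<^sup>2 / \<delta>" using \<delta> by (simp add: field_simps)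
        qed (use c \<delta> in auto)
        finally show "\<bar>source (p x) (y x) * d x\<bar> \<le> ?w x" by (simp add: abs_mult)
      qed
    qed (rule iw)
    also have "\<dots> = S * ((\<delta> * V + (LINT x|lebesgue_on \<Omega>. (d x)\<^sup>2) / \<delta>)
        + (\<delta> * (LINT x|lebesgue_on \<Omega>. \<bar>y x\<bar> powr Q) + \<delta> powr (1 - Q) * (LINT x|lebesgue_on \<Omega>. \<bar>d x\<bar> powr Q)))"
      using iy id i2 L2_integrable[OF const_L2[of \<delta>]] unfolding V_def by simp
    also have "\<dots> \<le> S * ((\<delta> * V + \<eta>\<^sup>2 / \<mu> / \<delta>) + (\<delta> * (K * (B + 1) powr Q) + \<delta> powr (1 - Q) * (K * \<eta> powr Q)))"
      using c \<delta> by (intro mult_left_mono add_mono divide_right_mono Iy Id I2) auto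
    also have "\<dots> = \<delta> * A + S * (\<eta>\<^sup>2 / \<mu> / \<delta> + \<delta> powr (1 - Q) * (K * \<eta> powr Q))"
      by (simp add: A_def algebra_simps)
    also have "\<dots> \<le> \<epsilon>" using \<delta>A \<eta>(2) by linarith
    finally show ?thesis .
  qed
  then show thesis using that \<eta>(1) by blast
qed

lemma F_pot_integrable:
  assumes y: "y \<in> H10 \<Omega>"
  shows "integrable (lebesgue_on \<Omega>) (\<lambda>x. F_pot (p x) (y x))"
proof -
  obtain P Q where PQ: "2 < pm \<Omega> p" "AE x in lebesgue_on \<Omega>. pm \<Omega> p \<le> p x \<and> p x \<le> P" by (rule exponent_bounds)
  obtain Q S K where c: "2 < Q" "AE x in lebesgue_on \<Omega>. \<forall>r. \<bar>r\<bar> powr p x \<le> 1 + \<bar>r\<bar> powr Q"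
    "\<And>z G. z \<in> H10 \<Omega> \<Longrightarrow> H10_norm \<Omega> z < G \<Longrightarrow> integrable (lebesgue_on \<Omega>) (\<lambda>x. \<bar>z x\<bar> powr Q)"
    by (rule source_growth) (rule that; assumption)
  show ?thesis
  proof (rule Bochner_Integration.integrable_bound)
    have "integrable (lebesgue_on \<Omega>) (\<lambda>x. \<bar>y x\<bar> powr Q)" by (rule c(3)[OF y, of "H10_norm \<Omega> y + 1"]) simp
    then show "integrable (lebesgue_on \<Omega>) (\<lambda>x. \<bar>source (p x) (y x) * y x\<bar> + (1 + \<bar>y x\<bar> powr Q))"
      using source_pairing_integrable[OF y y] L2_integrable[OF const_L2[of 1]] by simp
    show "(\<lambda>x. F_pot (p x) (y x)) \<in> borel_measurable (lebesgue_on \<Omega>)"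
      by (rule source_measurable(2)[OF L2_D(1)[OF H10_L2[OF y]]])
    show "AE x in lebesgue_on \<Omega>. norm (F_pot (p x) (y x)) \<le> norm (\<bar>source (p x) (y x) * y x\<bar> + (1 + \<bar>y x\<bar> powr Q))"
      using PQ(2) c(2)
    proof eventually_elim
      fix x assume px: "pm \<Omega> p \<le> p x \<and> p x \<le> P" and b: "\<forall>r. \<bar>r\<bar> powr p x \<le> 1 + \<bar>r\<bar> powr Q"
      have p1: "1 \<le> p x" using px PQ by simp
      then have p2: "1 \<le> (p x)\<^sup>2" by simp
      have "F_pot (p x) (y x) = source (p x) (y x) * y x / p x - \<bar>y x\<bar> powr p x / (p x)\<^sup>2"
        by (simp add: F_pot_def source_mult)
      then have "\<bar>F_pot (p x) (y x)\<bar> \<le> \<bar>source (p x) (y x) * y x\<bar> / p x + \<bar>y x\<bar> powr p x / (p x)\<^sup>2"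
        using p1 abs_triangle_ineq4[of "source (p x) (y x) * y x / p x" "\<bar>y x\<bar> powr p x / (p x)\<^sup>2"] by simp
      also have "\<dots> \<le> \<bar>source (p x) (y x) * y x\<bar> + \<bar>y x\<bar> powr p x"
        using p1 p2 by (intro add_mono) (auto simp: divide_le_eq mult_le_cancel_left1 intro: mult_right_le_one_le order_trans[OF _ mult_left_mono])
      also have "\<dots> \<le> \<bar>source (p x) (y x) * y x\<bar> + (1 + \<bar>y x\<bar> powr Q)" using b by simp
      finally show "norm (F_pot (p x) (y x)) \<le> norm (\<bar>source (p x) (y x) * y x\<bar> + (1 + \<bar>y x\<bar> powr Q))" by simp
    qed
  qed
qed

lemma source_energy_bound:
  assumes y: "y \<in> H10 \<Omega>"
  shows "(LINT x|lebesgue_on \<Omega>. source (p x) (y x) * y x)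
    \<ge> pm \<Omega> p * (LINT x|lebesgue_on \<Omega>. F_pot (p x) (y x)) - C_star \<Omega> p"
proof -
  obtain P Q where PQ: "2 < pm \<Omega> p" "AE x in lebesgue_on \<Omega>. pm \<Omega> p \<le> p x \<and> p x \<le> P" by (rule exponent_bounds)
  have "pm \<Omega> p * (LINT x|lebesgue_on \<Omega>. F_pot (p x) (y x)) - C_star \<Omega> p
     = (LINT x|lebesgue_on \<Omega>. pm \<Omega> p * F_pot (p x) (y x) - c_min (pm \<Omega> p) (p x))"
    unfolding C_star_def using F_pot_integrable[OF y] c_min_integrable by simp
  also have "\<dots> \<le> (LINT x|lebesgue_on \<Omega>. source (p x) (y x) * y x)"
  proof (rule integral_mono_AE)
    show "integrable (lebesgue_on \<Omega>) (\<lambda>x. pm \<Omega> p * F_pot (p x) (y x) - c_min (pm \<Omega> p) (p x))"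
      using F_pot_integrable[OF y] c_min_integrable by simp
    show "integrable (lebesgue_on \<Omega>) (\<lambda>x. source (p x) (y x) * y x)" by (rule source_pairing_integrable[OF y y])
    show "AE x in lebesgue_on \<Omega>. pm \<Omega> p * F_pot (p x) (y x) - c_min (pm \<Omega> p) (p x) \<le> source (p x) (y x) * y x"
      using PQ(2) by eventually_elim (use PQ(1) source_lower_bound in auto)
  qed
  finally show ?thesis .
qed

end

section \<open>Calculus on intervals\<close>

lemma AE_lebesgue_on_negligible:
  assumes "AE x in lebesgue_on S. P x" "S \<in> sets lebesgue"
  obtains N where "negligible N" "\<And>x. x \<in> S \<Longrightarrow> x \<notin> N \<Longrightarrow> P x"
proof -
  have "AE x in lebesgue. x \<in> S \<longrightarrow> P x"
    using assms by (subst (asm) AE_restrict_space_iff) auto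
  then obtain N where "{x \<in> space lebesgue. \<not> (x \<in> S \<longrightarrow> P x)} \<subseteq> N" "emeasure lebesgue N = 0" "N \<in> sets lebesgue"
    by (rule AE_E) (rule that; assumption)
  then show thesis by (intro that[of N]) (auto simp: negligible_iff_emeasure0)
qed

text \<open>An absolutely continuous function is the integral of its almost everywhere derivative. Fine
  partitions are split by their tags: at points of differentiability the increment is close to the
  derivative times the length; the intervals with exceptional tags lie in an open set of small
  measure, so absolute continuity makes their total increment small.\<close>

theorem abs_cont_has_integral:
  fixes f f' :: "real \<Rightarrow> real"
  assumes ac: "abs_cont_on {a..b} f" and ab: "a \<le> b" and N: "negligible N"
    and d: "\<And>x. x \<in> {a..b} - N \<Longrightarrow> (f has_real_derivative f' x) (at x within {a..b})"
    and z: "\<And>x. x \<in> N \<Longrightarrow> f' x = 0"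
  shows "(f' has_integral (f b - f a)) {a..b}"
  unfolding has_integral_real
proof (intro allI impI)
  fix e :: real assume e: "e > 0"
  obtain \<delta> where \<delta>: "\<delta> > 0" and acd: "\<And>m a' b'. (\<forall>i<m. a' i \<le> b' i \<and> {a' i..b' i} \<subseteq> {a..b}) \<Longrightarrow>
     (\<forall>i<m. \<forall>j<m. i \<noteq> j \<longrightarrow> {a' i<..<b' i} \<inter> {a' j<..<b' j} = {}) \<Longrightarrow>
     (\<Sum>i<(m::nat). b' i - a' i) < \<delta> \<Longrightarrow> (\<Sum>i<m. \<bar>f (b' i) - f (a' i)\<bar>) < e / 2"
    using ac[unfolded abs_cont_on_def, rule_format, of "e / 2"] e by auto
  obtain U where U: "open U" "N \<subseteq> U" "U - N \<in> lmeasurable" "emeasure lebesgue (U - N) < ennreal \<delta>"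
    using sets_lebesgue_outer_open[OF negligible_imp_sets[OF N] \<delta>] by metis
  have UN: "U = (U - N) \<union> N" using U(2) by auto
  have Um: "U \<in> lmeasurable" by (subst UN) (intro fmeasurable.Un U(3) negligible_imp_measurable[OF N])
  have "measure lebesgue U \<le> measure lebesgue (U - N) + measure lebesgue N"
    by (subst UN) (intro measure_Un_le; use U(3) N in \<open>auto simp: negligible_imp_sets fmeasurableD\<close>)
  also have "\<dots> < \<delta>"
    using U(3,4) \<delta> negligible_imp_measure0[OF N]
    by (simp add: emeasure_eq_measure2 ennreal_less_iff)
  finally have mU: "measure lebesgue U < \<delta>" .
  define \<epsilon> where "\<epsilon> = e / (2 * (b - a + 1))"
  have \<epsilon>: "\<epsilon> > 0" using e ab by (simp add: \<epsilon>_def)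
  have "\<exists>r>0. \<forall>y\<in>{a..b}. \<bar>y - x\<bar> < r \<longrightarrow> \<bar>f y - f x - f' x * (y - x)\<bar> \<le> \<epsilon> * \<bar>y - x\<bar>" if "x \<in> {a..b} - N" for x
  proof -
    have "(f has_derivative (\<lambda>h. f' x * h)) (at x within {a..b})"
      using d[OF that] by (simp add: has_field_derivative_def)
    then show ?thesis unfolding has_derivative_within_alt using \<epsilon> by (auto simp: real_norm_def)
  qed
  then obtain r where r: "\<And>x. x \<in> {a..b} - N \<Longrightarrow> r x > 0"
    "\<And>x y. x \<in> {a..b} - N \<Longrightarrow> y \<in> {a..b} \<Longrightarrow> \<bar>y - x\<bar> < r x \<Longrightarrow> \<bar>f y - f x - f' x * (y - x)\<bar> \<le> \<epsilon> * \<bar>y - x\<bar>"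
    by metis
  define \<gamma> where "\<gamma> = (\<lambda>x. if x \<in> N then U else if x \<in> {a..b} then ball x (r x) else ball x 1)"
  have g: "gauge \<gamma>" unfolding gauge_def \<gamma>_def using U r(1) by auto
  show "\<exists>\<gamma>. gauge \<gamma> \<and> (\<forall>\<D>. \<D> tagged_division_of {a..b} \<and> \<gamma> fine \<D> \<longrightarrow>
        norm ((\<Sum>(x,k)\<in>\<D>. measure lborel k *\<^sub>R f' x) - (f b - f a)) < e)"
  proof (intro exI[of _ \<gamma>] conjI allI impI g)
    fix \<D> assume D: "\<D> tagged_division_of {a..b} \<and> \<gamma> fine \<D>"
    note tag = tagged_division_ofD[OF conjunct1[OF D]]
    have fineD: "k \<subseteq> \<gamma> x" if "(x, k) \<in> \<D>" for x k using D that by (auto simp: fine_def)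
    have int: "\<exists>u v. u \<le> v \<and> k = {u..v} \<and> x \<in> {u..v} \<and> {u..v} \<subseteq> {a..b}" if "(x, k) \<in> \<D>" for x k
      using tag(2,3,4)[OF that] by (metis atLeastAtMost_iff box_real(2) order_trans)
    define \<D>N where "\<D>N = {xk \<in> \<D>. fst xk \<in> N}"
    have finN: "finite \<D>N" "\<D>N \<subseteq> \<D>" using tag(1) by (auto simp: \<D>N_def)
    let ?t = "\<lambda>(x, k). measure lborel k *\<^sub>R f' x - (f (Sup k) - f (Inf k))"
    have "(\<Sum>(x,k)\<in>\<D>. measure lborel k *\<^sub>R f' x) - (f b - f a) = (\<Sum>xk\<in>\<D>. ?t xk)"
      using additive_tagged_division_1[OF ab conjunct1[OF D], of f]
      by (simp add: sum_subtractf case_prod_unfold)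
    also have "\<dots> = (\<Sum>xk\<in>\<D> - \<D>N. ?t xk) + (\<Sum>xk\<in>\<D>N. ?t xk)"
      by (rule sum.subset_diff[OF finN(2) tag(1)])
    finally have eq: "(\<Sum>(x,k)\<in>\<D>. measure lborel k *\<^sub>R f' x) - (f b - f a) = (\<Sum>xk\<in>\<D> - \<D>N. ?t xk) + (\<Sum>xk\<in>\<D>N. ?t xk)" .
    have good: "\<bar>\<Sum>xk\<in>\<D> - \<D>N. ?t xk\<bar> \<le> \<epsilon> * (b - a)"
    proof -
      have "\<bar>\<Sum>xk\<in>\<D> - \<D>N. ?t xk\<bar> \<le> (\<Sum>xk\<in>\<D> - \<D>N. \<epsilon> * measure lborel (snd xk))"
      proof (rule order_trans[OF sum_abs], rule sum_mono)
        fix xk assume "xk \<in> \<D> - \<D>N"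
        then obtain x k where xk: "xk = (x, k)" "(x, k) \<in> \<D>" "x \<notin> N" by (cases xk) (auto simp: \<D>N_def)
        obtain u v where uv: "u \<le> v" "k = {u..v}" "x \<in> {u..v}" "{u..v} \<subseteq> {a..b}" using int[OF xk(2)] by blast
        have xab: "x \<in> {a..b} - N" using uv xk by auto
        have "{u..v} \<subseteq> ball x (r x)" using fineD[OF xk(2)] uv(2) xab by (auto simp: \<gamma>_def)
        then have "\<bar>u - x\<bar> < r x" "\<bar>v - x\<bar> < r x" using uv(1) by (auto simp: subset_iff dist_real_def abs_minus_commute)
        moreover have "u \<in> {a..b}" "v \<in> {a..b}" using uv by auto
        ultimately have "\<bar>f u - f x - f' x * (u - x)\<bar> \<le> \<epsilon> * \<bar>u - x\<bar>" "\<bar>f v - f x - f' x * (v - x)\<bar> \<le> \<epsilon> * \<bar>v - x\<bar>"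
          using r(2)[OF xab] by blast+
        then have "\<bar>f u - f x - f' x * (u - x)\<bar> + \<bar>f v - f x - f' x * (v - x)\<bar> \<le> \<epsilon> * (v - u)"
          using uv(3) by (simp add: abs_if algebra_simps split: if_splits)
        moreover have "(v - u) * f' x - (f v - f u) = (f u - f x - f' x * (u - x)) - (f v - f x - f' x * (v - x))"
          by (simp add: algebra_simps)
        ultimately have "\<bar>(v - u) * f' x - (f v - f u)\<bar> \<le> \<epsilon> * (v - u)" by linarith
        then show "\<bar>?t xk\<bar> \<le> \<epsilon> * measure lborel (snd xk)" using uv xk by simp
      qed
      also have "\<dots> \<le> (\<Sum>xk\<in>\<D>. \<epsilon> * measure lborel (snd xk))"
        using tag(1) \<epsilon> by (intro sum_mono2) auto
      also have "\<dots> = \<epsilon> * (b - a)"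
        using additive_content_tagged_division[of \<D> a b] D ab
        by (simp add: sum_distrib_left[symmetric] case_prod_unfold)
      finally show ?thesis .
    qed
    have bad: "\<bar>\<Sum>xk\<in>\<D>N. ?t xk\<bar> < e / 2"
    proof -
      obtain h where h: "bij_betw h {..<card \<D>N} \<D>N"
        using ex_bij_betw_nat_finite[OF finN(1)] by (auto simp: atLeast0LessThan)
      define a' b' where "a' = (\<lambda>i. Inf (snd (h i)))" and "b' = (\<lambda>i. Sup (snd (h i)))"
      have hD: "h i \<in> \<D>N" if "i < card \<D>N" for i using h that by (auto simp: bij_betw_def)
      have hi: "a' i \<le> b' i \<and> snd (h i) = {a' i..b' i} \<and> {a' i..b' i} \<subseteq> {a..b} \<and> {a' i..b' i} \<subseteq> U" if "i < card \<D>N" for i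
      proof -
        obtain x k where xk: "h i = (x, k)" by (cases "h i")
        have D1: "(x, k) \<in> \<D>" "x \<in> N" using hD[OF that] xk by (auto simp: \<D>N_def)
        obtain u v where uv: "u \<le> v" "k = {u..v}" "x \<in> {u..v}" "{u..v} \<subseteq> {a..b}" using int[OF D1(1)] by blast
        have "a' i = u" "b' i = v" using uv xk by (simp_all add: a'_def b'_def)
        then show ?thesis using uv xk fineD[OF D1(1)] D1(2) by (simp add: \<gamma>_def)
      qed
      have disj: "{a' i<..<b' i} \<inter> {a' j<..<b' j} = {}" if "i < card \<D>N" "j < card \<D>N" "i \<noteq> j" for i j
      proof -
        have "h i \<noteq> h j" using h that by (auto simp: bij_betw_def inj_on_def)
        moreover have "h i \<in> \<D>" "h j \<in> \<D>" using hD that finN by auto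
        ultimately have "interior (snd (h i)) \<inter> interior (snd (h j)) = {}"
          using tag(5)[of "fst (h i)" "snd (h i)" "fst (h j)" "snd (h j)"] by simp
        then show ?thesis using hi that by simp
      qed
      have "(\<Sum>i<card \<D>N. b' i - a' i) = (\<Sum>i<card \<D>N. measure lebesgue {a' i<..<b' i})"
        using hi by (intro sum.cong) auto
      also have "\<dots> = measure lebesgue (\<Union>i<card \<D>N. {a' i<..<b' i})"
      proof (rule measure_finite_Union[symmetric])
        show "disjoint_family_on (\<lambda>i. {a' i<..<b' i}) {..<card \<D>N}"
          using disj by (auto simp: disjoint_family_on_def)
        show "emeasure lebesgue {a' i<..<b' i} \<noteq> \<infinity>" for i by (cases "a' i \<le> b' i") auto
      qed auto
      also have "\<dots> \<le> measure lebesgue U"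
        using hi Um by (intro measure_mono_fmeasurable) (auto simp: subset_iff)
      finally have "(\<Sum>i<card \<D>N. b' i - a' i) < \<delta>" using mU by linarith
      then have *: "(\<Sum>i<card \<D>N. \<bar>f (b' i) - f (a' i)\<bar>) < e / 2"
        using hi disj by (intro acd) auto
      have "\<bar>\<Sum>xk\<in>\<D>N. ?t xk\<bar> \<le> (\<Sum>xk\<in>\<D>N. \<bar>?t xk\<bar>)" by (rule sum_abs)
      also have "\<dots> = (\<Sum>xk\<in>\<D>N. \<bar>f (Sup (snd xk)) - f (Inf (snd xk))\<bar>)"
        by (intro sum.cong refl) (auto simp: \<D>N_def z case_prod_unfold abs_minus_commute)
      also have "\<dots> = (\<Sum>i<card \<D>N. \<bar>f (b' i) - f (a' i)\<bar>)"
        unfolding a'_def b'_def by (rule sum.reindex_bij_betw[OF h, symmetric])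
      finally show ?thesis using * by linarith
    qed
    have "\<epsilon> * (b - a) \<le> \<epsilon> * (b - a + 1)" using \<epsilon> by simp
    also have "\<dots> = e / 2"
    proof -
      have "e / (2 * s) * s = e / 2" if "s \<noteq> 0" for s using that by simp
      from this[of "b - a + 1"] show ?thesis unfolding \<epsilon>_def using ab by linarith
    qed
    finally have "\<epsilon> * (b - a) \<le> e / 2" .
    then show "norm ((\<Sum>(x,k)\<in>\<D>. measure lborel k *\<^sub>R f' x) - (f b - f a)) < e"
      unfolding eq real_norm_def using good bad by linarith
  qed
qed

lemma smooth_step_scaled_DERIV:
  "((\<lambda>t. smooth_step (m * (t - c))) has_real_derivative m * smooth_kernel (m * (t - c))) (at t)"
proof -
  have "((\<lambda>t. m * (t - c)) has_real_derivative m) (at t)" by (auto intro!: derivative_eq_intros)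
  from DERIV_chain2[OF smooth_step_DERIV this] show ?thesis by (simp add: mult.commute)
qed

lemma deriv_ramp_difference:
  "deriv (\<lambda>t. smooth_step (m * (t - a)) - smooth_step (m * (t - b))) t
     = m * smooth_kernel (m * (t - a)) - m * smooth_kernel (m * (t - b))"
  by (intro DERIV_imp_deriv DERIV_diff smooth_step_scaled_DERIV)

text \<open>The kernel \<open>m \<rho>(m (t - c))\<close> has mass one and lives on \<open>[c, c + 1/m]\<close>.\<close>

lemma kernel_tendsto:
  fixes f :: "real \<Rightarrow> real"
  assumes f: "continuous_on {0<..<T} f" and c: "0 < c" "c < T"
  shows "(\<lambda>m. LINT t|lebesgue_on {0<..<T}. (real m * smooth_kernel (real m * (t - c))) * f t) \<longlonglongrightarrow> f c"
    and "\<forall>\<^sub>F m in sequentially. integrable (lebesgue_on {0<..<T}) (\<lambda>t. (real m * smooth_kernel (real m * (t - c))) * f t)"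
proof -
  let ?k = "\<lambda>m t. real m * smooth_kernel (real m * (t - c))"
  have kc: "continuous_on S (?k m)" for m S
    by (intro continuous_intros continuous_on_compose2[OF smooth_kernel_cont[of UNIV]]) auto
  have k0: "?k m t = 0" if "m > 0" "t \<notin> {c..c + 1 / real m}" for m t
  proof -
    have "real m * (t - c) \<le> 0 \<or> real m * (t - c) \<ge> 1"
      using that by (cases "t < c") (auto simp: field_simps mult_nonneg_nonpos)
    then show ?thesis using smooth_kernel_zero by simp
  qed
  have knn: "?k m t \<ge> 0" for m t using smooth_kernel_nonneg by simp
  have mass: "(?k m has_integral 1) {c..c + 1 / real m}" if "m > 0" for m
  proof -
    have "(?k m has_integral (smooth_step (real m * (c + 1 / real m - c)) - smooth_step (real m * (c - c)))) {c..c + 1 / real m}"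
    proof (rule fundamental_theorem_of_calculus)
      fix x
      have "((\<lambda>t. smooth_step (real m * (t - c))) has_real_derivative ?k m x) (at x)"
        by (rule smooth_step_scaled_DERIV)
      then show "((\<lambda>t. smooth_step (real m * (t - c))) has_vector_derivative ?k m x) (at x within {c..c + 1 / real m})"
        by (simp add: has_real_derivative_iff_has_vector_derivative has_vector_derivative_at_within)
    qed simp
    then show ?thesis using that by (simp add: smooth_step_0 smooth_step_1)
  qed
  have key: "integrable (lebesgue_on {0<..<T}) (\<lambda>t. ?k m t * f t) \<and>
      (LINT t|lebesgue_on {0<..<T}. ?k m t * f t) = integral {c..c + 1 / real m} (\<lambda>t. ?k m t * f t)"
    if m: "m > 0" "c + 1 / real m < T" for m
  proof -
    have sub: "{c..c + 1 / real m} \<subseteq> {0<..<T}" using m c by auto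
    have cont: "continuous_on {c..c + 1 / real m} (\<lambda>t. ?k m t * f t)"
      by (intro continuous_on_mult kc continuous_on_subset[OF f sub])
    have ai: "(\<lambda>t. ?k m t * f t) absolutely_integrable_on {c..c + 1 / real m}"
      by (rule absolutely_integrable_continuous_real[OF cont])
    have eq: "(\<lambda>t. if t \<in> {0<..<T} then ?k m t * f t else 0) = (\<lambda>t. if t \<in> {c..c + 1 / real m} then ?k m t * f t else 0)"
      using sub k0[OF m(1)] by (auto simp: fun_eq_iff)
    have "(\<lambda>t. ?k m t * f t) absolutely_integrable_on {0<..<T}"
      using ai absolutely_integrable_restrict_UNIV[of "{0<..<T}" "\<lambda>t. ?k m t * f t"]
        absolutely_integrable_restrict_UNIV[of "{c..c + 1 / real m}" "\<lambda>t. ?k m t * f t"] unfolding eq by simp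
    then have i: "integrable (lebesgue_on {0<..<T}) (\<lambda>t. ?k m t * f t)"
      by (rule absolutely_integrable_imp_integrable) auto
    have "(LINT t|lebesgue_on {0<..<T}. ?k m t * f t) = integral {0<..<T} (\<lambda>t. ?k m t * f t)"
      by (rule lebesgue_integral_eq_integral[OF i]) auto
    also have "\<dots> = integral {c..c + 1 / real m} (\<lambda>t. ?k m t * f t)"
      using integral_restrict_UNIV[of "{0<..<T}" "\<lambda>t. ?k m t * f t"]
        integral_restrict_UNIV[of "{c..c + 1 / real m}" "\<lambda>t. ?k m t * f t"] unfolding eq by simp
    finally show ?thesis using i by simp
  qed
  have "\<forall>\<^sub>F m in sequentially. 1 / real m < T - c"
    using c by (intro order_tendstoD(2)[OF lim_1_over_n]) auto
  then have ev: "\<forall>\<^sub>F m in sequentially. m > 0 \<and> c + 1 / real m < T"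
    using eventually_gt_at_top[of 0] by eventually_elim auto
  show "\<forall>\<^sub>F m in sequentially. integrable (lebesgue_on {0<..<T}) (\<lambda>t. ?k m t * f t)"
    using ev by eventually_elim (use key in blast)
  show "(\<lambda>m. LINT t|lebesgue_on {0<..<T}. ?k m t * f t) \<longlonglongrightarrow> f c"
  proof (rule tendstoI)
    fix e :: real assume e: "e > 0"
    have "isCont f c" using f c by (simp add: continuous_on_eq_continuous_at)
    then obtain s where s: "s > 0" "\<And>t. \<bar>t - c\<bar> < s \<Longrightarrow> \<bar>f t - f c\<bar> < e / 2"
      using e unfolding continuous_at_eps_delta by (metis dist_real_def half_gt_zero)
    have "\<forall>\<^sub>F m in sequentially. 1 / real m < s"
      using s by (intro order_tendstoD(2)[OF lim_1_over_n]) auto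
    then show "\<forall>\<^sub>F m in sequentially. dist (LINT t|lebesgue_on {0<..<T}. ?k m t * f t) (f c) < e"
      using ev
    proof eventually_elim
      fix m assume ms: "1 / real m < s" and m: "m > 0 \<and> c + 1 / real m < T"
      let ?J = "{c..c + 1 / real m}"
      have sub: "?J \<subseteq> {0<..<T}" using m c by auto
      have i1: "(\<lambda>t. ?k m t * f t) integrable_on ?J"
        by (intro integrable_continuous_real continuous_on_mult kc continuous_on_subset[OF f sub])
      have i2: "((\<lambda>t. ?k m t * f c) has_integral (1 * f c)) ?J" using mass m by (intro has_integral_mult_left) auto
      have i3: "((\<lambda>t. ?k m t * (e / 2)) has_integral (1 * (e / 2))) ?J" using mass m by (intro has_integral_mult_left) auto
      have "integral ?J (\<lambda>t. ?k m t * f t) - f c = integral ?J (\<lambda>t. ?k m t * f t - ?k m t * f c)"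
        using Henstock_Kurzweil_Integration.integral_diff[OF i1 has_integral_integrable[OF i2]] integral_unique[OF i2]
        by linarith
      moreover have "norm (integral ?J (\<lambda>t. ?k m t * f t - ?k m t * f c)) \<le> integral ?J (\<lambda>t. ?k m t * (e / 2))"
      proof (rule integral_norm_bound_integral)
        show "(\<lambda>t. ?k m t * f t - ?k m t * f c) integrable_on ?J"
          using i1 i2 by (intro integrable_diff) (auto intro: has_integral_integrable)
        show "(\<lambda>t. ?k m t * (e / 2)) integrable_on ?J" using i3 by (rule has_integral_integrable)
        fix t assume "t \<in> ?J"
        then have "\<bar>t - c\<bar> < s" using ms by auto
        then have "\<bar>f t - f c\<bar> \<le> e / 2" using s(2)[of t] by simp
        then have "?k m t * \<bar>f t - f c\<bar> \<le> ?k m t * (e / 2)" using knn by (intro mult_left_mono)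
        then show "norm (?k m t * f t - ?k m t * f c) \<le> ?k m t * (e / 2)"
          by (simp add: right_diff_distrib[symmetric] abs_mult abs_of_nonneg[OF smooth_kernel_nonneg])
      qed
      moreover have "integral ?J (\<lambda>t. ?k m t * (e / 2)) = e / 2" using integral_unique[OF i3] by simp
      ultimately have "\<bar>integral ?J (\<lambda>t. ?k m t * f t) - f c\<bar> \<le> e / 2"
        unfolding real_norm_def by linarith
      then show "dist (LINT t|lebesgue_on {0<..<T}. ?k m t * f t) (f c) < e"
        using key[of m] m e by (simp add: dist_real_def)
    qed
  qed
qed

text \<open>The du Bois-Reymond lemma: a continuous function with an integrable distributional derivative
  is an integral of that derivative. The test functions are smooth approximations of the indicator
  of \<open>[a, b]\<close>.\<close>

theorem weak_derivative_increment:
  fixes f k :: "real \<Rightarrow> real"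
  assumes f: "continuous_on {0<..<T} f" and k: "integrable (lebesgue_on {0<..<T}) k"
    and weak: "\<And>\<phi>. test_fun {0<..<T} \<phi> \<Longrightarrow>
      (LINT t|lebesgue_on {0<..<T}. deriv \<phi> t * f t) = - (LINT t|lebesgue_on {0<..<T}. \<phi> t * k t)"
    and ab: "0 < a" "a < b" "b < T"
  shows "(k has_integral (f b - f a)) {a..b}"
proof -
  let ?M = "lebesgue_on {0<..<T}"
  let ?\<phi> = "\<lambda>m t. smooth_step (real m * (t - a)) - smooth_step (real m * (t - b))"
  have Ck: "Ck_on j UNIV (?\<phi> m)" for j m
  proof -
    have "Ck_on j UNIV (\<lambda>t::real. smooth_step (t \<bullet> real m + (- real m * c)))" for c
      by (rule Ck_on_compose_affine[OF Ck_on_smooth_step])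
    then have "Ck_on j UNIV (\<lambda>t. smooth_step (real m * (t - c)))" for c
      by (simp add: algebra_simps)
    from Ck_on_add[OF this[of a] Ck_on_cmult[OF this[of b], of "-1"]] show ?thesis by simp
  qed
  have "\<forall>\<^sub>F m in sequentially. 1 / real m < T - b"
    using ab by (intro order_tendstoD(2)[OF lim_1_over_n]) auto
  then have ev: "\<forall>\<^sub>F m in sequentially. test_fun {0<..<T} (?\<phi> m)"
    using eventually_gt_at_top[of 0]
  proof eventually_elim
    fix m :: nat assume m: "1 / real m < T - b" "m > 0"
    show "test_fun {0<..<T} (?\<phi> m)"
    proof (rule test_funI[OF Ck, of _ "{a..b + 1 / real m}"])
      show "{t. ?\<phi> m t \<noteq> 0} \<subseteq> {a..b + 1 / real m}"
      proof (rule subsetI, rule ccontr)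
        fix t assume t: "t \<in> {t. ?\<phi> m t \<noteq> 0}" "t \<notin> {a..b + 1 / real m}"
        show False
        proof (cases "t < a")
          case True
          then have "real m * (t - a) \<le> 0" "real m * (t - b) \<le> 0" using ab by (auto intro: mult_nonneg_nonpos)
          then show False using t by (simp add: smooth_step_0)
        next
          case False
          then have "t - b \<ge> 1 / real m" using t(2) by auto
          then have "real m * (t - b) \<ge> real m * (1 / real m)" by (intro mult_left_mono) auto
          then have 1: "real m * (t - b) \<ge> 1" using m by simp
          moreover have "real m * (t - a) \<ge> real m * (t - b)" using ab by (intro mult_left_mono) auto
          ultimately show False using t by (simp add: smooth_step_1)
        qed
      qed
      show "{a..b + 1 / real m} \<subseteq> {0<..<T}" using m ab by auto
    qed simp
  qed
  have lhs: "(\<lambda>m. LINT t|?M. deriv (?\<phi> m) t * f t) \<longlonglongrightarrow> f a - f b"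
  proof (rule Lim_transform_eventually)
    show "(\<lambda>m. (LINT t|?M. (real m * smooth_kernel (real m * (t - a))) * f t)
         - (LINT t|?M. (real m * smooth_kernel (real m * (t - b))) * f t)) \<longlonglongrightarrow> f a - f b"
      using ab by (intro tendsto_diff kernel_tendsto(1)[OF f]) auto
    have "\<forall>\<^sub>F m in sequentially. integrable ?M (\<lambda>t. (real m * smooth_kernel (real m * (t - a))) * f t)"
         "\<forall>\<^sub>F m in sequentially. integrable ?M (\<lambda>t. (real m * smooth_kernel (real m * (t - b))) * f t)"
      using ab by (intro kernel_tendsto(2)[OF f]; simp)+
    then show "\<forall>\<^sub>F m in sequentially. (LINT t|?M. (real m * smooth_kernel (real m * (t - a))) * f t)
         - (LINT t|?M. (real m * smooth_kernel (real m * (t - b))) * f t) = (LINT t|?M. deriv (?\<phi> m) t * f t)"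
    proof eventually_elim
      fix m :: nat
      assume i: "integrable ?M (\<lambda>t. (real m * smooth_kernel (real m * (t - a))) * f t)"
        "integrable ?M (\<lambda>t. (real m * smooth_kernel (real m * (t - b))) * f t)"
      show "(LINT t|?M. (real m * smooth_kernel (real m * (t - a))) * f t)
         - (LINT t|?M. (real m * smooth_kernel (real m * (t - b))) * f t) = (LINT t|?M. deriv (?\<phi> m) t * f t)"
        unfolding deriv_ramp_difference left_diff_distrib by (rule Bochner_Integration.integral_diff[OF i, symmetric])
    qed
  qed
  have rhs: "(\<lambda>m. LINT t|?M. ?\<phi> m t * k t) \<longlonglongrightarrow> (LINT t|?M. indicator {a<..b} t * k t)"
  proof (rule integral_dominated_convergence[where w = "\<lambda>t. \<bar>k t\<bar>"])
    have [measurable]: "k \<in> borel_measurable ?M" using k by simp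
    have "(indicator {a<..b} :: real \<Rightarrow> real) \<in> borel_measurable ?M"
      by (intro measurable_restrict_space1 borel_measurable_indicator) auto
    then show "(\<lambda>t. indicator {a<..b} t * k t) \<in> borel_measurable ?M" by measurable
    show "(\<lambda>t. ?\<phi> m t * k t) \<in> borel_measurable ?M" for m
      using smooth_measurable_lebesgue_on[of "?\<phi> m"] Ck[of 0 m] by auto
    show "integrable ?M (\<lambda>t. \<bar>k t\<bar>)" using k by simp
    show "AE t in ?M. (\<lambda>m. ?\<phi> m t * k t) \<longlonglongrightarrow> indicator {a<..b} t * k t"
    proof (intro always_eventually allI tendsto_mult tendsto_const)
      fix t
      have "(\<lambda>m. ?\<phi> m t) \<longlonglongrightarrow> (if t - a > 0 then 1 else 0) - (if t - b > 0 then 1 else 0)"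
        by (intro tendsto_diff smooth_step_scaled_tendsto)
      moreover have "(if t - a > 0 then 1 else 0) - (if t - b > 0 then 1 else 0) = (indicator {a<..b} t :: real)"
        using ab by (auto simp: indicator_def)
      ultimately show "(\<lambda>m. ?\<phi> m t) \<longlonglongrightarrow> indicator {a<..b} t" by simp
    qed
    show "AE t in ?M. norm (?\<phi> m t * k t) \<le> \<bar>k t\<bar>" for m
    proof (intro always_eventually allI)
      fix t
      have "\<bar>?\<phi> m t\<bar> \<le> 1" using smooth_step_range[of "real m * (t - a)"] smooth_step_range[of "real m * (t - b)"] by linarith
      then show "norm (?\<phi> m t * k t) \<le> \<bar>k t\<bar>" by (simp add: abs_mult mult_left_le_one_le)
    qed
  qed
  have "(\<lambda>m. LINT t|?M. deriv (?\<phi> m) t * f t) \<longlonglongrightarrow> - (LINT t|?M. indicator {a<..b} t * k t)"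
    by (rule Lim_transform_eventually[OF tendsto_minus[OF rhs]])
      (use ev in \<open>eventually_elim, simp add: weak\<close>)
  from LIMSEQ_unique[OF lhs this] have eq: "f b - f a = (LINT t|?M. indicator {a<..b} t * k t)" by simp
  have ik: "integrable ?M (\<lambda>t. indicator {a<..b} t * k t)"
  proof (rule Bochner_Integration.integrable_bound[OF k])
    have "(indicator {a<..b} :: real \<Rightarrow> real) \<in> borel_measurable ?M"
      by (intro measurable_restrict_space1 borel_measurable_indicator) auto
    then show "(\<lambda>t. indicator {a<..b} t * k t) \<in> borel_measurable ?M" using k by measurable
  qed (auto simp: indicator_def)
  have "((\<lambda>t. indicator {a<..b} t * k t) has_integral (f b - f a)) {0<..<T}"
    unfolding eq by (rule has_integral_integral_lebesgue_on[OF ik]) auto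
  then have "((\<lambda>t. if t \<in> {0<..<T} then indicator {a<..b} t * k t else 0) has_integral (f b - f a)) UNIV"
    by (rule has_integral_restrict_UNIV[THEN iffD2])
  moreover have "(\<lambda>t. if t \<in> {0<..<T} then indicator {a<..b} t * k t else 0) = (\<lambda>t. if t \<in> {a<..b} then k t else 0)"
    using ab by (auto simp: fun_eq_iff indicator_def)
  ultimately have "((\<lambda>t. if t \<in> {a<..b} then k t else 0) has_integral (f b - f a)) UNIV"
    by simp
  then have "((\<lambda>t. if t \<in> {a..b} then k t else 0) has_integral (f b - f a)) UNIV"
    by (rule has_integral_spike[of "{a}", rotated 2]) auto
  then show ?thesis by (simp only: has_integral_restrict_UNIV)
qed

lemma integral_mono_negligible:
  fixes f g :: "real \<Rightarrow> real"
  assumes "f integrable_on S" "g integrable_on S" "negligible N" "\<And>x. x \<in> S \<Longrightarrow> x \<notin> N \<Longrightarrow> f x \<le> g x"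
  shows "integral S f \<le> integral S g"
proof -
  let ?f = "\<lambda>x. if x \<in> N then g x else f x"
  have "integral S f = integral S ?f" by (rule integral_spike[OF assms(3)]) auto
  also have "\<dots> \<le> integral S g"
    by (rule integral_le[OF integrable_spike[OF assms(1,3)] assms(2)]) (use assms(4) in auto)
  finally show ?thesis .
qed

section \<open>The evolution on a time interval\<close>

lemma L2_inner_tendsto_eventually:
  assumes f: "\<forall>\<^sub>F k in F. f k \<in> L2 \<Omega>" and g: "g \<in> L2 \<Omega>"
    and lim: "((\<lambda>k. L2_norm \<Omega> (\<lambda>x. f k x - g x)) \<longlongrightarrow> 0) F"
    and f': "\<forall>\<^sub>F k in F. f' k \<in> L2 \<Omega>" and g': "g' \<in> L2 \<Omega>"
    and lim': "((\<lambda>k. L2_norm \<Omega> (\<lambda>x. f' k x - g' x)) \<longlongrightarrow> 0) F"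
  shows "((\<lambda>k. L2_inner \<Omega> (f k) (f' k)) \<longlongrightarrow> L2_inner \<Omega> g g') F"
proof -
  let ?f = "\<lambda>k. if f k \<in> L2 \<Omega> then f k else g" and ?f' = "\<lambda>k. if f' k \<in> L2 \<Omega> then f' k else g'"
  have "((\<lambda>k. L2_inner \<Omega> (?f k) (?f' k)) \<longlongrightarrow> L2_inner \<Omega> g g') F"
  proof (rule L2_inner_tendsto)
    show "((\<lambda>k. L2_norm \<Omega> (\<lambda>x. ?f k x - g x)) \<longlongrightarrow> 0) F"
      by (rule Lim_transform_eventually[OF lim]) (use f in \<open>eventually_elim, simp\<close>)
    show "((\<lambda>k. L2_norm \<Omega> (\<lambda>x. ?f' k x - g' x)) \<longlongrightarrow> 0) F"
      by (rule Lim_transform_eventually[OF lim']) (use f' in \<open>eventually_elim, simp\<close>)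
  qed (use g g' in auto)
  then show ?thesis
    by (rule Lim_transform_eventually) (use f f' in \<open>eventually_elim, simp\<close>)
qed

text \<open>The choice \<open>\<kappa> = y / t\<close> turns a family of Young inequalities back into a Cauchy-Schwarz inequality.\<close>

lemma sq_le_of_weighted_bounds:
  fixes y t A :: real
  assumes "\<And>\<kappa>. \<kappa> > 0 \<Longrightarrow> y \<le> \<kappa> * t / 2 + A / (2 * \<kappa>)" "t > 0" "A \<ge> 0" "y \<ge> 0"
  shows "y\<^sup>2 \<le> t * A"
proof (cases "y = 0")
  case False
  then have y: "y > 0" using assms by simp
  have "y \<le> (y / t) * t / 2 + A / (2 * (y / t))" by (rule assms(1)) (use y assms in simp)
  also have "\<dots> = y / 2 + A * t / (2 * y)" using y assms by simp
  finally have "y / 2 \<le> A * t / (2 * y)" by simp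
  then show ?thesis using y by (simp add: field_simps power2_eq_square)
qed (use assms in simp)

lemma memory_kernel_reflect:
  assumes "continuous_on {0..t} g" "0 \<le> t"
  shows "integral {0..t} (\<lambda>s. g (t - s)) = integral {0..t} (g :: real \<Rightarrow> real)"
proof -
  have "(g has_integral integral {0..t} g) {0..t}" using assms by (intro integrable_integral integrable_continuous_real)
  then have "(g has_integral integral {0..t} g) (cbox 0 t)" by simp
  from has_integral_affinity[OF this, of "-1" t]
  have "((\<lambda>x. g (t - x)) has_integral integral {0..t} g) ((\<lambda>x. t - x) ` {0..t})"
    using assms by (simp add: image_affinity_cbox)
  moreover have "(\<lambda>x. t - x) ` {0..t} = {0..t}" using assms by (auto simp: image_iff intro!: bexI[of _ "t - _"])
  ultimately show ?thesis by (simp add: integral_unique)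
qed

lemma (in bounded_open_domain) weak_laplace:
  assumes z: "z \<in> H10 \<Omega>" and \<psi>: "test_fun \<Omega> \<psi>"
  shows "L2_inner \<Omega> (wgrad \<Omega> z) (grad \<psi>) = - L2_inner \<Omega> z (\<lambda>x. \<Sum>b\<in>Basis. partial b (partial b \<psi>) x)"
    and "(\<lambda>x. \<Sum>b\<in>Basis. partial b (partial b \<psi>) x) \<in> L2 \<Omega>"
proof -
  note G = has_weak_gradD[OF has_weak_grad_wgrad[OF H10_H1[OF z]]]
  have pp: "partial b (partial b \<psi>) \<in> L2 \<Omega>" if "b \<in> Basis" for b
    by (intro test_L2(1) test_fun_partial \<psi> that)
  have sumL2: "finite I \<Longrightarrow> I \<subseteq> Basis \<Longrightarrow> (\<lambda>x. \<Sum>b\<in>I. partial b (partial b \<psi>) x) \<in> L2 \<Omega> \<and>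
     L2_inner \<Omega> z (\<lambda>x. \<Sum>b\<in>I. partial b (partial b \<psi>) x) = (\<Sum>b\<in>I. L2_inner \<Omega> z (partial b (partial b \<psi>)))" for I
  proof (induction I rule: finite_induct)
    case empty then show ?case by (simp add: L2_zero) (simp add: L2_inner_def)
  next
    case (insert b I)
    then show ?case using pp[of b] L2_add[of "partial b (partial b \<psi>)" \<Omega>]
        L2_inner_add_right[of "partial b (partial b \<psi>)" \<Omega> _ z] H10_L2[OF z] by simp
  qed
  show "(\<lambda>x. \<Sum>b\<in>Basis. partial b (partial b \<psi>) x) \<in> L2 \<Omega>" using sumL2[of Basis] by simp
  have "L2_inner \<Omega> (wgrad \<Omega> z) (grad \<psi>) = (LINT x|lebesgue_on \<Omega>. (\<Sum>b\<in>Basis. (wgrad \<Omega> z x \<bullet> b) * partial b \<psi> x))"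
    unfolding L2_inner_def grad_def by (simp add: inner_sum_right mult.commute)
  also have "\<dots> = (\<Sum>b\<in>Basis. L2_inner \<Omega> (\<lambda>x. wgrad \<Omega> z x \<bullet> b) (partial b \<psi>))"
    unfolding L2_inner_def
    using L2_inner_integrable[OF L2_inner_component[OF G(1)] test_L2(1)[OF test_fun_partial[OF \<psi>]]]
    by (simp add: Bochner_Integration.integral_sum)
  also have "\<dots> = (\<Sum>b\<in>Basis. - L2_inner \<Omega> z (partial b (partial b \<psi>)))"
    using G(2)[OF test_fun_partial[OF \<psi>]] by (intro sum.cong) auto
  also have "\<dots> = - L2_inner \<Omega> z (\<lambda>x. \<Sum>b\<in>Basis. partial b (partial b \<psi>) x)"
    using sumL2[of Basis] by (simp add: sum_negf)
  finally show "L2_inner \<Omega> (wgrad \<Omega> z) (grad \<psi>) = - L2_inner \<Omega> z (\<lambda>x. \<Sum>b\<in>Basis. partial b (partial b \<psi>) x)" .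
qed

text \<open>Scaling \<open>z\<close> to the unit ball requires the homogeneity of the norm and of \<open>f\<close>, and the supremum is
  meaningful as the functional is bounded there.\<close>

lemma (in bounded_open_domain) H10_dual_pairing_le:
  assumes f: "f \<in> H10_dual \<Omega>" and z: "z \<in> H10 \<Omega>"
  shows "\<bar>f z\<bar> \<le> H10_dual_norm \<Omega> f * H10_norm \<Omega> z"
proof -
  obtain K where lin: "\<And>y z a b. y \<in> H10 \<Omega> \<Longrightarrow> z \<in> H10 \<Omega> \<Longrightarrow> f (\<lambda>x. a * y x + b * z x) = a * f y + b * f z"
    and K: "\<And>z. z \<in> H10 \<Omega> \<Longrightarrow> \<bar>f z\<bar> \<le> K * H10_norm \<Omega> z"
    using f unfolding H10_dual_def by blast
  have nn: "0 \<le> H10_norm \<Omega> y" for y by (simp add: H10_norm_def)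
  have hom: "(\<lambda>x. c * y x) \<in> H10 \<Omega> \<and> H10_norm \<Omega> (\<lambda>x. c * y x) = \<bar>c\<bar> * H10_norm \<Omega> y \<and> f (\<lambda>x. c * y x) = c * f y"
    if y: "y \<in> H10 \<Omega>" for c y
  proof -
    have zero: "(\<lambda>x. y x - y x) \<in> H10 \<Omega>" by (rule H10_diff(1)[OF y y])
    have 1: "(\<lambda>x. c * y x) \<in> H10 \<Omega>" using H10_lin(1)[OF zero y, of c] by simp
    have "AE x in lebesgue_on \<Omega>. wgrad \<Omega> (\<lambda>x. y x - y x) x = 0" using wgrad_diff[OF y y] by simp
    moreover have "AE x in lebesgue_on \<Omega>. wgrad \<Omega> (\<lambda>x. c * y x) x = wgrad \<Omega> (\<lambda>x. y x - y x) x + c *\<^sub>R wgrad \<Omega> y x"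
      using wgrad_lin[OF zero y, of c] by simp
    ultimately have "AE x in lebesgue_on \<Omega>. wgrad \<Omega> (\<lambda>x. c * y x) x = c *\<^sub>R wgrad \<Omega> y x" by eventually_elim simp
    then have "H10_norm \<Omega> (\<lambda>x. c * y x) = L2_norm \<Omega> (\<lambda>x. c *\<^sub>R wgrad \<Omega> y x)"
      unfolding H10_norm_def by (intro L2_norm_cong_AE wgrad_L2 1 L2_scaleR y)
    moreover have "f (\<lambda>x. c * y x) = c * f y" using lin[OF y y, of c 0] by simp
    ultimately show ?thesis using 1 by (simp add: L2_norm_scaleR H10_norm_def)
  qed
  let ?S = "{\<bar>f z\<bar> | z. z \<in> H10 \<Omega> \<and> H10_norm \<Omega> z \<le> 1}"
  have bdd: "bdd_above ?S"
  proof (rule bdd_aboveI[of _ "\<bar>K\<bar>"])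
    fix r assume "r \<in> ?S"
    then obtain y where y: "r = \<bar>f y\<bar>" "y \<in> H10 \<Omega>" "H10_norm \<Omega> y \<le> 1" by blast
    have "r \<le> K * H10_norm \<Omega> y" using K y by simp
    also have "\<dots> \<le> \<bar>K\<bar> * H10_norm \<Omega> y" using nn by (intro mult_right_mono) auto
    also have "\<dots> \<le> \<bar>K\<bar>" using y(3) nn by (simp add: mult_left_le)
    finally show "r \<le> \<bar>K\<bar>" .
  qed
  show ?thesis
  proof (cases "H10_norm \<Omega> z = 0")
    case True
    then show ?thesis using K[OF z] by simp
  next
    case False
    then have pos: "H10_norm \<Omega> z > 0" using nn[of z] by simp
    let ?c = "1 / H10_norm \<Omega> z"
    have "H10_norm \<Omega> (\<lambda>x. ?c * z x) \<le> 1" using hom[OF z, of ?c] pos by simp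
    then have "\<bar>f (\<lambda>x. ?c * z x)\<bar> \<in> ?S" using hom[OF z, of ?c] by blast
    then have "\<bar>f (\<lambda>x. ?c * z x)\<bar> \<le> H10_dual_norm \<Omega> f"
      unfolding H10_dual_norm_def by (rule cSup_upper[OF _ bdd])
    then have "?c * \<bar>f z\<bar> \<le> H10_dual_norm \<Omega> f" using hom[OF z, of ?c] pos by (simp add: abs_mult)
    then show ?thesis using pos by (simp add: field_simps)
  qed
qed

lemma H10_dual_diff:
  assumes "f \<in> H10_dual \<Omega>" "h \<in> H10_dual \<Omega>" shows "f - h \<in> H10_dual \<Omega>"
proof -
  obtain K K' where "\<And>z. z \<in> H10 \<Omega> \<Longrightarrow> \<bar>f z\<bar> \<le> K * H10_norm \<Omega> z" "\<And>z. z \<in> H10 \<Omega> \<Longrightarrow> \<bar>h z\<bar> \<le> K' * H10_norm \<Omega> z"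
    using assms unfolding H10_dual_def by blast
  then have "\<bar>(f - h) z\<bar> \<le> (K + K') * H10_norm \<Omega> z" if "z \<in> H10 \<Omega>" for z
    using that by (simp add: distrib_right) (smt (verit))
  moreover have "(f - h) (\<lambda>x. a * y x + b * z x) = a * (f - h) y + b * (f - h) z" if "y \<in> H10 \<Omega>" "z \<in> H10 \<Omega>" for a b y z
  proof -
    have "f (\<lambda>x. a * y x + b * z x) = a * f y + b * f z" "h (\<lambda>x. a * y x + b * z x) = a * h y + b * h z"
      using assms that unfolding H10_dual_def by blast+
    then show ?thesis by (simp add: algebra_simps)
  qed
  ultimately show ?thesis unfolding H10_dual_def by blast
qed

lemma abs_cont_on_subset:
  assumes f: "abs_cont_on I f" and sub: "J \<subseteq> I"
  shows "abs_cont_on J f"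
  unfolding abs_cont_on_def
proof (intro allI impI)
  fix \<epsilon> :: real assume "\<epsilon> > 0"
  from f[unfolded abs_cont_on_def, rule_format, OF this] obtain \<delta> where "\<delta> > 0" and
    \<delta>: "\<forall>(m::nat) a b. (\<forall>i<m. a i \<le> b i \<and> {a i..b i} \<subseteq> I) \<and>
         (\<forall>i<m. \<forall>j<m. i \<noteq> j \<longrightarrow> {a i<..<b i} \<inter> {a j<..<b j} = {}) \<and> (\<Sum>i<m. b i - a i) < \<delta>
         \<longrightarrow> (\<Sum>i<m. \<bar>f (b i) - f (a i)\<bar>) < \<epsilon>" by (elim exE conjE) (rule that; assumption)
  show "\<exists>\<delta>>0. \<forall>(m::nat) a b. (\<forall>i<m. a i \<le> b i \<and> {a i..b i} \<subseteq> J) \<and>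
         (\<forall>i<m. \<forall>j<m. i \<noteq> j \<longrightarrow> {a i<..<b i} \<inter> {a j<..<b j} = {}) \<and> (\<Sum>i<m. b i - a i) < \<delta>
         \<longrightarrow> (\<Sum>i<m. \<bar>f (b i) - f (a i)\<bar>) < \<epsilon>"
  proof (intro exI[of _ \<delta>] conjI allI impI \<open>\<delta> > 0\<close>)
    fix m :: nat and a b :: "nat \<Rightarrow> real"
    assume as: "(\<forall>i<m. a i \<le> b i \<and> {a i..b i} \<subseteq> J) \<and>
         (\<forall>i<m. \<forall>j<m. i \<noteq> j \<longrightarrow> {a i<..<b i} \<inter> {a j<..<b j} = {}) \<and> (\<Sum>i<m. b i - a i) < \<delta>"
    have "\<forall>i<m. a i \<le> b i \<and> {a i..b i} \<subseteq> I" using as sub by (meson subset_trans)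
    with as show "(\<Sum>i<m. \<bar>f (b i) - f (a i)\<bar>) < \<epsilon>" by (intro \<delta>[rule_format] conjI) simp_all
  qed
qed

text \<open>Strong measurability in the dual makes every scalar pairing measurable, and the dual norm
  bounds it.\<close>

lemma (in bounded_open_domain) dual_pairing_integrable:
  assumes w: "w \<in> L2_into {0<..<T} (H10_dual \<Omega>) (H10_dual_norm \<Omega>)" and z: "z \<in> H10 \<Omega>"
  shows "integrable (lebesgue_on {0<..<T}) (\<lambda>t. w t z)"
proof -
  let ?I = "{0<..<T}" let ?M = "lebesgue_on ?I"
  have Is: "?I \<in> sets lebesgue" by auto
  have wd: "AE t in ?M. w t \<in> H10_dual \<Omega>" and wi: "integrable ?M (\<lambda>t. (H10_dual_norm \<Omega> (w t))\<^sup>2)"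
    using w by (auto simp: L2_into_def)
  obtain s :: "nat \<Rightarrow> real \<Rightarrow> ('a \<Rightarrow> real) \<Rightarrow> real" where
    s': "\<forall>k. finite (s k ` ?I) \<and> s k ` ?I \<subseteq> H10_dual \<Omega> \<and> (\<forall>y. {t \<in> ?I. s k t = y} \<in> sets lebesgue)"
    and slim: "AE t in ?M. (\<lambda>k. H10_dual_norm \<Omega> (s k t - w t)) \<longlonglongrightarrow> 0"
  proof -
    have "strongly_measurable ?I (H10_dual \<Omega>) (H10_dual_norm \<Omega>) w" using w by (simp add: L2_into_def)
    then have "\<exists>s. (\<forall>k. finite (s k ` ?I) \<and> s k ` ?I \<subseteq> H10_dual \<Omega> \<and> (\<forall>y. {t \<in> ?I. s k t = y} \<in> sets lebesgue)) \<and>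
      (AE t in ?M. (\<lambda>k. H10_dual_norm \<Omega> (s k t - w t)) \<longlonglongrightarrow> 0)" by (simp only: strongly_measurable_def)
    then show thesis by (elim exE conjE) (rule that; assumption)
  qed
  have s: "finite (s k ` ?I)" "s k ` ?I \<subseteq> H10_dual \<Omega>" "{t \<in> ?I. s k t = y} \<in> sets lebesgue" for k y
  proof -
    note s'k = spec[OF s', of k]
    show "finite (s k ` ?I)" by (rule conjunct1[OF s'k])
    show "s k ` ?I \<subseteq> H10_dual \<Omega>" by (rule conjunct1[OF conjunct2[OF s'k]])
    show "{t \<in> ?I. s k t = y} \<in> sets lebesgue" by (rule spec[OF conjunct2[OF conjunct2[OF s'k]]])
  qed
  have sub: "A \<in> sets ?M" if "A \<in> sets lebesgue" "A \<subseteq> ?I" for A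
    using that Is by (simp add: sets_restrict_space_iff)
  have sm: "(\<lambda>t. s k t z) \<in> borel_measurable ?M" for k
  proof (rule measurableI)
    fix B :: "real set" assume "B \<in> sets borel"
    have "(\<lambda>t. s k t z) -` B \<inter> space ?M = (\<Union>y\<in>{y \<in> s k ` ?I. y z \<in> B}. {t \<in> ?I. s k t = y})" by auto
    moreover have "\<dots> \<in> sets ?M"
    proof (rule sets.finite_UN)
      show "finite {y \<in> s k ` ?I. y z \<in> B}" using s(1)[of k] by simp
      show "{t \<in> ?I. s k t = y} \<in> sets ?M" for y by (rule sub[OF s(3)]) (rule Collect_restrict)
    qed
    ultimately show "(\<lambda>t. s k t z) -` B \<inter> space ?M \<in> sets ?M" by (simp only:)
  qed simp
  have "AE t in ?M. (\<lambda>k. s k t z) \<longlonglongrightarrow> w t z \<and> w t \<in> H10_dual \<Omega>"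
    using slim wd AE_space[of ?M]
  proof eventually_elim
    fix t assume lim: "(\<lambda>k. H10_dual_norm \<Omega> (s k t - w t)) \<longlonglongrightarrow> 0" and wt: "w t \<in> H10_dual \<Omega>" and t: "t \<in> space ?M"
    have "(\<lambda>k. s k t z - w t z) \<longlonglongrightarrow> 0"
    proof (rule Lim_null_comparison)
      show "(\<lambda>k. H10_dual_norm \<Omega> (s k t - w t) * H10_norm \<Omega> z) \<longlonglongrightarrow> 0"
        using tendsto_mult_right[OF lim, of "H10_norm \<Omega> z"] by simp
      have "s k t - w t \<in> H10_dual \<Omega>" for k using s(2)[of k] t wt by (intro H10_dual_diff) auto
      then show "\<forall>\<^sub>F k in sequentially. norm (s k t z - w t z) \<le> H10_dual_norm \<Omega> (s k t - w t) * H10_norm \<Omega> z"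
        using H10_dual_pairing_le[OF _ z, of "s _ t - w t"] by (intro always_eventually) auto
    qed
    then show "(\<lambda>k. s k t z) \<longlonglongrightarrow> w t z \<and> w t \<in> H10_dual \<Omega>" using wt by (simp add: LIM_zero_iff)
  qed
  then obtain N where N: "negligible N" "\<And>t. t \<in> ?I \<Longrightarrow> t \<notin> N \<Longrightarrow> (\<lambda>k. s k t z) \<longlonglongrightarrow> w t z \<and> w t \<in> H10_dual \<Omega>"
    by (rule AE_lebesgue_on_negligible[OF _ Is]) (rule that; assumption)
  define W where "W = (\<lambda>t. if t \<in> N then 0 else w t z)"
  have Ns: "N \<in> sets lebesgue" using N(1) by (rule negligible_imp_sets)
  have Wm: "W \<in> borel_measurable ?M"
  proof (rule borel_measurable_LIMSEQ_real)
    show "(\<lambda>t. if t \<in> N then 0 else s k t z) \<in> borel_measurable ?M" for k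
    proof (rule measurable_If_set[OF _ sm])
      show "N \<inter> space ?M \<in> sets ?M" using Ns Is by (auto simp: sets_restrict_space_iff)
    qed simp
    show "(\<lambda>k. if t \<in> N then 0 else s k t z) \<longlonglongrightarrow> W t" if "t \<in> space ?M" for t
      using N(2)[of t] that by (auto simp: W_def)
  qed
  have dom: "integrable ?M (\<lambda>t. (H10_norm \<Omega> z)\<^sup>2 + (H10_dual_norm \<Omega> (w t))\<^sup>2)"
  proof -
    have "?I \<in> lmeasurable" by (rule bounded_set_imp_lmeasurable) auto
    then show ?thesis
      by (intro Bochner_Integration.integrable_add wi finite_measure.integrable_const finite_measure_lebesgue_on)
  qed
  have "integrable ?M W"
  proof (rule Bochner_Integration.integrable_bound[OF dom Wm])
    show "AE t in ?M. norm (W t) \<le> norm ((H10_norm \<Omega> z)\<^sup>2 + (H10_dual_norm \<Omega> (w t))\<^sup>2)"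
    proof (rule AE_I2)
      fix t assume t: "t \<in> space ?M"
      show "norm (W t) \<le> norm ((H10_norm \<Omega> z)\<^sup>2 + (H10_dual_norm \<Omega> (w t))\<^sup>2)"
      proof (cases "t \<in> N")
        case False
        have "\<bar>w t z\<bar> \<le> H10_dual_norm \<Omega> (w t) * H10_norm \<Omega> z"
          using N(2)[of t] False t by (intro H10_dual_pairing_le z) auto
        also have "\<dots> \<le> (H10_norm \<Omega> z)\<^sup>2 + (H10_dual_norm \<Omega> (w t))\<^sup>2"
        proof -
          have "2 * H10_dual_norm \<Omega> (w t) * H10_norm \<Omega> z \<le> (H10_dual_norm \<Omega> (w t))\<^sup>2 + (H10_norm \<Omega> z)\<^sup>2"
            by (rule sum_squares_bound)
          moreover have "0 \<le> H10_dual_norm \<Omega> (w t) * H10_norm \<Omega> z"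
            using \<open>\<bar>w t z\<bar> \<le> _\<close> abs_ge_zero order_trans by blast
          ultimately show ?thesis by linarith
        qed
        finally show ?thesis using False by (simp add: W_def)
      qed (simp add: W_def)
    qed
  qed
  then have "W absolutely_integrable_on ?I"
    using Is by (simp add: set_integrable_def integrable_restrict_space)
  then have "(\<lambda>t. w t z) absolutely_integrable_on ?I"
    by (rule absolutely_integrable_spike[OF _ N(1)]) (simp add: W_def)
  then show ?thesis by (rule absolutely_integrable_imp_integrable[OF _ Is])
qed

text \<open>An energy solution on a bounded time interval together with the two facts about its energy on which
  the argument relies: absolute continuity and the almost everywhere derivative.\<close>

locale evolution = log_source_domain \<Omega> p for \<Omega> :: "'a::euclidean_space set" and p +
  fixes g :: "real \<Rightarrow> real" and u0 u1 :: "'a \<Rightarrow> real" and u v :: "real \<Rightarrow> 'a \<Rightarrow> real" and T :: real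
  assumes T: "T > 0" and kernel: "hyp_H2 g"
    and solution: "energy_solution \<Omega> p g u0 u1 T u v"
    and energy_ac: "abs_cont_on {0..T} (energy \<Omega> p g u v)"
    and energy_rate: "AE t in lebesgue. 0 < t \<and> t < T \<longrightarrow>
           (energy \<Omega> p g u v has_real_derivative
              (- (L2_norm \<Omega> (wgrad \<Omega> (v t)))\<^sup>2 - g t * (L2_norm \<Omega> (wgrad \<Omega> (u t)))\<^sup>2 / 2
               + integral {0..t} (\<lambda>s. rderiv g (t - s)
                   * (L2_norm \<Omega> (wgrad \<Omega> (u t) - wgrad \<Omega> (u s)))\<^sup>2) / 2)) (at t)"
begin

abbreviation "\<mu> \<equiv> first_dirichlet_eigenvalue \<Omega>"
abbreviation "m \<equiv> pm \<Omega> p"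
abbreviation "nrm \<equiv> L2_norm \<Omega>"
abbreviation "V \<equiv> H10_norm \<Omega>"

definition moment :: "real \<Rightarrow> real" where
  "moment t = L2_inner \<Omega> (u t) (v t)"

lemma mu_pos: "\<mu> > 0" and Poincare: "z \<in> H10 \<Omega> \<Longrightarrow> \<mu> * (nrm z)\<^sup>2 \<le> (V z)\<^sup>2"
  using first_eigenvalue[OF nonempty] by (auto simp: H10_norm_def)

lemma V_nonneg [simp]: "0 \<le> V z"
  by (simp add: H10_norm_def)

lemma u_H10: "t \<in> {0..T} \<Longrightarrow> u t \<in> H10 \<Omega>"
  and u_cont: "t \<in> {0..T} \<Longrightarrow> ((\<lambda>s. V (\<lambda>x. u s x - u t x)) \<longlongrightarrow> 0) (at t within {0..T})"
  and v_L2: "t \<in> {0..T} \<Longrightarrow> v t \<in> L2 \<Omega>"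
  and v_cont: "t \<in> {0..T} \<Longrightarrow> ((\<lambda>s. nrm (\<lambda>x. v s x - v t x)) \<longlongrightarrow> 0) (at t within {0..T})"
  and u_deriv: "t \<in> {0..T} \<Longrightarrow> ((\<lambda>s. nrm (\<lambda>x. (u s x - u t x) / (s - t) - v t x)) \<longlongrightarrow> 0) (at t within {0..T})"
  using solution unfolding energy_solution_def C_into_def has_L2_derivative_on_def by (auto simp: fun_diff_def)

lemma within_interval: "\<forall>\<^sub>F s in at t within {0..T}. s \<in> {0..T} \<and> s \<noteq> t"
  by (auto simp: eventually_at_filter)

lemma nrm_le_V: "z \<in> H10 \<Omega> \<Longrightarrow> nrm z \<le> V z / sqrt \<mu>"
proof (rule power2_le_imp_le)
  assume "z \<in> H10 \<Omega>"
  then show "(nrm z)\<^sup>2 \<le> (V z / sqrt \<mu>)\<^sup>2" using Poincare[of z] mu_pos by (simp add: power_divide field_simps)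
qed (use mu_pos in simp)

lemma u_cont_L2:
  assumes t: "t \<in> {0..T}"
  shows "((\<lambda>s. nrm (\<lambda>x. u s x - u t x)) \<longlongrightarrow> 0) (at t within {0..T})"
proof (rule Lim_null_comparison)
  show "((\<lambda>s. V (\<lambda>x. u s x - u t x) / sqrt \<mu>) \<longlongrightarrow> 0) (at t within {0..T})"
    using tendsto_divide[OF u_cont[OF t] tendsto_const, of "sqrt \<mu>"] mu_pos by simp
  show "\<forall>\<^sub>F s in at t within {0..T}. norm (nrm (\<lambda>x. u s x - u t x)) \<le> V (\<lambda>x. u s x - u t x) / sqrt \<mu>"
    using within_interval by eventually_elim (auto intro!: nrm_le_V H10_diff(1) u_H10 t simp: )
qed

lemma ev_u_L2: "\<forall>\<^sub>F s in at t within {0..T}. u s \<in> L2 \<Omega>"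
  and ev_v_L2: "\<forall>\<^sub>F s in at t within {0..T}. v s \<in> L2 \<Omega>"
  using within_interval[of t] by (eventually_elim, blast intro: H10_L2 u_H10 v_L2)+

lemma const_diff_tendsto: "((\<lambda>s. nrm (\<lambda>x. z x - z x)) \<longlongrightarrow> 0) F" for z :: "'a \<Rightarrow> 'c::euclidean_space"
  by (simp add: L2_norm_def)

lemma inner_v_continuous:
  assumes z: "z \<in> L2 \<Omega>" shows "continuous_on {0..T} (\<lambda>t. L2_inner \<Omega> (v t) z)"
  unfolding continuous_on_def
  by (intro ballI L2_inner_tendsto_eventually ev_v_L2 v_L2 v_cont const_diff_tendsto z always_eventually allI)

lemma moment_continuous: "continuous_on {0..T} moment"
  unfolding continuous_on_def moment_def
  by (intro ballI L2_inner_tendsto_eventually ev_v_L2 ev_u_L2 v_L2 v_cont u_cont_L2 H10_L2 u_H10)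

lemma grad_inner_tendsto:
  assumes t: "t \<in> {0..T}"
  shows "((\<lambda>s. nrm (\<lambda>x. wgrad \<Omega> (u s) x - wgrad \<Omega> (u t) x)) \<longlongrightarrow> 0) (at t within {0..T})"
proof (rule Lim_transform_eventually[OF u_cont[OF t]])
  show "\<forall>\<^sub>F s in at t within {0..T}. V (\<lambda>x. u s x - u t x) = nrm (\<lambda>x. wgrad \<Omega> (u s) x - wgrad \<Omega> (u t) x)"
    using within_interval by eventually_elim (auto intro!: H10_norm_diff u_H10 t)
qed

lemma ev_grad_L2: "\<forall>\<^sub>F s in at t within {0..T}. wgrad \<Omega> (u s) \<in> L2 \<Omega>"
  using within_interval[of t] by (eventually_elim, blast intro: wgrad_L2 u_H10)

lemma grad_inner_continuous:
  assumes z: "G \<in> L2 \<Omega>" shows "continuous_on {0..T} (\<lambda>t. L2_inner \<Omega> (wgrad \<Omega> (u t)) G)"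
  unfolding continuous_on_def
  by (intro ballI L2_inner_tendsto_eventually ev_grad_L2 wgrad_L2 u_H10 grad_inner_tendsto const_diff_tendsto z always_eventually allI)

lemma V_sq_continuous: "continuous_on {0..T} (\<lambda>t. (V (u t))\<^sup>2)"
  unfolding continuous_on_def L2_norm_sq H10_norm_def
  by (intro ballI L2_inner_tendsto_eventually ev_grad_L2 wgrad_L2 u_H10 grad_inner_tendsto)

lemma V_bounded:
  obtains B where "B \<ge> 0" "\<And>t. t \<in> {0..T} \<Longrightarrow> V (u t) \<le> B"
proof -
  have "compact ((\<lambda>t. (V (u t))\<^sup>2) ` {0..T})" by (intro compact_continuous_image V_sq_continuous) auto
  then obtain K where K': "\<forall>t\<in>{0..T}. norm ((V (u t))\<^sup>2) \<le> K"
    using compact_imp_bounded[of "(\<lambda>t. (V (u t))\<^sup>2) ` {0..T}"] unfolding bounded_iff by blast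
  then have K: "\<And>t. t \<in> {0..T} \<Longrightarrow> (V (u t))\<^sup>2 \<le> K" by simp
  have "V (u t) \<le> sqrt K" if "t \<in> {0..T}" for t using K[OF that] by (rule real_le_rsqrt)
  moreover have "0 \<le> sqrt K" using K[of 0] T by (meson atLeastAtMost_iff order_less_imp_le order_refl order_trans real_sqrt_ge_zero zero_le_power2)
  ultimately show thesis using that by blast
qed

lemma inner_u_deriv:
  assumes t: "t \<in> {0..T}" and z: "z \<in> L2 \<Omega>"
  shows "((\<lambda>s. L2_inner \<Omega> (u s) z) has_real_derivative L2_inner \<Omega> (v t) z) (at t within {0..T})"
  unfolding has_field_derivative_iff
proof (rule Lim_transform_eventually)
  show "((\<lambda>s. L2_inner \<Omega> (\<lambda>x. (1 / (s - t)) * (u s x - u t x)) z) \<longlongrightarrow> L2_inner \<Omega> (v t) z) (at t within {0..T})"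
  proof (rule L2_inner_tendsto_eventually)
    show "\<forall>\<^sub>F s in at t within {0..T}. (\<lambda>x. (1 / (s - t)) * (u s x - u t x)) \<in> L2 \<Omega>"
      using ev_u_L2 by eventually_elim (intro L2_cmult L2_diff H10_L2[OF u_H10[OF t]])
    show "((\<lambda>s. nrm (\<lambda>x. (1 / (s - t)) * (u s x - u t x) - v t x)) \<longlongrightarrow> 0) (at t within {0..T})"
      using u_deriv[OF t] by simp
  qed (use z v_L2 t const_diff_tendsto in auto)
  show "\<forall>\<^sub>F s in at t within {0..T}. L2_inner \<Omega> (\<lambda>x. (1 / (s - t)) * (u s x - u t x)) z
      = (L2_inner \<Omega> (u s) z - L2_inner \<Omega> (u t) z) / (s - t)"
    using ev_u_L2
  proof eventually_elim
    fix s assume "u s \<in> L2 \<Omega>"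
    then show "L2_inner \<Omega> (\<lambda>x. (1 / (s - t)) * (u s x - u t x)) z
      = (L2_inner \<Omega> (u s) z - L2_inner \<Omega> (u t) z) / (s - t)"
      unfolding L2_inner_cmult_left using z H10_L2[OF u_H10[OF t]] by (simp add: L2_inner_diff_left)
  qed
qed

lemma norm_sq_u_deriv:
  assumes t: "t \<in> {0..T}"
  shows "((\<lambda>s. (nrm (u s))\<^sup>2) has_real_derivative 2 * moment t) (at t within {0..T})"
  unfolding has_field_derivative_iff
proof (rule Lim_transform_eventually)
  have ut: "u t \<in> L2 \<Omega>" by (rule H10_L2[OF u_H10[OF t]])
  have "((\<lambda>s. L2_inner \<Omega> (\<lambda>x. (1 / (s - t)) * (u s x - u t x)) (\<lambda>x. u s x + u t x)) \<longlongrightarrow> L2_inner \<Omega> (v t) (\<lambda>x. u t x + u t x)) (at t within {0..T})"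
  proof (rule L2_inner_tendsto_eventually)
    show "\<forall>\<^sub>F s in at t within {0..T}. (\<lambda>x. (1 / (s - t)) * (u s x - u t x)) \<in> L2 \<Omega>"
      using ev_u_L2 by eventually_elim (intro L2_cmult L2_diff ut)
    show "((\<lambda>s. nrm (\<lambda>x. (1 / (s - t)) * (u s x - u t x) - v t x)) \<longlongrightarrow> 0) (at t within {0..T})"
      using u_deriv[OF t] by simp
    show "\<forall>\<^sub>F s in at t within {0..T}. (\<lambda>x. u s x + u t x) \<in> L2 \<Omega>"
      using ev_u_L2 by eventually_elim (intro L2_add ut)
    show "((\<lambda>s. nrm (\<lambda>x. u s x + u t x - (u t x + u t x))) \<longlongrightarrow> 0) (at t within {0..T})"
      using u_cont_L2[OF t] by simp
  qed (use v_L2 t L2_add[OF ut ut] in auto)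
  moreover have "L2_inner \<Omega> (v t) (\<lambda>x. u t x + u t x) = 2 * moment t"
    unfolding L2_inner_add_right[OF ut ut v_L2[OF t]] moment_def L2_inner_commute[of \<Omega> "v t"] by simp
  ultimately show "((\<lambda>s. L2_inner \<Omega> (\<lambda>x. (1 / (s - t)) * (u s x - u t x)) (\<lambda>x. u s x + u t x)) \<longlongrightarrow> 2 * moment t) (at t within {0..T})"
    by (simp only:)
  show "\<forall>\<^sub>F s in at t within {0..T}. L2_inner \<Omega> (\<lambda>x. (1 / (s - t)) * (u s x - u t x)) (\<lambda>x. u s x + u t x)
      = ((nrm (u s))\<^sup>2 - (nrm (u t))\<^sup>2) / (s - t)"
    using ev_u_L2
  proof eventually_elim
    fix s assume us: "u s \<in> L2 \<Omega>"
    have "L2_inner \<Omega> (\<lambda>x. u s x - u t x) (\<lambda>x. u s x + u t x) = (nrm (u s))\<^sup>2 - (nrm (u t))\<^sup>2"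
      using us ut L2_diff[OF us ut] unfolding L2_norm_sq
      by (simp add: L2_inner_add_right L2_inner_diff_left L2_inner_commute[of \<Omega> "u t" "u s"])
    then show "L2_inner \<Omega> (\<lambda>x. (1 / (s - t)) * (u s x - u t x)) (\<lambda>x. u s x + u t x)
      = ((nrm (u s))\<^sup>2 - (nrm (u t))\<^sup>2) / (s - t)"
      unfolding L2_inner_cmult_left by simp
  qed
qed

lemma velocity_facts:
  obtains N where "negligible N" "\<And>t. t \<in> {0<..<T} \<Longrightarrow> t \<notin> N \<Longrightarrow> v t \<in> H10 \<Omega>"
proof -
  have "AE t in lebesgue_on {0<..<T}. v t \<in> H10 \<Omega>"
    using solution by (auto simp: energy_solution_def L2_into_def)
  then show thesis by (rule AE_lebesgue_on_negligible) (auto intro: that)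
qed

lemma dissipation_integrable:
  assumes "0 \<le> a" "b \<le> T"
  shows "(\<lambda>t. (V (v t))\<^sup>2) integrable_on {a..b}"
proof -
  have "integrable (lebesgue_on {0<..<T}) (\<lambda>t. (V (v t))\<^sup>2)"
    using solution by (auto simp: energy_solution_def L2_into_def)
  then have "(\<lambda>t. (V (v t))\<^sup>2) integrable_on {0<..<T}" by (rule integrable_on_lebesgue_on) auto
  then have "(\<lambda>t. (V (v t))\<^sup>2) integrable_on {0..T}" by (simp add: integrable_on_Icc_iff_Ioo)
  then show ?thesis by (rule integrable_on_subinterval) (use assms in auto)
qed

text \<open>Pairing with a fixed test element turns the equation in the dual space into a scalar one, to which
  the du Bois-Reymond lemma applies.\<close>

lemma velocity_increment:
  assumes z: "z \<in> H10 \<Omega>" and ab: "0 < a" "a < b" "b < T"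
  obtains k N where "(k has_integral (L2_inner \<Omega> (v b) z - L2_inner \<Omega> (v a) z)) {a..b}" "negligible N"
    "\<And>t. t \<in> {a..b} \<Longrightarrow> t \<notin> N \<Longrightarrow> v t \<in> H10 \<Omega> \<and>
       k t = (LINT x|lebesgue_on \<Omega>. source (p x) (u t x) * z x)
         - L2_inner \<Omega> (wgrad \<Omega> (u t)) (wgrad \<Omega> z) - L2_inner \<Omega> (wgrad \<Omega> (v t)) (wgrad \<Omega> z)
         + integral {0..t} (\<lambda>s. g (t - s) * L2_inner \<Omega> (wgrad \<Omega> (u s)) (wgrad \<Omega> z))"
proof -
  obtain w where w: "w \<in> L2_into {0<..<T} (H10_dual \<Omega>) (H10_dual_norm \<Omega>)" "has_dual_derivative_on \<Omega> {0<..<T} v w"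
    and eq: "AE t in lebesgue_on {0<..<T}. w t z + L2_inner \<Omega> (wgrad \<Omega> (u t)) (wgrad \<Omega> z) + L2_inner \<Omega> (wgrad \<Omega> (v t)) (wgrad \<Omega> z)
             - integral {0..t} (\<lambda>s. g (t - s) * L2_inner \<Omega> (wgrad \<Omega> (u s)) (wgrad \<Omega> z))
           = (LINT x|lebesgue_on \<Omega>. source (p x) (u t x) * z x)"
  proof -
    from solution obtain w where w: "w \<in> L2_into {0<..<T} (H10_dual \<Omega>) (H10_dual_norm \<Omega>)" "has_dual_derivative_on \<Omega> {0<..<T} v w"
      and eq: "\<forall>z\<in>H10 \<Omega>. AE t in lebesgue_on {0<..<T}.
           integrable (lebesgue_on \<Omega>) (\<lambda>x. source (p x) (u t x) * z x) \<and>
           w t z + L2_inner \<Omega> (wgrad \<Omega> (u t)) (wgrad \<Omega> z) + L2_inner \<Omega> (wgrad \<Omega> (v t)) (wgrad \<Omega> z)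
             - integral {0..t} (\<lambda>s. g (t - s) * L2_inner \<Omega> (wgrad \<Omega> (u s)) (wgrad \<Omega> z))
           = (LINT x|lebesgue_on \<Omega>. source (p x) (u t x) * z x)"
      unfolding energy_solution_def by blast
    from bspec[OF eq z] have "AE t in lebesgue_on {0<..<T}. w t z + L2_inner \<Omega> (wgrad \<Omega> (u t)) (wgrad \<Omega> z) + L2_inner \<Omega> (wgrad \<Omega> (v t)) (wgrad \<Omega> z)
             - integral {0..t} (\<lambda>s. g (t - s) * L2_inner \<Omega> (wgrad \<Omega> (u s)) (wgrad \<Omega> z))
           = (LINT x|lebesgue_on \<Omega>. source (p x) (u t x) * z x)"
      by eventually_elim blast
    with w show thesis by (rule that)
  qed
  have int: "((\<lambda>t. w t z) has_integral (L2_inner \<Omega> (v b) z - L2_inner \<Omega> (v a) z)) {a..b}"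
  proof (rule weak_derivative_increment[OF _ dual_pairing_integrable[OF w(1) z] _ ab])
    show "continuous_on {0<..<T} (\<lambda>t. L2_inner \<Omega> (v t) z)"
      by (rule continuous_on_subset[OF inner_v_continuous[OF H10_L2[OF z]]]) auto
    show "(LINT t|lebesgue_on {0<..<T}. deriv \<phi> t * L2_inner \<Omega> (v t) z) = - (LINT t|lebesgue_on {0<..<T}. \<phi> t * w t z)"
      if "test_fun {0<..<T} \<phi>" for \<phi>
      using w(2) z that unfolding has_dual_derivative_on_def by blast
  qed
  obtain N1 where N1: "negligible N1" "\<And>t. t \<in> {0<..<T} \<Longrightarrow> t \<notin> N1 \<Longrightarrow> w t z + L2_inner \<Omega> (wgrad \<Omega> (u t)) (wgrad \<Omega> z) + L2_inner \<Omega> (wgrad \<Omega> (v t)) (wgrad \<Omega> z)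
             - integral {0..t} (\<lambda>s. g (t - s) * L2_inner \<Omega> (wgrad \<Omega> (u s)) (wgrad \<Omega> z))
           = (LINT x|lebesgue_on \<Omega>. source (p x) (u t x) * z x)"
    by (rule AE_lebesgue_on_negligible[OF eq]) (auto intro: that)
  obtain N2 where N2: "negligible N2" "\<And>t. t \<in> {0<..<T} \<Longrightarrow> t \<notin> N2 \<Longrightarrow> v t \<in> H10 \<Omega>"
    by (rule velocity_facts) (rule that; assumption)
  show thesis
  proof (rule that[OF int negligible_Un[OF N1(1) N2(1)]])
    fix t assume "t \<in> {a..b}" "t \<notin> N1 \<union> N2"
    then show "v t \<in> H10 \<Omega> \<and>
       w t z = (LINT x|lebesgue_on \<Omega>. source (p x) (u t x) * z x)
         - L2_inner \<Omega> (wgrad \<Omega> (u t)) (wgrad \<Omega> z) - L2_inner \<Omega> (wgrad \<Omega> (v t)) (wgrad \<Omega> z)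
         + integral {0..t} (\<lambda>s. g (t - s) * L2_inner \<Omega> (wgrad \<Omega> (u s)) (wgrad \<Omega> z))"
      using N1(2)[of t] N2(2)[of t] ab by auto
  qed
qed

lemma g_cont: "continuous_on {0..} g" and g_nonneg: "0 \<le> t \<Longrightarrow> 0 \<le> g t"
  and rderiv_nonpos: "0 \<le> t \<Longrightarrow> rderiv g t \<le> 0"
  using kernel by (auto simp: hyp_H2_def intro: differentiable_imp_continuous_on)

text \<open>In the energy identity only the viscous dissipation is kept; the two memory terms are nonpositive
  because \<open>g \<ge> 0\<close> and \<open>g' \<le> 0\<close>.\<close>

lemma energy_decrease:
  assumes ab: "0 \<le> a" "a \<le> b" "b \<le> T"
  shows "energy \<Omega> p g u v b - energy \<Omega> p g u v a \<le> - integral {a..b} (\<lambda>t. (V (v t))\<^sup>2)"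
proof -
  let ?E = "energy \<Omega> p g u v"
  let ?R = "\<lambda>t. - (L2_norm \<Omega> (wgrad \<Omega> (v t)))\<^sup>2 - g t * (L2_norm \<Omega> (wgrad \<Omega> (u t)))\<^sup>2 / 2
               + integral {0..t} (\<lambda>s. rderiv g (t - s)
                   * (L2_norm \<Omega> (wgrad \<Omega> (u t) - wgrad \<Omega> (u s)))\<^sup>2) / 2"
  have "AE t in lebesgue_on UNIV. 0 < t \<and> t < T \<longrightarrow> (?E has_real_derivative ?R t) (at t)"
    unfolding lebesgue_on_UNIV_eq by (rule energy_rate)
  then obtain N where N: "negligible N" "\<And>t. t \<notin> N \<Longrightarrow> 0 < t \<Longrightarrow> t < T \<Longrightarrow> (?E has_real_derivative ?R t) (at t)"
    by (rule AE_lebesgue_on_negligible) (auto intro: that)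
  define N' where "N' = N \<union> {0, T}"
  have N': "negligible N'" unfolding N'_def using N(1) by simp
  define R where "R = (\<lambda>t. if t \<in> N' then 0 else ?R t)"
  have int: "(R has_integral (?E b - ?E a)) {a..b}"
  proof (rule abs_cont_has_integral[OF _ ab(2) N'])
    have sub: "{a..b} \<subseteq> {0..T}" using ab by auto
    show "abs_cont_on {a..b} ?E" by (rule abs_cont_on_subset[OF energy_ac sub])
    show "(?E has_real_derivative R t) (at t within {a..b})" if "t \<in> {a..b} - N'" for t
      using N(2)[of t] that ab by (auto simp: R_def N'_def intro: has_field_derivative_at_within)
    show "R t = 0" if "t \<in> N'" for t using that by (simp add: R_def)
  qed
  have "integral {a..b} R \<le> integral {a..b} (\<lambda>t. - (V (v t))\<^sup>2)"
  proof (rule integral_mono_negligible[OF _ _ N'])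
    show "R integrable_on {a..b}" using int by (rule has_integral_integrable)
    show "(\<lambda>t. - (V (v t))\<^sup>2) integrable_on {a..b}"
      by (intro integrable_neg dissipation_integrable) (use ab in auto)
    fix t assume t: "t \<in> {a..b}" "t \<notin> N'"
    have "integral {0..t} (\<lambda>s. rderiv g (t - s) * (L2_norm \<Omega> (wgrad \<Omega> (u t) - wgrad \<Omega> (u s)))\<^sup>2) \<le> 0"
    proof (cases "(\<lambda>s. rderiv g (t - s) * (L2_norm \<Omega> (wgrad \<Omega> (u t) - wgrad \<Omega> (u s)))\<^sup>2) integrable_on {0..t}")
      case True
      then have "integral {0..t} (\<lambda>s. rderiv g (t - s) * (L2_norm \<Omega> (wgrad \<Omega> (u t) - wgrad \<Omega> (u s)))\<^sup>2) \<le> integral {0..t} (\<lambda>s. 0)"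
        by (rule integral_le) (use rderiv_nonpos in \<open>auto intro!: mult_nonpos_nonneg\<close>)
      then show ?thesis by simp
    qed (simp add: not_integrable_integral)
    moreover have "0 \<le> g t * (L2_norm \<Omega> (wgrad \<Omega> (u t)))\<^sup>2" using g_nonneg[of t] t ab by simp
    ultimately show "R t \<le> - (V (v t))\<^sup>2" using t(2) by (simp add: R_def H10_norm_def)
  qed
  then show ?thesis using int by (simp add: integral_unique)
qed

text \<open>Testing with \<open>\<nabla>\<psi>\<close> avoids vector-valued integration:
  \<open>(\<nabla>(u(t) - u(0)), \<nabla>\<psi>) = - \<integral> (v, \<Delta>\<psi>) = \<integral> (\<nabla>v, \<nabla>\<psi>)\<close>, and \<open>\<psi>\<close> may approximate \<open>u(t) - u(0)\<close>.
  Young's inequality with a free weight \<open>\<kappa>\<close> replaces Cauchy-Schwarz in time.\<close>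

lemma displacement_bound:
  assumes t: "0 < t" "t \<le> T"
  shows "(V (\<lambda>x. u t x - u 0 x))\<^sup>2 \<le> t * integral {0..t} (\<lambda>s. (V (v s))\<^sup>2)"
proof -
  define z where "z = (\<lambda>x. u t x - u 0 x)"
  define A where "A = integral {0..t} (\<lambda>s. (V (v s))\<^sup>2)"
  have t0: "t \<in> {0..T}" "0 \<in> {0..T}" using t by auto
  have z: "z \<in> H10 \<Omega>" unfolding z_def by (intro H10_diff(1) u_H10 t0)
  have di: "(\<lambda>s. (V (v s))\<^sup>2) integrable_on {0..t}" by (rule dissipation_integrable) (use t in auto)
  have A: "A \<ge> 0" unfolding A_def using di by (intro Henstock_Kurzweil_Integration.integral_nonneg) auto
  obtain N where N: "negligible N" "\<And>t. t \<in> {0<..<T} \<Longrightarrow> t \<notin> N \<Longrightarrow> v t \<in> H10 \<Omega>"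
    by (rule velocity_facts) (rule that; assumption)
  have test: "L2_inner \<Omega> (wgrad \<Omega> z) (grad \<psi>) \<le> nrm (grad \<psi>) * (\<kappa> * t / 2 + A / (2 * \<kappa>))"
    if \<psi>: "test_fun \<Omega> \<psi>" and \<kappa>: "\<kappa> > 0" for \<psi> \<kappa>
  proof -
    let ?L = "\<lambda>x. \<Sum>b\<in>Basis. partial b (partial b \<psi>) x"
    have L: "?L \<in> L2 \<Omega>" by (rule weak_laplace(2)[OF z \<psi>])
    have "((\<lambda>s. L2_inner \<Omega> (v s) ?L) has_integral (L2_inner \<Omega> (u t) ?L - L2_inner \<Omega> (u 0) ?L)) {0..t}"
    proof (rule fundamental_theorem_of_calculus)
      fix s assume "s \<in> {0..t}"
      then have "((\<lambda>s. L2_inner \<Omega> (u s) ?L) has_real_derivative L2_inner \<Omega> (v s) ?L) (at s within {0..T})"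
        using t by (intro inner_u_deriv L) auto
      then have "((\<lambda>s. L2_inner \<Omega> (u s) ?L) has_real_derivative L2_inner \<Omega> (v s) ?L) (at s within {0..t})"
        by (rule has_field_derivative_subset) (use t in auto)
      then show "((\<lambda>s. L2_inner \<Omega> (u s) ?L) has_vector_derivative L2_inner \<Omega> (v s) ?L) (at s within {0..t})"
        by (simp add: has_real_derivative_iff_has_vector_derivative)
    qed (use t in simp)
    then have hi: "((\<lambda>s. - L2_inner \<Omega> (v s) ?L) has_integral (- L2_inner \<Omega> z ?L)) {0..t}"
      using L H10_L2[OF u_H10[OF t0(1)]] H10_L2[OF u_H10[OF t0(2)]] unfolding z_def
      by (subst L2_inner_diff_left) (auto dest: has_integral_neg)
    have "L2_inner \<Omega> (wgrad \<Omega> z) (grad \<psi>) = integral {0..t} (\<lambda>s. - L2_inner \<Omega> (v s) ?L)"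
      unfolding weak_laplace(1)[OF z \<psi>] by (rule integral_unique[OF hi, symmetric])
    also have "\<dots> \<le> integral {0..t} (\<lambda>s. nrm (grad \<psi>) * (\<kappa> / 2 + (V (v s))\<^sup>2 / (2 * \<kappa>)))"
    proof (rule integral_mono_negligible)
      show "(\<lambda>s. - L2_inner \<Omega> (v s) ?L) integrable_on {0..t}" using hi by (rule has_integral_integrable)
      show "(\<lambda>s. nrm (grad \<psi>) * (\<kappa> / 2 + (V (v s))\<^sup>2 / (2 * \<kappa>))) integrable_on {0..t}"
        using di by (intro integrable_on_mult_right integrable_add integrable_on_divide integrable_const_ivl)
      show "negligible (N \<union> {0, T})" using N by simp
      fix s assume s: "s \<in> {0..t}" "s \<notin> N \<union> {0, T}"
      then have vs: "v s \<in> H10 \<Omega>" using N(2)[of s] t by auto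
      have "- L2_inner \<Omega> (v s) ?L = L2_inner \<Omega> (wgrad \<Omega> (v s)) (grad \<psi>)" using weak_laplace(1)[OF vs \<psi>] by simp
      also have "\<dots> \<le> V (v s) * nrm (grad \<psi>)"
        using L2_Cauchy_Schwarz[OF wgrad_L2[OF vs] test_L2(2)[OF \<psi>]] by (simp add: H10_norm_def)
      also have "\<dots> \<le> (\<kappa> / 2 + (V (v s))\<^sup>2 / (2 * \<kappa>)) * nrm (grad \<psi>)"
      proof (rule mult_right_mono)
        have "2 * \<kappa> * V (v s) \<le> \<kappa>\<^sup>2 + (V (v s))\<^sup>2" by (rule sum_squares_bound)
        then show "V (v s) \<le> \<kappa> / 2 + (V (v s))\<^sup>2 / (2 * \<kappa>)" using \<kappa> by (simp add: field_simps power2_eq_square)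
      qed simp
      finally show "- L2_inner \<Omega> (v s) ?L \<le> nrm (grad \<psi>) * (\<kappa> / 2 + (V (v s))\<^sup>2 / (2 * \<kappa>))" by (simp add: mult.commute)
    qed
    also have "\<dots> = nrm (grad \<psi>) * (\<kappa> * t / 2 + A / (2 * \<kappa>))"
    proof -
      have "((\<lambda>s. \<kappa> / 2) has_integral \<kappa> * t / 2) {0..t}"
        using has_integral_const_real[of "\<kappa> / 2" 0 t] t by (simp add: mult.commute)
      then have "((\<lambda>s. nrm (grad \<psi>) * (\<kappa> / 2 + (V (v s))\<^sup>2 / (2 * \<kappa>))) has_integral nrm (grad \<psi>) * (\<kappa> * t / 2 + A / (2 * \<kappa>))) {0..t}"
        unfolding A_def by (intro has_integral_mult_right has_integral_add[OF _ has_integral_divide] integrable_integral di)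
      then show ?thesis by (rule integral_unique)
    qed
    finally show ?thesis .
  qed
  have "V z \<le> \<kappa> * t / 2 + A / (2 * \<kappa>)" if \<kappa>: "\<kappa> > 0" for \<kappa>
  proof -
    obtain \<phi> where \<phi>: "\<And>k::nat. test_fun \<Omega> (\<phi> k)" "(\<lambda>k. L2_norm \<Omega> (\<lambda>x. \<phi> k x - z x)) \<longlonglongrightarrow> 0"
      "(\<lambda>k. L2_norm \<Omega> (\<lambda>x. grad (\<phi> k) x - wgrad \<Omega> z x)) \<longlonglongrightarrow> 0"
      by (rule H10_approx[OF z]) (rule that; assumption)
    note GL = wgrad_L2[OF z]
    have "(\<lambda>k. L2_inner \<Omega> (wgrad \<Omega> z) (grad (\<phi> k))) \<longlonglongrightarrow> L2_inner \<Omega> (wgrad \<Omega> z) (wgrad \<Omega> z)"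
      by (intro L2_inner_tendsto GL test_L2 \<phi> const_diff_tendsto)
    moreover have "(\<lambda>k. nrm (grad (\<phi> k)) * (\<kappa> * t / 2 + A / (2 * \<kappa>))) \<longlonglongrightarrow> nrm (wgrad \<Omega> z) * (\<kappa> * t / 2 + A / (2 * \<kappa>))"
      by (intro tendsto_mult tendsto_const L2_norm_tendsto GL test_L2 \<phi>)
    ultimately have "L2_inner \<Omega> (wgrad \<Omega> z) (wgrad \<Omega> z) \<le> nrm (wgrad \<Omega> z) * (\<kappa> * t / 2 + A / (2 * \<kappa>))"
      by (rule LIMSEQ_le) (use test[OF \<phi>(1) \<kappa>] in auto)
    then have le: "V z * V z \<le> V z * (\<kappa> * t / 2 + A / (2 * \<kappa>))"
      by (simp add: L2_norm_sq[symmetric] H10_norm_def power2_eq_square)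
    show ?thesis
    proof (cases "V z = 0")
      case True
      then show ?thesis using \<kappa> t A by simp
    next
      case False
      then show ?thesis using le V_nonneg[of z] by (simp add: mult_le_cancel_left_pos)
    qed
  qed
  then have "(V z)\<^sup>2 \<le> t * A" by (rule sq_le_of_weighted_bounds) (use t A in auto)
  then show ?thesis by (simp add: z_def A_def)
qed

end

section \<open>Exponential growth of the modified moment\<close>

lemma abs_cont_on_imp_continuous_on:
  assumes f: "abs_cont_on {a..b} f" shows "continuous_on {a..b} f"
  unfolding continuous_on_iff
proof (intro ballI allI impI)
  fix x e :: real assume x: "x \<in> {a..b}" and e: "e > 0"
  from f[unfolded abs_cont_on_def, rule_format, OF e] obtain \<delta> where "\<delta> > 0" and
    \<delta>: "\<forall>(m::nat) aa ba. (\<forall>i<m. aa i \<le> ba i \<and> {aa i..ba i} \<subseteq> {a..b}) \<and>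
         (\<forall>i<m. \<forall>j<m. i \<noteq> j \<longrightarrow> {aa i<..<ba i} \<inter> {aa j<..<ba j} = {}) \<and> (\<Sum>i<m. ba i - aa i) < \<delta>
         \<longrightarrow> (\<Sum>i<m. \<bar>f (ba i) - f (aa i)\<bar>) < e" by (elim exE conjE) (rule that; assumption)
  have le: "\<bar>f d - f c\<bar> < e" if "c \<le> d" "c \<in> {a..b}" "d \<in> {a..b}" "d - c < \<delta>" for c d
    using \<delta>[rule_format, of 1 "\<lambda>_. c" "\<lambda>_. d"] that by auto
  show "\<exists>d>0. \<forall>x'\<in>{a..b}. dist x' x < d \<longrightarrow> dist (f x') (f x) < e"
  proof (intro exI[of _ \<delta>] conjI ballI impI \<open>\<delta> > 0\<close>)
    fix y assume y: "y \<in> {a..b}" "dist y x < \<delta>"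
    show "dist (f y) (f x) < e"
    proof (cases "x \<le> y")
      case True
      then show ?thesis using le[of x y] x y by (simp add: dist_real_def)
    next
      case False
      then have "\<bar>f x - f y\<bar> < e" using le[of y x] x y by (simp add: dist_real_def)
      then show ?thesis by (simp add: dist_real_def abs_minus_commute)
    qed
  qed
qed

text \<open>The right side \<open>h\<close> of the hypothesis satisfies \<open>h' = C f \<ge> C h\<close>, so \<open>exp (- C t) h(t)\<close> does not
  decrease.\<close>

lemma integral_Gronwall:
  fixes f :: "real \<Rightarrow> real"
  assumes f: "continuous_on {0..t} f" and C: "C \<ge> 0" and t: "0 \<le> t"
    and le: "\<And>s. s \<in> {0..t} \<Longrightarrow> f s \<ge> f 0 + C * integral {0..s} f"
  shows "f t \<ge> f 0 * exp (C * t)"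
proof -
  define h where "h = (\<lambda>s. f 0 + C * integral {0..s} f)"
  have h': "(h has_real_derivative C * f s) (at s within {0..t})" if "s \<in> {0..t}" for s
    unfolding h_def using integral_has_real_derivative[OF f that] by (auto intro!: derivative_eq_intros)
  have d: "((\<lambda>s. exp (- (C * s)) * h s) has_real_derivative exp (- (C * s)) * (C * f s - C * h s)) (at s within {0..t})"
    if "s \<in> {0..t}" for s
    using h'[OF that] by (auto intro!: derivative_eq_intros simp: algebra_simps)
  have "((\<lambda>s. exp (- (C * s)) * (C * f s - C * h s)) has_integral (exp (- (C * t)) * h t - exp (- (C * 0)) * h 0)) {0..t}"
    using d by (intro fundamental_theorem_of_calculus t) (simp add: has_real_derivative_iff_has_vector_derivative)
  then have "0 \<le> exp (- (C * t)) * h t - exp (- (C * 0)) * h 0"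
  proof (rule has_integral_nonneg)
    fix s assume "s \<in> {0..t}"
    then have "C * h s \<le> C * f s" unfolding h_def by (intro mult_left_mono le C)
    then show "0 \<le> exp (- (C * s)) * (C * f s - C * h s)" by simp
  qed
  then have "f 0 \<le> exp (- (C * t)) * h t" by (simp add: h_def)
  then have "f 0 * exp (C * t) \<le> exp (- (C * t)) * h t * exp (C * t)" by (rule mult_right_mono) simp
  also have "\<dots> = h t" by (simp add: exp_minus)
  also have "\<dots> \<le> f t" unfolding h_def by (rule le) (use t in simp)
  finally show ?thesis .
qed

text \<open>The conditions on \<open>C\<close> are the two bounds that the growth constant respects, the second one
  cleared of its denominator.\<close>

locale growing_evolution = evolution +
  fixes C :: real
  assumes C_pos: "C > 0" and C_le: "C \<le> m + 2"
    and C_gap: "C * (2 * m + \<mu>) \<le> 2 * \<mu> * ((m - 1)\<^sup>2 * ell g - 1)"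
begin

abbreviation "\<E> \<equiv> shifted_energy \<Omega> p g u v"

definition modified :: "real \<Rightarrow> real" where
  "modified t = moment t - m / C * \<E> t"

lemma m_gt_2: "m > 2"
  by (rule pm_gt_2)

lemma energy_continuous: "continuous_on {0..T} \<E>"
  unfolding shifted_energy_def by (intro continuous_intros abs_cont_on_imp_continuous_on energy_ac)

lemma modified_continuous: "continuous_on {0..T} modified"
  unfolding modified_def by (intro continuous_intros moment_continuous energy_continuous)

lemma kernel_mass:
  assumes t: "0 \<le> t"
  shows "0 \<le> integral {0..t} g" "integral {0..t} g \<le> 1 - ell g" "ell g > 0"
    and "(\<lambda>s. g (t - s)) integrable_on {0..t}" "integral {0..t} (\<lambda>s. g (t - s)) = integral {0..t} g"
proof -
  have gi: "g integrable_on {0..}" and "ell g > 0" using kernel by (auto simp: hyp_H2_def)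
  then show "ell g > 0" by simp
  have ct: "continuous_on {0..t} g" by (rule continuous_on_subset[OF g_cont]) auto
  then have gt: "g integrable_on {0..t}" by (rule integrable_continuous_real)
  show "0 \<le> integral {0..t} g" by (rule Henstock_Kurzweil_Integration.integral_nonneg[OF gt]) (simp add: g_nonneg)
  have "integral {0..t} g \<le> integral {0..} g"
    by (rule integral_subset_le[OF _ gt gi]) (auto simp: g_nonneg)
  then show "integral {0..t} g \<le> 1 - ell g" by (simp add: ell_def)
  show "(\<lambda>s. g (t - s)) integrable_on {0..t}"
    by (intro integrable_continuous_real continuous_on_compose2[OF g_cont] continuous_intros) auto
  show "integral {0..t} (\<lambda>s. g (t - s)) = integral {0..t} g" by (rule memory_kernel_reflect[OF ct t])
qed

lemma memory_integrable:
  assumes t: "t \<in> {0..T}" and G: "G \<in> L2 \<Omega>"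
  shows "(\<lambda>s. g (t - s) * L2_inner \<Omega> (wgrad \<Omega> (u s)) G) integrable_on {0..t}"
    and "(\<lambda>s. g (t - s) * (nrm (wgrad \<Omega> (u t) - wgrad \<Omega> (u s)))\<^sup>2) integrable_on {0..t}"
proof -
  have sub: "{0..t} \<subseteq> {0..T}" using t by auto
  have c: "continuous_on {0..t} (\<lambda>s. g (t - s))"
    by (intro continuous_on_compose2[OF g_cont] continuous_intros) auto
  have ci: "continuous_on {0..t} (\<lambda>s. L2_inner \<Omega> (wgrad \<Omega> (u s)) G)" if "G \<in> L2 \<Omega>" for G
    by (rule continuous_on_subset[OF grad_inner_continuous[OF that] sub])
  show "(\<lambda>s. g (t - s) * L2_inner \<Omega> (wgrad \<Omega> (u s)) G) integrable_on {0..t}"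
    by (intro integrable_continuous_real continuous_on_mult c ci G)
  have ut: "wgrad \<Omega> (u t) \<in> L2 \<Omega>" by (intro wgrad_L2 u_H10 t)
  have "continuous_on {0..t} (\<lambda>s. g (t - s) * ((V (u t))\<^sup>2 - 2 * L2_inner \<Omega> (wgrad \<Omega> (u s)) (wgrad \<Omega> (u t)) + (V (u s))\<^sup>2))"
    by (intro continuous_on_mult c continuous_on_add continuous_on_diff continuous_on_const ci ut
        continuous_on_subset[OF V_sq_continuous sub])
  then have "(\<lambda>s. g (t - s) * ((V (u t))\<^sup>2 - 2 * L2_inner \<Omega> (wgrad \<Omega> (u s)) (wgrad \<Omega> (u t)) + (V (u s))\<^sup>2)) integrable_on {0..t}"
    by (rule integrable_continuous_real)
  then show "(\<lambda>s. g (t - s) * (nrm (wgrad \<Omega> (u t) - wgrad \<Omega> (u s)))\<^sup>2) integrable_on {0..t}"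
  proof (rule integrable_eq)
    fix s assume "s \<in> {0..t}"
    then have us: "wgrad \<Omega> (u s) \<in> L2 \<Omega>" using sub by (intro wgrad_L2 u_H10) auto
    show "g (t - s) * ((V (u t))\<^sup>2 - 2 * L2_inner \<Omega> (wgrad \<Omega> (u s)) (wgrad \<Omega> (u t)) + (V (u s))\<^sup>2)
        = g (t - s) * (nrm (wgrad \<Omega> (u t) - wgrad \<Omega> (u s)))\<^sup>2"
      unfolding fun_diff_def L2_norm_diff_sq[OF ut us] H10_norm_def L2_inner_commute[of \<Omega> "wgrad \<Omega> (u s)"] by simp
  qed
qed

text \<open>Splitting \<open>\<nabla>u(s) = \<nabla>u(t) - (\<nabla>u(t) - \<nabla>u(s))\<close> and weighting Young's inequality by \<open>m\<close>, so that
  the memory part of the loss is exactly \<open>m\<close> times the memory term of the energy.\<close>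

lemma memory_lower_bound:
  assumes t: "t \<in> {0..T}"
  shows "integral {0..t} (\<lambda>s. g (t - s) * L2_inner \<Omega> (wgrad \<Omega> (u s)) (wgrad \<Omega> (u t)))
    \<ge> integral {0..t} g * (V (u t))\<^sup>2 * (1 - 1 / (2 * m))
      - m / 2 * integral {0..t} (\<lambda>s. g (t - s) * (nrm (wgrad \<Omega> (u t) - wgrad \<Omega> (u s)))\<^sup>2)"
proof -
  have ut: "wgrad \<Omega> (u t) \<in> L2 \<Omega>" by (intro wgrad_L2 u_H10 t)
  have t0: "0 \<le> t" using t by simp
  note km = kernel_mass[OF t0] and mi = memory_integrable[OF t ut]
  let ?K = "\<lambda>s. g (t - s) * (V (u t))\<^sup>2 * (1 - 1 / (2 * m))
      - m / 2 * (g (t - s) * (nrm (wgrad \<Omega> (u t) - wgrad \<Omega> (u s)))\<^sup>2)"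
  have "(?K has_integral (integral {0..t} g * (V (u t))\<^sup>2 * (1 - 1 / (2 * m))
      - m / 2 * integral {0..t} (\<lambda>s. g (t - s) * (nrm (wgrad \<Omega> (u t) - wgrad \<Omega> (u s)))\<^sup>2))) {0..t}"
    using integrable_integral[OF km(4)] unfolding km(5)
    by (intro has_integral_diff has_integral_mult_left has_integral_mult_right integrable_integral mi(2))
  moreover have "((\<lambda>s. g (t - s) * L2_inner \<Omega> (wgrad \<Omega> (u s)) (wgrad \<Omega> (u t))) has_integral
     integral {0..t} (\<lambda>s. g (t - s) * L2_inner \<Omega> (wgrad \<Omega> (u s)) (wgrad \<Omega> (u t)))) {0..t}"
    by (rule integrable_integral[OF mi(1)])
  ultimately show ?thesis
  proof (rule has_integral_le)
    fix s assume s: "s \<in> {0..t}"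
    then have us: "wgrad \<Omega> (u s) \<in> L2 \<Omega>" using t by (intro wgrad_L2 u_H10) auto
    let ?d = "nrm (wgrad \<Omega> (u t) - wgrad \<Omega> (u s))"
    have "L2_inner \<Omega> (\<lambda>x. wgrad \<Omega> (u t) x - wgrad \<Omega> (u s) x) (wgrad \<Omega> (u t)) \<le> ?d * V (u t)"
      using L2_Cauchy_Schwarz[OF L2_diff[OF ut us] ut] by (simp add: H10_norm_def fun_diff_def)
    also have "\<dots> \<le> m / 2 * ?d\<^sup>2 + (V (u t))\<^sup>2 / (2 * m)"
    proof -
      have "2 * (m * ?d) * V (u t) \<le> (m * ?d)\<^sup>2 + (V (u t))\<^sup>2" by (rule sum_squares_bound)
      then show ?thesis using m_gt_2 by (simp add: field_simps power2_eq_square)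
    qed
    finally have "(V (u t))\<^sup>2 * (1 - 1 / (2 * m)) - m / 2 * ?d\<^sup>2 \<le> L2_inner \<Omega> (wgrad \<Omega> (u s)) (wgrad \<Omega> (u t))"
      unfolding L2_inner_diff_left[OF ut us ut] by (simp add: L2_norm_sq[symmetric] H10_norm_def algebra_simps)
    then have "g (t - s) * ((V (u t))\<^sup>2 * (1 - 1 / (2 * m)) - m / 2 * ?d\<^sup>2) \<le> g (t - s) * L2_inner \<Omega> (wgrad \<Omega> (u s)) (wgrad \<Omega> (u t))"
      by (rule mult_left_mono) (use s g_nonneg in simp)
    then show "?K s \<le> g (t - s) * L2_inner \<Omega> (wgrad \<Omega> (u s)) (wgrad \<Omega> (u t))" by (simp add: algebra_simps)
  qed
qed

text \<open>The source term is bounded below by \<open>m\<close> times the potential energy, hence by the kinetic, elastic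
  and memory energy minus \<open>m \<E>\<close>. The memory energy cancels, and with \<open>l = 1 - \<integral>\<^sub>0\<^sup>t g\<close> the coefficient
  left in front of \<open>\<parallel>\<nabla>u\<parallel>\<^sup>2\<close> is \<open>m l / 2 - l - (1 - l) / (2 m) = ((m - 1)\<^sup>2 l - 1) / (2 m)\<close>. The choice of \<open>C\<close>
  lets it absorb both the viscous term and \<open>C (u, v)\<close>.\<close>

lemma pointwise_growth:
  assumes t: "t \<in> {0..T}" and vt: "v t \<in> H10 \<Omega>"
  shows "C * modified t \<le> (LINT x|lebesgue_on \<Omega>. source (p x) (u t x) * u t x)
      - L2_inner \<Omega> (wgrad \<Omega> (u t)) (wgrad \<Omega> (u t)) - L2_inner \<Omega> (wgrad \<Omega> (v t)) (wgrad \<Omega> (u t))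
      + integral {0..t} (\<lambda>s. g (t - s) * L2_inner \<Omega> (wgrad \<Omega> (u s)) (wgrad \<Omega> (u t)))
      + (nrm (v t))\<^sup>2 + m / C * (V (v t))\<^sup>2"
proof -
  let ?S = "LINT x|lebesgue_on \<Omega>. source (p x) (u t x) * u t x"
  let ?F = "LINT x|lebesgue_on \<Omega>. F_pot (p x) (u t x)"
  let ?M = "integral {0..t} (\<lambda>s. g (t - s) * L2_inner \<Omega> (wgrad \<Omega> (u s)) (wgrad \<Omega> (u t)))"
  define J where "J = integral {0..t} (\<lambda>s. g (t - s) * (nrm (wgrad \<Omega> (u t) - wgrad \<Omega> (u s)))\<^sup>2)"
  define Gt where "Gt = integral {0..t} g"
  define l where "l = 1 - Gt"
  define n2 where "n2 = (V (u t))\<^sup>2"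
  define q where "q = L2_inner \<Omega> (wgrad \<Omega> (v t)) (wgrad \<Omega> (u t))"
  define W where "W = (V (v t))\<^sup>2"
  define k where "k = (nrm (v t))\<^sup>2"
  define a where "a = (nrm (u t))\<^sup>2"
  have mm: "m > 2" and mu: "\<mu> > 0" by (rule m_gt_2, rule mu_pos)
  have ut: "u t \<in> H10 \<Omega>" by (rule u_H10[OF t])
  have n2: "n2 \<ge> 0" and k: "k \<ge> 0" by (simp_all add: n2_def k_def)
  have S: "?S \<ge> m * ?F - C_star \<Omega> p" by (rule source_energy_bound[OF ut])
  have E: "m * \<E> t = m * (k / 2 + l * n2 / 2 + J / 2 - ?F) + C_star \<Omega> p"
    using mm by (simp add: shifted_energy_def energy_def k_def l_def n2_def J_def Gt_def H10_norm_def algebra_simps)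
  have M: "?M \<ge> Gt * n2 * (1 - 1 / (2 * m)) - m / 2 * J"
    using memory_lower_bound[OF t] by (simp add: Gt_def n2_def J_def)
  have q: "q \<le> m / C * W + C / (4 * m) * n2"
  proof -
    have "q \<le> V (v t) * V (u t)" unfolding q_def
      using L2_Cauchy_Schwarz[OF wgrad_L2[OF vt] wgrad_L2[OF ut]] by (simp add: H10_norm_def)
    moreover have "2 * (2 * m * V (v t)) * (C * V (u t)) \<le> (2 * m * V (v t))\<^sup>2 + (C * V (u t))\<^sup>2" by (rule sum_squares_bound)
    then have "V (v t) * V (u t) \<le> m / C * W + C / (4 * m) * n2" unfolding W_def n2_def
      using mm C_pos by (simp add: field_simps power2_eq_square)
    ultimately show ?thesis by linarith
  qed
  have mo: "moment t \<le> k / 2 + a / 2"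
  proof -
    have "moment t \<le> nrm (u t) * nrm (v t)" unfolding moment_def
      using L2_Cauchy_Schwarz[OF H10_L2[OF ut] v_L2[OF t]] by simp
    moreover have "2 * nrm (u t) * nrm (v t) \<le> a + k" unfolding a_def k_def by (rule sum_squares_bound)
    ultimately show ?thesis by simp
  qed
  have a: "a \<le> n2 / \<mu>" using Poincare[OF ut] mu by (simp add: a_def n2_def field_simps)
  have "C * moment t \<le> C * (k / 2 + (n2 / \<mu>) / 2)"
    by (rule mult_left_mono) (use mo a C_pos in auto)
  also have "\<dots> = C / 2 * k + C / (2 * \<mu>) * n2" by (simp add: algebra_simps)
  also have "\<dots> \<le> (m / 2 + 1) * k + C / (2 * \<mu>) * n2"
    by (intro add_right_mono mult_right_mono) (use C_le k in auto)
  finally have CM: "C * moment t \<le> (m / 2 + 1) * k + C / (2 * \<mu>) * n2" .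
  have l: "ell g \<le> l" using kernel_mass(2)[of t] t by (simp add: l_def Gt_def)
  have coeff: "C / (2 * \<mu>) + C / (4 * m) \<le> m * l / 2 - 1 + Gt * (1 - 1 / (2 * m))"
  proof -
    have "C / (2 * \<mu>) + C / (4 * m) = C * (2 * m + \<mu>) / (4 * m * \<mu>)" using mm mu by (simp add: field_simps)
    also have "\<dots> \<le> 2 * \<mu> * ((m - 1)\<^sup>2 * ell g - 1) / (4 * m * \<mu>)"
      by (rule divide_right_mono[OF C_gap]) (use mm mu in simp)
    also have "\<dots> = ((m - 1)\<^sup>2 * ell g - 1) / (2 * m)" using mm mu by (simp add: field_simps)
    also have "\<dots> \<le> ((m - 1)\<^sup>2 * l - 1) / (2 * m)"
      by (intro divide_right_mono diff_right_mono mult_left_mono l) (use mm in auto)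
    also have "\<dots> = m * l / 2 - 1 + Gt * (1 - 1 / (2 * m))"
      using mm by (simp add: l_def field_simps power2_eq_square)
    finally show ?thesis .
  qed
  have c2: "(C / (2 * \<mu>) + C / (4 * m)) * n2 \<le> (m * l / 2 - 1 + Gt * (1 - 1 / (2 * m))) * n2"
    by (rule mult_right_mono[OF coeff n2])
  have "C * modified t = C * moment t - m * \<E> t" using C_pos by (simp add: modified_def algebra_simps)
  also have "\<dots> \<le> (m / 2 + 1) * k + C / (2 * \<mu>) * n2 - m * \<E> t" using CM by simp
  also have "\<dots> \<le> ?S - n2 - q + ?M + k + m / C * W"
    using S E M q c2 by (simp add: algebra_simps)
  finally show ?thesis by (simp add: n2_def q_def k_def W_def H10_norm_def L2_norm_sq)
qed

text \<open>On a short interval the equation is tested with the fixed element \<open>u(b)\<close>, which avoids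
  differentiating \<open>(u, v)\<close>; by continuity of \<open>u\<close> in \<open>H\<^sup>1\<^sub>0\<close> and of \<open>v\<close> in \<open>L\<^sup>2\<close> the error is at most
  \<open>\<epsilon>\<close> times an integrable function.\<close>

lemma local_growth:
  assumes x: "0 < x" "x < T" and \<epsilon>: "\<epsilon> > 0"
  shows "\<exists>d>0. \<forall>a b. a \<le> x \<and> x \<le> b \<and> b - a < d \<longrightarrow> 0 < a \<longrightarrow> b < T \<longrightarrow>
    integral {a..b} (\<lambda>t. C * modified t - \<epsilon> * (1 + (V (v t))\<^sup>2)) \<le> modified b - modified a"
proof -
  obtain B where B: "B \<ge> 0" "\<And>t. t \<in> {0..T} \<Longrightarrow> V (u t) \<le> B" by (rule V_bounded) (rule that; assumption)
  obtain \<eta>1 where \<eta>1: "\<eta>1 > 0" "\<And>y d. y \<in> H10 \<Omega> \<Longrightarrow> d \<in> H10 \<Omega> \<Longrightarrow> H10_norm \<Omega> y \<le> B \<Longrightarrow> H10_norm \<Omega> d < \<eta>1 \<Longrightarrow>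
     \<bar>LINT x|lebesgue_on \<Omega>. source (p x) (y x) * d x\<bar> \<le> \<epsilon> / 4"
    by (rule source_pairing_small[of "\<epsilon> / 4" B]) (use \<epsilon> B in auto)
  define \<eta> where "\<eta> = min \<eta>1 (\<epsilon> / (4 * (2 * B + 1)))"
  have \<eta>: "\<eta> > 0" "\<eta> \<le> \<eta>1" "(2 * B + 1) * \<eta> \<le> \<epsilon> / 4"
  proof -
    show "\<eta> > 0" using \<eta>1 \<epsilon> B by (simp add: \<eta>_def)
    show "\<eta> \<le> \<eta>1" by (simp add: \<eta>_def)
    have "\<eta> \<le> \<epsilon> / (4 * (2 * B + 1))" by (simp add: \<eta>_def)
    then show "(2 * B + 1) * \<eta> \<le> \<epsilon> / 4" using B(1) by (simp add: field_simps)
  qed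
  have xT: "x \<in> {0..T}" using x by simp
  define K where "K = nrm (v x) + 1"
  have K: "K > 0" unfolding K_def by (simp add: add_nonneg_pos)
  define \<theta> where "\<theta> = min 1 (\<epsilon> / (4 * K))"
  have \<theta>: "\<theta> > 0" "\<theta> \<le> 1" "2 * \<theta> * K \<le> \<epsilon> / 2"
  proof -
    show "\<theta> > 0" "\<theta> \<le> 1" using \<epsilon> K by (auto simp: \<theta>_def)
    have "\<theta> \<le> \<epsilon> / (4 * K)" by (simp add: \<theta>_def)
    then show "2 * \<theta> * K \<le> \<epsilon> / 2" using K by (simp add: field_simps)
  qed
  have "\<forall>\<^sub>F s in at x within {0..T}. V (\<lambda>y. u s y - u x y) < \<eta> / 2"
    using u_cont[OF xT] by (rule order_tendstoD) (use \<eta> in simp)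
  then obtain d1 where d1: "d1 > 0" "\<And>s. s \<in> {0..T} \<Longrightarrow> s \<noteq> x \<Longrightarrow> dist s x < d1 \<Longrightarrow> V (\<lambda>y. u s y - u x y) < \<eta> / 2"
    unfolding eventually_at by (elim exE conjE) (rule that, auto)
  have "\<forall>\<^sub>F s in at x within {0..T}. nrm (\<lambda>y. v s y - v x y) < \<theta>"
    using v_cont[OF xT] by (rule order_tendstoD) (use \<theta> in simp)
  then obtain d2 where d2: "d2 > 0" "\<And>s. s \<in> {0..T} \<Longrightarrow> s \<noteq> x \<Longrightarrow> dist s x < d2 \<Longrightarrow> nrm (\<lambda>y. v s y - v x y) < \<theta>"
    unfolding eventually_at by (elim exE conjE) (rule that, auto)
  have Vself: "V (\<lambda>y. u x y - u x y) = 0"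
    using H10_norm_diff[OF u_H10[OF xT] u_H10[OF xT]] by (simp add: L2_norm_def)
  have near_u: "V (\<lambda>y. u s y - u x y) < \<eta> / 2" if "s \<in> {0..T}" "dist s x < d1" for s
    using d1(2)[of s] that Vself \<eta>(1) by (cases "s = x") auto
  have near_v: "nrm (\<lambda>y. v s y - v x y) < \<theta>" if "s \<in> {0..T}" "dist s x < d2" for s
    using d2(2)[of s] that \<theta>(1) by (cases "s = x") (auto simp: L2_norm_def)
  show ?thesis
  proof (intro exI[of _ "min d1 d2"] conjI allI impI)
    show "min d1 d2 > 0" using d1 d2 by simp
    fix a b assume ab: "a \<le> x \<and> x \<le> b \<and> b - a < min d1 d2" and a: "0 < a" and b: "b < T"
    show "integral {a..b} (\<lambda>t. C * modified t - \<epsilon> * (1 + (V (v t))\<^sup>2)) \<le> modified b - modified a"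
    proof (cases "a = b")
      case False
      then have lt: "a < b" using ab by simp
      have dist: "t \<in> {0..T}" "dist t x < d1" "dist t x < d2" if "t \<in> {a..b}" for t
        using that ab a b by (auto simp: dist_real_def)
      have aT: "a \<in> {0..T}" and bT: "b \<in> {0..T}" using ab a b x by auto
      note ub = u_H10[OF bT]
      obtain k N where k: "(k has_integral (L2_inner \<Omega> (v b) (u b) - L2_inner \<Omega> (v a) (u b))) {a..b}" "negligible N"
        "\<And>t. t \<in> {a..b} \<Longrightarrow> t \<notin> N \<Longrightarrow> v t \<in> H10 \<Omega> \<and>
           k t = (LINT x|lebesgue_on \<Omega>. source (p x) (u t x) * u b x)
             - L2_inner \<Omega> (wgrad \<Omega> (u t)) (wgrad \<Omega> (u b)) - L2_inner \<Omega> (wgrad \<Omega> (v t)) (wgrad \<Omega> (u b))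
             + integral {0..t} (\<lambda>s. g (t - s) * L2_inner \<Omega> (wgrad \<Omega> (u s)) (wgrad \<Omega> (u b)))"
        by (rule velocity_increment[OF ub a lt b]) (rule that; assumption)
      have hv: "((\<lambda>t. L2_inner \<Omega> (v t) (v a)) has_integral (L2_inner \<Omega> (u b) (v a) - L2_inner \<Omega> (u a) (v a))) {a..b}"
      proof (rule fundamental_theorem_of_calculus)
        fix s assume s: "s \<in> {a..b}"
        have "((\<lambda>s. L2_inner \<Omega> (u s) (v a)) has_real_derivative L2_inner \<Omega> (v s) (v a)) (at s within {0..T})"
          by (intro inner_u_deriv v_L2 aT dist s)
        then have "((\<lambda>s. L2_inner \<Omega> (u s) (v a)) has_real_derivative L2_inner \<Omega> (v s) (v a)) (at s within {a..b})"
          by (rule has_field_derivative_subset) (use aT bT in auto)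
        then show "((\<lambda>s. L2_inner \<Omega> (u s) (v a)) has_vector_derivative L2_inner \<Omega> (v s) (v a)) (at s within {a..b})"
          by (simp add: has_real_derivative_iff_has_vector_derivative)
      qed (use lt in simp)
      have dis: "(\<lambda>t. (V (v t))\<^sup>2) integrable_on {a..b}" by (rule dissipation_integrable) (use a b in auto)
      \<comment> \<open>\<open>(u(b), v(b)) - (u(a), v(a))\<close> is split as \<open>(v(b) - v(a), u(b)) + (v(a), u(b) - u(a))\<close>.\<close>
      have tot: "((\<lambda>t. k t + L2_inner \<Omega> (v t) (v a) + m / C * (V (v t))\<^sup>2) has_integral
          (L2_inner \<Omega> (v b) (u b) - L2_inner \<Omega> (v a) (u b) + (L2_inner \<Omega> (u b) (v a) - L2_inner \<Omega> (u a) (v a))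
            + m / C * integral {a..b} (\<lambda>t. (V (v t))\<^sup>2))) {a..b}"
        by (intro has_integral_add k(1) hv has_integral_mult_right integrable_integral dis)
      have "integral {a..b} (\<lambda>t. C * modified t - \<epsilon> * (1 + (V (v t))\<^sup>2))
          \<le> integral {a..b} (\<lambda>t. k t + L2_inner \<Omega> (v t) (v a) + m / C * (V (v t))\<^sup>2)"
      proof (rule integral_mono_negligible[OF _ has_integral_integrable[OF tot] k(2)])
        have "continuous_on {a..b} modified" by (rule continuous_on_subset[OF modified_continuous]) (use a b in auto)
        then show "(\<lambda>t. C * modified t - \<epsilon> * (1 + (V (v t))\<^sup>2)) integrable_on {a..b}"
          by (intro integrable_diff integrable_on_mult_right integrable_add integrable_const_ivl dis integrable_continuous_real)
        fix t assume t: "t \<in> {a..b}" "t \<notin> N"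
        note tT = dist(1)[OF t(1)]
        have vt: "v t \<in> H10 \<Omega>" using k(3)[OF t] by blast
        note ut = u_H10[OF tT]
        note Gt = wgrad_L2[OF ut] and Gb = wgrad_L2[OF ub] and Gv = wgrad_L2[OF vt]
        define dd where "dd = (\<lambda>y. u b y - u t y)"
        have dH: "dd \<in> H10 \<Omega>" unfolding dd_def by (rule H10_diff(1)[OF ub ut])
        define D where "D = (\<lambda>y. wgrad \<Omega> (u b) y - wgrad \<Omega> (u t) y)"
        have DL: "D \<in> L2 \<Omega>" unfolding D_def by (rule L2_diff[OF Gb Gt])
        have VD: "V dd = nrm D" unfolding dd_def D_def by (rule H10_norm_diff[OF ub ut])
        have Vd: "nrm D < \<eta>"
        proof -
          have "nrm D \<le> nrm (\<lambda>y. wgrad \<Omega> (u b) y - wgrad \<Omega> (u x) y) + nrm (\<lambda>y. wgrad \<Omega> (u x) y - wgrad \<Omega> (u t) y)"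
            unfolding D_def by (intro L2_norm_triangle_diff Gb Gt wgrad_L2 u_H10 xT)
          also have "\<dots> = V (\<lambda>y. u b y - u x y) + V (\<lambda>y. u t y - u x y)"
            using H10_norm_diff[OF ub u_H10[OF xT]] H10_norm_diff[OF ut u_H10[OF xT]]
            by (simp add: L2_norm_diff_commute[of \<Omega> "wgrad \<Omega> (u x)"])
          also have "\<dots> < \<eta> / 2 + \<eta> / 2" using lt t by (intro add_strict_mono near_u dist) auto
          finally show ?thesis by simp
        qed
        \<comment> \<open>Replacing \<open>u(b)\<close> by \<open>u(t)\<close> in each term of the equation costs a multiple of \<open>\<eta>\<close>, or at
          most \<open>\<epsilon> / 4\<close> in the source, and \<open>v(a)\<close> by \<open>v(t)\<close> at most \<open>\<epsilon> / 2\<close>.\<close>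
        have e1: "(LINT x|lebesgue_on \<Omega>. source (p x) (u t x) * u b x) \<ge> (LINT x|lebesgue_on \<Omega>. source (p x) (u t x) * u t x) - \<epsilon> / 4"
        proof -
          have "\<bar>LINT x|lebesgue_on \<Omega>. source (p x) (u t x) * dd x\<bar> \<le> \<epsilon> / 4"
            by (rule \<eta>1(2)[OF ut dH B(2)[OF tT]]) (use Vd VD \<eta> in simp)
          moreover have "(LINT x|lebesgue_on \<Omega>. source (p x) (u t x) * dd x)
             = (LINT x|lebesgue_on \<Omega>. source (p x) (u t x) * u b x) - (LINT x|lebesgue_on \<Omega>. source (p x) (u t x) * u t x)"
            unfolding dd_def right_diff_distrib
            by (intro Bochner_Integration.integral_diff source_pairing_integrable ut ub)
          ultimately show ?thesis by linarith
        qed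
        have split: "L2_inner \<Omega> G (wgrad \<Omega> (u b)) = L2_inner \<Omega> G (wgrad \<Omega> (u t)) + L2_inner \<Omega> G D" if "G \<in> L2 \<Omega>" for G
          unfolding D_def L2_inner_diff_right[OF Gb Gt that] by simp
        have e2: "L2_inner \<Omega> (wgrad \<Omega> (u t)) D \<le> B * \<eta>"
        proof -
          have "L2_inner \<Omega> (wgrad \<Omega> (u t)) D \<le> nrm (wgrad \<Omega> (u t)) * nrm D"
            using L2_Cauchy_Schwarz[OF Gt DL] by simp
          also have "\<dots> \<le> B * \<eta>" using B(2)[OF tT] Vd B(1) by (intro mult_mono) (auto simp: H10_norm_def)
          finally show ?thesis .
        qed
        have e3: "L2_inner \<Omega> (wgrad \<Omega> (v t)) D \<le> \<eta> * (1 + (V (v t))\<^sup>2)"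
        proof -
          have "L2_inner \<Omega> (wgrad \<Omega> (v t)) D \<le> nrm (wgrad \<Omega> (v t)) * nrm D"
            using L2_Cauchy_Schwarz[OF Gv DL] by simp
          also have "\<dots> \<le> (1 + (V (v t))\<^sup>2) * \<eta>"
          proof (rule mult_mono)
            have "2 * V (v t) * 1 \<le> (V (v t))\<^sup>2 + 1\<^sup>2" by (rule sum_squares_bound)
            then have "2 * V (v t) \<le> (V (v t))\<^sup>2 + 1" by simp
            then show "nrm (wgrad \<Omega> (v t)) \<le> 1 + (V (v t))\<^sup>2"
              unfolding H10_norm_def[symmetric] using V_nonneg[of "v t"] by linarith
          qed (use Vd in auto)
          finally show ?thesis by (simp add: mult.commute)
        qed
        have e4: "integral {0..t} (\<lambda>s. g (t - s) * L2_inner \<Omega> (wgrad \<Omega> (u s)) (wgrad \<Omega> (u b)))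
           \<ge> integral {0..t} (\<lambda>s. g (t - s) * L2_inner \<Omega> (wgrad \<Omega> (u s)) (wgrad \<Omega> (u t))) - B * \<eta>"
        proof -
          have t0: "0 \<le> t" using tT by simp
          note km = kernel_mass[OF t0]
          have "integral {0..t} (\<lambda>s. g (t - s) * L2_inner \<Omega> (wgrad \<Omega> (u s)) (wgrad \<Omega> (u t)) - g (t - s) * (B * \<eta>))
             \<le> integral {0..t} (\<lambda>s. g (t - s) * L2_inner \<Omega> (wgrad \<Omega> (u s)) (wgrad \<Omega> (u b)))"
          proof (rule integral_le)
            show "(\<lambda>s. g (t - s) * L2_inner \<Omega> (wgrad \<Omega> (u s)) (wgrad \<Omega> (u t)) - g (t - s) * (B * \<eta>)) integrable_on {0..t}"
              by (intro integrable_diff memory_integrable(1) tT Gt integrable_on_mult_left km(4))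
            show "(\<lambda>s. g (t - s) * L2_inner \<Omega> (wgrad \<Omega> (u s)) (wgrad \<Omega> (u b))) integrable_on {0..t}"
              by (intro memory_integrable(1) tT Gb)
            fix s assume s: "s \<in> {0..t}"
            then have sT: "s \<in> {0..T}" using tT by auto
            note Gs = wgrad_L2[OF u_H10[OF sT]]
            have "- L2_inner \<Omega> (wgrad \<Omega> (u s)) D \<le> nrm (wgrad \<Omega> (u s)) * nrm D"
              using L2_Cauchy_Schwarz[OF Gs DL] by simp
            also have "\<dots> \<le> B * \<eta>" using B(2)[OF sT] Vd B(1) by (intro mult_mono) (auto simp: H10_norm_def)
            finally have "L2_inner \<Omega> (wgrad \<Omega> (u s)) (wgrad \<Omega> (u t)) - B * \<eta> \<le> L2_inner \<Omega> (wgrad \<Omega> (u s)) (wgrad \<Omega> (u b))"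
              unfolding split[OF Gs] by simp
            then have "g (t - s) * (L2_inner \<Omega> (wgrad \<Omega> (u s)) (wgrad \<Omega> (u t)) - B * \<eta>) \<le> g (t - s) * L2_inner \<Omega> (wgrad \<Omega> (u s)) (wgrad \<Omega> (u b))"
              by (rule mult_left_mono) (use s g_nonneg in simp)
            then show "g (t - s) * L2_inner \<Omega> (wgrad \<Omega> (u s)) (wgrad \<Omega> (u t)) - g (t - s) * (B * \<eta>) \<le> g (t - s) * L2_inner \<Omega> (wgrad \<Omega> (u s)) (wgrad \<Omega> (u b))"
              by (simp add: right_diff_distrib)
          qed
          moreover have "integral {0..t} (\<lambda>s. g (t - s) * L2_inner \<Omega> (wgrad \<Omega> (u s)) (wgrad \<Omega> (u t)) - g (t - s) * (B * \<eta>))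
             = integral {0..t} (\<lambda>s. g (t - s) * L2_inner \<Omega> (wgrad \<Omega> (u s)) (wgrad \<Omega> (u t))) - integral {0..t} g * (B * \<eta>)"
            unfolding km(5)[symmetric]
            by (subst Henstock_Kurzweil_Integration.integral_diff)
              (simp_all add: memory_integrable(1)[OF tT Gt] integrable_on_mult_left km(4))
          moreover have "integral {0..t} g * (B * \<eta>) \<le> B * \<eta>"
            using km(1,2,3) B(1) \<eta>(1) by (intro mult_left_le_one_le) auto
          ultimately show ?thesis by linarith
        qed
        have e5: "L2_inner \<Omega> (v t) (v a) \<ge> (nrm (v t))\<^sup>2 - \<epsilon> / 2"
        proof -
          note vtL = v_L2[OF tT] and vaL = v_L2[OF aT] and vxL = v_L2[OF xT]
          have "(nrm (v t))\<^sup>2 - L2_inner \<Omega> (v t) (v a) = L2_inner \<Omega> (v t) (\<lambda>y. v t y - v a y)"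
            unfolding L2_inner_diff_right[OF vtL vaL vtL] by (simp add: L2_norm_sq)
          also have "\<dots> \<le> nrm (v t) * nrm (\<lambda>y. v t y - v a y)"
            using L2_Cauchy_Schwarz[OF vtL L2_diff[OF vtL vaL]] by simp
          also have "\<dots> \<le> K * (2 * \<theta>)"
          proof (rule mult_mono)
            have "nrm (v t) \<le> nrm (\<lambda>y. v t y - v x y) + nrm (v x)"
              using L2_norm_triangle[OF L2_diff[OF vtL vxL] vxL] by simp
            then show "nrm (v t) \<le> K" using near_v[of t] dist[OF t(1)] \<theta>(2) by (simp add: K_def)
            have "nrm (\<lambda>y. v t y - v a y) \<le> nrm (\<lambda>y. v t y - v x y) + nrm (\<lambda>y. v x y - v a y)"
              by (rule L2_norm_triangle_diff[OF vtL vxL vaL])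
            also have "\<dots> \<le> \<theta> + \<theta>"
              unfolding L2_norm_diff_commute[of \<Omega> "v x"]
              using near_v[of t] near_v[of a] dist[OF t(1)] dist[of a] lt by (intro add_mono) auto
            finally show "nrm (\<lambda>y. v t y - v a y) \<le> 2 * \<theta>" by simp
          qed (use K in auto)
          also have "\<dots> \<le> \<epsilon> / 2" using \<theta>(3) by (simp add: mult.commute mult.left_commute)
          finally show ?thesis by simp
        qed
        have kt: "k t = (LINT x|lebesgue_on \<Omega>. source (p x) (u t x) * u b x)
             - (L2_inner \<Omega> (wgrad \<Omega> (u t)) (wgrad \<Omega> (u t)) + L2_inner \<Omega> (wgrad \<Omega> (u t)) D)
             - (L2_inner \<Omega> (wgrad \<Omega> (v t)) (wgrad \<Omega> (u t)) + L2_inner \<Omega> (wgrad \<Omega> (v t)) D)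
             + integral {0..t} (\<lambda>s. g (t - s) * L2_inner \<Omega> (wgrad \<Omega> (u s)) (wgrad \<Omega> (u b)))"
          using k(3)[OF t] split[OF Gt] split[OF Gv] by simp
        have pg: "C * modified t \<le> (LINT x|lebesgue_on \<Omega>. source (p x) (u t x) * u t x)
            - L2_inner \<Omega> (wgrad \<Omega> (u t)) (wgrad \<Omega> (u t)) - L2_inner \<Omega> (wgrad \<Omega> (v t)) (wgrad \<Omega> (u t))
            + integral {0..t} (\<lambda>s. g (t - s) * L2_inner \<Omega> (wgrad \<Omega> (u s)) (wgrad \<Omega> (u t)))
            + (nrm (v t))\<^sup>2 + m / C * (V (v t))\<^sup>2" by (rule pointwise_growth[OF tT vt])
        have sm: "2 * (B * \<eta>) + \<eta> * (1 + (V (v t))\<^sup>2) + \<epsilon> / 4 + \<epsilon> / 2 \<le> \<epsilon> * (1 + (V (v t))\<^sup>2)"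
        proof -
          have h: "2 * (B * \<eta>) + \<eta> \<le> \<epsilon> / 4" using \<eta>(3) by (simp add: algebra_simps)
          have "\<eta> \<le> \<epsilon>" using h B(1) \<eta>(1) \<epsilon> mult_nonneg_nonneg[of B \<eta>] by linarith
          then have "\<eta> * (V (v t))\<^sup>2 \<le> \<epsilon> * (V (v t))\<^sup>2" by (rule mult_right_mono) simp
          then show ?thesis using h \<epsilon> unfolding distrib_left by linarith
        qed
        show "C * modified t - \<epsilon> * (1 + (V (v t))\<^sup>2) \<le> k t + L2_inner \<Omega> (v t) (v a) + m / C * (V (v t))\<^sup>2"
          using kt pg sm e1 e2 e3 e4 e5 by linarith
      qed
      also have "\<dots> = moment b - moment a + m / C * integral {a..b} (\<lambda>t. (V (v t))\<^sup>2)"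
        unfolding integral_unique[OF tot] moment_def
        by (simp add: L2_inner_commute[of \<Omega> "v b" "u b"] L2_inner_commute[of \<Omega> "v a" "u b"])
      also have "\<dots> \<le> moment b - moment a + m / C * (\<E> a - \<E> b)"
      proof -
        have "integral {a..b} (\<lambda>t. (V (v t))\<^sup>2) \<le> \<E> a - \<E> b"
          using energy_decrease[of a b] a b lt by (simp add: shifted_energy_def integral_neg)
        then show ?thesis using m_gt_2 C_pos by (intro add_left_mono mult_left_mono) auto
      qed
      also have "\<dots> = modified b - modified a" by (simp add: modified_def algebra_simps)
      finally show ?thesis .
    qed simp
  qed
qed

text \<open>The inequality of \<open>local_growth\<close> is additive in the interval, so bisection extends it to every
  interval inside \<open>(0, T)\<close>, and \<open>\<epsilon>\<close> then tends to zero. The weak form of the equation is available on the open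
  interval only, hence the strict bounds.\<close>

lemma interior_growth:
  assumes a: "0 < a" and ab: "a \<le> b" and b: "b < T"
  shows "modified b - modified a \<ge> C * integral {a..b} modified"
proof -
  have mi: "modified integrable_on {c..d}" if "0 < c" "d < T" for c d
    by (intro integrable_continuous_real continuous_on_subset[OF modified_continuous]) (use that in auto)
  have di: "(\<lambda>t. 1 + (V (v t))\<^sup>2) integrable_on {c..d}" if "0 < c" "d < T" for c d
    by (intro integrable_add integrable_const_ivl dissipation_integrable) (use that in auto)
  let ?I = "integral {a..b} (\<lambda>t. 1 + (V (v t))\<^sup>2)"
  have I: "?I \<ge> 0" by (rule Henstock_Kurzweil_Integration.integral_nonneg[OF di[OF a b]]) simp
  have step: "C * integral {a..b} modified - \<epsilon> * ?I \<le> modified b - modified a" if \<epsilon>: "\<epsilon> > 0" for \<epsilon>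
  proof -
    let ?h = "\<lambda>t. C * modified t - \<epsilon> * (1 + (V (v t))\<^sup>2)"
    have hi: "?h integrable_on {c..d}" if "0 < c" "d < T" for c d
      by (intro integrable_diff integrable_on_mult_right mi[OF that] di[OF that])
    have "0 < a \<longrightarrow> b < T \<longrightarrow> integral {a..b} ?h \<le> modified b - modified a"
    proof (rule Bolzano[OF ab])
      fix c d e assume cd: "0 < c \<longrightarrow> d < T \<longrightarrow> integral {c..d} ?h \<le> modified d - modified c"
        and de: "0 < d \<longrightarrow> e < T \<longrightarrow> integral {d..e} ?h \<le> modified e - modified d" and le: "c \<le> d" "d \<le> e"
      show "0 < c \<longrightarrow> e < T \<longrightarrow> integral {c..e} ?h \<le> modified e - modified c"
      proof (intro impI)
        assume c: "0 < c" and e: "e < T"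
        have "integral {c..e} ?h = integral {c..d} ?h + integral {d..e} ?h"
          using Henstock_Kurzweil_Integration.integral_combine[OF le hi[OF c e]] by simp
        then show "integral {c..e} ?h \<le> modified e - modified c" using cd de le c e by simp
      qed
    next
      fix x assume "a \<le> x" "x \<le> b"
      then show "\<exists>d>0. \<forall>a b. a \<le> x \<and> x \<le> b \<and> b - a < d \<longrightarrow> 0 < a \<longrightarrow> b < T \<longrightarrow> integral {a..b} ?h \<le> modified b - modified a"
        using a b \<epsilon> by (intro local_growth) auto
    qed
    moreover have "integral {a..b} ?h = C * integral {a..b} modified - \<epsilon> * ?I"
      using mi[OF a b] di[OF a b] by (simp add: Henstock_Kurzweil_Integration.integral_diff integrable_on_mult_right)
    ultimately show ?thesis using a b by simp
  qed
  show ?thesis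
  proof (rule field_le_epsilon)
    fix e :: real assume e: "e > 0"
    have "C * integral {a..b} modified \<le> modified b - modified a + e / (?I + 1) * ?I"
      using step[of "e / (?I + 1)"] e I by simp
    also have "e / (?I + 1) * ?I \<le> e" using e I by (simp add: field_simps)
    finally show "C * integral {a..b} modified \<le> modified b - modified a + e" by simp
  qed
qed

text \<open>Continuity at \<open>t = 0\<close> brings the initial value in.\<close>

lemma exponential_growth:
  assumes t: "0 \<le> t" "t < T"
  shows "modified t \<ge> modified 0 * exp (C * t)"
proof (rule integral_Gronwall)
  show "continuous_on {0..t} modified" by (rule continuous_on_subset[OF modified_continuous]) (use t in auto)
  fix s assume s: "s \<in> {0..t}"
  have c: "continuous_on {0..s} modified" by (rule continuous_on_subset[OF modified_continuous]) (use s t in auto)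
  then have i: "modified integrable_on {0..s}" by (rule integrable_continuous_real)
  define D where "D = (\<lambda>a. modified s - modified a - C * (integral {0..s} modified - integral {0..a} modified))"
  show "modified s \<ge> modified 0 + C * integral {0..s} modified"
  proof (cases "s = 0")
    case False
    have "0 \<le> D 0"
    proof (rule continuous_ge_on_closure[of "{0<..s}" D])
      show "continuous_on (closure {0<..s}) D" unfolding D_def
        using False s by (auto intro!: continuous_intros c indefinite_integral_continuous_1 i)
      show "0 \<in> closure {0<..s}" using False s by auto
      fix a assume "a \<in> {0<..s}"
      then have a: "0 < a" "a \<le> s" by auto
      have "integral {0..s} modified - integral {0..a} modified = integral {a..s} modified"
        using Henstock_Kurzweil_Integration.integral_combine[of 0 a s modified] a i by simp
      then show "0 \<le> D a" using interior_growth[of a s] a s t by (simp add: D_def)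
    qed
    then show ?thesis by (simp add: D_def)
  qed simp
qed (use t C_pos in auto)

end

section \<open>Crossing the energy level\<close>

lemma ex1_positive_root:
  fixes A B c :: real
  assumes A: "A > 0" and c: "c > 0"
  shows "\<exists>!t. 0 < t \<and> A * t\<^sup>2 + B * t - c = 0"
proof (rule ex_ex1I)
  define D where "D = sqrt (B\<^sup>2 + 4 * A * c)"
  have pos: "4 * A * c > 0" using A c by simp
  have D2: "D\<^sup>2 = B\<^sup>2 + 4 * A * c" unfolding D_def using pos by (intro real_sqrt_pow2) (simp add: add_nonneg_nonneg)
  have "\<bar>B\<bar> < D" unfolding D_def by (rule real_less_rsqrt) (use pos in simp)
  then have "0 < (D - B) / (2 * A)" using A by simp
  moreover have "A * ((D - B) / (2 * A))\<^sup>2 + B * ((D - B) / (2 * A)) - c = (D\<^sup>2 - B\<^sup>2 - 4 * A * c) / (4 * A)"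
    using A by (simp add: field_simps power2_eq_square)
  ultimately show "\<exists>t. 0 < t \<and> A * t\<^sup>2 + B * t - c = 0" using D2 by (intro exI[of _ "(D - B) / (2 * A)"]) simp
next
  fix s t assume "0 < s \<and> A * s\<^sup>2 + B * s - c = 0" "0 < t \<and> A * t\<^sup>2 + B * t - c = 0"
  then have s: "s > 0" "A * s * s + B * s = c" and t: "t > 0" "A * t * t + B * t = c"
    by (simp_all add: power2_eq_square mult.assoc)
  have "(A * s * t + c) * (t - s) = (A * t * t + B * t - c) * s - (A * s * s + B * s - c) * t"
    by (simp add: algebra_simps)
  then have "(A * s * t + c) * (t - s) = 0" using s(2) t(2) by simp
  moreover have "A * s * t + c > 0" using A c s t by (simp add: add_pos_pos)
  ultimately show "s = t" by simp
qed

context growing_evolution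
begin

lemma displacement_energy_bound:
  assumes t: "0 < t" "t \<le> T" and E: "\<E> t \<ge> - \<beta>"
  shows "(V (\<lambda>x. u t x - u 0 x))\<^sup>2 \<le> t * (\<E> 0 + \<beta>)"
    and "(nrm (\<lambda>x. u t x - u 0 x))\<^sup>2 \<le> t * (\<E> 0 + \<beta>) / \<mu>"
proof -
  have "integral {0..t} (\<lambda>t. (V (v t))\<^sup>2) \<le> \<E> 0 - \<E> t"
    using energy_decrease[of 0 t] t by (simp add: shifted_energy_def)
  then have "t * integral {0..t} (\<lambda>t. (V (v t))\<^sup>2) \<le> t * (\<E> 0 + \<beta>)"
    using E t by (intro mult_left_mono) auto
  with displacement_bound[OF t] show V: "(V (\<lambda>x. u t x - u 0 x))\<^sup>2 \<le> t * (\<E> 0 + \<beta>)" by (rule order_trans)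
  have "\<mu> * (nrm (\<lambda>x. u t x - u 0 x))\<^sup>2 \<le> (V (\<lambda>x. u t x - u 0 x))\<^sup>2"
    by (intro Poincare H10_diff(1) u_H10) (use t in auto)
  with V show "(nrm (\<lambda>x. u t x - u 0 x))\<^sup>2 \<le> t * (\<E> 0 + \<beta>) / \<mu>" using mu_pos by (simp add: field_simps)
qed

text \<open>As long as \<open>\<E> \<ge> - \<beta>\<close>, the growth of the modified moment makes
  \<open>d/dt \<parallel>u\<parallel>\<^sup>2 = 2 (u, v) \<ge> 2 L\<^sub>0 exp (C t) - L\<^sub>0\<close>, which beats the derivative of \<open>L\<^sub>0 t + C L\<^sub>0 t\<^sup>2\<close>, while
  the dissipated energy limits \<open>\<parallel>u(t) - u(0)\<parallel>\<close>. The time \<open>\<tau>\<close> is where the two bounds collide.\<close>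

lemma energy_reaches_level:
  assumes L0: "modified 0 > 0" and E0: "\<E> 0 \<ge> 0" and beta: "\<beta> = C * modified 0 / (2 * m)"
    and \<tau>: "0 < \<tau>" "\<tau> < T"
    and root: "C * modified 0 * \<tau>\<^sup>2 + (modified 0 - 2 * (\<E> 0 + \<beta>) / \<mu>) * \<tau> - (nrm (u 0))\<^sup>2 = 0"
  obtains tb where "0 < tb" "tb < \<tau>" "\<E> tb = - \<beta>"
proof -
  let ?L = "modified 0"
  have "\<beta> > 0" unfolding beta using L0 C_pos m_gt_2 by simp
  have False if none: "\<And>t. 0 < t \<Longrightarrow> t < \<tau> \<Longrightarrow> \<E> t \<noteq> - \<beta>"
  proof -
    have above: "\<E> t \<ge> - \<beta>" if t: "0 \<le> t" "t \<le> \<tau>" for t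
    proof (rule ccontr)
      assume less: "\<not> \<E> t \<ge> - \<beta>"
      have "\<exists>s\<ge>0. s \<le> t \<and> \<E> s = - \<beta>"
        by (rule IVT2') (use less t \<tau> E0 \<open>\<beta> > 0\<close> in \<open>auto intro: continuous_on_subset[OF energy_continuous]\<close>)
      then obtain s where s: "0 \<le> s" "s \<le> t" "\<E> s = - \<beta>" by blast
      have "s \<noteq> 0" using s(3) E0 \<open>\<beta> > 0\<close> by auto
      moreover have "s \<noteq> t" using s(3) less by auto
      ultimately show False using none[of s] s t by simp
    qed
    \<comment> \<open>The quadratic term of the exponential series makes the final comparison strict.\<close>
    have mom: "2 * moment t \<ge> ?L + 2 * C * ?L * t + ?L * C\<^sup>2 * t\<^sup>2" if t: "0 \<le> t" "t \<le> \<tau>" for t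
    proof -
      have "1 + C * t + (C * t)\<^sup>2 / 2 \<le> exp (C * t)" by (rule exp_lower_Taylor_quadratic) (use t C_pos in simp)
      then have "?L * (1 + C * t + (C * t)\<^sup>2 / 2) \<le> ?L * exp (C * t)" by (rule mult_left_mono) (use L0 in simp)
      also have "\<dots> \<le> modified t" by (rule exponential_growth) (use t \<tau> in auto)
      finally have g: "?L * (1 + C * t + (C * t)\<^sup>2 / 2) \<le> modified t" .
      have "m / C * (- \<beta>) \<le> m / C * \<E> t" by (rule mult_left_mono[OF above[OF t]]) (use m_gt_2 C_pos in simp)
      moreover have "m / C * (- \<beta>) = - ?L / 2" unfolding beta using m_gt_2 C_pos by simp
      moreover have "moment t = modified t + m / C * \<E> t" by (simp add: modified_def)
      ultimately have "moment t \<ge> modified t - ?L / 2" by linarith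
      with g have "2 * moment t \<ge> 2 * (?L * (1 + C * t + (C * t)\<^sup>2 / 2)) - ?L" by linarith
      then show ?thesis by (simp add: algebra_simps power_mult_distrib)
    qed
    have lower: "0 \<le> (nrm (u \<tau>))\<^sup>2 - ?L * \<tau> - C * ?L * \<tau>\<^sup>2 - ?L * C\<^sup>2 * \<tau> ^ 3 / 3 - ((nrm (u 0))\<^sup>2 - ?L * 0 - C * ?L * 0\<^sup>2 - ?L * C\<^sup>2 * 0 ^ 3 / 3)"
    proof (rule has_integral_nonneg)
      show "((\<lambda>t. 2 * moment t - ?L - 2 * C * ?L * t - ?L * C\<^sup>2 * t\<^sup>2) has_integral
        ((nrm (u \<tau>))\<^sup>2 - ?L * \<tau> - C * ?L * \<tau>\<^sup>2 - ?L * C\<^sup>2 * \<tau> ^ 3 / 3 - ((nrm (u 0))\<^sup>2 - ?L * 0 - C * ?L * 0\<^sup>2 - ?L * C\<^sup>2 * 0 ^ 3 / 3))) {0..\<tau>}"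
      proof (rule fundamental_theorem_of_calculus)
        fix t assume t: "t \<in> {0..\<tau>}"
        have "((\<lambda>t. (nrm (u t))\<^sup>2) has_real_derivative 2 * moment t) (at t within {0..T})"
          by (rule norm_sq_u_deriv) (use t \<tau> in auto)
        then have "((\<lambda>t. (nrm (u t))\<^sup>2) has_real_derivative 2 * moment t) (at t within {0..\<tau>})"
          by (rule has_field_derivative_subset) (use \<tau> in auto)
        then have "((\<lambda>t. (nrm (u t))\<^sup>2 - (?L * t + C * ?L * t\<^sup>2 + ?L * C\<^sup>2 * t ^ 3 / 3)) has_real_derivative
            2 * moment t - (?L + 2 * C * ?L * t + ?L * C\<^sup>2 * t\<^sup>2)) (at t within {0..\<tau>})"
          by (rule DERIV_diff) (auto intro!: derivative_eq_intros simp: power2_eq_square algebra_simps)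
        then show "((\<lambda>t. (nrm (u t))\<^sup>2 - ?L * t - C * ?L * t\<^sup>2 - ?L * C\<^sup>2 * t ^ 3 / 3) has_vector_derivative
            2 * moment t - ?L - 2 * C * ?L * t - ?L * C\<^sup>2 * t\<^sup>2) (at t within {0..\<tau>})"
          by (simp add: has_real_derivative_iff_has_vector_derivative diff_diff_eq add.assoc)
      qed (use \<tau> in simp)
      show "0 \<le> 2 * moment t - ?L - 2 * C * ?L * t - ?L * C\<^sup>2 * t\<^sup>2" if "t \<in> {0..\<tau>}" for t
        using mom[of t] that by simp
    qed
    have u\<tau>: "u \<tau> \<in> L2 \<Omega>" and u0: "u 0 \<in> L2 \<Omega>" using \<tau> by (auto intro!: H10_L2 u_H10)
    have "nrm (u \<tau>) \<le> nrm (\<lambda>x. u \<tau> x - u 0 x) + nrm (u 0)"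
      using L2_norm_triangle[OF L2_diff[OF u\<tau> u0] u0] by simp
    then have "(nrm (u \<tau>))\<^sup>2 \<le> (nrm (\<lambda>x. u \<tau> x - u 0 x) + nrm (u 0))\<^sup>2" by (rule power_mono) simp
    also have "\<dots> \<le> 2 * (nrm (\<lambda>x. u \<tau> x - u 0 x))\<^sup>2 + 2 * (nrm (u 0))\<^sup>2"
      using sum_squares_bound[of "nrm (\<lambda>x. u \<tau> x - u 0 x)" "nrm (u 0)"] by (simp add: power2_sum)
    also have "\<dots> \<le> 2 * (\<tau> * (\<E> 0 + \<beta>) / \<mu>) + 2 * (nrm (u 0))\<^sup>2"
      using displacement_energy_bound(2)[of \<tau> \<beta>] above[of \<tau>] \<tau> by simp
    also have "\<dots> = (nrm (u 0))\<^sup>2 + ?L * \<tau> + C * ?L * \<tau>\<^sup>2"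
      using root by (simp add: algebra_simps)
    finally have "?L * C\<^sup>2 * \<tau> ^ 3 \<le> 0" using lower by simp
    moreover have "?L * C\<^sup>2 * \<tau> ^ 3 > 0" using L0 C_pos \<tau> by simp
    ultimately show False by simp
  qed
  then show thesis using that by blast
qed

lemma state_at_level:
  assumes L0: "modified 0 > 0" and beta: "\<beta> = C * modified 0 / (2 * m)" and nonneg: "\<E> 0 + \<beta> \<ge> 0"
    and tb: "0 < tb" "tb < \<tau>" "\<tau> < T" "\<E> tb = - \<beta>"
  shows "moment tb \<ge> modified 0 / 2"
    and "(nrm (u tb))\<^sup>2 \<le> (nrm (u 0) + sqrt (\<tau> * (\<E> 0 + \<beta>) / \<mu>))\<^sup>2"
    and "(V (u tb))\<^sup>2 \<le> (V (u 0) + sqrt (\<tau> * (\<E> 0 + \<beta>)))\<^sup>2"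
proof -
  have "modified 0 * 1 \<le> modified 0 * exp (C * tb)"
    by (rule mult_left_mono) (use L0 C_pos tb in auto)
  also have "\<dots> \<le> modified tb" by (rule exponential_growth) (use tb in auto)
  finally show "moment tb \<ge> modified 0 / 2"
    using m_gt_2 C_pos unfolding modified_def[of tb] tb(4) beta by simp
  have ut: "u tb \<in> H10 \<Omega>" and u0: "u 0 \<in> H10 \<Omega>" using tb by (auto intro!: u_H10)
  have tE: "tb * (\<E> 0 + \<beta>) \<le> \<tau> * (\<E> 0 + \<beta>)" using tb nonneg by (intro mult_right_mono) auto
  note d = displacement_energy_bound[of tb \<beta>]
  have "nrm (u tb) \<le> nrm (u 0) + nrm (\<lambda>x. u tb x - u 0 x)"
    using L2_norm_triangle[OF L2_diff[OF H10_L2[OF ut] H10_L2[OF u0]] H10_L2[OF u0]] by simp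
  also have "nrm (\<lambda>x. u tb x - u 0 x) \<le> sqrt (\<tau> * (\<E> 0 + \<beta>) / \<mu>)"
  proof (rule real_le_rsqrt)
    have "(nrm (\<lambda>x. u tb x - u 0 x))\<^sup>2 \<le> tb * (\<E> 0 + \<beta>) / \<mu>" by (rule d(2)) (use tb in auto)
    also have "\<dots> \<le> \<tau> * (\<E> 0 + \<beta>) / \<mu>" by (rule divide_right_mono[OF tE]) (use mu_pos in simp)
    finally show "(nrm (\<lambda>x. u tb x - u 0 x))\<^sup>2 \<le> \<tau> * (\<E> 0 + \<beta>) / \<mu>" .
  qed
  finally show "(nrm (u tb))\<^sup>2 \<le> (nrm (u 0) + sqrt (\<tau> * (\<E> 0 + \<beta>) / \<mu>))\<^sup>2" by (intro power_mono) auto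
  note Gt = wgrad_L2[OF ut] and G0 = wgrad_L2[OF u0]
  have "V (u tb) \<le> V (u 0) + V (\<lambda>x. u tb x - u 0 x)"
    using L2_norm_triangle[OF L2_diff[OF Gt G0] G0] unfolding H10_norm_diff[OF ut u0] by (simp add: H10_norm_def)
  also have "V (\<lambda>x. u tb x - u 0 x) \<le> sqrt (\<tau> * (\<E> 0 + \<beta>))"
    by (intro real_le_rsqrt order_trans[OF d(1) tE]) (use tb in auto)
  finally show "(V (u tb))\<^sup>2 \<le> (V (u 0) + sqrt (\<tau> * (\<E> 0 + \<beta>)))\<^sup>2" by (intro power_mono) auto
qed

end

text \<open>Positivity of the growth constant is the hypothesis \<open>ell g > 1 / (m - 1)\<^sup>2\<close> together with
  \<open>\<lambda>\<^sub>1 > 0\<close>.\<close>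

lemma growing_evolution_of_local_theory:
  assumes domain: "smooth_bounded_domain \<Omega>" and H1: "hyp_H1 \<Omega> p" and H2: "hyp_H2 g"
    and known: "local_theory \<Omega> p g"
    and ell: "ell g > 1 / (pm \<Omega> p - 1)\<^sup>2" and data: "u0 \<in> H10 \<Omega>" "u1 \<in> L2 \<Omega>"
    and sol: "maximal_energy_solution \<Omega> p g u0 u1 Tmax u v"
    and T: "0 < T" "ereal T < Tmax"
  shows "growing_evolution \<Omega> p g u0 u1 u v T (growth_const \<Omega> p g)"
proof -
  have dom: "open \<Omega>" "bounded \<Omega>" "\<Omega> \<noteq> {}" using domain by (auto simp: smooth_bounded_domain_def)
  have upto: "energy_solution_upto \<Omega> p g u0 u1 Tmax u v" using sol by (simp add: maximal_energy_solution_def)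
  have kn: "(\<forall>T. 0 < T \<and> ereal T < Tmax \<longrightarrow> abs_cont_on {0..T} (energy \<Omega> p g u v)) \<and>
        (AE t in lebesgue. 0 < t \<and> ereal t < Tmax \<longrightarrow>
           (energy \<Omega> p g u v has_real_derivative
              (- (L2_norm \<Omega> (wgrad \<Omega> (v t)))\<^sup>2 - g t * (L2_norm \<Omega> (wgrad \<Omega> (u t)))\<^sup>2 / 2
               + integral {0..t} (\<lambda>s. rderiv g (t - s)
                   * (L2_norm \<Omega> (wgrad \<Omega> (u t) - wgrad \<Omega> (u s)))\<^sup>2) / 2)) (at t))"
    using known[unfolded local_theory_def, rule_format, OF data] sol by blast
  interpret log_source_domain \<Omega> p by unfold_locales (use dom H1 in auto)
  interpret evolution \<Omega> p g u0 u1 u v T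
  proof
    show "T > 0" by (rule T)
    show "hyp_H2 g" by (rule H2)
    show "energy_solution \<Omega> p g u0 u1 T u v" using upto T by (simp add: energy_solution_upto_def)
    show "abs_cont_on {0..T} (energy \<Omega> p g u v)" using kn T by blast
    from conjunct2[OF kn]
    show "AE t in lebesgue. 0 < t \<and> t < T \<longrightarrow>
           (energy \<Omega> p g u v has_real_derivative
              (- (L2_norm \<Omega> (wgrad \<Omega> (v t)))\<^sup>2 - g t * (L2_norm \<Omega> (wgrad \<Omega> (u t)))\<^sup>2 / 2
               + integral {0..t} (\<lambda>s. rderiv g (t - s)
                   * (L2_norm \<Omega> (wgrad \<Omega> (u t) - wgrad \<Omega> (u s)))\<^sup>2) / 2)) (at t)"
    proof eventually_elim
      case (elim t)
      have "ereal t < Tmax" if "t < T" using that T(2) by (meson ereal_less_eq(3) less_imp_le order_le_less_trans)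
      with elim show ?case by blast
    qed
  qed
  have mm: "m > 2" by (rule pm_gt_2)
  have gap: "0 < (m - 1)\<^sup>2 * ell g - 1" using ell mm by (simp add: field_simps)
  have den: "0 < 2 * m + \<mu>" using mm mu_pos by simp
  define A where "A = 2 * \<mu> * ((m - 1)\<^sup>2 * ell g - 1)"
  have A: "A > 0" unfolding A_def using mu_pos gap by simp
  have C: "growth_const \<Omega> p g = min (m + 2) (A / (2 * m + \<mu>))" by (simp add: growth_const_def A_def)
  show ?thesis
  proof
    show "growth_const \<Omega> p g > 0" unfolding C using mm A den by simp
    show "growth_const \<Omega> p g \<le> m + 2" unfolding C by simp
    have "growth_const \<Omega> p g \<le> A / (2 * m + \<mu>)" unfolding C by simp
    then show "growth_const \<Omega> p g * (2 * m + \<mu>) \<le> 2 * \<mu> * ((m - 1)\<^sup>2 * ell g - 1)"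
      unfolding A_def[symmetric] using den by (simp add: pos_le_divide_eq)
  qed
qed

theorem lemma3p8:
  fixes \<Omega> :: "(real ^ 'n) set" and p :: "real ^ 'n \<Rightarrow> real" and g :: "real \<Rightarrow> real"
    and u0 u1 :: "real ^ 'n \<Rightarrow> real" and u ut :: "real \<Rightarrow> real ^ 'n \<Rightarrow> real"
    and Tmax :: ereal and C L0 \<beta> lambda1 :: real and \<E> :: "real \<Rightarrow> real"
  assumes domain: "smooth_bounded_domain \<Omega>"
    and H1: "hyp_H1 \<Omega> p"
    and H2: "hyp_H2 g"
    and known: "local_theory \<Omega> p g"
    and ell: "ell g > 1 / (pm \<Omega> p - 1)\<^sup>2"
    and data: "u0 \<in> H10 \<Omega>" "u1 \<in> L2 \<Omega>"
    and sol: "maximal_energy_solution \<Omega> p g u0 u1 Tmax u ut"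
    and lambda1: "lambda1 = first_dirichlet_eigenvalue \<Omega>"
    and C: "C = growth_const \<Omega> p g"
    and E: "\<E> = shifted_energy \<Omega> p g u ut"
    and E0: "\<E> 0 \<ge> 0"
    and L0: "L0 = L2_inner \<Omega> u0 u1 - pm \<Omega> p / C * \<E> 0" "L0 > 0"
    and beta: "\<beta> = C * L0 / (2 * pm \<Omega> p)"
  shows "let Q = (\<lambda>\<tau>. C * L0 * \<tau>\<^sup>2 + (L0 - 2 * (\<E> 0 + \<beta>) / lambda1) * \<tau> - (L2_norm \<Omega> u0)\<^sup>2) in
    (\<exists>!\<tau>. 0 < \<tau> \<and> Q \<tau> = 0) \<and>
    (\<forall>\<tau>. 0 < \<tau> \<and> Q \<tau> = 0 \<longrightarrow>
      (let U = (L2_norm \<Omega> u0 + sqrt (\<tau> * (\<E> 0 + \<beta>) / lambda1))\<^sup>2;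
           G = (L2_norm \<Omega> (wgrad \<Omega> u0) + sqrt (\<tau> * (\<E> 0 + \<beta>)))\<^sup>2
       in Tmax \<le> ereal \<tau> \<or>
          (\<exists>tb. 0 < tb \<and> tb < \<tau> \<and> \<E> tb = - \<beta> \<and>
             L2_inner \<Omega> (u tb) (ut tb) \<ge> L0 / 2 \<and>
             (L2_norm \<Omega> (u tb))\<^sup>2 \<le> U \<and>
             (L2_norm \<Omega> (wgrad \<Omega> (u tb)))\<^sup>2 \<le> G)))"
proof -
  have Tm: "0 < Tmax" using sol by (simp add: maximal_energy_solution_def energy_solution_upto_def)
  note evolution = growing_evolution_of_local_theory[OF domain H1 H2 known ell data sol, folded C]
  obtain T0 where T0: "0 < T0" "ereal T0 < Tmax"
    using ereal_dense2[OF Tm] by (auto simp: zero_ereal_def)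
  interpret start: growing_evolution \<Omega> p g u0 u1 u ut T0 C by (rule evolution[OF T0])
  have init: "L2_norm \<Omega> (u 0) = L2_norm \<Omega> u0" "wgrad \<Omega> (u 0) = wgrad \<Omega> u0" "L2_inner \<Omega> (u 0) (ut 0) = L2_inner \<Omega> u0 u1"
  proof -
    have ae: "AE x in lebesgue_on \<Omega>. u 0 x = u0 x" "AE x in lebesgue_on \<Omega>. ut 0 x = u1 x"
      using start.solution by (simp_all add: energy_solution_def)
    have L: "u 0 \<in> L2 \<Omega>" "ut 0 \<in> L2 \<Omega>" "u0 \<in> L2 \<Omega>"
      using start.H10_L2 start.u_H10[of 0] start.v_L2[of 0] T0 data by auto
    show "L2_norm \<Omega> (u 0) = L2_norm \<Omega> u0" by (rule L2_norm_cong_AE[OF ae(1) L(1,3)])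
    show "wgrad \<Omega> (u 0) = wgrad \<Omega> u0" by (rule start.wgrad_cong_AE[OF ae(1) L(1,3)])
    show "L2_inner \<Omega> (u 0) (ut 0) = L2_inner \<Omega> u0 u1"
      by (rule L2_inner_cong_AE[OF ae(1) ae(2) L(1,3,2) data(2)])
  qed
  have modified0: "start.modified 0 = L0"
    unfolding start.modified_def start.moment_def init L0(1) E by simp
  have "L2_inner \<Omega> u0 u1 > 0"
  proof -
    have "pm \<Omega> p / C * \<E> 0 \<ge> 0" using E0 start.C_pos start.m_gt_2 by (intro mult_nonneg_nonneg) auto
    then show ?thesis using L0 by linarith
  qed
  \<comment> \<open>So the constant term of the quadratic is not zero, and it is negative at \<open>0\<close>.\<close>
  then have norm0: "L2_norm \<Omega> u0 \<noteq> 0"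
    using L2_Cauchy_Schwarz[OF start.H10_L2[OF data(1)] data(2)] by auto
  show ?thesis unfolding Let_def
  proof (intro conjI allI impI)
    show "\<exists>!\<tau>. 0 < \<tau> \<and> C * L0 * \<tau>\<^sup>2 + (L0 - 2 * (\<E> 0 + \<beta>) / lambda1) * \<tau> - (L2_norm \<Omega> u0)\<^sup>2 = 0"
      by (rule ex1_positive_root) (use start.C_pos L0(2) norm0 in auto)
    fix \<tau> assume "0 < \<tau> \<and> C * L0 * \<tau>\<^sup>2 + (L0 - 2 * (\<E> 0 + \<beta>) / lambda1) * \<tau> - (L2_norm \<Omega> u0)\<^sup>2 = 0"
    then have \<tau>: "0 < \<tau>" and root: "C * L0 * \<tau>\<^sup>2 + (L0 - 2 * (\<E> 0 + \<beta>) / lambda1) * \<tau> - (L2_norm \<Omega> u0)\<^sup>2 = 0"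
      by auto
    show "Tmax \<le> ereal \<tau> \<or>
          (\<exists>tb. 0 < tb \<and> tb < \<tau> \<and> \<E> tb = - \<beta> \<and>
             L2_inner \<Omega> (u tb) (ut tb) \<ge> L0 / 2 \<and>
             (L2_norm \<Omega> (u tb))\<^sup>2 \<le> (L2_norm \<Omega> u0 + sqrt (\<tau> * (\<E> 0 + \<beta>) / lambda1))\<^sup>2 \<and>
             (L2_norm \<Omega> (wgrad \<Omega> (u tb)))\<^sup>2 \<le> (L2_norm \<Omega> (wgrad \<Omega> u0) + sqrt (\<tau> * (\<E> 0 + \<beta>)))\<^sup>2)"
    proof (cases "Tmax \<le> ereal \<tau>")
      case False
      then obtain T where T': "\<tau> < T" "ereal T < Tmax" using ereal_dense2[of "ereal \<tau>" Tmax] by (auto simp: not_le)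
      interpret growing_evolution \<Omega> p g u0 u1 u ut T C by (rule evolution) (use \<tau> T' in auto)
      have mod0: "modified 0 = L0" using modified0 by (simp add: modified_def start.modified_def moment_def start.moment_def)
      have b: "\<beta> = C * modified 0 / (2 * m)" using beta mod0 by simp
      have b0: "\<beta> \<ge> 0" unfolding beta using start.C_pos start.m_gt_2 L0(2) by simp
      obtain tb where tb: "0 < tb" "tb < \<tau>" "shifted_energy \<Omega> p g u ut tb = - \<beta>"
        by (rule energy_reaches_level[OF _ _ b \<tau> T'(1)])
          (use L0(2) E0 root in \<open>auto simp: mod0 init E lambda1\<close>)
      have "L0 / 2 \<le> L2_inner \<Omega> (u tb) (ut tb)"
        "(L2_norm \<Omega> (u tb))\<^sup>2 \<le> (L2_norm \<Omega> u0 + sqrt (\<tau> * (\<E> 0 + \<beta>) / lambda1))\<^sup>2"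
        "(L2_norm \<Omega> (wgrad \<Omega> (u tb)))\<^sup>2 \<le> (L2_norm \<Omega> (wgrad \<Omega> u0) + sqrt (\<tau> * (\<E> 0 + \<beta>)))\<^sup>2"
        using state_at_level[OF _ b _ tb(1,2) T'(1) tb(3)] L0(2) E0 b0
        by (simp_all add: mod0 init E lambda1 moment_def H10_norm_def)
      then show ?thesis using tb unfolding E by blast
    qed simp
  qed
qed

end
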